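(* Let $v\ge1$ and $w\ge2$ be integers and $n=v+w$. For all $c\in(0,1)$ we have $$\mu_c\ \ge\ \left(\frac{\mu_0}{\mu_1}-\frac{c^2v(v-1)}{(1-c^2)w(w-1)+c^2v(v-1)}\left(\frac{\mu_0}{\mu_1}-c^{2w/n}\right)\right)\mu_1$$ and $$\mu_c\ \ge\ c^{2w/n}\mu_1 .$$
   Context: For $c\ge 0$ let $\mathbb{H}_c^v$ be the complete simply connected $v$-dimensional Riemannian manifold of sectional curvature $-c^2$ (so $\mathbb{H}_0^v=\mathbb{R}^v$), with metric $\eta_c^v$; let $\mathbb{S}^w$ be the round unit sphere with metric $\rho^w$. Put $\mathbb{M}_c=\mathbb{H}_c^v\times\mathbb{S}^w$ with metric $G_c=\eta_c^v+\rho^w$, whose scalar curvature is $s_c=w(w-1)-c^2v(v-1)$. Then $\mu_c$ denotes the conformal Yamabe constant of $\mathbb{M}_c$: $$\mu_c=\mu(\mathbb{M}_c,G_c)=\inf_{u\in C_c^\infty(\mathbb{M}_c),\,u\not\equiv0}\frac{\int_{\mathbb{M}_c}(a_n|du|^2+s_cu^2)\,dv^{G_c}}{\|u\|^2_{L^{p_n}(\mathbb{M}_c)}},\qquad a_n=\frac{4(n-1)}{n-2},\quad p_n=\frac{2n}{n-2}.$$ *)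

theory Defs
  imports "HOL-Analysis.Analysis"
begin

section \<open>Smooth maps on open subsets of normed spaces\<close>

primrec Ck_on :: "nat \<Rightarrow> 'a::real_normed_vector set \<Rightarrow> ('a \<Rightarrow> 'b::real_normed_vector) \<Rightarrow> bool" where
  "Ck_on 0 S f \<longleftrightarrow> continuous_on S f"
| "Ck_on (Suc k) S f \<longleftrightarrow> (\<forall>x\<in>S. f differentiable (at x)) \<and>
     (\<forall>v. Ck_on k S (\<lambda>x. frechet_derivative f (at x) v))"

definition smooth_on :: "'a::real_normed_vector set \<Rightarrow> ('a \<Rightarrow> 'b::real_normed_vector) \<Rightarrow> bool" where
  "smooth_on S f \<longleftrightarrow> (\<forall>k. Ck_on k S f)"


section \<open>Riemannian metrics on embedded submanifolds\<close>

text \<open>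
  Manifolds are embedded submanifolds M of a Euclidean space \<open>'e\<close>; their dimension is \<open>CARD('n)\<close>
  for the index type of the parameter space \<open>real ^ 'n\<close>. A Riemannian metric is given by a form
  \<open>g p\<close> on \<open>'e\<close> for each point p of M, of which only the values on vectors tangent to M at p matter.
\<close>

type_synonym 'e metric = "'e \<Rightarrow> 'e \<Rightarrow> 'e \<Rightarrow> real"

definition local_param ::
  "'e::euclidean_space set \<Rightarrow> (real ^ 'n::finite) set \<Rightarrow> (real ^ 'n \<Rightarrow> 'e) \<Rightarrow> bool" where
  "local_param M U \<phi> \<longleftrightarrow>
     open U \<and> smooth_on U \<phi> \<and> (\<forall>q\<in>U. inj (frechet_derivative \<phi> (at q))) \<and>
     openin (top_of_set M) (\<phi> ` U) \<and> (\<exists>\<psi>. homeomorphism U (\<phi> ` U) \<phi> \<psi>)"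

definition partial_deriv :: "'n::finite \<Rightarrow> (real ^ 'n \<Rightarrow> 'b::real_normed_vector) \<Rightarrow> real ^ 'n \<Rightarrow> 'b" where
  "partial_deriv i f q = frechet_derivative f (at q) (axis i 1)"

definition metric_coeffs ::
  "'e::euclidean_space metric \<Rightarrow> (real ^ 'n::finite \<Rightarrow> 'e) \<Rightarrow> real ^ 'n \<Rightarrow> real ^ 'n ^ 'n" where
  "metric_coeffs g \<phi> q = (\<chi> i j. g (\<phi> q) (partial_deriv i \<phi> q) (partial_deriv j \<phi> q))"

text \<open>
  The squared norm of the differential of u at p, \<open>g\<^sup>i\<^sup>j \<partial>\<^sub>i u \<partial>\<^sub>j u\<close> in any local coordinates around p;
  the value does not depend on the coordinates.
\<close>

definition diff_normsq ::
  "'n::finite itself \<Rightarrow> 'e::euclidean_space set \<Rightarrow> 'e metric \<Rightarrow> ('e \<Rightarrow> real) \<Rightarrow> 'e \<Rightarrow> real" where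
  "diff_normsq _ M g u p = (THE r. \<exists>U (\<phi> :: real ^ 'n \<Rightarrow> 'e). \<exists>q\<in>U. local_param M U \<phi> \<and> \<phi> q = p \<and>
     r = (\<Sum>i\<in>UNIV. \<Sum>j\<in>UNIV. matrix_inv (metric_coeffs g \<phi> q) $ i $ j *
            partial_deriv i (u \<circ> \<phi>) q * partial_deriv j (u \<circ> \<phi>) q))"

text \<open>
  The Riemannian volume is the unique Borel measure on M that is \<open>sqrt (det (g\<^sub>i\<^sub>j)) dx\<close> in all local
  coordinates.
\<close>

definition riemannian_volume ::
  "'n::finite itself \<Rightarrow> 'e::euclidean_space set \<Rightarrow> 'e metric \<Rightarrow> 'e measure" where
  "riemannian_volume _ M g = (THE \<mu>. sets \<mu> = sets (restrict_space borel M) \<and>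
     (\<forall>U (\<phi> :: real ^ 'n \<Rightarrow> 'e). local_param M U \<phi> \<longrightarrow>
        (\<forall>A\<in>sets borel. A \<subseteq> \<phi> ` U \<longrightarrow>
           emeasure \<mu> A = (\<integral>\<^sup>+q. ennreal (sqrt (det (metric_coeffs g \<phi> q))) *
                                  indicator (U \<inter> \<phi> -` A) q \<partial>lborel))))"

text \<open>Only the values of u on M matter for membership in \<open>C\<^sub>c\<^sup>\<infinity>(M)\<close>.\<close>

definition smooth_compact_support ::
  "'n::finite itself \<Rightarrow> 'e::euclidean_space set \<Rightarrow> ('e \<Rightarrow> real) set" where
  "smooth_compact_support _ M =
     {u. (\<forall>U (\<phi> :: real ^ 'n \<Rightarrow> 'e). local_param M U \<phi> \<longrightarrow> smooth_on U (u \<circ> \<phi>)) \<and>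
         (\<exists>K\<subseteq>M. compact K \<and> (\<forall>p\<in>M - K. u p = 0))}"


section \<open>The conformal Yamabe constant\<close>

definition yamabe_a :: "nat \<Rightarrow> real" where
  "yamabe_a n = 4 * (real n - 1) / (real n - 2)"

definition yamabe_p :: "nat \<Rightarrow> real" where
  "yamabe_p n = 2 * real n / (real n - 2)"

definition Lp_norm :: "'e measure \<Rightarrow> real \<Rightarrow> ('e \<Rightarrow> real) \<Rightarrow> real" where
  "Lp_norm \<mu> p u = (\<integral>x. \<bar>u x\<bar> powr p \<partial>\<mu>) powr (1 / p)"

text \<open>Here s stands for the scalar curvature of (M, g).\<close>

definition yamabe_quotient ::
  "'n::finite itself \<Rightarrow> 'e::euclidean_space set \<Rightarrow> 'e metric \<Rightarrow> ('e \<Rightarrow> real) \<Rightarrow> ('e \<Rightarrow> real) \<Rightarrow> real" where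
  "yamabe_quotient N M g s u =
     (\<integral>x. yamabe_a CARD('n) * diff_normsq N M g u x + s x * (u x)\<^sup>2 \<partial>riemannian_volume N M g) /
     (Lp_norm (riemannian_volume N M g) (yamabe_p CARD('n)) u)\<^sup>2"

text \<open>
  The infimum is taken in the reals, so it is meaningful when the quotients are bounded below,
  which is the case for the manifolds \<open>H\<^sub>c \<times> S\<close> below if \<open>0 \<le> c \<le> 1\<close>.
\<close>

definition yamabe_constant ::
  "'n::finite itself \<Rightarrow> 'e::euclidean_space set \<Rightarrow> 'e metric \<Rightarrow> ('e \<Rightarrow> real) \<Rightarrow> real" where
  "yamabe_constant N M g s =
     Inf {yamabe_quotient N M g s u | u. u \<in> smooth_compact_support N M \<and> (\<exists>p\<in>M. u p \<noteq> 0)}"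


section \<open>The spaces \<open>H\<^sub>c \<times> S\<close>\<close>

text \<open>
  Hyperbolic space of curvature \<open>-c\<^sup>2\<close> is the ball of radius \<open>2 / c\<close> with Riemann's constant
  curvature metric \<open>|dx|\<^sup>2 / (1 + K |x|\<^sup>2 / 4)\<^sup>2\<close>, \<open>K = -c\<^sup>2\<close>. This is the Poincare ball model up to
  a dilation of the coordinates; for \<open>c = 0\<close> it is Euclidean space itself.
\<close>

definition hyp_space :: "real \<Rightarrow> (real ^ 'v::finite) set" where
  "hyp_space c = {x. c * norm x < 2}"

definition hyp_metric :: "real \<Rightarrow> (real ^ 'v::finite) metric" where
  "hyp_metric c x \<xi> \<xi>' = (\<xi> \<bullet> \<xi>') / (1 - c\<^sup>2 * (norm x)\<^sup>2 / 4)\<^sup>2"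

lemma hyp_space_0: "hyp_space 0 = UNIV" and hyp_metric_0: "hyp_metric 0 x \<xi> \<xi>' = \<xi> \<bullet> \<xi>'"
  by (simp_all add: hyp_space_def hyp_metric_def)

text \<open>The unit sphere of dimension \<open>CARD('w)\<close>, in the Euclidean space \<open>(real ^ 'w) \<times> real\<close>.\<close>

definition unit_sphere :: "((real ^ 'w::finite) \<times> real) set" where
  "unit_sphere = sphere 0 1"

definition round_metric :: "((real ^ 'w::finite) \<times> real) metric" where
  "round_metric z \<zeta> \<zeta>' = \<zeta> \<bullet> \<zeta>'"

definition product_metric :: "'d metric \<Rightarrow> 'e metric \<Rightarrow> ('d \<times> 'e) metric" where
  "product_metric g h p \<xi> \<xi>' = g (fst p) (fst \<xi>) (fst \<xi>') + h (snd p) (snd \<xi>) (snd \<xi>')"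

definition M_space :: "real \<Rightarrow> ((real ^ 'v::finite) \<times> ((real ^ 'w::finite) \<times> real)) set" where
  "M_space c = hyp_space c \<times> unit_sphere"

definition G_metric :: "real \<Rightarrow> ((real ^ 'v::finite) \<times> ((real ^ 'w::finite) \<times> real)) metric" where
  "G_metric c = product_metric (hyp_metric c) round_metric"

definition M_scal :: "nat \<Rightarrow> nat \<Rightarrow> real \<Rightarrow> real" where
  "M_scal v w c = real w * (real w - 1) - c\<^sup>2 * real v * (real v - 1)"

text \<open>The index type \<open>'v + 'w\<close> makes the manifold have dimension \<open>CARD('v) + CARD('w)\<close>.\<close>

definition yamabe_mu :: "'v::finite itself \<Rightarrow> 'w::finite itself \<Rightarrow> real \<Rightarrow> real" where
  "yamabe_mu _ _ c =
     yamabe_constant TYPE('v + 'w)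
       (M_space c :: ((real ^ 'v) \<times> (real ^ 'w) \<times> real) set) (G_metric c)
       (\<lambda>_. M_scal CARD('v) CARD('w) c)"

end

theory Submission
 imports Defs
begin

text \<open>
 The scalar curvature \<open>w(w - 1) - c^2 v(v - 1)\<close> is the convex combination, with weight
 \<open>c^2 v(v - 1) / ((1 - c^2) w(w - 1) + c^2 v(v - 1))\<close>, of \<open>w(w - 1)\<close> and \<open>c^2 (w(w - 1) - v(v - 1))\<close>, so two
 comparison inequalities on \<open>M\<^sub>c\<close> suffice. With the second scalar term the functional is at least
 \<open>c\<^bsup>2w/n\<^esup> \<mu>\<^sub>1\<close>, since a dilation of the hyperbolic factor to curvature -1 only makes the
 spherical energy relatively smaller. With the first it is at least \<open>\<mu>\<^sub>0\<close>, by rearranging the slices of a test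
 function over the points of the sphere into radial functions on Euclidean space: the isoperimetric
 inequality of hyperbolic space is at least the Euclidean one, which is shown with a Knothe map in horospherical
 coordinates. The rearrangement is built from a smoothed layer-cake formula, so that it stays a smooth test
 function; it preserves the power integral only in the limit. For \<open>v = 1\<close> the base is already the line.
\<close>

text \<open>The constants are infima over smooth compactly supported functions, so every comparison
  function must itself be one. This is the obstacle that shapes the proof: volumes of superlevel
  sets are in general not smooth at critical values, and the classical rearrangement leaves the
  class. A kernel in place of the indicator makes the distribution function of a nonzero slice
  smooth and strictly decreasing in the level, so the implicit function theorem inverts it jointly
  with the point of the sphere. In horospherical coordinates hyperbolic space is one chart with a
  diagonal metric depending on a single coordinate, and its density has constant logarithmic
  derivative b (v - 1). In the transport argument the frame factors multiply to the reciprocal of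
  the density, which cancels it in the arithmetic-geometric mean inequality; the logarithmic
  derivative leaves a drift term proportional to the mean of the first transport coordinate, zero by
  symmetry of the ball. The exponent 2w/n is homogeneity: c^2 from the energy and c^(v (n - 2)/n)
  from the norm, divided by c^v from the volume.\<close>

abbreviation (input) "FD f x \<equiv> frechet_derivative f (at x)"

abbreviation (input) nn_lborel :: "('a::euclidean_space => ennreal) => ennreal" (binder "LBNN " 10)
 where "nn_lborel \<equiv> nn_integral lborel"

abbreviation (input) "cts \<equiv> continuous_on"

abbreviation (input) "bmeas \<equiv> borel_measurable borel"

abbreviation (input) "ind \<equiv> indicator"

abbreviation (input) RD_at ("RD _ _ :> _" [1000, 1000, 60] 60)
 where "RD f x :> d \<equiv> (f has_real_derivative d) (at x)"

type_synonym 'n rv = "real ^ 'n"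

section \<open>Calculus of smooth maps\<close>

named_theorems smooth_intros

lemma Ck_on_cong:
 assumes "open S" "!!x. x \<in> S ==> f x = g x" "Ck_on k S f"
 shows "Ck_on k S g"
 using assms(2,3)
proof (induction k arbitrary: f g)
 case 0
 thus ?case by (simp cong: continuous_on_cong)
next
 case (Suc k)
 have der: "(f has_derivative FD f x) (at x)" if "x \<in> S" for x
  using Suc.prems(2) that by (auto simp: frechet_derivative_works)
 have der2: "(g has_derivative FD f x) (at x)" if "x \<in> S" for x
  using has_derivative_transform_within_open[OF der[OF that] assms(1) that] Suc.prems(1) by blast
 have eq: "FD g x = FD f x" if "x \<in> S" for x
  using frechet_derivative_at[OF der2[OF that]] by simp
 show ?case
  using der2 Suc.prems(2) eq
  by (auto simp: differentiable_def intro: Suc.IH[where f = "%x. FD f x v" for v])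
qed

lemma Ck_on_has_derivative:
 "Ck_on (Suc k) S f ==> x \<in> S ==> (f has_derivative FD f x) (at x)"
 by (auto simp: frechet_derivative_works)

text \<open>Any candidate derivative will do: on an open set it agrees with
  \<open>frechet_derivative\<close> by uniqueness, so smoothness proofs need not compute with the
  choice operator.\<close>

lemma Ck_on_SucI:
 assumes "open S" "!!x. x \<in> S ==> (f has_derivative f' x) (at x)" "!!v. Ck_on k S (%x. f' x v)"
 shows "Ck_on (Suc k) S f"
proof -
 have "Ck_on k S (%x. FD f x v)" for v
  by (rule Ck_on_cong[OF assms(1) _ assms(3)[of v]]) (simp add: frechet_derivative_at[OF assms(2), symmetric])
 thus ?thesis using assms(2) by (auto simp: differentiable_def)
qed

lemma Ck_on_Suc_imp: "Ck_on (Suc k) S f ==> Ck_on k S f"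
proof (induction k arbitrary: f)
 case 0
 thus ?case
  by (auto intro!: continuous_at_imp_continuous_on differentiable_imp_continuous_within)
next
 case (Suc k)
 thus ?case by (metis Ck_on.simps(2))
qed

lemma Ck_on_mono: "Ck_on k S f ==> j <= k ==> Ck_on j S f"
 by (induction k) (auto simp: le_Suc_eq simp del: Ck_on.simps dest: Ck_on_Suc_imp)

lemma Ck_on_subset: "Ck_on k S f ==> T \<subseteq> S ==> Ck_on k T f"
 by (induction k arbitrary: f) (auto intro: continuous_on_subset)

text \<open>Lets smoothness be checked on an open cover, for functions given by different formulas
  on overlapping sets.\<close>

lemma Ck_on_local:
 assumes "!!x. x \<in> S ==> \<exists>T. open T & x \<in> T & Ck_on k T f"
 shows "Ck_on k S f"
 using assms
proof (induction k arbitrary: f)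
 case 0
 have "continuous (at x) f" if "x \<in> S" for x
  using 0[OF that] by (auto simp: continuous_on_eq_continuous_at)
 thus ?case by (auto intro: continuous_at_imp_continuous_on)
next
 case (Suc k)
 have "f differentiable at x" if "x \<in> S" for x
  using Suc.prems[OF that] by auto
 moreover have "Ck_on k S (%x. FD f x v)" for v
  by (rule Suc.IH) (use Suc.prems in force)
 ultimately show ?case by auto
qed

lemma Ck_on_const: "open S ==> Ck_on k S (%x. c)"
proof (induction k arbitrary: c)
 case (Suc k)
 show ?case by (rule Ck_on_SucI[OF Suc.prems, of _ "%x v. 0"]) (auto intro: Suc simp del: Ck_on.simps)
qed auto

lemma Ck_on_bounded_linear: "open S ==> bounded_linear f ==> Ck_on k S f"
proof (cases k)
 case 0
 thus "bounded_linear f ==> ?thesis"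
  by (simp add: linear_continuous_on)
next
 case (Suc j)
 assume S: "open S" and f: "bounded_linear f"
 show ?thesis unfolding Suc
  by (rule Ck_on_SucI[OF S, of _ "%x. f"])
   (auto simp del: Ck_on.simps intro: Ck_on_const S f bounded_linear_imp_has_derivative)
qed

lemma Ck_on_add:
 "open S ==> Ck_on k S f ==> Ck_on k S g ==> Ck_on k S (%x. f x + g x)"
proof (induction k arbitrary: f g)
 case (Suc k)
 show ?case
  by (rule Ck_on_SucI[OF Suc.prems(1)], rule has_derivative_add)
   (use Suc in \<open>auto simp: frechet_derivative_works\<close>)
qed (auto intro: continuous_on_add)

lemma Ck_on_linear_compose:
 assumes "open S" "bounded_linear L"
 shows "Ck_on k S f ==> Ck_on k S (%x. L (f x))"
proof (induction k arbitrary: f)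
 case 0
 thus ?case using assms(2) by (auto intro: linear_continuous_on_compose bounded_linear.linear
   bounded_linear.continuous_on)
next
 case (Suc k)
 show ?case
  by (rule Ck_on_SucI[OF assms(1)], rule bounded_linear.has_derivative[OF assms(2)])
   (use Suc in \<open>auto simp: frechet_derivative_works\<close>)
qed

lemma Ck_on_bilinear:
 assumes "open S" "bounded_bilinear B"
 shows "Ck_on k S f ==> Ck_on k S g ==> Ck_on k S (%x. B (f x) (g x))"
proof (induction k arbitrary: f g)
 case 0
 thus ?case using assms(2) by (auto intro: bounded_bilinear.continuous_on)
next
 case (Suc k)
 show ?case
  by (rule Ck_on_SucI[OF assms(1)], rule bounded_bilinear.FDERIV[OF assms(2)])
   (use Suc Ck_on_Suc_imp[OF Suc.prems(1)] Ck_on_Suc_imp[OF Suc.prems(2)] assms(1) in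
    \<open>auto simp: frechet_derivative_works intro!: Ck_on_add\<close>)
qed

lemma Ck_on_sum:
 "open S ==> (!!i. i \<in> I ==> Ck_on k S (f i)) ==> Ck_on k S (%x. \<Sum>i\<in>I. f i x)"
 by (induction I rule: infinite_finite_induct) (auto simp del: Ck_on.simps intro: Ck_on_const Ck_on_add)

lemma Ck_on_compose:
 fixes f :: "'a::real_normed_vector => 'b::euclidean_space" and g :: "'b => 'c::real_normed_vector"
 assumes S: "open S" and T: "open T"
 shows "Ck_on k S f ==> f ` S \<subseteq> T ==> Ck_on k T g ==> Ck_on k S (%x. g (f x))"
proof (induction k arbitrary: g)
 case 0
 thus ?case by (auto intro: continuous_on_compose2)
next
 case (Suc k)
 let ?g' = "%y. FD g y"
 let ?f' = "%x. FD f x"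
 have g': "(g has_derivative ?g' (f x)) (at (f x))" if "x \<in> S" for x
  using Suc.prems that by (auto simp: frechet_derivative_works)
 have f': "(f has_derivative ?f' x) (at x)" if "x \<in> S" for x
  using Suc.prems that by (auto simp: frechet_derivative_works)
 \<comment> \<open>\<open>Ck_on\<close> speaks of derivatives in fixed directions, while here the
   direction \<open>?f' x v\<close> moves with x. Expanding it in the basis separates the two
   dependences, which is why the middle space is Euclidean.\<close>
 have expand: "?g' (f x) w = (\<Sum>b\<in>Basis. (w \<bullet> b) *\<^sub>R ?g' (f x) b)" if "x \<in> S" for x w
 proof -
  have lin: "linear (?g' (f x))"
   using g'[OF that] has_derivative_linear by blast
  have "?g' (f x) w = ?g' (f x) (\<Sum>b\<in>Basis. (w \<bullet> b) *\<^sub>R b)"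
   by (simp add: euclidean_representation)
  also have "... = (\<Sum>b\<in>Basis. (w \<bullet> b) *\<^sub>R ?g' (f x) b)"
   by (simp add: linear_sum[OF lin] linear_scale[OF lin])
  finally show ?thesis .
 qed
 show ?case
 proof (rule Ck_on_SucI[OF S])
  fix x assume x: "x \<in> S"
  show "((%x. g (f x)) has_derivative (%v. ?g' (f x) (?f' x v))) (at x)"
   using has_derivative_compose[OF f'[OF x] g'[OF x]] .
 next
  fix v
  have fk: "Ck_on k S f" using Suc.prems(1) Ck_on_Suc_imp by blast
  have "Ck_on k S (%x. \<Sum>b\<in>Basis. (?f' x v \<bullet> b) *\<^sub>R ?g' (f x) b)"
  proof (intro Ck_on_sum[OF S] Ck_on_bilinear[OF S bounded_bilinear_scaleR])
   fix b :: 'b assume "b \<in> Basis"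
   show "Ck_on k S (%x. ?f' x v \<bullet> b)"
    by (rule Ck_on_linear_compose[OF S bounded_linear_inner_left]) (use Suc.prems in auto)
   show "Ck_on k S (%x. ?g' (f x) b)"
    by (rule Suc.IH[OF fk Suc.prems(2)]) (use Suc.prems in auto)
  qed
  thus "Ck_on k S (%x. ?g' (f x) (?f' x v))"
   by (rule Ck_on_cong[OF S, rotated]) (simp add: expand[symmetric])
 qed
qed

lemma smooth_on_cong: "open S ==> (!!x. x \<in> S ==> f x = g x) ==> smooth_on S f ==> smooth_on S g"
 using Ck_on_cong unfolding smooth_on_def by blast

lemma smooth_on_subset: "smooth_on S f ==> T \<subseteq> S ==> smooth_on T f"
 using Ck_on_subset unfolding smooth_on_def by blast

lemma smooth_on_local:
 "(!!x. x \<in> S ==> \<exists>T. open T & x \<in> T & smooth_on T f) ==> smooth_on S f"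
 unfolding smooth_on_def by (intro allI Ck_on_local) metis

lemma smooth_on_const [smooth_intros]: "open S ==> smooth_on S (%x. c)"
 by (simp add: smooth_on_def Ck_on_const del: Ck_on.simps)

lemma smooth_on_bounded_linear: "open S ==> bounded_linear f ==> smooth_on S f"
 by (simp add: smooth_on_def Ck_on_bounded_linear del: Ck_on.simps)

lemma smooth_on_id [smooth_intros]: "open S ==> smooth_on S (%x. x)"
 by (simp add: smooth_on_bounded_linear bounded_linear_ident)

lemma smooth_on_add [smooth_intros]:
 "open S ==> smooth_on S f ==> smooth_on S g ==> smooth_on S (%x. f x + g x)"
 by (simp add: smooth_on_def Ck_on_add del: Ck_on.simps)

lemma smooth_on_sum [smooth_intros]:
 "open S ==> (!!i. i \<in> I ==> smooth_on S (f i)) ==> smooth_on S (%x. \<Sum>i\<in>I. f i x)"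
 by (simp add: smooth_on_def Ck_on_sum del: Ck_on.simps)

lemma smooth_on_linear_compose:
 "bounded_linear L ==> open S ==> smooth_on S f ==> smooth_on S (%x. L (f x))"
 by (simp add: smooth_on_def Ck_on_linear_compose del: Ck_on.simps)

lemmas smooth_on_fst [smooth_intros] = smooth_on_linear_compose[OF bounded_linear_fst]
lemmas smooth_on_snd [smooth_intros] = smooth_on_linear_compose[OF bounded_linear_snd]
lemmas smooth_on_vec_nth [smooth_intros] = smooth_on_linear_compose[OF bounded_linear_vec_nth]

lemma smooth_on_minus [smooth_intros]: "open S ==> smooth_on S f ==> smooth_on S (%x. - f x)"
 by (rule smooth_on_linear_compose[OF bounded_linear_minus]) (auto intro: bounded_linear_ident)

lemma smooth_on_diff [smooth_intros]:
 "open S ==> smooth_on S f ==> smooth_on S g ==> smooth_on S (%x. f x - g x)"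
 using smooth_on_add[of S f "%x. - g x"] smooth_on_minus[of S g] by simp

lemma smooth_on_bilinear:
 "bounded_bilinear B ==> open S ==> smooth_on S f ==> smooth_on S g ==> smooth_on S (%x. B (f x) (g x))"
 by (simp add: smooth_on_def Ck_on_bilinear del: Ck_on.simps)

lemmas smooth_on_scaleR [smooth_intros] = smooth_on_bilinear[OF bounded_bilinear_scaleR]
lemmas smooth_on_inner [smooth_intros] = smooth_on_bilinear[OF bounded_bilinear_inner]

lemma smooth_on_mult [smooth_intros]:
 fixes f g :: "_ => real"
 shows "open S ==> smooth_on S f ==> smooth_on S g ==> smooth_on S (%x. f x * g x)"
 by (rule smooth_on_bilinear[OF bounded_bilinear_mult])

lemma smooth_on_power [smooth_intros]:
 fixes f :: "_ => real"
 shows "open S ==> smooth_on S f ==> smooth_on S (%x. f x ^ n)"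
 by (induction n) (auto intro: smooth_intros)

lemma smooth_on_compose:
 fixes f :: "'a::real_normed_vector => 'b::euclidean_space" and g :: "'b => 'c::real_normed_vector"
 shows "smooth_on T g ==> open T ==> open S ==> smooth_on S f ==> f ` S \<subseteq> T ==> smooth_on S (%x. g (f x))"
 by (simp add: smooth_on_def Ck_on_compose del: Ck_on.simps)

lemma smooth_on_Pair [smooth_intros]:
 assumes "open S" "smooth_on S f" "smooth_on S g"
 shows "smooth_on S (%x. (f x, g x))"
proof -
 have "bounded_linear (%x. (x, 0))" "bounded_linear (%x. (0, x))"
  by (auto intro!: bounded_linear_Pair bounded_linear_ident bounded_linear_zero)
 hence "smooth_on S (%x. (f x, 0) + (0, g x))"
  using assms by (intro smooth_intros) (auto intro: smooth_on_linear_compose)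
 thus ?thesis by simp
qed

lemma smooth_on_vec_lambda [smooth_intros]:
 fixes f :: "'i::finite => 'a::real_normed_vector => real"
 assumes "open S" "!!i. smooth_on S (f i)"
 shows "smooth_on S (%x. \<chi> i. f i x)"
proof -
 have "smooth_on S (%x. \<Sum>i\<in>UNIV. f i x *\<^sub>R axis i (1::real))"
  using assms by (auto intro!: smooth_intros)
 thus ?thesis
  by (rule smooth_on_cong[OF assms(1), rotated])
   (simp add: vec_eq_iff axis_def if_distrib if_distribR sum.delta cong: if_cong)
qed

lemma smooth_on_cts: "smooth_on S f ==> cts S f"
 unfolding smooth_on_def using Ck_on.simps(1) by blast

lemma smooth_on_has_derivative:
 "smooth_on S f ==> x \<in> S ==> (f has_derivative FD f x) (at x)"
 unfolding smooth_on_def using Ck_on_has_derivative by blast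

lemma smooth_on_frechet_derivative:
 "smooth_on S f ==> smooth_on S (%x. FD f x v)"
 unfolding smooth_on_def by (metis Ck_on.simps(2))

lemma Ck_on_Suc_real:
 assumes "open S" "!!x. x \<in> S ==> RD f x :> f' x" "Ck_on k S f'"
 shows "Ck_on (Suc k) S f"
proof (rule Ck_on_SucI[OF assms(1)])
 show "(f has_derivative (%v. f' x * v)) (at x)" if "x \<in> S" for x
  using assms(2)[OF that] by (simp add: has_field_derivative_def)
 show "Ck_on k S (%x. f' x * v)" for v
  by (rule Ck_on_linear_compose[OF assms(1) bounded_linear_mult_left assms(3)])
qed

lemma smooth_on_exp_real: "open S ==> smooth_on S (exp :: real => real)"
 unfolding smooth_on_def
proof
 fix k assume S: "open S"
 show "Ck_on k S (exp :: real => real)"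
 proof (induction k)
  case (Suc k)
  thus ?case by (intro Ck_on_Suc_real[OF S, of _ exp]) (auto simp: DERIV_exp)
 qed (auto intro!: continuous_intros)
qed

lemma smooth_on_exp [smooth_intros]:
 fixes f :: "_ => real"
 shows "open S ==> smooth_on S f ==> smooth_on S (%x. exp (f x))"
 by (rule smooth_on_compose[OF smooth_on_exp_real[OF open_UNIV]]) auto

lemma smooth_on_powr_real: "smooth_on {0<..} (%x::real. x powr a)"
 unfolding smooth_on_def
proof
 fix k
 show "Ck_on k {0<..} (%x::real. x powr a)"
 proof (induction k arbitrary: a)
  case (Suc k)
  show ?case
  proof (rule Ck_on_Suc_real[where f' = "%x. a * x powr (a - 1)"])
   show "Ck_on k {0<..} (%x::real. a * x powr (a - 1))"
    by (rule Ck_on_linear_compose[OF _ bounded_linear_mult_right Suc.IH]) auto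
  qed (auto intro!: has_real_derivative_powr)
 qed (auto intro!: continuous_intros)
qed

lemma smooth_on_powr [smooth_intros]:
 fixes f :: "_ => real"
 shows "open S ==> smooth_on S f ==> (!!x. x \<in> S ==> f x > 0) ==> smooth_on S (%x. f x powr a)"
 by (rule smooth_on_compose[OF smooth_on_powr_real]) auto

lemma smooth_on_inverse_real: "smooth_on (- {0}) (inverse :: real => real)"
 unfolding smooth_on_def
proof
 fix k
 show "Ck_on k (- {0}) (inverse :: real => real)"
 proof (induction k)
  case (Suc k)
  have "Ck_on k (- {0}) (%x::real. inverse x * inverse x)"
   by (rule Ck_on_bilinear[OF _ bounded_bilinear_mult Suc.IH Suc.IH]) auto
  hence "Ck_on k (- {0}) (%x::real. - 1 * (inverse x * inverse x))"
   by (rule Ck_on_linear_compose[OF _ bounded_linear_mult_right, rotated]) auto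
  thus ?case
   by (rule Ck_on_Suc_real[rotated 2])
    (auto intro!: derivative_eq_intros simp: power2_eq_square)
 qed (auto intro!: continuous_intros)
qed

lemma smooth_on_inverse [smooth_intros]:
 fixes f :: "_ => real"
 shows "open S ==> smooth_on S f ==> (!!x. x \<in> S ==> f x ~= 0) ==> smooth_on S (%x. inverse (f x))"
 by (rule smooth_on_compose[OF smooth_on_inverse_real]) auto

lemma smooth_on_divide [smooth_intros]:
 fixes f g :: "_ => real"
 shows "open S ==> smooth_on S f ==> smooth_on S g ==> (!!x. x \<in> S ==> g x ~= 0) ==>
  smooth_on S (%x. f x / g x)"
 unfolding divide_inverse by (intro smooth_intros)

text \<open>A family closed under differentiation up to constant coefficients is smooth. The index
  shifts by 1 and 2 are those of \<open>flat_exp\<close>.\<close>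

lemma Ck_on_all_Suc_real:
 fixes F :: "nat => real => real"
 assumes "open S" "!!n x. x \<in> S ==> (F n has_real_derivative a n * F (n + 1) x + b n * F (n + 2) x) (at x)"
 shows "smooth_on S (F n)"
 unfolding smooth_on_def
proof
 fix k
 show "Ck_on k S (F n)"
 proof (induction k arbitrary: n)
  case 0
  thus ?case using assms(2) by (auto intro!: continuous_at_imp_continuous_on DERIV_isCont)
 next
  case (Suc k)
  show ?case
   by (rule Ck_on_Suc_real[OF assms(1) assms(2)])
    (use assms(1) in \<open>auto intro!: Ck_on_add Ck_on_linear_compose[OF _ bounded_linear_mult_right] Suc.IH simp del: Ck_on.simps\<close>)
 qed
qed

section \<open>A flat function and the softened positive part\<close>

definition flat_exp :: "real => nat => real => real" where
 "flat_exp \<eta> n x = (if x <= 0 then 0 else inverse x ^ n * exp (- \<eta> / x))"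

text \<open>From (1 + z/m)^m <= e^z with m = n + 2: the exponential beats the pole with two powers
  of x to spare, enough for the difference quotient at 0 to vanish.\<close>

lemma flat_exp_bound:
 assumes "\<eta> > 0"
 shows "\<bar>flat_exp \<eta> n x\<bar> <= (real (n + 2) / \<eta>) ^ (n + 2) * x^2"
proof (cases "x > 0")
 case True
 let ?m = "n + 2"
 have "(\<eta> / x / real ?m) ^ ?m <= (1 + (\<eta> / x) / real ?m) ^ ?m"
  using assms True by (intro power_mono) auto
 also have "... <= exp (\<eta> / x)"
  using assms True by (intro exp_ge_one_plus_x_over_n_power_n) (auto intro: order_trans[of _ 0])
 finally have "inverse (exp (\<eta> / x)) <= inverse ((\<eta> / x / real ?m) ^ ?m)"
  using assms True by (intro le_imp_inverse_le) auto
 hence "exp (- \<eta> / x) <= (real ?m * x / \<eta>) ^ ?m"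
  by (simp add: exp_minus power_divide power_mult_distrib field_simps)
 hence "inverse x ^ n * exp (- \<eta> / x) <= inverse x ^ n * (real ?m * x / \<eta>) ^ ?m"
  using True by (intro mult_left_mono) auto
 also have "... = (real ?m / \<eta>) ^ ?m * x^2"
 proof -
  have "(real ?m * x / \<eta>) ^ ?m = ((real ?m / \<eta>) * x) ^ ?m" by simp
  also have "... = (real ?m / \<eta>) ^ ?m * (x ^ n * x^2)"
   by (simp only: power_mult_distrib power_add mult_ac)
  finally have "(real ?m * x / \<eta>) ^ ?m = (real ?m / \<eta>) ^ ?m * (x ^ n * x^2)" .
  moreover have "inverse x ^ n * (x ^ n * x^2) = x^2"
   using True by (simp add: power_inverse)
  ultimately show ?thesis by (simp only: mult.left_commute[of "inverse x ^ n"])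
 qed
 finally show ?thesis using True by (simp add: flat_exp_def)
qed (use assms in \<open>auto simp: flat_exp_def\<close>)

lemma flat_exp_has_derivative:
 assumes "\<eta> > 0"
 shows "(flat_exp \<eta> n has_real_derivative - real n * flat_exp \<eta> (n + 1) x + \<eta> * flat_exp \<eta> (n + 2) x) (at x)"
proof (cases "x = 0")
 case False
 show ?thesis
 proof (cases "x > 0")
  case True
  have "((%x. inverse x ^ n * exp (- \<eta> / x)) has_real_derivative
    - real n * flat_exp \<eta> (n + 1) x + \<eta> * flat_exp \<eta> (n + 2) x) (at x)"
  proof -
   have "RD (%x. inverse x ^ n) x :> - real n * inverse x ^ (n + 1)"
   proof (cases n)
    case (Suc m)
    thus ?thesis
     using True by (intro DERIV_cong[OF DERIV_power[OF DERIV_inverse]]) (simp_all add: algebra_simps)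
   qed auto
   moreover have "RD (%x. exp (- \<eta> / x)) x :> \<eta> * inverse x ^ 2 * exp (- \<eta> / x)"
    using True by (auto intro!: derivative_eq_intros simp: power2_eq_square field_simps)
   ultimately have "((%x. inverse x ^ n * exp (- \<eta> / x)) has_real_derivative
     - real n * inverse x ^ (n + 1) * exp (- \<eta> / x) + \<eta> * inverse x ^ 2 * exp (- \<eta> / x) * inverse x ^ n) (at x)"
    by (rule DERIV_mult)
   thus ?thesis
    using True by (simp add: flat_exp_def power2_eq_square mult_ac)
  qed
  thus ?thesis
   by (rule has_field_derivative_transform_within_open[of _ _ _ "{0<..}"])
    (use True in \<open>auto simp: flat_exp_def\<close>)
 next
  case xneg: False
  have "RD (%x. 0) x :> - real n * flat_exp \<eta> (n + 1) x + \<eta> * flat_exp \<eta> (n + 2) x"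
   using xneg by (simp add: flat_exp_def)
  thus ?thesis
   by (rule has_field_derivative_transform_within_open[of _ _ _ "{..<0}"])
    (use False xneg in \<open>auto simp: flat_exp_def\<close>)
 qed
next
 case True
 obtain C where C: "!!y. \<bar>flat_exp \<eta> n y\<bar> <= C * y^2"
  using flat_exp_bound[OF assms] by blast
 have "((%y. flat_exp \<eta> n y / y) \<longlongrightarrow> 0) (at 0)"
 proof (rule Lim_null_comparison[where g = "%y. C * \<bar>y\<bar>"])
  have "norm (flat_exp \<eta> n y / y) <= C * \<bar>y\<bar>" for y
  proof (cases "y = 0")
   case False
   have "\<bar>flat_exp \<eta> n y\<bar> / \<bar>y\<bar> <= C * y^2 / \<bar>y\<bar>"
    using C[of y] by (intro divide_right_mono) auto
   also have "... = C * \<bar>y\<bar>"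
    using False by (simp add: power2_eq_square field_simps abs_if)
   finally show ?thesis by simp
  qed auto
  thus "\<forall>\<^sub>F y in at 0. norm (flat_exp \<eta> n y / y) <= C * \<bar>y\<bar>" by simp
  show "((%y. C * \<bar>y\<bar>) \<longlongrightarrow> 0) (at 0)"
   by (rule tendsto_mult_right_zero) (auto intro: tendsto_eq_intros)
 qed
 thus ?thesis using True by (simp add: has_field_derivative_iff flat_exp_def)
qed

lemma smooth_on_flat_exp: "\<eta> > 0 ==> smooth_on UNIV (flat_exp \<eta> n)"
 by (rule Ck_on_all_Suc_real[where F = "flat_exp \<eta>" and a = "%n. - real n" and b = "%n. \<eta>"])
  (use flat_exp_has_derivative in simp_all)

text \<open>A smooth substitute for max x 0 with slope in [0, 1] and error at most \<eta>. Applied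
  to a level minus a threshold it cuts off small values without increasing gradients.\<close>

definition soft_pos :: "real => real => real" where
 "soft_pos \<eta> x = x * flat_exp \<eta> 0 x"

definition soft_pos' :: "real => real => real" where
 "soft_pos' \<eta> x = (if x <= 0 then 0 else (1 + \<eta> / x) * exp (- \<eta> / x))"

lemma smooth_on_soft_pos: "\<eta> > 0 ==> smooth_on UNIV (soft_pos \<eta>)"
 unfolding soft_pos_def[abs_def] by (intro smooth_intros smooth_on_flat_exp) auto

lemma soft_pos_has_derivative:
 assumes "\<eta> > 0"
 shows "(soft_pos \<eta> has_real_derivative soft_pos' \<eta> x) (at x)"
proof -
 have "(soft_pos \<eta> has_real_derivative 1 * flat_exp \<eta> 0 x +
   (- real 0 * flat_exp \<eta> (0 + 1) x + \<eta> * flat_exp \<eta> (0 + 2) x) * x) (at x)"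
  unfolding soft_pos_def[abs_def] by (intro DERIV_mult DERIV_ident flat_exp_has_derivative assms)
 moreover have "1 * flat_exp \<eta> 0 x + (- real 0 * flat_exp \<eta> (0 + 1) x + \<eta> * flat_exp \<eta> (0 + 2) x) * x
   = soft_pos' \<eta> x"
  by (auto simp: flat_exp_def soft_pos'_def field_simps power2_eq_square)
 ultimately show ?thesis by simp
qed

lemma soft_pos'_bounds:
 assumes "\<eta> > 0"
 shows "0 <= soft_pos' \<eta> x" "soft_pos' \<eta> x <= 1"
proof -
 have "1 + \<eta> / x <= exp (\<eta> / x)" by (rule exp_ge_add_one_self)
 hence "(1 + \<eta> / x) * exp (- \<eta> / x) <= exp (\<eta> / x) * exp (- \<eta> / x)"
  by (intro mult_right_mono) auto
 thus "soft_pos' \<eta> x <= 1" by (simp add: soft_pos'_def flip: exp_add)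
qed (use assms in \<open>auto simp: soft_pos'_def\<close>)

lemma soft_pos_bounds:
 assumes "\<eta> > 0"
 shows "0 <= soft_pos \<eta> x" "x - \<eta> <= soft_pos \<eta> x" "soft_pos \<eta> x <= max x 0" "x <= 0 ==> soft_pos \<eta> x = 0"
  "x > 0 ==> soft_pos \<eta> x > 0"
proof -
 have "1 + (- \<eta> / x) <= exp (- \<eta> / x)" by (rule exp_ge_add_one_self)
 hence "x > 0 ==> x * (1 + (- \<eta> / x)) <= x * exp (- \<eta> / x)"
  by (intro mult_left_mono) auto
 thus "x - \<eta> <= soft_pos \<eta> x"
  using assms by (auto simp: soft_pos_def flat_exp_def algebra_simps)
 have "exp (- \<eta> / x) <= 1" if "x > 0" using that assms by auto
 thus "soft_pos \<eta> x <= max x 0"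
  by (auto simp: soft_pos_def flat_exp_def mult_left_le)
qed (auto simp: soft_pos_def flat_exp_def)

section \<open>Differentiability of continuous solutions of equations\<close>

lemma has_derivative_at_eventually:
 "(f has_derivative f') (at x) \<longleftrightarrow> bounded_linear f' &
  (\<forall>e>0. \<forall>\<^sub>F y in nhds x. norm (f y - f x - f' (y - x)) <= e * norm (y - x))"
 by (auto simp: has_derivative_at_alt eventually_nhds_metric dist_norm)

text \<open>A left inverse L of the injective derivative \<open>sg'\<close> turns the equation into
  h = L f up to an error small relative to h z - h x. This first gives a Lipschitz bound for h at x
  and then, inserted into the error, differentiability. It serves both the implicit function theorem
  and the transition maps of charts.\<close>

lemma has_derivative_continuous_lift:
 fixes sg :: "'b::euclidean_space => 'e::euclidean_space" and f :: "'a::real_normed_vector => 'e"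
 assumes h: "isCont h x" and eq: "\<forall>\<^sub>F z in nhds x. sg (h z) = f z"
  and sg: "(sg has_derivative sg') (at (h x))" and inj: "inj sg'"
  and f: "(f has_derivative f') (at x)"
 obtains h' where "(h has_derivative h') (at x)" "!!v. sg' (h' v) = f' v"
proof -
 obtain L where L: "linear L" "L \<circ> sg' = id"
  using linear_injective_left_inverse[OF has_derivative_linear[OF sg] inj] by blast
 have bL: "bounded_linear L" using L(1) linear_conv_bounded_linear by blast
 let ?F = "%z. L (f z)" and ?F' = "%v. L (f' v)"
 have F: "(?F has_derivative ?F') (at x)" by (rule bounded_linear.has_derivative[OF bL f])
 have "((%y. L (sg y)) has_derivative (%v. v)) (at (h x))"
  using bounded_linear.has_derivative[OF bL sg] L(2) by (simp add: fun_eq_iff)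
 hence G: "\<forall>\<^sub>F y in nhds (h x). norm (L (sg y) - L (sg (h x)) - (y - h x)) <= e * norm (y - h x)" if "e > 0" for e
  using that unfolding has_derivative_at_eventually by blast
 have ex: "sg (h x) = f x" using eventually_nhds_x_imp_x[OF eq] .
 have hx: "filterlim h (nhds (h x)) (nhds x)" using h by (simp add: isCont_def tendsto_at_iff_tendsto_nhds)
 have small: "\<forall>\<^sub>F z in nhds x. norm (?F z - ?F x - (h z - h x)) <= e * norm (h z - h x)" if "e > 0" for e
  using eventually_compose_filterlim[OF G[OF that] hx] eq by eventually_elim (simp add: ex)
 obtain K where K: "K > 0" "!!v. norm (?F' v) <= norm v * K"
  using bounded_linear.pos_bounded[OF has_derivative_bounded_linear[OF F]] by blast
 define B where "B = 2 * (K + 1)"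
 have B: "B > 0" using K(1) by (simp add: B_def)
 have F1: "\<forall>\<^sub>F z in nhds x. norm (?F z - ?F x - ?F' (z - x)) <= e * norm (z - x)" if "e > 0" for e
  using F that unfolding has_derivative_at_eventually by blast
 have lip: "\<forall>\<^sub>F z in nhds x. norm (h z - h x) <= B * norm (z - x)"
  using small[of "1/2", simplified] F1[of 1, simplified]
 proof eventually_elim
  case (elim z)
  have "norm (h z - h x) <= norm (?F z - ?F x) + norm (?F z - ?F x - (h z - h x))"
   using norm_triangle_ineq4[of "?F z - ?F x" "?F z - ?F x - (h z - h x)"] by simp
  moreover have "norm (?F z - ?F x) <= norm (?F z - ?F x - ?F' (z - x)) + norm (?F' (z - x))"
   using norm_triangle_sub[of "?F z - ?F x" "?F' (z - x)"] by simp
  ultimately show ?case using elim K(2)[of "z - x"] by (simp add: B_def algebra_simps)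
 qed
 have der: "(h has_derivative ?F') (at x)"
  unfolding has_derivative_at_eventually
 proof (intro conjI allI impI)
  show "bounded_linear ?F'" by (rule has_derivative_bounded_linear[OF F])
  fix e :: real assume e: "e > 0"
  hence "e / 2 > 0" "e / (2 * B) > 0" using B by auto
  from F1[OF this(1)] small[OF this(2)] lip
  show "\<forall>\<^sub>F z in nhds x. norm (h z - h x - ?F' (z - x)) <= e * norm (z - x)"
  proof eventually_elim
   case (elim z)
   have "h z - h x - ?F' (z - x) = (?F z - ?F x - ?F' (z - x)) - (?F z - ?F x - (h z - h x))" by (simp only: algebra_simps)
   hence "norm (h z - h x - ?F' (z - x)) <= norm (?F z - ?F x - ?F' (z - x)) + norm (?F z - ?F x - (h z - h x))"
    by (metis norm_triangle_ineq4)
   also have "... <= e / 2 * norm (z - x) + e / (2 * B) * (B * norm (z - x))"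
    using elim(1) order_trans[OF elim(2) mult_left_mono[OF elim(3)]] e B by (intro add_mono) auto
   finally show ?case using B by (simp add: field_simps)
  qed
 qed
 have "((%z. sg (h z)) has_derivative f') (at x)"
  by (rule has_derivative_transform_eventually[OF f])
   (use eq ex in \<open>auto simp: eventually_at_filter elim: eventually_mono\<close>)
 hence "(%v. sg' (?F' v)) = f'"
  using has_derivative_unique[OF has_derivative_compose[OF der sg]] by blast
 thus ?thesis using that[OF der] by metis
qed

text \<open>As the solution is known to be continuous, the lifting lemma applies to r -> (sg r, r)
  and the immersion z -> (F z, snd z). The derivative so obtained is an expression in
  \<open>sg\<close> itself, which raises the order of smoothness by one in each induction
  step.\<close>

lemma smooth_on_implicit:
 fixes F :: "real \<times> 'a::euclidean_space => real"
 assumes U: "open U" and F: "smooth_on U F" and Q: "open Q" and sg: "cts Q sg"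
  and inU: "!!r. r \<in> Q ==> (sg r, r) \<in> U" and zero: "!!r. r \<in> Q ==> F (sg r, r) = 0"
  and ndeg: "!!r. r \<in> Q ==> FD F (sg r, r) (1, 0) ~= 0"
 shows "smooth_on Q sg"
  and "!!r. r \<in> Q ==> (sg has_derivative (%v. - FD F (sg r, r) (0, v) /
     FD F (sg r, r) (1, 0))) (at r)"
proof -
 define D where "D r = FD F (sg r, r)" for r
 have FD: "(F has_derivative D r) (at (sg r, r))" if "r \<in> Q" for r
  unfolding D_def by (rule smooth_on_has_derivative[OF F inU[OF that]])
 have der: "(sg has_derivative (%v. - D r (0, v) / D r (1, 0))) (at r)" if r: "r \<in> Q" for r
 proof -
  interpret D: linear "D r" using FD[OF r] has_derivative_linear by blast
  have split: "D r (s, v) = s * D r (1, 0) + D r (0, v)" for s v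
   using D.add[of "s *\<^sub>R (1, 0)" "(0, v)"] D.scaleR[of s "(1, 0)"] by simp
  have cont: "isCont (%r. (sg r, r)) r"
   using sg Q r by (auto intro!: continuous_intros simp: continuous_on_eq_continuous_at)
  have inj: "inj (%z. (D r z, snd z))"
  proof (rule injI)
   fix z z' assume "(D r z, snd z) = (D r z', snd z')"
   hence "D r z = D r z'" "snd z = snd z'" by auto
   hence "fst z * D r (1, 0) = fst z' * D r (1, 0)"
    using split[of "fst z" "snd z", unfolded prod.collapse]
     split[of "fst z'" "snd z'", unfolded prod.collapse] by (simp only:)
   thus "z = z'"
    using ndeg[OF r] \<open>snd z = snd z'\<close> by (simp add: D_def prod_eq_iff)
  qed
  have der1: "((%z. (F z, snd z)) has_derivative (%z. (D r z, snd z))) (at (sg r, r))"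
   using FD[OF r] by (intro has_derivative_Pair) (auto intro!: derivative_eq_intros)
  have ev: "\<forall>\<^sub>F z in nhds r. (F (sg z, z), snd (sg z, z)) = (0, z)"
   using Q r zero by (auto simp: eventually_nhds)
  have der2: "((%z. (0::real, z)) has_derivative (%v. (0, v))) (at r)"
   by (auto intro!: derivative_eq_intros)
  obtain h' where h': "((%r. (sg r, r)) has_derivative h') (at r)" "!!v. (D r (h' v), snd (h' v)) = (0, v)"
   using has_derivative_continuous_lift[OF cont ev der1 inj der2] by blast
  have "(sg has_derivative (%v. fst (h' v))) (at r)"
   using has_derivative_fst[OF h'(1)] by simp
  moreover have "fst (h' v) = - D r (0, v) / D r (1, 0)" for v
  proof -
   have "D r (h' v) = 0" "snd (h' v) = v" using h'(2)[of v] by auto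
   hence "fst (h' v) * D r (1, 0) = - D r (0, v)"
    using split[of "fst (h' v)" "snd (h' v)", unfolded prod.collapse] by simp
   thus ?thesis using ndeg[OF r, folded D_def] by (intro eq_divide_imp)
  qed
  ultimately show ?thesis by simp
 qed
 thus "!!r. r \<in> Q ==> (sg has_derivative (%v. - FD F (sg r, r) (0, v) /
     FD F (sg r, r) (1, 0))) (at r)"
  by (simp add: D_def)
 have "Ck_on k Q sg" for k
 proof (induction k)
  case (Suc k)
  have pair: "Ck_on k Q (%r. (sg r, r))"
  proof -
   have "bounded_linear (%x::real. (x, 0::'a))" "bounded_linear (%x::'a. (0::real, x))"
    by (auto intro!: bounded_linear_Pair bounded_linear_ident bounded_linear_zero)
   hence "Ck_on k Q (%r. (sg r, 0) + (0, r))"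
    by (intro Ck_on_add Q Ck_on_linear_compose[OF Q _ Suc.IH] Ck_on_bounded_linear)
   thus ?thesis by simp
  qed
  have comp: "Ck_on k Q (%r. D r v)" for v
   unfolding D_def
   by (rule Ck_on_compose[OF Q U pair]) (use inU smooth_on_frechet_derivative[OF F] in \<open>auto simp: smooth_on_def\<close>)
  have inv: "Ck_on k Q (%r. inverse (D r (1, 0)))"
   by (rule Ck_on_compose[OF Q _ comp, of "- {0}"])
    (use ndeg smooth_on_inverse_real in \<open>auto simp: D_def smooth_on_def\<close>)
  have "Ck_on k Q (%r. - (D r (0, v) * inverse (D r (1, 0))))" for v
   by (intro Ck_on_linear_compose[OF Q bounded_linear_minus[OF bounded_linear_ident]]
     Ck_on_bilinear[OF Q bounded_bilinear_mult] comp inv)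
  thus ?case
   by (intro Ck_on_SucI[OF Q der]) (simp_all add: divide_inverse del: Ck_on.simps)
 qed (use sg in simp)
 thus "smooth_on Q sg" by (simp add: smooth_on_def del: Ck_on.simps)
qed

section \<open>Smooth dependence of integrals on parameters\<close>

lemma has_derivative_integral_param:
 fixes F :: "'p::euclidean_space => 'q::euclidean_space => real"
 assumes Q: "open Q" and F: "Ck_on (Suc k) (UNIV \<times> Q) (%z. F (fst z) (snd z))" and q: "q \<in> Q"
 defines "D \<equiv> %z. FD (%z. F (fst z) (snd z)) z"
 shows "((%q. integral (cbox a b) (%p. F p q)) has_derivative
   (%v. integral (cbox a b) (%p. D (p, q) (0, v)))) (at q)"
proof -
 have D: "((%z. F (fst z) (snd z)) has_derivative D z) (at z)" if "snd z \<in> Q" for z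
  unfolding D_def by (rule Ck_on_has_derivative[OF F]) (use that in \<open>auto simp: mem_Times_iff\<close>)
 have DC: "Ck_on k (UNIV \<times> Q) (%z. D z v)" for v
  using F unfolding D_def Ck_on.simps(2) by blast
 \<comment> \<open>The Leibniz rule takes the partial derivative as a continuous map into bounded
   linear functions, hence the packaging as a \<open>blinfun\<close>.\<close>
 define L where "L q p = Blinfun (%v. D (p, q) (0, v))" for q p
 have bl: "bounded_linear (%v. D (p, q) (0, v))" if "q \<in> Q" for p q
 proof -
  have "bounded_linear (D (p, q))" using D[of "(p,q)"] that has_derivative_bounded_linear by auto
  moreover have "bounded_linear (%v::'q. (0::'p, v))"
   by (intro bounded_linear_Pair bounded_linear_ident bounded_linear_zero)
  ultimately show ?thesis by (rule bounded_linear_compose)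
 qed
 have L: "blinfun_apply (L q p) v = D (p, q) (0, v)" if "q \<in> Q" for p q v
  unfolding L_def using bounded_linear_Blinfun_apply[OF bl[OF that]] by simp
 have contD: "cts (Q \<times> cbox a b) (%(q, p). D (p, q) v)" for v
 proof -
  have "cts (UNIV \<times> Q) (%z. D z v)"
   using DC[of v] Ck_on_mono[of k _ _ 0] by auto
  hence "cts (Q \<times> cbox a b) (%z. D (prod.swap z) v)"
   by (rule continuous_on_compose2) (auto intro: continuous_on_swap)
  thus ?thesis by (simp add: case_prod_unfold prod.swap_def)
 qed
 have contL: "cts (Q \<times> cbox a b) (%(q, p). L q p)"
 proof (rule continuous_on_blinfun_componentwise)
  fix i :: 'q
  have "cts (Q \<times> cbox a b) (%(q, p). D (p, q) (0, i))" by (rule contD)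
  thus "cts (Q \<times> cbox a b) (%x. blinfun_apply (case x of (q, p) => L q p) i)"
   by (rule continuous_on_eq) (auto simp: L)
 qed
 have contF: "cts (cbox a b) (%p. F p q)" if "q \<in> Q" for q
 proof -
  have "cts (UNIV \<times> Q) (%z. F (fst z) (snd z))"
   using Ck_on_mono[OF F, of 0] by auto
  hence "cts (cbox a b) (%p. F (fst (p, q)) (snd (p, q)))"
   by (rule continuous_on_compose2) (auto intro!: continuous_intros that)
  thus ?thesis by simp
 qed
 show ?thesis
 proof -
  obtain e where e: "e > 0" "ball q e \<subseteq> Q" using Q q openE by blast
  have "((%q. integral (cbox a b) (%p. F p q)) has_derivative
    integral (cbox a b) (L q)) (at q within ball q e)"
  proof (rule leibniz_rule)
   fix x and p :: 'p assume x: "x \<in> ball q e"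
   have xQ: "x \<in> Q" using e x by auto
   have "((%x. (p, x)) has_derivative (%v. (0, v))) (at x)"
    by (intro has_derivative_Pair has_derivative_const has_derivative_ident)
   hence "((%x. F (fst (p, x)) (snd (p, x))) has_derivative (%v. D (p, x) (0, v))) (at x)"
    by (rule has_derivative_compose) (rule D, simp add: xQ)
   moreover have "blinfun_apply (L x p) = (%v. D (p, x) (0, v))"
    using L[OF xQ] by blast
   ultimately show "((%x. F p x) has_derivative blinfun_apply (L x p)) (at x within ball q e)"
    by (simp add: has_derivative_at_withinI)
  next
   fix x assume "x \<in> ball q e"
   thus "(%p. F p x) integrable_on cbox a b"
    using e by (intro integrable_continuous contF) auto
  next
   show "cts (ball q e \<times> cbox a b) (%(x, t). L x t)"
    by (rule continuous_on_subset[OF contL]) (use e in auto)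
  qed (use e in auto)
  moreover have "blinfun_apply (integral (cbox a b) (L q)) v = integral (cbox a b) (%p. D (p, q) (0, v))" for v
  proof -
   have "cts (cbox a b) (L q)"
   proof -
    have "cts (cbox a b) (%p. (q, p))"
     by (rule continuous_on_Pair[OF continuous_on_const continuous_on_id])
    from continuous_on_compose2[OF contL this] q show ?thesis by auto
   qed
   thus ?thesis
    by (subst blinfun_apply_integral) (auto simp: L[OF q] intro: integrable_continuous)
  qed
  hence "blinfun_apply (integral (cbox a b) (L q)) = (%v. integral (cbox a b) (%p. D (p, q) (0, v)))"
   by blast
  ultimately show ?thesis
   using e(1) by (simp add: at_within_open[of q "ball q e"])
 qed
qed

lemma Ck_on_integral_param:
 fixes F :: "'p::euclidean_space => 'q::euclidean_space => real"
 assumes "open Q"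
 shows "Ck_on k (UNIV \<times> Q) (%z. F (fst z) (snd z)) ==> Ck_on k Q (%q. integral (cbox a b) (%p. F p q))"
proof (induction k arbitrary: F)
 case 0
 hence "cts (UNIV \<times> Q) (%z. F (fst z) (snd z))" by simp
 hence "cts (Q \<times> cbox a b) (%z. F (fst (prod.swap z)) (snd (prod.swap z)))"
  by (rule continuous_on_compose2) (auto intro: continuous_on_swap)
 hence "cts (Q \<times> cbox a b) (%(q, p). F p q)"
  by (simp add: case_prod_unfold)
 thus ?case by (simp add: integral_continuous_on_param)
next
 case (Suc k)
 define D where "D z = FD (%z. F (fst z) (snd z)) z" for z
 have DC: "Ck_on k (UNIV \<times> Q) (%z. D z v)" for v
  using Suc.prems unfolding D_def Ck_on.simps(2) by blast
 show ?case
 proof (rule Ck_on_SucI[OF assms has_derivative_integral_param[OF assms Suc.prems, folded D_def]])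
  fix v
  show "Ck_on k Q (%q. integral (cbox a b) (%p. D (p, q) (0, v)))"
   using Suc.IH[of "%p q. D (p, q) (0, v)"] DC[of "(0, v)"] by simp
 qed
qed

lemma smooth_on_integral_param:
 fixes F :: "'p::euclidean_space => 'q::euclidean_space => real"
 assumes "open Q" "smooth_on (UNIV \<times> Q) (%z. F (fst z) (snd z))"
 shows "smooth_on Q (%q. integral (cbox a b) (%p. F p q))"
 using assms Ck_on_integral_param unfolding smooth_on_def by blast

section \<open>Reindexing and change of variables\<close>

lemma Basis_vec_eq: "(Basis :: (real ^ 'n::finite) set) = range (%i. axis i 1)"
 by (auto simp: Basis_vec_def)

lemma inj_axis_one: "inj (%i. axis i (1::real) :: real ^ 'n::finite)"
 by (auto simp: inj_on_def axis_eq_axis)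

lemma prod_Basis_vec:
 fixes x :: "real ^ 'n::finite"
 shows "(\<Prod>b\<in>Basis. f (x \<bullet> b)) = (\<Prod>i\<in>UNIV. f (x $ i))"
 unfolding Basis_vec_eq by (subst prod.reindex[OF inj_axis_one]) (simp add: inner_axis)

lemma emeasure_lborel_box_vec:
 fixes l u :: "real ^ 'n::finite"
 assumes "!!i. l $ i <= u $ i"
 shows "emeasure lborel (box l u) = ennreal (\<Prod>i\<in>UNIV. u $ i - l $ i)"
proof -
 have "emeasure lborel (box l u) = (\<Prod>b\<in>Basis. (u - l) \<bullet> b)"
  by (rule emeasure_lborel_box) (use assms in \<open>auto simp: Basis_vec_eq inner_axis\<close>)
 also have "(\<Prod>b\<in>Basis. (u - l) \<bullet> b) = (\<Prod>i\<in>UNIV. (u - l) $ i)"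
  by (rule prod_Basis_vec[where f = "%x. x"])
 finally show ?thesis by simp
qed

lemma mem_box_vec: "x \<in> box l u \<longleftrightarrow> (\<forall>i. l $ i < x $ i & x $ i < u $ i)" for x :: "real ^ 'n::finite"
 by (auto simp: mem_box Basis_vec_eq inner_axis)

lemma mem_cbox_vec: "x \<in> cbox l u \<longleftrightarrow> (\<forall>i. l $ i <= x $ i & x $ i <= u $ i)" for x :: "real ^ 'n::finite"
 by (auto simp: mem_box Basis_vec_eq inner_axis)

lemma lborel_eqI_vec:
 fixes M :: "(real ^ 'n::finite) measure"
 assumes "!!l u. (!!i. l $ i <= u $ i) ==> emeasure M (box l u) = ennreal (\<Prod>i\<in>UNIV. u $ i - l $ i)"
  and "sets M = sets borel"
 shows "lborel = M"
proof (rule lborel_eqI[OF _ assms(2)])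
 fix l u :: "real ^ 'n"
 assume le: "!!b. b \<in> Basis ==> l \<bullet> b <= u \<bullet> b"
 have "l $ i <= u $ i" for i using le[of "axis i 1"] by (simp add: Basis_vec_eq inner_axis)
 hence "emeasure M (box l u) = ennreal (\<Prod>i\<in>UNIV. (u - l) $ i)"
  using assms(1) by simp
 also have "(\<Prod>i\<in>UNIV. (u - l) $ i) = (\<Prod>b\<in>Basis. (u - l) \<bullet> b)"
  by (rule prod_Basis_vec[where f = "%x. x", symmetric])
 finally show "emeasure M (box l u) = (\<Prod>b\<in>Basis. (u - l) \<bullet> b)" .
qed

definition vreindex :: "('n => 'm) => real ^ 'm::finite => real ^ 'n::finite" where
 "vreindex \<rho> y = (\<chi> i. y $ \<rho> i)"

lemma vreindex_inverse: "bij \<rho> ==> vreindex (inv \<rho>) (vreindex \<rho> y) = y"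
 by (simp add: vreindex_def vec_eq_iff bij_is_surj surj_f_inv_f)

lemma vreindex_inverse': "bij \<rho> ==> vreindex \<rho> (vreindex (inv \<rho>) y) = y"
 by (simp add: vreindex_def vec_eq_iff bij_is_inj inv_f_f)

lemma bounded_linear_vreindex: "bounded_linear (vreindex \<rho>)"
 by (subst linear_conv_bounded_linear[symmetric]) (auto intro!: linearI simp: vreindex_def vec_eq_iff)

lemma measurable_bounded_linear: "bounded_linear L ==> L \<in> bmeas"
 by (intro borel_measurable_continuous_onI) (simp add: linear_continuous_on)

lemma distr_vreindex:
 fixes \<rho> :: "'n::finite => 'm::finite"
 assumes "bij \<rho>"
 shows "distr lborel borel (vreindex \<rho>) = lborel"
proof (rule lborel_eqI_vec[symmetric])
 fix l u :: "real ^ 'n"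
 assume le: "!!i. l $ i <= u $ i"
 have meas: "vreindex \<rho> \<in> bmeas"
  by (rule measurable_bounded_linear[OF bounded_linear_vreindex])
 have inv: "\<rho> (inv \<rho> i) = i" "inv \<rho> (\<rho> k) = k" for i k
  using assms by (simp_all add: bij_is_surj surj_f_inv_f bij_is_inj)
 have f1: "l $ inv \<rho> i < x $ i & x $ i < u $ inv \<rho> i" if "\<forall>i. l $ i < x $ \<rho> i & x $ \<rho> i < u $ i" for x :: "real ^ 'm" and i
  using spec[OF that, of "inv \<rho> i"] by (simp add: inv)
 have f2: "l $ i < x $ \<rho> i & x $ \<rho> i < u $ i" if "\<forall>i. l $ inv \<rho> i < x $ i & x $ i < u $ inv \<rho> i" for x :: "'m rv" and i
  using spec[OF that, of "\<rho> i"] by (simp add: inv)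
 have "vreindex \<rho> -` box l u = box (vreindex (inv \<rho>) l) (vreindex (inv \<rho>) u)"
  by (rule set_eqI, simp only: vimage_eq mem_box_vec vreindex_def vec_lambda_beta) (use f1 f2 in blast)
 hence "emeasure (distr lborel borel (vreindex \<rho>)) (box l u) = ennreal (\<Prod>i\<in>UNIV. u $ inv \<rho> i - l $ inv \<rho> i)"
  using meas le by (subst emeasure_distr) (auto simp: emeasure_lborel_box_vec vreindex_def)
 also have "(\<Prod>i\<in>UNIV. u $ inv \<rho> i - l $ inv \<rho> i) = (\<Prod>i\<in>UNIV. u $ i - l $ i)"
  using bij_imp_bij_inv[OF assms] by (rule prod.reindex_bij_betw)
 finally show "emeasure (distr lborel borel (vreindex \<rho>)) (box l u) = ennreal (\<Prod>i\<in>UNIV. u $ i - l $ i)" .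
qed simp

text \<open>Conjugation with f is a sign-preserving bijection between the permutations of the two
  index types.\<close>

lemma det_reindex:
 fixes A :: "real ^ 'n ^ 'n::finite" and f :: "'m::finite => 'n"
 assumes f: "bij f"
 shows "det (\<chi> i j. A $ f i $ f j) = det A"
proof -
 let ?m = "map_permutation (UNIV::'m set) f"
 have inj: "inj f" and surj: "surj f" using f by (auto simp: bij_def)
 have app: "?m p (f i) = f (p i)" for p i
  using inj surj by (simp add: map_permutation_def restrict_id_def)
 have perm: "?m p permutes UNIV" if "p permutes UNIV" for p
  by (rule map_permutation_permutes[OF f that])
 have bij: "bij_betw ?m {p. p permutes UNIV} {p. p permutes UNIV}"
 proof (rule bij_betwI')
  fix p q assume "p \<in> {p. p permutes (UNIV::'m set)}" "q \<in> {p. p permutes (UNIV::'m set)}"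
  show "(?m p = ?m q) = (p = q)"
  proof
   assume "?m p = ?m q"
   hence "f (p i) = f (q i)" for i using app[of p i] app[of q i] by simp
   thus "p = q" using inj by (auto simp: inj_def)
  qed simp
 next
  fix p assume "p \<in> {p. p permutes (UNIV::'m set)}"
  thus "?m p \<in> {p. p permutes UNIV}" using perm by simp
 next
  fix q assume q: "q \<in> {p. p permutes (UNIV::'n set)}"
  have "bij (inv f \<circ> q \<circ> f)"
  proof -
   have "bij q" using q permutes_bij by blast
   thus ?thesis using f by (intro bij_comp bij_imp_bij_inv)
  qed
  hence "inv f \<circ> q \<circ> f permutes UNIV" by (rule bij_imp_permutes) simp
  moreover have "q x = ?m (inv f \<circ> q \<circ> f) x" for x
   using app[of "inv f \<circ> q \<circ> f" "inv f x"] surj by (simp add: surj_f_inv_f)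
  ultimately show "\<exists>p\<in>{p. p permutes UNIV}. q = ?m p" by blast
 qed
 have "det A = (\<Sum>p | p permutes UNIV. of_int (sign (?m p)) * (\<Prod>i\<in>UNIV. A $ i $ ?m p i))"
  unfolding det_def by (rule sum.reindex_bij_betw[OF bij, symmetric])
 also have "... = (\<Sum>p | p permutes UNIV. of_int (sign p) * (\<Prod>i\<in>UNIV. A $ f i $ f (p i)))"
 proof (rule sum.cong[OF refl])
  fix p assume "p \<in> {p. p permutes (UNIV::'m set)}"
  hence "sign (?m p) = sign p" by (intro sign_map_permutation) (auto intro: inj)
  moreover have "(\<Prod>i\<in>UNIV. A $ i $ ?m p i) = (\<Prod>i\<in>UNIV. A $ f i $ ?m p (f i))"
   by (rule prod.reindex_bij_betw[OF f, symmetric])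
  ultimately show "of_int (sign (?m p)) * (\<Prod>i\<in>UNIV. A $ i $ ?m p i) =
    of_int (sign p) * (\<Prod>i\<in>UNIV. A $ f i $ f (p i))"
   by (simp add: app)
 qed
 also have "... = det (\<chi> i j. A $ f i $ f j)" by (simp add: det_def)
 finally show ?thesis ..
qed

text \<open>
 The change of variables theorem of the library requires a well-ordered index type;
 an arbitrary finite type is isomorphic to such a type.
\<close>

typedef 'a ordered_copy = "UNIV :: 'a set" ..

instance ordered_copy :: (finite) finite
proof
 have "(UNIV :: 'a ordered_copy set) = range Abs_ordered_copy"
  by (metis Abs_ordered_copy_cases surjI)
 thus "finite (UNIV :: 'a ordered_copy set)" by (metis finite finite_imageI)
qed

instantiation ordered_copy :: (finite) wellorder
begin

definition less_eq_ordered_copy :: "'a ordered_copy => 'a ordered_copy => bool" where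
 "less_eq_ordered_copy x y \<longleftrightarrow> to_nat (Rep_ordered_copy x) <= to_nat (Rep_ordered_copy y)"

definition less_ordered_copy :: "'a ordered_copy => 'a ordered_copy => bool" where
 "less_ordered_copy x y \<longleftrightarrow> to_nat (Rep_ordered_copy x) < to_nat (Rep_ordered_copy y)"

instance
proof
 fix P :: "'a ordered_copy => bool" and a
 assume step: "!!x. (!!y. y < x ==> P y) ==> P x"
 show "P a"
  by (induction a rule: measure_induct_rule[of "%x. to_nat (Rep_ordered_copy x)"])
   (auto intro: step simp: less_ordered_copy_def)
qed (auto simp: less_eq_ordered_copy_def less_ordered_copy_def Rep_ordered_copy_inject)

end

lemma bij_Rep_ordered_copy: "bij (Rep_ordered_copy :: 'a ordered_copy => 'a)"
 by (rule bijI') (auto simp: Rep_ordered_copy_inject intro: Abs_ordered_copy_inverse[symmetric])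

lemma emeasure_differentiable_image_wellorder:
 fixes h :: "real ^ 'n::{finite,wellorder} => real ^ 'n::_"
 assumes S: "S \<in> sets borel" and hS: "h ` S \<in> sets borel"
  and der: "!!x. x \<in> S ==> (h has_derivative h' x) (at x)" and inj: "inj_on h S"
  and J: "J \<in> bmeas" "!!x. x \<in> S ==> J x = \<bar>det (matrix (h' x))\<bar>"
 shows "emeasure lborel (h ` S) = (LBNN x. ennreal (J x) * ind S x)"
proof -
 have leb: "S \<in> sets lebesgue" using S by auto
 have der': "(h has_derivative h' x) (at x within S)" if "x \<in> S" for x
  using der[OF that] has_derivative_at_withinI by blast
 note key = has_measure_differentiable_image[OF leb der' inj]
 let ?J = "%x. J x * ind S x"
 have Jnn: "?J x >= 0" for x using J(2) by (auto simp: indicator_def)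
 have hi: "((%x. \<bar>det (matrix (h' x))\<bar>) has_integral m) S \<longleftrightarrow> (?J has_integral m) UNIV" for m
 proof -
  have "((%x. \<bar>det (matrix (h' x))\<bar>) has_integral m) S \<longleftrightarrow>
    ((%x. if x \<in> S then \<bar>det (matrix (h' x))\<bar> else 0) has_integral m) UNIV"
   by (rule has_integral_restrict_UNIV[symmetric])
  also have "(%x. if x \<in> S then \<bar>det (matrix (h' x))\<bar> else 0) = ?J"
   using J(2) by (auto simp: fun_eq_iff)
  finally show ?thesis .
 qed
 have meas: "?J \<in> borel_measurable lborel" using J(1) S by auto
 have eqn: "(LBNN x. ennreal (J x) * ind S x) = (LBNN x. ennreal (?J x))"
  using J(2) by (intro nn_integral_cong) (auto simp: indicator_def)
 have fin_iff: "h ` S \<in> lmeasurable \<longleftrightarrow> emeasure lborel (h ` S) < \<infinity>"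
  using hS by (auto simp: fmeasurable_def)
 show ?thesis
 proof (cases "emeasure lborel (h ` S) < \<infinity>")
  case True
  hence "((%x. \<bar>det (matrix (h' x))\<bar>) has_integral measure lebesgue (h ` S)) S"
   using key fin_iff by blast
  hence "(LBNN x. ennreal \<bar>det (matrix (h' x))\<bar> * ind S x) = ennreal (measure lebesgue (h ` S))"
   by (intro nn_integral_has_integral_lebesgue') auto
  moreover have "(LBNN x. ennreal \<bar>det (matrix (h' x))\<bar> * ind S x) =
    (LBNN x. ennreal (J x) * ind S x)"
   using J(2) by (intro nn_integral_cong) (simp split: split_indicator)
  moreover have "emeasure lborel (h ` S) = ennreal (measure lebesgue (h ` S))"
   using True hS by (simp add: emeasure_eq_ennreal_measure)
  ultimately show ?thesis by simp
 next
  \<comment> \<open>If the image had infinite measure and the integral were finite, the Jacobian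
    would be integrable, and the equivalence in \<open>key\<close> would give the image finite
    measure.\<close>
  case False
  show ?thesis
  proof (rule ccontr)
   assume neq: "\<not> ?thesis"
   moreover have "emeasure lborel (h ` S) = \<infinity>"
    using False by (metis infinity_ennreal_def top.not_eq_extremum)
   ultimately have "(LBNN x. ennreal (?J x)) ~= \<infinity>"
    using eqn by simp
   hence "(LBNN x. ennreal (?J x)) < \<infinity>"
    by (simp add: less_top)
   hence "integrable lborel ?J"
    using meas Jnn by (auto simp: integrable_iff_bounded)
   hence "(?J has_integral (LBINT x. ?J x)) UNIV"
    by (rule has_integral_integral_lborel)
   hence "h ` S \<in> lmeasurable" using key hi by blast
   thus False using fin_iff False by simp
  qed
 qed
qed

text \<open>Conjugation with the coordinate permutation \<open>vreindex\<close> moves the problem to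
  a well-ordered index type. It preserves Lebesgue measure, and reindexing rows and columns together
  preserves the determinant.\<close>

lemma emeasure_differentiable_image:
 fixes h :: "real ^ 'n::finite => real ^ 'n"
 assumes S: "S \<in> sets borel" and hS: "h ` S \<in> sets borel"
  and der: "!!x. x \<in> S ==> (h has_derivative h' x) (at x)" and inj: "inj_on h S"
  and J: "J \<in> bmeas" "!!x. x \<in> S ==> J x = \<bar>det (matrix (h' x))\<bar>"
 shows "emeasure lborel (h ` S) = (LBNN x. ennreal (J x) * ind S x)"
proof -
 define \<rho> :: "'n ordered_copy => 'n" where "\<rho> = Rep_ordered_copy"
 have \<rho>: "bij \<rho>" by (simp add: \<rho>_def bij_Rep_ordered_copy)
 let ?to = "vreindex \<rho> :: 'n rv => real ^ 'n ordered_copy"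
 let ?from = "vreindex (inv \<rho>) :: real ^ 'n ordered_copy => 'n rv"
 have ft [simp]: "?from (?to x) = x" for x by (rule vreindex_inverse[OF \<rho>])
 have tf [simp]: "?to (?from y) = y" for y by (rule vreindex_inverse'[OF \<rho>])
 have meas [measurable]: "?to \<in> bmeas" "?from \<in> bmeas"
  by (auto intro: measurable_bounded_linear bounded_linear_vreindex)
 have image_vimage: "?to ` A = ?from -` A" for A
  by (auto simp: image_iff) (metis tf)
 have borel: "?to ` A \<in> sets borel" if "A \<in> sets borel" for A
  unfolding image_vimage by (rule measurable_sets_borel[OF meas(2) that])
 have em: "emeasure lborel (?to ` A) = emeasure lborel A" if A: "A \<in> sets borel" for A
 proof -
  have "emeasure lborel A = emeasure (distr lborel borel ?from) A"
   by (simp add: distr_vreindex[OF bij_imp_bij_inv[OF \<rho>]])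
  thus ?thesis using A by (simp add: emeasure_distr image_vimage)
 qed
 define k where "k = (%y. ?to (h (?from y)))"
 define k' where "k' = (%y v. ?to (h' (?from y) (?from v)))"
 have kS: "k ` (?to ` S) = ?to ` (h ` S)" by (auto simp: k_def image_iff)
 have bl: "bounded_linear ?to" "bounded_linear ?from" by (rule bounded_linear_vreindex)+
 have kd: "(k has_derivative k' y) (at y)" if "y \<in> ?to ` S" for y
 proof -
  have "?from y \<in> S" using that by auto
  hence "((%y. h (?from y)) has_derivative (%v. h' (?from y) (?from v))) (at y)"
   by (intro has_derivative_compose[OF bounded_linear_imp_has_derivative[OF bl(2)] der])
  thus ?thesis
   unfolding k_def k'_def by (rule bounded_linear.has_derivative[OF bl(1)])
 qed
 have kinj: "inj_on k (?to ` S)"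
 proof (rule inj_onI)
  fix y z assume yz: "y \<in> ?to ` S" "z \<in> ?to ` S" "k y = k z"
  then obtain s t where st: "s \<in> S" "t \<in> S" "y = ?to s" "z = ?to t" by blast
  have "?from (k y) = ?from (k z)" using yz(3) by simp
  hence "h s = h t" by (simp add: k_def st(3,4))
  hence "s = t" using inj st(1,2) by (simp add: inj_on_eq_iff)
  thus "y = z" by (simp add: st(3,4))
 qed
 have det: "det (matrix (k' y)) = det (matrix (h' (?from y)))" for y
 proof -
  have inv: "inv \<rho> (\<rho> j) = j" for j using \<rho> by (simp add: bij_is_inj)
  have eq: "inv \<rho> i = j \<longleftrightarrow> i = \<rho> j" for i j using \<rho> by (metis bij_inv_eq_iff)
  have "?from (axis j 1) = axis (\<rho> j) 1" for j
   by (simp add: vreindex_def axis_def vec_eq_iff eq)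
  hence "matrix (k' y) = (\<chi> i j. matrix (h' (?from y)) $ \<rho> i $ \<rho> j)"
   by (simp add: matrix_def k'_def vreindex_def)
  thus ?thesis using det_reindex[OF \<rho>] by metis
 qed
 have "emeasure lborel (h ` S) = emeasure lborel (k ` (?to ` S))"
  unfolding kS using em[OF hS] by simp
 also have "... = (LBNN y. ennreal (J (?from y)) * ind (?to ` S) y)"
 proof (rule emeasure_differentiable_image_wellorder[OF borel[OF S] _ kd kinj])
  show "k ` ?to ` S \<in> sets borel" unfolding kS by (rule borel[OF hS])
  show "(%y. J (?from y)) \<in> bmeas" using J(1) by measurable
  show "J (?from y) = \<bar>det (matrix (k' y))\<bar>" if "y \<in> ?to ` S" for y
   using that J(2) det by auto
 qed
 also have "... = (LBNN y. ennreal (J (?from y)) * ind S (?from y))"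
  by (intro nn_integral_cong) (auto simp: image_vimage indicator_def)
 also have "... = (\<integral>\<^sup>+x. ennreal (J x) * ind S x \<partial>distr lborel borel ?from)"
  using J(1) S by (subst nn_integral_distr) auto
 finally show ?thesis by (simp add: distr_vreindex[OF bij_imp_bij_inv[OF \<rho>]])
qed

lemma nn_integral_change_of_variables:
 fixes h :: "real ^ 'n::finite => real ^ 'n" and f :: "'n rv => ennreal"
 assumes S: "S \<in> sets borel" and hS: "h ` S \<in> sets borel"
  and hE: "!!E. E \<in> sets borel ==> S \<inter> h -` E \<in> sets borel"
  and der: "!!x. x \<in> S ==> (h has_derivative h' x) (at x)" and inj: "inj_on h S"
  and J: "J \<in> bmeas" "!!x. x \<in> S ==> J x = \<bar>det (matrix (h' x))\<bar>"
  and f: "f \<in> bmeas"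
 shows "(LBNN y. f y * ind (h ` S) y) = (LBNN x. ennreal (J x) * f (h x) * ind S x)"
proof -
 \<comment> \<open>Extension by 0 gives a Borel function on the whole space, so that a push-forward
   measure exists; the density vanishes off S, where the extension is arbitrary.\<close>
 define g where "g x = (if x \<in> S then h x else 0)" for x
 have g [measurable]: "g \<in> bmeas"
 proof (rule measurableI)
  fix E :: "'n rv set" assume E: "E \<in> sets borel"
  have "g -` E \<inter> space borel = (S \<inter> h -` E) \<union> (if 0 \<in> E then - S else {})"
   by (auto simp: g_def split: if_splits)
  thus "g -` E \<inter> space borel \<in> sets borel" using hE[OF E] S by auto
 qed auto
 have JS: "(%x. ennreal (J x) * ind S x) \<in> borel_measurable lborel" using J S by auto
 have "density lborel (ind (h ` S)) = distr (density lborel (%x. ennreal (J x) * ind S x)) lborel g"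
 proof (rule measure_eqI)
  fix E assume "E \<in> sets (density lborel (ind (h ` S)))"
  hence E: "E \<in> sets borel" by simp
  have im: "h ` (S \<inter> h -` E) = h ` S \<inter> E" by auto
  have "emeasure (density lborel (ind (h ` S))) E = emeasure lborel (h ` S \<inter> E)"
   using E hS by (simp add: emeasure_density indicator_inter_arith[symmetric])
  also have "... = emeasure lborel (h ` (S \<inter> h -` E))" by (simp add: im)
  also have "... = (LBNN x. ennreal (J x) * ind (S \<inter> h -` E) x)"
   using hE[OF E] hS E der inj J by (intro emeasure_differentiable_image) (auto simp: im intro: inj_on_subset)
  also have "... = (LBNN x. ennreal (J x) * ind S x * ind (g -` E) x)"
   by (intro nn_integral_cong) (auto simp: g_def indicator_def)
  also have "... = emeasure (distr (density lborel (%x. ennreal (J x) * ind S x)) lborel g) E"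
   using E JS measurable_sets_borel[OF g E] by (simp add: emeasure_distr emeasure_density)
  finally show "emeasure (density lborel (ind (h ` S))) E =
    emeasure (distr (density lborel (%x. ennreal (J x) * ind S x)) lborel g) E" .
 qed simp
 hence "(\<integral>\<^sup>+y. f y \<partial>density lborel (ind (h ` S))) =
   (\<integral>\<^sup>+y. f y \<partial>distr (density lborel (%x. ennreal (J x) * ind S x)) lborel g)"
  by simp
 also have "... = (LBNN x. (ennreal (J x) * ind S x) * f (g x))"
  using f JS by (subst nn_integral_distr) (auto simp: nn_integral_density)
 also have "... = (LBNN x. ennreal (J x) * f (h x) * ind S x)"
  by (intro nn_integral_cong) (auto simp: g_def indicator_def)
 also have "(\<integral>\<^sup>+y. f y \<partial>density lborel (ind (h ` S))) = (LBNN y. f y * ind (h ` S) y)"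
  using f hS by (simp add: nn_integral_density mult.commute)
 finally show ?thesis .
qed

section \<open>Change of local parametrization\<close>

lemma borel_preimage_continuous_on:
 assumes "cts U f" "U \<in> sets borel" "A \<in> sets borel"
 shows "U \<inter> f -` A \<in> sets borel"
proof -
 have "f -` A \<inter> space (restrict_space borel U) \<in> sets (restrict_space borel U)"
  using borel_measurable_continuous_on_restrict[OF assms(1)] assms(3) by (rule measurable_sets)
 thus ?thesis
  using assms(2) by (simp add: sets_restrict_space_iff space_restrict_space Int_commute)
qed

lemma borel_measurable_if_continuous_on:
 fixes f :: "'a::topological_space => real"
 assumes "cts U f" "U \<in> sets borel"
 shows "(%x. if x \<in> U then f x else 0) \<in> bmeas"
proof -
 have "(%x. f x * ind U x) \<in> bmeas"
  using borel_measurable_continuous_on_restrict[OF assms(1)] assms(2)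
  by (subst (asm) borel_measurable_restrict_space_iff) (simp_all add: mult.commute)
 moreover have "(%x. f x * ind U x) = (%x. if x \<in> U then f x else 0)"
  by (auto simp: fun_eq_iff)
 ultimately show ?thesis by simp
qed

lemma local_paramD:
 assumes "local_param M U \<phi>"
 shows "open U" "smooth_on U \<phi>" "!!q. q \<in> U ==> inj (FD \<phi> q)"
  "openin (top_of_set M) (\<phi> ` U)" "inj_on \<phi> U" "\<phi> ` U \<subseteq> M" "cts U \<phi>"
  "!!q. q \<in> U ==> (\<phi> has_derivative FD \<phi> q) (at q)"
proof -
 show "open U" "smooth_on U \<phi>" "!!q. q \<in> U ==> inj (FD \<phi> q)"
  "openin (top_of_set M) (\<phi> ` U)" "inj_on \<phi> U"
  using assms by (auto simp: local_param_def homeomorphism_def intro: inj_on_inverseI)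
 thus "\<phi> ` U \<subseteq> M" "cts U \<phi>"
   "!!q. q \<in> U ==> (\<phi> has_derivative FD \<phi> q) (at q)"
  using openin_subset smooth_on_cts smooth_on_has_derivative by fastforce+
qed

text \<open>A parametrization is only required to be a homeomorphism onto its image, so the
  transition map is at first merely continuous. It is differentiable by the lifting lemma, as
  \<open>sg\<close> is an immersion.\<close>

lemma local_param_transition:
 fixes \<phi> sg :: "real ^ 'n::finite => 'e::euclidean_space"
 assumes \<phi>: "local_param M U \<phi>" and sg: "local_param M V sg"
 obtains h where "open (U \<inter> \<phi> -` (sg ` V))" "cts (U \<inter> \<phi> -` (sg ` V)) h"
  "!!q. q \<in> U \<inter> \<phi> -` (sg ` V) ==> h q \<in> V" "!!q. q \<in> U \<inter> \<phi> -` (sg ` V) ==> sg (h q) = \<phi> q"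
  "!!q. q \<in> U \<inter> \<phi> -` (sg ` V) ==> (h has_derivative FD h q) (at q)"
  "!!q v. q \<in> U \<inter> \<phi> -` (sg ` V) ==>
   FD sg (h q) (FD h q v) = FD \<phi> q v"
proof -
 let ?W = "U \<inter> \<phi> -` (sg ` V)"
 obtain \<psi> where \<psi>: "homeomorphism V (sg ` V) sg \<psi>" using sg by (auto simp: local_param_def)
 obtain T where T: "open T" "sg ` V = M \<inter> T"
  using local_paramD(4)[OF sg] by (auto simp: openin_open)
 have W: "?W = U \<inter> \<phi> -` T" using local_paramD(6)[OF \<phi>] T(2) by auto
 have open_W: "open ?W"
  unfolding W using local_paramD(1,7)[OF \<phi>] T(1) by (simp add: continuous_open_preimage)
 define h where "h = (%q. \<psi> (\<phi> q))"
 have hV: "h q \<in> V" if "q \<in> ?W" for q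
  using that \<psi> by (auto simp: h_def homeomorphism_def)
 have sgh: "sg (h q) = \<phi> q" if "q \<in> ?W" for q
  using that \<psi> by (auto simp: h_def homeomorphism_def)
 have cont: "cts ?W h"
  unfolding h_def
  by (rule continuous_on_compose2[of "sg ` V" \<psi>])
   (use \<psi> local_paramD(7)[OF \<phi>] in \<open>auto simp: homeomorphism_def intro: continuous_on_subset\<close>)
 have der: "\<exists>h'. (h has_derivative h') (at q) &
   (\<forall>v. FD sg (h q) (h' v) = FD \<phi> q v)" if q: "q \<in> ?W" for q
 proof -
  have 1: "isCont h q" using cont open_W q by (simp add: continuous_on_eq_continuous_at)
  have 2: "\<forall>\<^sub>F z in nhds q. sg (h z) = \<phi> z"
   using open_W q sgh unfolding eventually_nhds by blast
  have 3: "(sg has_derivative FD sg (h q)) (at (h q))"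
   by (rule local_paramD(8)[OF sg hV[OF q]])
  have 4: "(\<phi> has_derivative FD \<phi> q) (at q)"
   using local_paramD(8)[OF \<phi>] q by blast
  show ?thesis
   using has_derivative_continuous_lift[OF 1 2 3 local_paramD(3)[OF sg hV[OF q]] 4] by metis
 qed
 show ?thesis
 proof (rule that[OF open_W cont hV sgh])
  fix q v assume q: "q \<in> ?W"
  obtain h' where h': "(h has_derivative h') (at q)"
   "!!v. FD sg (h q) (h' v) = FD \<phi> q v"
   using der[OF q] by blast
  have eq: "FD h q = h'" using frechet_derivative_at[OF h'(1)] by simp
  show "(h has_derivative FD h q) (at q)" using h'(1) eq by simp
  show "FD sg (h q) (FD h q v) = FD \<phi> q v"
   using h'(2) eq by simp
 qed auto
qed

section \<open>Gram matrices and dual norms under linear changes of coordinates\<close>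

definition inner_form :: "('e::real_vector => 'e => real) => bool" where
 "inner_form B \<longleftrightarrow> bilinear B & (\<forall>\<xi>. \<xi> ~= 0 \<longrightarrow> 0 < B \<xi> \<xi>)"

definition form_matrix :: "('e::real_vector => 'e => real) => (real ^ 'n::finite => 'e) => real ^ 'n ^ 'n" where
 "form_matrix B D = (\<chi> i j. B (D (axis i 1)) (D (axis j 1)))"

lemma metric_coeffs_eq_form_matrix: "metric_coeffs g \<phi> q = form_matrix (g (\<phi> q)) (FD \<phi> q)"
 by (simp add: metric_coeffs_def form_matrix_def partial_deriv_def)

lemma vec_axis_expansion: "(\<Sum>i\<in>UNIV. x $ i *\<^sub>R axis i 1) = (x :: real ^ 'n::finite)"
 by (simp add: vec_eq_iff axis_def if_distrib if_distribR sum.delta cong: if_cong)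

lemma linear_axis_expansion:
 fixes D :: "real ^ 'n::finite => 'e::real_vector"
 assumes "linear D"
 shows "D x = (\<Sum>i\<in>UNIV. x $ i *\<^sub>R D (axis i 1))"
proof -
 have "D x = D (\<Sum>i\<in>UNIV. x $ i *\<^sub>R axis i 1)" by (simp only: vec_axis_expansion)
 also have "... = (\<Sum>i\<in>UNIV. x $ i *\<^sub>R D (axis i 1))"
  using assms by (simp add: linear_sum linear_scale)
 finally show ?thesis .
qed

lemma form_matrix_apply:
 assumes B: "bilinear B" and D: "linear D"
 shows "x \<bullet> (form_matrix B D *v y) = B (D x) (D y)"
proof -
 have lB: "linear (B a)" "linear (%x. B x a)" for a using B by (auto simp: bilinear_def)
 have "form_matrix B D *v y = (\<chi> i. B (D (axis i 1)) (D y))"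
 proof -
  have "(\<Sum>j\<in>UNIV. B (D (axis i 1)) (D (axis j 1)) * y $ j) = B (D (axis i 1)) (D y)" for i
   unfolding linear_axis_expansion[OF D, of y] by (simp add: linear_sum[OF lB(1)] linear_scale[OF lB(1)] mult.commute)
  thus ?thesis by (simp add: form_matrix_def matrix_vector_mult_def)
 qed
 hence "x \<bullet> (form_matrix B D *v y) = (\<Sum>i\<in>UNIV. x $ i * B (D (axis i 1)) (D y))"
  by (simp add: inner_vec_def)
 also have "... = B (D x) (D y)"
  unfolding linear_axis_expansion[OF D, of x] by (simp add: linear_sum[OF lB(2)] linear_scale[OF lB(2)])
 finally show ?thesis .
qed

lemma invertible_form_matrix:
 assumes B: "inner_form B" and D: "linear D" "inj D"
 shows "invertible (form_matrix B D)"
proof -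
 have "x = 0" if "form_matrix B D *v x = 0" for x
 proof (rule ccontr)
  assume "x ~= 0"
  hence "D x ~= 0" using D linear_injective_0 by blast
  hence "0 < B (D x) (D x)" using B by (auto simp: inner_form_def)
  moreover have "B (D x) (D x) = x \<bullet> (form_matrix B D *v x)"
   using form_matrix_apply[of B D x x] B D by (simp add: inner_form_def)
  ultimately show False using that by simp
 qed
 thus ?thesis by (simp add: invertible_left_inverse matrix_left_invertible_ker)
qed

lemma form_matrix_compose:
 fixes D :: "real ^ 'n::finite => 'e::real_vector" and h' :: "real ^ 'm::finite => real ^ 'n"
 assumes B: "bilinear B" and D: "linear D" and h: "linear h'"
 shows "form_matrix B (%v. D (h' v)) = transpose (matrix h') ** form_matrix B D ** matrix h'"
proof -
 have l: "linear (%v. D (h' v))" using linear_compose[OF h D] by (simp add: o_def)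
 have "x \<bullet> (form_matrix B (%v. D (h' v)) *v y) = x \<bullet> ((transpose (matrix h') ** form_matrix B D ** matrix h') *v y)" for x y
 proof -
  have "x \<bullet> (transpose T *v z) = (T *v x) \<bullet> z" for T :: "real ^ 'm ^ 'n" and z
   unfolding transpose_matrix_vector by (subst inner_commute, subst dot_lmul_matrix) (rule inner_commute)
  hence "x \<bullet> ((transpose (matrix h') ** form_matrix B D ** matrix h') *v y)
    = (matrix h' *v x) \<bullet> (form_matrix B D *v (matrix h' *v y))"
   by (simp only: matrix_vector_mul_assoc[symmetric])
  thus ?thesis
   using h by (simp add: form_matrix_apply[OF B l] form_matrix_apply[OF B D] matrix_works)
 qed
 hence "form_matrix B (%v. D (h' v)) *v y = (transpose (matrix h') ** form_matrix B D ** matrix h') *v y" for y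
  by (metis vector_eq_ldot)
 thus ?thesis by (simp add: matrix_eq)
qed

lemma matrix_inv_works:
 assumes "invertible (A :: real ^ 'n ^ 'n::finite)"
 shows "A *v (matrix_inv A *v x) = x" "matrix_inv A *v (A *v x) = x"
proof -
 have "A ** matrix_inv A = mat 1 & matrix_inv A ** A = mat 1"
  using assms unfolding invertible_def matrix_inv_def by (rule someI_ex)
 thus "A *v (matrix_inv A *v x) = x" "matrix_inv A *v (A *v x) = x"
  by (simp_all add: matrix_vector_mul_assoc)
qed

definition dual_normsq :: "('e::real_vector => 'e => real) => (real ^ 'n::finite => 'e) => (real ^ 'n => real) => real" where
 "dual_normsq B D l = (\<Sum>i\<in>UNIV. \<Sum>j\<in>UNIV. matrix_inv (form_matrix B D) $ i $ j * l (axis i 1) * l (axis j 1))"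

lemma dual_normsq_eq:
 fixes l :: "real ^ 'n::finite => real"
 shows "dual_normsq B D l = (\<chi> i. l (axis i 1)) \<bullet> (matrix_inv (form_matrix B D) *v (\<chi> i. l (axis i 1)))"
 by (simp add: dual_normsq_def inner_vec_def matrix_vector_mult_def sum_distrib_left mult_ac)

lemma linear_inner_axis: "linear l ==> (\<chi> i. l (axis i 1)) \<bullet> x = l x" for l :: "real ^ 'n::finite => real"
 by (subst (2) linear_axis_expansion) (auto simp: inner_vec_def mult.commute)

text \<open>If x represents the covector with respect to the pulled-back form, then h' x represents
  l with respect to the original one, and both dual norms equal l (h' x).\<close>

lemma dual_normsq_compose:
 fixes D :: "real ^ 'n::finite => 'e::real_vector" and h' :: "real ^ 'n => 'n rv"
 assumes B: "inner_form B" and D: "linear D" "inj D" and h: "linear h'" "inj h'" and l: "linear l"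
 shows "dual_normsq B (%v. D (h' v)) (%v. l (h' v)) = dual_normsq B D l"
proof -
 let ?C = "form_matrix B D" and ?C' = "form_matrix B (%v. D (h' v))"
 let ?b = "\<chi> i. l (axis i 1)" and ?b' = "\<chi> i. l (h' (axis i 1))"
 have lin: "linear (%v. D (h' v))" "linear (%v. l (h' v))"
  using linear_compose[OF h(1) D(1)] linear_compose[OF h(1) l] by (simp_all add: o_def)
 have injc: "inj (%v. D (h' v))" using inj_compose[OF D(2) h(2)] by (simp add: o_def)
 have C: "invertible ?C" and C': "invertible ?C'"
  using invertible_form_matrix B D lin injc by blast+
 have bil: "bilinear B" using B by (simp add: inner_form_def)
 define x where "x = matrix_inv ?C' *v ?b'"
 have x: "?C' *v x = ?b'" by (simp add: x_def matrix_inv_works[OF C'])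
 have "z \<bullet> (?C *v h' x) = z \<bullet> ?b" for z
 proof -
  obtain y where y: "z = h' y" using h linear_injective_imp_surjective by (metis surjD)
  have "z \<bullet> (?C *v h' x) = y \<bullet> (?C' *v x)"
   by (simp add: y form_matrix_apply[OF bil D(1)] form_matrix_apply[OF bil lin(1)])
  also have "... = l (h' y)" using linear_inner_axis[OF lin(2), of y] by (simp add: x inner_commute)
  also have "... = z \<bullet> ?b" using linear_inner_axis[OF l, of z] by (simp add: y inner_commute)
  finally show ?thesis .
 qed
 hence "?C *v h' x = ?b" by (metis vector_eq_ldot)
 hence hx: "matrix_inv ?C *v ?b = h' x" by (metis matrix_inv_works(2)[OF C])
 have "dual_normsq B (%v. D (h' v)) (%v. l (h' v)) = ?b' \<bullet> x"
  by (simp add: dual_normsq_eq x_def)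
 also have "... = l (h' x)" by (rule linear_inner_axis[OF lin(2)])
 also have "... = ?b \<bullet> h' x" by (rule linear_inner_axis[OF l, symmetric])
 finally show ?thesis by (simp add: dual_normsq_eq hx)
qed

text \<open>The definite description in \<open>diff_normsq\<close> has a value because the
  expression is the same in all charts around the point, by \<open>dual_normsq_compose\<close> for
  the derivative of the transition map. Any one chart then computes it.\<close>

lemma diff_normsq_eq:
 fixes sg :: "real ^ 'n::finite => 'e::euclidean_space"
 assumes sg: "local_param M V sg" and q: "q \<in> V" and g: "inner_form (g (sg q))"
  and u: "u \<in> smooth_compact_support TYPE('n) M"
 shows "diff_normsq TYPE('n) M g u (sg q) =
  dual_normsq (g (sg q)) (FD sg q) (FD (%x. u (sg x)) q)"
proof -
 have smooth: "smooth_on U (%x. u (\<phi> x))" if "local_param M U \<phi>" for U and \<phi> :: "real ^ 'n => 'e"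
  using u that by (auto simp: smooth_compact_support_def o_def)
 have inv: "dual_normsq (g (\<phi> q')) (FD \<phi> q') (FD (%x. u (\<phi> x)) q') =
   dual_normsq (g (sg q)) (FD sg q) (FD (%x. u (sg x)) q)"
  if \<phi>: "local_param M U \<phi>" and q': "q' \<in> U" "\<phi> q' = sg q" for U q' and \<phi> :: "'n rv => 'e"
 proof -
  obtain h where h: "open (U \<inter> \<phi> -` (sg ` V))" "cts (U \<inter> \<phi> -` (sg ` V)) h"
   "!!q. q \<in> U \<inter> \<phi> -` (sg ` V) ==> h q \<in> V" "!!q. q \<in> U \<inter> \<phi> -` (sg ` V) ==> sg (h q) = \<phi> q"
   "!!q. q \<in> U \<inter> \<phi> -` (sg ` V) ==> (h has_derivative FD h q) (at q)"
   "!!q v. q \<in> U \<inter> \<phi> -` (sg ` V) ==>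
    FD sg (h q) (FD h q v) = FD \<phi> q v"
   using local_param_transition[OF \<phi> sg] by metis
  let ?W = "U \<inter> \<phi> -` (sg ` V)" and ?h' = "FD h q'"
  let ?D = "FD sg q" and ?l = "FD (%x. u (sg x)) q"
  have W: "q' \<in> ?W" using q' q by auto
  have hq: "h q' = q"
   using h(3,4)[OF W] local_paramD(5)[OF sg] q q'(2) by (metis inj_onD)
  have D\<phi>: "FD \<phi> q' = (%v. ?D (?h' v))"
   using h(6)[OF W] by (auto simp: hq)
  have ul: "((%x. u (sg x)) has_derivative ?l) (at q)"
   by (rule smooth_on_has_derivative[OF smooth[OF sg] q])
  have "((%x. u (sg (h x))) has_derivative (%v. ?l (?h' v))) (at q')"
   using has_derivative_compose[OF h(5)[OF W], of "%x. u (sg x)" ?l] ul by (simp add: hq)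
  hence "((%x. u (\<phi> x)) has_derivative (%v. ?l (?h' v))) (at q')"
   by (rule has_derivative_transform_within_open[OF _ h(1) W]) (simp add: h(4))
  hence l\<phi>: "FD (%x. u (\<phi> x)) q' = (%v. ?l (?h' v))"
   by (rule frechet_derivative_at[symmetric])
  have lin: "linear ?D" "linear ?h'" "linear ?l"
   using local_paramD(8)[OF sg q] h(5)[OF W] ul has_derivative_linear by blast+
  have "inj (%v. ?D (?h' v))" using local_paramD(3)[OF \<phi> q'(1)] by (simp add: D\<phi>)
  hence "inj ?h'" by (auto simp: inj_on_def)
  thus ?thesis
   unfolding D\<phi> l\<phi> q'(2) using lin g local_paramD(3)[OF sg q] by (intro dual_normsq_compose)
 qed
 have val: "(\<Sum>i\<in>UNIV. \<Sum>j\<in>UNIV. matrix_inv (metric_coeffs g \<phi> q') $ i $ j *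
      partial_deriv i (u \<circ> \<phi>) q' * partial_deriv j (u \<circ> \<phi>) q') =
   dual_normsq (g (\<phi> q')) (FD \<phi> q') (FD (%x. u (\<phi> x)) q')"
  for \<phi> :: "'n rv => 'e" and q'
  by (simp add: dual_normsq_def metric_coeffs_eq_form_matrix partial_deriv_def o_def)
 show ?thesis
  unfolding diff_normsq_def val
 proof (rule the_equality)
  show "\<exists>U (\<phi> :: 'n rv => 'e). \<exists>q'\<in>U. local_param M U \<phi> & \<phi> q' = sg q &
    dual_normsq (g (sg q)) (FD sg q) (FD (%x. u (sg x)) q) =
    dual_normsq (g (\<phi> q')) (FD \<phi> q') (FD (%x. u (\<phi> x)) q')"
   by (intro exI[of _ V] exI[of _ sg] bexI[of _ q] conjI sg refl q)
 next
  fix r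
  assume "\<exists>U (\<phi> :: 'n rv => 'e). \<exists>q'\<in>U. local_param M U \<phi> & \<phi> q' = sg q &
    r = dual_normsq (g (\<phi> q')) (FD \<phi> q') (FD (%x. u (\<phi> x)) q')"
  thus "r = dual_normsq (g (sg q)) (FD sg q) (FD (%x. u (sg x)) q)"
   using inv by blast
 qed
qed

section \<open>The Riemannian volume in charts\<close>

definition chart_density :: "'e::euclidean_space metric => (real ^ 'n::finite => 'e) => real ^ 'n => real" where
 "chart_density g \<phi> q = sqrt (det (metric_coeffs g \<phi> q))"

definition riemannian_on :: "'e::euclidean_space set => 'e metric => bool" where
 "riemannian_on M g \<longleftrightarrow> (\<forall>p\<in>M. inner_form (g p)) &
   cts (M \<times> UNIV \<times> UNIV) (%z. g (fst z) (fst (snd z)) (snd (snd z)))"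

lemma continuous_on_chart_density:
 assumes "local_param M U \<phi>" "riemannian_on M g"
 shows "cts U (chart_density g \<phi>)"
proof -
 have c: "cts U (%q. metric_coeffs g \<phi> q $ i $ j)" for i j
 proof -
  let ?f = "%q. (\<phi> q, partial_deriv i \<phi> q, partial_deriv j \<phi> q)"
  have f: "cts U ?f"
   unfolding partial_deriv_def
   by (intro continuous_on_Pair local_paramD(7)[OF assms(1)]
     smooth_on_cts[OF smooth_on_frechet_derivative[OF local_paramD(2)[OF assms(1)]]])
  have fs: "?f ` U \<subseteq> M \<times> UNIV \<times> UNIV" using local_paramD(6)[OF assms(1)] by auto
  have G: "cts (M \<times> UNIV \<times> UNIV) (%z. g (fst z) (fst (snd z)) (snd (snd z)))"
   using assms(2) by (simp add: riemannian_on_def)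
  have "cts U (%q. g (fst (?f q)) (fst (snd (?f q))) (snd (snd (?f q))))"
   by (rule continuous_on_compose2[OF G f fs])
  thus ?thesis by (simp add: metric_coeffs_def)
 qed
 show ?thesis
  unfolding chart_density_def det_def
  by (intro continuous_on_real_sqrt continuous_on_sum continuous_on_mult continuous_on_const continuous_on_prod c)
qed

lemma chart_density_nonzero:
 assumes "local_param M U \<phi>" "riemannian_on M g" "q \<in> U"
 shows "chart_density g \<phi> q ~= 0"
proof -
 have "invertible (metric_coeffs g \<phi> q)"
  unfolding metric_coeffs_eq_form_matrix
  using assms local_paramD(3,6)[OF assms(1)] has_derivative_linear[OF local_paramD(8)[OF assms(1,3)]]
  by (intro invertible_form_matrix) (auto simp: riemannian_on_def)
 thus ?thesis by (simp add: chart_density_def invertible_det_nz)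
qed

text \<open>The Gram matrices are congruent through the Jacobian matrix of the transition, so the
  densities differ by its absolute determinant, which the change of variables absorbs.\<close>

lemma chart_density_change:
 fixes \<phi> sg :: "real ^ 'n::finite => 'e::euclidean_space"
 assumes \<phi>: "local_param M U \<phi>" and sg: "local_param M V sg" and g: "riemannian_on M g"
  and A: "A \<in> sets borel" "A \<subseteq> \<phi> ` U" "A \<subseteq> sg ` V"
 shows "(LBNN q. ennreal (chart_density g \<phi> q) * ind (U \<inter> \<phi> -` A) q) =
  (LBNN q. ennreal (chart_density g sg q) * ind (V \<inter> sg -` A) q)"
proof -
 obtain h where h: "open (U \<inter> \<phi> -` (sg ` V))" "cts (U \<inter> \<phi> -` (sg ` V)) h"
  "!!q. q \<in> U \<inter> \<phi> -` (sg ` V) ==> h q \<in> V" "!!q. q \<in> U \<inter> \<phi> -` (sg ` V) ==> sg (h q) = \<phi> q"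
  "!!q. q \<in> U \<inter> \<phi> -` (sg ` V) ==> (h has_derivative FD h q) (at q)"
  "!!q v. q \<in> U \<inter> \<phi> -` (sg ` V) ==>
   FD sg (h q) (FD h q v) = FD \<phi> q v"
  using local_param_transition[OF \<phi> sg] by metis
 let ?W = "U \<inter> \<phi> -` (sg ` V)" and ?h' = "%q. FD h q"
 define S where "S = U \<inter> \<phi> -` A"
 have SW: "S \<subseteq> ?W" using A by (auto simp: S_def)
 have Sb: "S \<in> sets borel"
  unfolding S_def using local_paramD(1,7)[OF \<phi>] A(1) by (intro borel_preimage_continuous_on) auto
 have hS: "h ` S = V \<inter> sg -` A"
 proof (intro set_eqI iffI)
  fix y assume "y \<in> h ` S"
  then obtain q where q: "q \<in> S" "y = h q" by auto
  hence "q \<in> ?W" using SW by blast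
  thus "y \<in> V \<inter> sg -` A" using h(3,4)[of q] q by (auto simp: S_def)
 next
  fix y assume y: "y \<in> V \<inter> sg -` A"
  then obtain q where q: "q \<in> U" "\<phi> q = sg y" using A(2) by force
  hence qS: "q \<in> S" using y by (simp add: S_def)
  hence qW: "q \<in> ?W" using SW by blast
  have "sg (h q) = sg y" using h(4)[OF qW] q by simp
  hence "h q = y" using local_paramD(5)[OF sg] h(3)[OF qW] y by (auto simp: inj_on_eq_iff)
  thus "y \<in> h ` S" using qS by blast
 qed
 have hSb: "h ` S \<in> sets borel"
  unfolding hS using local_paramD(1,7)[OF sg] A(1) by (intro borel_preimage_continuous_on) auto
 have inj: "inj_on h S"
 proof (rule inj_onI)
  fix x y assume xy: "x \<in> S" "y \<in> S" "h x = h y"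
  hence "\<phi> x = \<phi> y" using h(4)[of x] h(4)[of y] SW by (metis subsetD)
  thus "x = y" using xy local_paramD(5)[OF \<phi>] by (auto simp: S_def inj_on_eq_iff)
 qed
 have dens: "chart_density g \<phi> q = \<bar>det (matrix (?h' q))\<bar> * chart_density g sg (h q)" if q: "q \<in> ?W" for q
 proof -
  have pM: "sg (h q) \<in> M" using h(3)[OF q] local_paramD(6)[OF sg] by auto
  have "bilinear (g (sg (h q)))" using g pM by (auto simp: riemannian_on_def inner_form_def)
  moreover have "linear (FD sg (h q))" "linear (?h' q)"
   using has_derivative_linear local_paramD(8)[OF sg h(3)[OF q]] h(5)[OF q] by blast+
  ultimately have "form_matrix (g (sg (h q))) (%v. FD sg (h q) (?h' q v)) =
    transpose (matrix (?h' q)) ** metric_coeffs g sg (h q) ** matrix (?h' q)"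
   unfolding metric_coeffs_eq_form_matrix by (rule form_matrix_compose)
  moreover have "(%v. FD sg (h q) (?h' q v)) = FD \<phi> q"
   using h(6)[OF q] by blast
  ultimately have "metric_coeffs g \<phi> q = transpose (matrix (?h' q)) ** metric_coeffs g sg (h q) ** matrix (?h' q)"
   by (simp add: metric_coeffs_eq_form_matrix[of g \<phi>] h(4)[OF q])
  hence "det (metric_coeffs g \<phi> q) = (det (matrix (?h' q)))^2 * det (metric_coeffs g sg (h q))"
   by (simp add: det_mul power2_eq_square)
  thus ?thesis by (simp add: chart_density_def real_sqrt_mult)
 qed
 \<comment> \<open>The transition is known to be differentiable, not continuously so, and
   measurability of its determinant is unclear. The quotient of the two continuous densities has the
   same values and is Borel.\<close>
 define J where "J q = (if q \<in> ?W then chart_density g \<phi> q / chart_density g sg (h q) else 0)" for q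
 have Jm: "J \<in> bmeas"
  unfolding J_def[abs_def]
 proof (rule borel_measurable_if_continuous_on)
  have "cts ?W (chart_density g \<phi>)"
   using continuous_on_chart_density[OF \<phi> g] by (rule continuous_on_subset) auto
  moreover have "cts ?W (%q. chart_density g sg (h q))"
   by (rule continuous_on_compose2[OF continuous_on_chart_density[OF sg g] h(2)]) (use h(3) in auto)
  ultimately show "cts ?W (%q. chart_density g \<phi> q / chart_density g sg (h q))"
   by (intro continuous_on_divide) (use chart_density_nonzero[OF sg g h(3)] in auto)
 qed (use h(1) in auto)
 have J: "J q = \<bar>det (matrix (?h' q))\<bar>" if "q \<in> S" for q
  using that SW dens[of q] chart_density_nonzero[OF sg g h(3)[of q]] by (auto simp: J_def)
 define f where "f y = ennreal (if y \<in> V then chart_density g sg y else 0)" for y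
 have fm: "f \<in> bmeas"
  unfolding f_def[abs_def]
  using borel_measurable_if_continuous_on[OF continuous_on_chart_density[OF sg g]] local_paramD(1)[OF sg]
  by measurable
 have "(LBNN y. f y * ind (h ` S) y) = (LBNN x. ennreal (J x) * f (h x) * ind S x)"
 proof (rule nn_integral_change_of_variables[OF Sb hSb _ _ inj Jm J fm])
  fix E :: "(real ^ 'n) set" assume "E \<in> sets borel"
  hence "?W \<inter> h -` E \<in> sets borel"
   using h(1) by (intro borel_preimage_continuous_on[OF h(2)]) auto
  hence "S \<inter> (?W \<inter> h -` E) \<in> sets borel" using Sb by blast
  moreover have "S \<inter> (?W \<inter> h -` E) = S \<inter> h -` E" using SW by blast
  ultimately show "S \<inter> h -` E \<in> sets borel" by simp
 next
  show "(h has_derivative ?h' x) (at x)" if "x \<in> S" for x using that SW h(5) by blast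
 qed
 moreover have "(LBNN y. f y * ind (h ` S) y) =
   (LBNN q. ennreal (chart_density g sg q) * ind (V \<inter> sg -` A) q)"
  by (intro nn_integral_cong) (auto simp: f_def hS split: split_indicator)
 moreover have "(LBNN x. ennreal (J x) * f (h x) * ind S x) =
   (LBNN q. ennreal (chart_density g \<phi> q) * ind (U \<inter> \<phi> -` A) q)"
 proof (intro nn_integral_cong)
  fix x
  show "ennreal (J x) * f (h x) * ind S x = ennreal (chart_density g \<phi> x) * ind (U \<inter> \<phi> -` A) x"
  proof (cases "x \<in> S")
   case True
   hence x: "x \<in> ?W" using SW by blast
   have "ennreal (J x) * f (h x) = ennreal (J x * chart_density g sg (h x))"
    using h(3)[OF x] J[OF True] by (simp add: f_def ennreal_mult')
   thus ?thesis using True J[OF True] dens[OF x] by (simp add: S_def)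
  qed (simp add: S_def)
 qed
 ultimately show ?thesis by simp
qed

text \<open>Evaluates the definite description of the volume for two global charts that cover M.
  Sets are split along \<open>range sg\<close>: the piece inside is measured by the first chart, the
  piece outside is null in the second. The same splitting shows that the defining property leaves no
  choice for the measure.\<close>

lemma riemannian_volume_eq:
 fixes sg sg' :: "real ^ 'n::finite => 'e::euclidean_space"
 assumes sg: "local_param M UNIV sg" and sg': "local_param M UNIV sg'" and g: "riemannian_on M g"
  and cover: "M \<subseteq> range sg \<union> range sg'" and M: "M \<in> sets borel"
  and null: "sg' -` (M - range sg) \<in> null_sets lborel"
 shows "riemannian_volume TYPE('n) M g =
  distr (density lborel (%q. ennreal (chart_density g sg q))) (restrict_space borel M) sg"
proof -
 let ?\<mu> = "distr (density lborel (%q. ennreal (chart_density g sg q))) (restrict_space borel M) sg"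
 let ?P = "%\<mu>. sets \<mu> = sets (restrict_space borel M) &
   (\<forall>U (\<phi> :: real ^ 'n => 'e). local_param M U \<phi> \<longrightarrow>
    (\<forall>A\<in>sets borel. A \<subseteq> \<phi> ` U \<longrightarrow>
      emeasure \<mu> A = (LBNN q. ennreal (chart_density g \<phi> q) * ind (U \<inter> \<phi> -` A) q)))"
 have sub: "range sg \<subseteq> M" "range sg' \<subseteq> M" using local_paramD(6) sg sg' by blast+
 have cont: "cts UNIV sg" "cts UNIV sg'" using local_paramD(7) sg sg' by blast+
 have sgm: "sg \<in> bmeas" "sg' \<in> bmeas"
  using cont borel_measurable_continuous_onI by blast+
 have sgm': "sg \<in> lborel \<rightarrow>\<^sub>M restrict_space borel M"
  using sgm(1) sub(1) by (intro measurable_restrict_space2) auto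
 have R: "range sg \<in> sets borel"
 proof -
  obtain T where "open T" "range sg = M \<inter> T"
   using local_paramD(4)[OF sg] by (auto simp: openin_open)
  thus ?thesis using M by auto
 qed
 have dm: "chart_density g sg \<in> bmeas" "chart_density g sg' \<in> bmeas"
  using continuous_on_chart_density[OF sg g] continuous_on_chart_density[OF sg' g]
  by (auto intro: borel_measurable_continuous_onI)
 have sets: "A \<in> sets (restrict_space borel M) \<longleftrightarrow> A \<in> sets borel & A \<subseteq> M" for A
  using M by (auto simp: sets_restrict_space_iff)
 have emu: "emeasure ?\<mu> A = (LBNN q. ennreal (chart_density g sg q) * ind (sg -` A) q)"
  if "A \<in> sets borel" "A \<subseteq> M" for A
  using that sgm' dm sets measurable_sets_borel[OF sgm(1) that(1)]
  by (subst emeasure_distr) (auto simp: emeasure_density)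
 have P: "?P ?\<mu>"
 proof (intro conjI allI ballI impI)
  fix U and \<phi> :: "'n rv => 'e" and A
  assume \<phi>: "local_param M U \<phi>" and A: "A \<in> sets borel" "A \<subseteq> \<phi> ` U"
  have AM: "A \<subseteq> M" using A(2) local_paramD(6)[OF \<phi>] by blast
  let ?I = "%A. (LBNN q. ennreal (chart_density g \<phi> q) * ind (U \<inter> \<phi> -` A) q)"
  have b: "A \<inter> range sg \<in> sets borel" "A - range sg \<in> sets borel" using A R by auto
  have "emeasure ?\<mu> A = (LBNN q. ennreal (chart_density g sg q) * ind (UNIV \<inter> sg -` (A \<inter> range sg)) q)"
   unfolding emu[OF A(1) AM] by (intro nn_integral_cong) (auto split: split_indicator)
  also have "... = ?I (A \<inter> range sg)"
   by (rule chart_density_change[OF sg \<phi> g b(1)]) (use A in auto)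
  finally have 1: "emeasure ?\<mu> A = ?I (A \<inter> range sg)" .
  have "?I (A - range sg) = (LBNN q. ennreal (chart_density g sg' q) * ind (UNIV \<inter> sg' -` (A - range sg)) q)"
   by (rule chart_density_change[OF \<phi> sg' g b(2)]) (use A AM cover in auto)
  also have "... = 0"
  proof (rule nn_integral_0_iff_AE[THEN iffD2])
   show "(%q. ennreal (chart_density g sg' q) * ind (UNIV \<inter> sg' -` (A - range sg)) q) \<in> borel_measurable lborel"
    using dm(2) measurable_sets_borel[OF sgm(2) b(2)] by measurable
   show "AE q in lborel. ennreal (chart_density g sg' q) * ind (UNIV \<inter> sg' -` (A - range sg)) q = 0"
    by (rule AE_I'[OF null]) (use AM in \<open>auto split: split_indicator_asm\<close>)
  qed
  finally have 2: "?I (A - range sg) = 0" .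
  have Um: "U \<inter> \<phi> -` B \<in> sets borel" if "B \<in> sets borel" for B
   using local_paramD(1,7)[OF \<phi>] that by (intro borel_preimage_continuous_on) auto
  let ?d = "%q. ennreal (if q \<in> U then chart_density g \<phi> q else 0)"
  have dm: "?d \<in> bmeas"
   using borel_measurable_if_continuous_on[OF continuous_on_chart_density[OF \<phi> g]] local_paramD(1)[OF \<phi>]
   by measurable
  have Id: "?I B = (LBNN q. ?d q * ind (U \<inter> \<phi> -` B) q)" for B
   by (intro nn_integral_cong) (auto split: split_indicator)
  have "?I A = (LBNN q. ?d q * ind (U \<inter> \<phi> -` (A \<inter> range sg)) q + ?d q * ind (U \<inter> \<phi> -` (A - range sg)) q)"
   unfolding Id by (intro nn_integral_cong) (auto split: split_indicator)
  also have "... = ?I (A \<inter> range sg) + ?I (A - range sg)"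
   unfolding Id using Um[OF b(1)] Um[OF b(2)] dm
   by (intro nn_integral_add borel_measurable_times_ennreal borel_measurable_indicator) simp_all
  finally show "emeasure ?\<mu> A = ?I A" using 1 2 by simp
 qed simp
 show ?thesis
  unfolding riemannian_volume_def chart_density_def[symmetric]
 proof (rule the_equality[where P = ?P])
  show "?P ?\<mu>" by (rule P)
 next
  fix \<mu> assume \<mu>: "?P \<mu>"
  show "\<mu> = ?\<mu>"
  proof (rule measure_eqI)
   show "sets \<mu> = sets ?\<mu>" using \<mu> by simp
   fix A assume "A \<in> sets \<mu>"
   hence A: "A \<in> sets borel" "A \<subseteq> M" using \<mu> sets by auto
   have b: "A \<inter> range sg \<in> sets borel" "A - range sg \<in> sets borel" using A R by auto
   have c: "A \<inter> range sg \<subseteq> sg ` UNIV" "A - range sg \<subseteq> sg' ` UNIV" using A cover by auto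
   have split: "emeasure \<nu> A = emeasure \<nu> (A \<inter> range sg) + emeasure \<nu> (A - range sg)" if "?P \<nu>" for \<nu>
   proof -
    have "A \<inter> range sg \<in> sets \<nu>" "A - range sg \<in> sets \<nu>" using that b A sets by auto
    moreover have "A = (A \<inter> range sg) \<union> (A - range sg)" by auto
    ultimately show ?thesis by (metis Diff_disjoint inf_commute Int_Diff plus_emeasure Diff_Int_distrib2 inf_bot_left)
   qed
   have "emeasure \<mu> (A \<inter> range sg) = emeasure ?\<mu> (A \<inter> range sg)"
    using \<mu> P sg b(1) c(1) by presburger
   moreover have "emeasure \<mu> (A - range sg) = emeasure ?\<mu> (A - range sg)"
    using \<mu> P sg' b(2) c(2) by presburger
   ultimately show "emeasure \<mu> A = emeasure ?\<mu> A"
    using split[OF \<mu>] split[OF P] by simp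
  qed
 qed
qed

section \<open>Inversions\<close>

text \<open>Reflection in the sphere of radius sqrt 2 about a. One map serves two purposes: centred
  at a pole it exchanges the equatorial plane and the unit sphere, and centred at minus a unit
  vector it exchanges a half space and the unit ball.\<close>

definition inversion :: "'a::euclidean_space => 'a => 'a" where
 "inversion a x = a + (2 / ((x - a) \<bullet> (x - a))) *\<^sub>R (x - a)"

definition inversion' :: "'a::euclidean_space => 'a => 'a => 'a" where
 "inversion' a x \<xi> = (2 / ((x - a) \<bullet> (x - a))) *\<^sub>R \<xi>
   - (4 * ((x - a) \<bullet> \<xi>) / ((x - a) \<bullet> (x - a))\<^sup>2) *\<^sub>R (x - a)"

lemma inversion_has_derivative:
 assumes "x ~= a"
 shows "(inversion a has_derivative inversion' a x) (at x)"
proof -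
 let ?D = "%x. (x - a) \<bullet> (x - a)"
 have D: "?D x ~= 0" using assms by simp
 have 1: "(?D has_derivative (%\<xi>. 2 * ((x - a) \<bullet> \<xi>))) (at x)"
  by (auto intro!: derivative_eq_intros simp: inner_commute)
 have 2: "((%x. 2 / ?D x) has_derivative (%\<xi>. - 4 * ((x - a) \<bullet> \<xi>) / (?D x)\<^sup>2)) (at x)"
 proof -
  have "((%x. 2 * inverse (?D x)) has_derivative
    (%\<xi>. 2 * - (inverse (?D x) * (2 * ((x - a) \<bullet> \<xi>)) * inverse (?D x)))) (at x)"
   by (rule has_derivative_mult_right[OF Deriv.has_derivative_inverse[OF D 1]])
  thus ?thesis by (simp add: divide_inverse power2_eq_square mult_ac)
 qed
 have "((%x. a + (2 / ?D x) *\<^sub>R (x - a)) has_derivative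
   (%\<xi>. (2 / ?D x) *\<^sub>R \<xi> + (- 4 * ((x - a) \<bullet> \<xi>) / (?D x)\<^sup>2) *\<^sub>R (x - a))) (at x)"
  by (rule derivative_eq_intros 2 refl | simp)+
 thus ?thesis
  unfolding inversion_def[abs_def] inversion'_def[abs_def] by simp
qed

text \<open>Conformality of inversions. The metrics of the stereographic and of the horospherical
  charts are both read off from this factor.\<close>

lemma inversion'_inner:
 assumes "x ~= a"
 shows "inversion' a x \<xi> \<bullet> inversion' a x \<zeta> = 4 / ((x - a) \<bullet> (x - a))\<^sup>2 * (\<xi> \<bullet> \<zeta>)"
proof -
 define d where "d = x - a"
 define D where "D = d \<bullet> d"
 have D: "D ~= 0" using assms by (simp add: D_def d_def)
 have "inversion' a x \<xi> \<bullet> inversion' a x \<zeta> =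
   ((2 / D) *\<^sub>R \<xi> - (4 * (d \<bullet> \<xi>) / D\<^sup>2) *\<^sub>R d) \<bullet> ((2 / D) *\<^sub>R \<zeta> - (4 * (d \<bullet> \<zeta>) / D\<^sup>2) *\<^sub>R d)"
  by (simp only: inversion'_def d_def[symmetric] D_def[symmetric])
 also have "... = (2 / D) * ((2 / D) * (\<xi> \<bullet> \<zeta>)) - (2 / D) * ((4 * (d \<bullet> \<zeta>) / D\<^sup>2) * (d \<bullet> \<xi>))
   - ((4 * (d \<bullet> \<xi>) / D\<^sup>2) * ((2 / D) * (d \<bullet> \<zeta>)) - (4 * (d \<bullet> \<xi>) / D\<^sup>2) * ((4 * (d \<bullet> \<zeta>) / D\<^sup>2) * D))"
  by (simp only: inner_diff_left inner_diff_right inner_scaleR_left inner_scaleR_right D_def[symmetric] inner_commute[of \<xi> d])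
   (simp add: algebra_simps)
 also have "... = 4 / D\<^sup>2 * (\<xi> \<bullet> \<zeta>)"
  using D by (simp add: field_simps power2_eq_square)
 finally show ?thesis by (simp add: D_def d_def)
qed

lemma inversion_neq: "x ~= a ==> inversion a x ~= a"
 by (simp add: inversion_def)

lemma inversion_involution:
 assumes "x ~= a"
 shows "inversion a (inversion a x) = x"
proof -
 let ?D = "(x - a) \<bullet> (x - a)"
 have D: "?D ~= 0" using assms by simp
 have "inversion a (inversion a x) = a + (2 / ((2 / ?D) * ((2 / ?D) * ?D))) *\<^sub>R (2 / ?D) *\<^sub>R (x - a)"
  unfolding inversion_def[of a "inversion a x"] by (simp add: inversion_def)
 also have "... = x" using D by (simp add: field_simps)
 finally show ?thesis .
qed

lemma smooth_on_inversion: "smooth_on (- {a}) (inversion a)"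
 unfolding inversion_def[abs_def]
 by (intro smooth_intros) auto

lemma continuous_on_inversion: "cts (- {a}) (inversion a)"
 by (rule smooth_on_cts[OF smooth_on_inversion])

section \<open>Stereographic charts of the sphere\<close>

definition stereo :: "real => real ^ 'w::finite => (real ^ 'w) \<times> real" where
 "stereo ep y = inversion (0, ep) (y, 0)"

lemma stereo_eq:
 assumes "ep = 1 \<or> ep = -1"
 shows "stereo ep y = ((2 / (1 + y \<bullet> y)) *\<^sub>R y, ep - 2 * ep / (1 + y \<bullet> y))"
 using assms by (auto simp: stereo_def inversion_def add.commute)

lemma stereo_mem:
 assumes "ep = 1 \<or> ep = -1"
 shows "stereo ep y \<in> unit_sphere - {(0, ep)}"
proof -
 let ?s = "1 + y \<bullet> y"
 have s: "?s > 0" by (simp add: add_pos_nonneg)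
 have e: "ep * ep = 1" using assms by auto
 have "stereo ep y \<bullet> stereo ep y = (2 / ?s) * (2 / ?s) * (?s - 1) + (ep * ep) * (1 - 2 / ?s)^2"
  by (simp add: stereo_eq[OF assms] power2_eq_square algebra_simps)
 also have "... = 1"
 proof -
  have "(2 / t) * (2 / t) * (t - 1) + 1 * (1 - 2 / t)^2 = 1" if "t ~= 0" for t :: real
   using that by (simp add: field_simps power2_eq_square)
  from this[of ?s] show ?thesis using s unfolding e by simp
 qed
 finally have "norm (stereo ep y) = 1" by (simp add: norm_eq_sqrt_inner)
 moreover have "stereo ep y ~= (0, ep)" unfolding stereo_def by (rule inversion_neq) (use assms in auto)
 ultimately show ?thesis by (simp add: unit_sphere_def)
qed

definition stereo_inv :: "real => (real ^ 'w::finite) \<times> real => real ^ 'w" where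
 "stereo_inv ep z = fst (inversion (0, ep) z)"

lemma stereo_inv_stereo: "ep = 1 \<or> ep = -1 ==> stereo_inv ep (stereo ep y) = y"
 unfolding stereo_inv_def stereo_def by (subst inversion_involution) auto

lemma stereo_stereo_inv:
 assumes "ep = 1 \<or> ep = -1" "z \<in> unit_sphere - {(0, ep)}"
 shows "stereo ep (stereo_inv ep z) = z"
proof -
 let ?a = "(0, ep) :: (real ^ 'a) \<times> real"
 have e: "ep * ep = 1" using assms by auto
 have z: "z \<bullet> z = 1" using assms(2) by (simp add: unit_sphere_def norm_eq_sqrt_inner)
 have D: "(z - ?a) \<bullet> (z - ?a) = 2 - 2 * (ep * snd z)"
 proof -
  have "(z - ?a) \<bullet> (z - ?a) = z \<bullet> z - 2 * (ep * snd z) + ep * ep"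
   by (simp add: inner_prod_def algebra_simps)
  thus ?thesis by (simp add: z e)
 qed
 have "z ~= ?a" using assms(2) by simp
 hence "2 - 2 * (ep * snd z) ~= 0" using D by (metis eq_iff_diff_eq_0 inner_eq_zero_iff)
 hence ne: "1 - ep * snd z ~= 0" by auto
 have "snd (inversion ?a z) = ep + (2 / (2 - 2 * (ep * snd z))) * (snd z - ep)"
  unfolding inversion_def D by simp
 also have "... = ep + (snd z - ep) / (1 - ep * snd z)"
  using ne by (simp add: field_simps)
 also have "snd z - ep = - ep * (1 - ep * snd z)"
  using e by (simp add: algebra_simps)
 also have "ep + (- ep * (1 - ep * snd z)) / (1 - ep * snd z) = 0" using ne by simp
 finally have "inversion ?a z = (stereo_inv ep z, 0)"
  by (simp add: stereo_inv_def prod_eq_iff)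
 thus ?thesis
  unfolding stereo_def using inversion_involution[OF \<open>z ~= ?a\<close>] by simp
qed

lemma smooth_on_stereo: "ep = 1 \<or> ep = -1 ==> smooth_on UNIV (stereo ep)"
 unfolding stereo_def[abs_def]
 by (rule smooth_on_compose[OF smooth_on_inversion[of "(0, ep)"]]) (auto intro!: smooth_intros)

lemma smooth_on_stereo_inv: "smooth_on (- {(0, ep)}) (stereo_inv ep)"
 unfolding stereo_inv_def[abs_def] by (intro smooth_on_fst smooth_on_inversion) auto

definition stereo' :: "real => real ^ 'w::finite => real ^ 'w => 'w rv \<times> real" where
 "stereo' ep y \<xi> = inversion' (0, ep) (y, 0) (\<xi>, 0)"

lemma stereo_has_derivative:
 assumes "ep = 1 \<or> ep = -1"
 shows "(stereo ep has_derivative stereo' ep y) (at y)"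
proof -
 have "((%y. (y, 0)) has_derivative (%\<xi>. (\<xi>, 0))) (at y)"
  by (intro has_derivative_Pair has_derivative_ident has_derivative_const)
 thus ?thesis
  unfolding stereo_def[abs_def] stereo'_def[abs_def]
  by (rule has_derivative_compose) (rule inversion_has_derivative, use assms in auto)
qed

lemma stereo'_inner:
 assumes "ep = 1 \<or> ep = -1"
 shows "stereo' ep y \<xi> \<bullet> stereo' ep y \<zeta> = (2 / (1 + y \<bullet> y))^2 * (\<xi> \<bullet> \<zeta>)"
proof -
 have "(y, 0) ~= (0, ep)" using assms by auto
 from inversion'_inner[OF this, of "(\<xi>, 0)" "(\<zeta>, 0)"] assms show ?thesis
  by (auto simp: stereo'_def power_divide add.commute)
qed

section \<open>Horospherical charts of hyperbolic space\<close>

text \<open>The upper half space with its height written as e^(-r), r being the coordinate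
  \<open>io\<close>. The hyperbolic metric becomes dr^2 + e^(2r) |dx|^2, with r an arc length along
  vertical geodesics.\<close>

definition half_space :: "'v => real ^ 'v::finite => real ^ 'v" where
 "half_space io r = (\<chi> i. if i = io then exp (- r $ io) else r $ i)"

definition half_space' :: "'v => real ^ 'v::finite => real ^ 'v => 'v rv" where
 "half_space' io r \<xi> = (\<chi> i. if i = io then - exp (- r $ io) * \<xi> $ io else \<xi> $ i)"

lemma smooth_on_half_space: "smooth_on UNIV (half_space io)"
proof -
 have "smooth_on UNIV (%r :: real ^ 'a. if i = io then exp (- r $ io) else r $ i)" for i
  by (cases "i = io") (auto intro!: smooth_intros)
 thus ?thesis unfolding half_space_def[abs_def] by (intro smooth_on_vec_lambda) auto
qed

lemma half_space_has_derivative: "(half_space io has_derivative half_space' io r) (at r)"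
proof -
 have "((%r. half_space io r \<bullet> b) has_derivative (%\<xi>. half_space' io r \<xi> \<bullet> b)) (at r)"
  if "b \<in> Basis" for b
 proof -
  obtain i where b: "b = axis i 1" using \<open>b \<in> Basis\<close> by (auto simp: Basis_vec_eq)
  have bl: "bounded_linear (%r :: real ^ 'a. r $ k)" for k by (rule bounded_linear_vec_nth)
  show ?thesis
   using bounded_linear_imp_has_derivative[OF bl]
   by (cases "i = io")
    (auto simp: b inner_axis half_space_def half_space'_def intro!: derivative_eq_intros)
 qed
 thus ?thesis using has_derivative_componentwise_within by blast
qed

text \<open>Horospherical coordinates with an extra scale k. The pairs (c, 1) and (1, c) have the
  same product c k, so the dilation from curvature -c^2 to curvature -1 changes only k and leaves
  the exponential factors alone. For c = 0 the chart is a dilation of Euclidean space.\<close>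

definition hchart :: "'v => real => real => real ^ 'v::finite => real ^ 'v" where
 "hchart io c k p = (if c = 0 then k *\<^sub>R p
   else (2 / c) *\<^sub>R inversion (- axis io 1) (half_space io ((c * k) *\<^sub>R p)))"

definition hchart' :: "'v => real => real => real ^ 'v::finite => real ^ 'v => 'v rv" where
 "hchart' io c k p \<xi> = (if c = 0 then k *\<^sub>R \<xi>
   else (2 / c) *\<^sub>R inversion' (- axis io 1) (half_space io ((c * k) *\<^sub>R p))
    (half_space' io ((c * k) *\<^sub>R p) ((c * k) *\<^sub>R \<xi>)))"

definition hchart_inv :: "'v => real => real => real ^ 'v::finite => real ^ 'v" where
 "hchart_inv io c k Q = (if c = 0 then (1 / k) *\<^sub>R Q
   else let x = inversion (- axis io 1) ((c / 2) *\<^sub>R Q) in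
    (1 / (c * k)) *\<^sub>R (\<chi> i. if i = io then - ln (x $ io) else x $ i))"

lemma half_space_nth: "half_space io r $ io > 0"
 by (simp add: half_space_def)

lemma half_space_neq: "half_space io r ~= - axis io 1"
proof
 assume "half_space io r = - axis io 1"
 thus False using half_space_nth[of io r] by (simp add: axis_def)
qed

lemma axis_inner_self: "axis i (1::real) \<bullet> axis i 1 = (1::real)"
 by (simp add: norm_eq_1[symmetric])

text \<open>Positive height corresponds to norm below 1. The same identity turns the conformal
  factor of the ball model into that of the half space.\<close>

lemma inversion_normsq:
 fixes x :: "real ^ 'v::finite" and io :: 'v
 defines "e \<equiv> axis io (1::real)"
 assumes "x ~= - e"
 shows "1 - inversion (- e) x \<bullet> inversion (- e) x = 4 * x $ io / ((x + e) \<bullet> (x + e))"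
proof -
 let ?D = "(x + e) \<bullet> (x + e)"
 have D: "?D ~= 0" using assms by (simp add: eq_neg_iff_add_eq_0)
 have ee: "e \<bullet> e = 1" unfolding e_def by (rule axis_inner_self)
 have ex: "e \<bullet> x = x $ io" by (simp add: e_def inner_commute[of _ x] inner_axis)
 have ed: "e \<bullet> (x + e) = x $ io + 1" by (simp add: inner_add_right ee ex)
 have "inversion (- e) x = (2 / ?D) *\<^sub>R (x + e) - e"
  by (simp add: inversion_def)
 hence "inversion (- e) x \<bullet> inversion (- e) x = (2 / ?D) * ((2 / ?D) * ?D) - 2 * ((2 / ?D) * (e \<bullet> (x + e))) + e \<bullet> e"
 proof -
  have "(t *\<^sub>R d - e) \<bullet> (t *\<^sub>R d - e) = t * (t * (d \<bullet> d)) - 2 * (t * (e \<bullet> d)) + e \<bullet> e" for t and d :: "real ^ 'v"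
   by (simp add: algebra_simps inner_commute)
  thus "inversion (- e) x = (2 / ?D) *\<^sub>R (x + e) - e ==> ?thesis" by (simp only:)
 qed
 also have "... = 1 - 4 * x $ io / ?D"
  unfolding ee ed using D by (simp add: field_simps)
 finally show ?thesis by simp
qed

lemma hchart_mem:
 assumes "c >= 0"
 shows "hchart io c k p \<in> hyp_space c"
proof (cases "c = 0")
 case False
 let ?x = "half_space io ((c * k) *\<^sub>R p)" and ?e = "axis io 1 :: real ^ 'a"
 have "(?x + ?e) \<bullet> (?x + ?e) > 0"
  using half_space_neq[of io] by (simp add: eq_neg_iff_add_eq_0)
 hence "1 - inversion (- ?e) ?x \<bullet> inversion (- ?e) ?x > 0"
  unfolding inversion_normsq[OF half_space_neq] using half_space_nth[of io] by simp
 hence "norm (inversion (- ?e) ?x) < 1"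
  by (simp add: norm_eq_sqrt_inner)
 thus ?thesis using False assms by (simp add: hchart_def hyp_space_def)
qed (auto simp: hyp_space_def)

lemma hchart_inv_hchart:
 assumes "k > 0" "c >= 0"
 shows "hchart_inv io c k (hchart io c k p) = p"
proof (cases "c = 0")
 case False
 hence e: "(c / 2) *\<^sub>R hchart io c k p = inversion (- axis io 1) (half_space io ((c * k) *\<^sub>R p))"
  by (simp add: hchart_def)
 have "inversion (- axis io 1) ((c / 2) *\<^sub>R hchart io c k p) = half_space io ((c * k) *\<^sub>R p)"
  unfolding e by (rule inversion_involution[OF half_space_neq])
 hence "hchart_inv io c k (hchart io c k p) = (1 / (c * k)) *\<^sub>R (c * k) *\<^sub>R p"
  using False by (simp add: hchart_inv_def Let_def) (auto simp: half_space_def vec_eq_iff)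
 thus ?thesis using False assms by simp
qed (use assms in \<open>auto simp: hchart_inv_def hchart_def\<close>)

lemma hyp_space_inversion_pos:
 fixes Q :: "real ^ 'v::finite" and io :: 'v
 assumes "c > 0" "Q \<in> hyp_space c"
 shows "(c / 2) *\<^sub>R Q ~= - axis io 1" "inversion (- axis io 1) ((c / 2) *\<^sub>R Q) $ io > 0"
proof -
 let ?q = "(c / 2) *\<^sub>R Q" and ?e = "axis io 1 :: real ^ 'v"
 have n: "norm ?q < 1" using assms by (simp add: hyp_space_def)
 have ne: "norm ?e = 1" by simp
 show qne: "?q ~= - ?e" using n ne by (metis less_irrefl norm_minus_cancel)
 let ?x = "inversion (- ?e) ?q"
 have "?q \<bullet> ?q < 1" using n by (simp add: dot_square_norm abs_square_less_1)
 hence 1: "0 < 1 - ?q \<bullet> ?q" by simp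
 have 2: "1 - ?q \<bullet> ?q = 4 * ?x $ io / ((?x + ?e) \<bullet> (?x + ?e))"
  using inversion_normsq[OF inversion_neq[OF qne]] unfolding inversion_involution[OF qne] .
 have 3: "(?x + ?e) \<bullet> (?x + ?e) > 0"
  using inversion_neq[OF qne] by (simp add: eq_neg_iff_add_eq_0)
 show "?x $ io > 0" using 1 3 unfolding 2 zero_less_divide_iff by auto
qed

lemma hchart_hchart_inv:
 assumes "k > 0" "c >= 0" "Q \<in> hyp_space c"
 shows "hchart io c k (hchart_inv io c k Q) = Q"
proof (cases "c = 0")
 case False
 hence c: "c > 0" using assms by simp
 let ?q = "(c / 2) *\<^sub>R Q" and ?e = "axis io 1 :: real ^ 'a"
 let ?x = "inversion (- ?e) ?q"
 note pos = hyp_space_inversion_pos[OF c assms(3), of io]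
 have "half_space io ((c * k) *\<^sub>R hchart_inv io c k Q) = ?x"
  using False assms(1) pos(2) by (auto simp: hchart_inv_def Let_def half_space_def vec_eq_iff)
 thus ?thesis
  using False by (simp add: hchart_def inversion_involution[OF pos(1)])
qed (use assms in \<open>auto simp: hchart_inv_def hchart_def\<close>)

lemma continuous_on_hchart_inv:
 assumes "c >= 0"
 shows "cts (hyp_space c) (hchart_inv io c k)"
proof (cases "c = 0")
 case True
 thus ?thesis unfolding hchart_inv_def by (auto intro!: continuous_intros)
next
 case False
 hence c: "c > 0" using assms by simp
 let ?x = "%Q :: real ^ 'a. inversion (- axis io 1) ((c / 2) *\<^sub>R Q)"
 have x: "cts (hyp_space c) ?x"
 proof (rule continuous_on_compose2[OF continuous_on_inversion])
  show "(%Q. (c / 2) *\<^sub>R Q) ` hyp_space c \<subseteq> - {- axis io 1}"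
  proof (rule image_subsetI)
   fix Q :: "'a rv" assume "Q \<in> hyp_space c"
   thus "(c / 2) *\<^sub>R Q \<in> - {- axis io 1}"
    unfolding Compl_iff singleton_iff by (rule hyp_space_inversion_pos(1)[OF c])
  qed
 qed (intro continuous_intros)
 have xi: "cts (hyp_space c) (%Q. ?x Q $ i)" for i
  by (intro continuous_intros x)
 have "cts (hyp_space c) (%Q. if i = io then - ln (?x Q $ io) else ?x Q $ i)" for i
 proof (cases "i = io")
  case True
  have "cts (hyp_space c) (%Q. ln (?x Q $ io))"
  proof (rule continuous_on_ln[OF xi], rule ballI)
   fix Q :: "'a rv" assume "Q \<in> hyp_space c"
   thus "?x Q $ io ~= 0" using hyp_space_inversion_pos(2)[OF c, of Q io] by simp
  qed
  thus ?thesis using True by (simp add: continuous_on_minus)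
 qed (use xi in simp)
 thus ?thesis
  unfolding hchart_inv_def Let_def using False
  by (simp add: continuous_on_scaleR continuous_on_const continuous_on_vec_lambda)
qed

lemma smooth_on_hchart: "smooth_on UNIV (hchart io c k)"
proof (cases "c = 0")
 case True
 thus ?thesis unfolding hchart_def[abs_def] by (auto intro!: smooth_intros)
next
 case False
 have "smooth_on UNIV (%p. half_space io ((c * k) *\<^sub>R p))"
  by (rule smooth_on_compose[OF smooth_on_half_space]) (auto intro!: smooth_intros)
 hence "smooth_on UNIV (%p. inversion (- axis io 1) (half_space io ((c * k) *\<^sub>R p)))"
  by (intro smooth_on_compose[OF smooth_on_inversion]) (auto simp: half_space_neq half_space_neq[symmetric])
 thus ?thesis unfolding hchart_def[abs_def] using False by (auto intro!: smooth_intros)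
qed

lemma hchart_has_derivative: "(hchart io c k has_derivative hchart' io c k p) (at p)"
proof (cases "c = 0")
 case True
 thus ?thesis unfolding hchart_def[abs_def] hchart'_def[abs_def]
  by (auto intro!: derivative_eq_intros)
next
 case False
 have "((%p. (c * k) *\<^sub>R p) has_derivative (%\<xi>. (c * k) *\<^sub>R \<xi>)) (at p)"
  by (auto intro!: derivative_eq_intros)
 from has_derivative_compose[OF has_derivative_compose[OF this half_space_has_derivative]
  inversion_has_derivative[OF half_space_neq]]
 have "((%p. (2 / c) *\<^sub>R inversion (- axis io 1) (half_space io ((c * k) *\<^sub>R p))) has_derivative
  (%\<xi>. (2 / c) *\<^sub>R inversion' (- axis io 1) (half_space io ((c * k) *\<^sub>R p))
    (half_space' io ((c * k) *\<^sub>R p) ((c * k) *\<^sub>R \<xi>)))) (at p)"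
  by (rule has_derivative_scaleR_right)
 thus ?thesis using False by (simp add: hchart_def[abs_def] hchart'_def[abs_def])
qed

text \<open>The conformal factor of the inversion cancels against the denominator of the ball metric
  and leaves the half space metric; the height e^(-c k p) then yields the exponential in all
  directions but \<open>io\<close>.\<close>

lemma hchart'_metric:
 assumes "c >= 0"
 shows "hyp_metric c (hchart io c k p) (hchart' io c k p \<xi>) (hchart' io c k p \<zeta>) =
  (\<Sum>i\<in>UNIV. k^2 * (if i = io then 1 else exp (2 * (c * k) * p $ io)) * \<xi> $ i * \<zeta> $ i)"
proof (cases "c = 0")
 case True
 thus ?thesis
  by (auto simp: hchart_def hchart'_def hyp_metric_def inner_vec_def sum_distrib_left power2_eq_square mult_ac
    intro!: sum.cong)
next
 case False
 let ?r = "(c * k) *\<^sub>R p" and ?e = "axis io 1 :: real ^ 'a"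
 let ?x = "half_space io ?r"
 let ?D = "(?x - - ?e) \<bullet> (?x - - ?e)" and ?q = "inversion (- ?e) ?x"
 let ?P = "%\<xi>. half_space' io ?r ((c * k) *\<^sub>R \<xi>)"
 have D: "?D > 0" using half_space_neq[of io ?r] by (simp add: eq_neg_iff_add_eq_0)
 have x0: "?x $ io = exp (- (c * k * p $ io))" by (simp add: half_space_def)
 have "c^2 * (norm (hchart io c k p))^2 / 4 = ?q \<bullet> ?q"
  using False by (simp add: hchart_def power_mult_distrib power_divide dot_square_norm)
 hence den: "1 - c\<^sup>2 * (norm (hchart io c k p))^2 / 4 = 4 * ?x $ io / ?D"
  using inversion_normsq[OF half_space_neq, of io ?r] by simp
 have "hyp_metric c (hchart io c k p) (hchart' io c k p \<xi>) (hchart' io c k p \<zeta>) =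
   ((2 / c) * ((2 / c) * (4 / ?D\<^sup>2 * (?P \<xi> \<bullet> ?P \<zeta>)))) / (4 * ?x $ io / ?D)\<^sup>2"
  unfolding hyp_metric_def den using False
  by (simp only: hchart'_def if_False inner_scaleR_left inner_scaleR_right inversion'_inner[OF half_space_neq])
 also have "... = (?P \<xi> \<bullet> ?P \<zeta>) / (c^2 * (?x $ io)^2)"
  using D False half_space_nth[of io ?r] by (simp add: field_simps power2_eq_square)
 also have "... = (\<Sum>i\<in>UNIV. ?P \<xi> $ i * ?P \<zeta> $ i / (c^2 * (?x $ io)^2))"
  by (simp add: inner_vec_def sum_divide_distrib)
 also have "... = (\<Sum>i\<in>UNIV. k^2 * (if i = io then 1 else exp (2 * (c * k) * p $ io)) * \<xi> $ i * \<zeta> $ i)"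
 proof (rule sum.cong[OF refl])
  fix i
  have ex: "exp (2 * (c * k) * p $ io) * (exp (- (c * k * p $ io)))^2 = 1"
   by (simp add: power2_eq_square flip: exp_add)
  show "?P \<xi> $ i * ?P \<zeta> $ i / (c^2 * (?x $ io)^2) =
    k^2 * (if i = io then 1 else exp (2 * (c * k) * p $ io)) * \<xi> $ i * \<zeta> $ i"
  proof (cases "i = io")
   case True
   thus ?thesis
    using False by (simp add: x0 half_space'_def field_simps power2_eq_square)
  next
   case i: False
   have "?P \<xi> $ i * ?P \<zeta> $ i = c^2 * k^2 * \<xi> $ i * \<zeta> $ i"
    using i by (simp add: half_space'_def power2_eq_square mult_ac)
   also have "... = (c^2 * (?x $ io)^2) * (k^2 * exp (2 * (c * k) * p $ io) * \<xi> $ i * \<zeta> $ i)"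
    unfolding x0 using ex by (simp add: mult_ac)
   finally show ?thesis using False i x0 by (simp add: field_simps)
  qed
 qed
 finally show ?thesis .
qed

section \<open>Charts of the product spaces\<close>

definition vfst :: "real ^ ('v::finite + 'w::finite) => real ^ 'v" where
 "vfst q = (\<chi> i. q $ Inl i)"

definition vsnd :: "real ^ ('v::finite + 'w::finite) => real ^ 'w" where
 "vsnd q = (\<chi> j. q $ Inr j)"

definition vjoin :: "real ^ 'v::finite => real ^ 'w::finite => real ^ ('v + 'w)" where
 "vjoin p y = (\<chi> k. case k of Inl i => p $ i | Inr j => y $ j)"

lemma vfst_vjoin [simp]: "vfst (vjoin p y) = p" and vsnd_vjoin [simp]: "vsnd (vjoin p y) = y"
 by (simp_all add: vfst_def vsnd_def vjoin_def)

lemma vjoin_vfst_vsnd [simp]: "vjoin (vfst q) (vsnd q) = q"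
 by (simp add: vfst_def vsnd_def vjoin_def vec_eq_iff split: sum.split)

lemma vfst_nth [simp]: "vfst q $ i = q $ Inl i" and vsnd_nth [simp]: "vsnd q $ j = q $ Inr j"
 by (simp_all add: vfst_def vsnd_def)

lemma vjoin_nth [simp]: "vjoin p y $ Inl i = p $ i" "vjoin p y $ Inr j = y $ j"
 by (simp_all add: vjoin_def)

lemma bounded_linear_vfst: "bounded_linear vfst" and bounded_linear_vsnd: "bounded_linear vsnd"
 by (subst linear_conv_bounded_linear[symmetric], auto intro!: linearI simp: vec_eq_iff)+

lemma bounded_linear_vjoin: "bounded_linear (%z. vjoin (fst z) (snd z))"
 by (subst linear_conv_bounded_linear[symmetric])
  (auto intro!: linearI simp: vec_eq_iff vjoin_def split: sum.split)

lemmas smooth_on_vfst [smooth_intros] = smooth_on_linear_compose[OF bounded_linear_vfst]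
lemmas smooth_on_vsnd [smooth_intros] = smooth_on_linear_compose[OF bounded_linear_vsnd]

lemma smooth_on_vjoin [smooth_intros]:
 "open S ==> smooth_on S f ==> smooth_on S g ==> smooth_on S (%x. vjoin (f x) (g x))"
 using smooth_on_linear_compose[OF bounded_linear_vjoin, of S "%x. (f x, g x)"] smooth_on_Pair[of S f g] by simp

lemmas continuous_on_vfst [continuous_intros] = bounded_linear.continuous_on[OF bounded_linear_vfst]
lemmas continuous_on_vsnd [continuous_intros] = bounded_linear.continuous_on[OF bounded_linear_vsnd]

lemma continuous_on_vjoin [continuous_intros]:
 "cts S f ==> cts S g ==> cts S (%x. vjoin (f x) (g x))"
 using bounded_linear.continuous_on[OF bounded_linear_vjoin, of S "%x. (f x, g x)"]
  continuous_on_Pair[of S f g] by simp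

lemma distr_vjoin:
 "distr lborel borel (%z. vjoin (fst z) (snd z)) = (lborel :: (real ^ ('v::finite + 'w::finite)) measure)"
proof (rule lborel_eqI_vec[symmetric])
 let ?J = "%z :: (real ^ 'v) \<times> (real ^ 'w). vjoin (fst z) (snd z)"
 fix l u :: "real ^ ('v + 'w)"
 assume le: "!!i. l $ i <= u $ i"
 have Jm: "?J \<in> bmeas"
  by (rule measurable_bounded_linear[OF bounded_linear_vjoin])
 have "?J -` box l u = box (vfst l) (vfst u) \<times> box (vsnd l) (vsnd u)"
  by (auto simp: mem_box_vec split_sum_all)
 hence "emeasure (distr lborel borel ?J) (box l u) = emeasure (lborel \<Otimes>\<^sub>M lborel) (box (vfst l) (vfst u) \<times> box (vsnd l) (vsnd u))"
  using Jm by (subst emeasure_distr) (auto simp: lborel_prod)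
 also have "... = emeasure lborel (box (vfst l) (vfst u)) * emeasure lborel (box (vsnd l) (vsnd u))"
  by (rule lborel.emeasure_pair_measure_Times) auto
 also have "... = ennreal (\<Prod>i\<in>UNIV. u $ Inl i - l $ Inl i) * ennreal (\<Prod>j\<in>UNIV. u $ Inr j - l $ Inr j)"
  using le by (simp add: emeasure_lborel_box_vec)
 also have "... = ennreal ((\<Prod>i\<in>UNIV. u $ Inl i - l $ Inl i) * (\<Prod>j\<in>UNIV. u $ Inr j - l $ Inr j))"
  using le by (intro ennreal_mult[symmetric] prod_nonneg) auto
 also have "(\<Prod>i\<in>UNIV. u $ Inl i - l $ Inl i) * (\<Prod>j\<in>UNIV. u $ Inr j - l $ Inr j) = (\<Prod>k\<in>UNIV. u $ k - l $ k)"
  unfolding UNIV_sum by (subst prod.union_disjoint) (auto simp: prod.reindex)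
 finally show "emeasure (distr lborel borel ?J) (box l u) = ennreal (\<Prod>k\<in>UNIV. u $ k - l $ k)" .
qed simp

lemma nn_integral_vjoin:
 fixes f :: "real ^ ('v::finite + 'w::finite) => ennreal"
 assumes f: "f \<in> bmeas"
 shows "(LBNN q. f q) = (LBNN y. (LBNN p. f (vjoin p y)))"
proof -
 have Jm: "(%z :: (real ^ 'v) \<times> (real ^ 'w). vjoin (fst z) (snd z)) \<in> bmeas"
  by (rule measurable_bounded_linear[OF bounded_linear_vjoin])
 hence Jm': "(%z :: 'v rv \<times> 'w rv. vjoin (fst z) (snd z)) \<in> borel_measurable (lborel \<Otimes>\<^sub>M lborel)"
  by (simp add: lborel_prod)
 have "(LBNN q. f q) = (\<integral>\<^sup>+q. f q \<partial>distr lborel borel (%z. vjoin (fst z) (snd z)))"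
  by (simp add: distr_vjoin)
 also have "... = (\<integral>\<^sup>+z. f (vjoin (fst z) (snd z)) \<partial>(lborel \<Otimes>\<^sub>M lborel))"
  using f Jm by (subst nn_integral_distr) (auto simp: lborel_prod)
 also have "... = (LBNN y. (LBNN p. f (vjoin p y)))"
  using measurable_compose[OF Jm' f]
  by (subst lborel_pair.nn_integral_snd[symmetric]) (auto simp: case_prod_unfold)
 finally show ?thesis .
qed

definition pchart :: "'v::finite => real => real => real => real ^ ('v + 'w::finite) => (real ^ 'v) \<times> (real ^ 'w) \<times> real" where
 "pchart io c k ep q = (hchart io c k (vfst q), stereo ep (vsnd q))"

definition pchart' :: "'v::finite => real => real => real => real ^ ('v + 'w::finite) => real ^ ('v + 'w) => (real ^ 'v) \<times> (real ^ 'w) \<times> real" where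
 "pchart' io c k ep q \<xi> = (hchart' io c k (vfst q) (vfst \<xi>), stereo' ep (vsnd q) (vsnd \<xi>))"

definition pchart_inv :: "'v::finite => real => real => real => (real ^ 'v) \<times> (real ^ 'w::finite) \<times> real => real ^ ('v + 'w)" where
 "pchart_inv io c k ep z = vjoin (hchart_inv io c k (fst z)) (stereo_inv ep (snd z))"

text \<open>Diagonal entries of the metric in the product chart. The parameter b stands for c k and
  is kept separate, so that k can vary while b is fixed.\<close>

definition chart_coeff :: "'v => real => real => real ^ ('v::finite + 'w::finite) => 'v + 'w => real" where
 "chart_coeff io b k q m = (case m of
   Inl i => k^2 * (if i = io then 1 else exp (2 * b * q $ Inl io))
  | Inr j => (2 / (1 + vsnd q \<bullet> vsnd q))^2)"

lemma one_plus_inner_pos: "0 < 1 + y \<bullet> (y :: 'a::real_inner)"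
 by (simp add: add_pos_nonneg)

lemma chart_coeff_pos: "k > 0 ==> chart_coeff io b k q m > 0"
 using one_plus_inner_pos[of "vsnd q"]
 by (auto simp: chart_coeff_def zero_less_power split: sum.split)

lemma pchart_has_derivative:
 assumes "ep = 1 \<or> ep = -1"
 shows "(pchart io c k ep has_derivative pchart' io c k ep q) (at q)"
 unfolding pchart_def[abs_def] pchart'_def[abs_def]
 by (intro has_derivative_Pair
   has_derivative_compose[OF bounded_linear_imp_has_derivative[OF bounded_linear_vfst] hchart_has_derivative]
   has_derivative_compose[OF bounded_linear_imp_has_derivative[OF bounded_linear_vsnd] stereo_has_derivative[OF assms]])

lemma sum_UNIV_sum: "(\<Sum>m\<in>(UNIV :: ('v::finite + 'w::finite) set). f m) = (\<Sum>i\<in>UNIV. f (Inl i)) + (\<Sum>j\<in>UNIV. f (Inr j))"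
 unfolding UNIV_sum by (subst sum.union_disjoint) (auto simp: sum.reindex)

lemma prod_UNIV_sum: "(\<Prod>m\<in>(UNIV :: ('v::finite + 'w::finite) set). f m) = (\<Prod>i\<in>UNIV. f (Inl i)) * (\<Prod>j\<in>UNIV. f (Inr j))"
 unfolding UNIV_sum by (subst prod.union_disjoint) (auto simp: prod.reindex)

lemma pchart'_metric:
 fixes q :: "real ^ ('v::finite + 'w::finite)"
 assumes "c >= 0" "ep = 1 \<or> ep = -1"
 shows "G_metric c (pchart io c k ep q) (pchart' io c k ep q \<xi>) (pchart' io c k ep q \<zeta>) =
  (\<Sum>m\<in>UNIV. chart_coeff io (c * k) k q m * \<xi> $ m * \<zeta> $ m)"
 unfolding sum_UNIV_sum
 by (simp add: G_metric_def product_metric_def pchart_def pchart'_def round_metric_def hchart'_metric[OF assms(1)]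
   stereo'_inner[OF assms(2)] chart_coeff_def inner_vec_def sum_distrib_left sum_distrib_right mult_ac cong: if_cong)

lemma hyp_space_denominator_pos:
 assumes "c >= 0" "x \<in> hyp_space c"
 shows "1 - c\<^sup>2 * (norm x)^2 / 4 > 0"
proof -
 have "(c * norm x)^2 < 2^2"
  using assms by (intro power_strict_mono) (auto simp: hyp_space_def)
 thus ?thesis by (simp add: power_mult_distrib)
qed

lemma riemannian_on_M_space:
 assumes "c >= 0"
 shows "riemannian_on (M_space c :: ((real ^ 'v::finite) \<times> (real ^ 'w::finite) \<times> real) set) (G_metric c)"
 unfolding riemannian_on_def
proof
 show "\<forall>p\<in>(M_space c :: ((real ^ 'v) \<times> (real ^ 'w) \<times> real) set). inner_form (G_metric c p)"
 proof
  fix p :: "'v rv \<times> 'w rv \<times> real" assume "p \<in> M_space c"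
  hence d: "1 - c\<^sup>2 * (norm (fst p))^2 / 4 > 0"
   using hyp_space_denominator_pos[OF assms] by (auto simp: M_space_def)
  show "inner_form (G_metric c p)"
   unfolding inner_form_def bilinear_def
  proof (intro conjI allI impI)
   show "linear (G_metric c p x)" for x
    by (intro linearI) (simp_all add: G_metric_def product_metric_def hyp_metric_def round_metric_def
      algebra_simps inner_add_right add_divide_distrib)
   show "linear (%x. G_metric c p x y)" for y
    by (intro linearI) (simp_all add: G_metric_def product_metric_def hyp_metric_def round_metric_def
      algebra_simps inner_add_left add_divide_distrib)
   fix \<xi> :: "'v rv \<times> 'w rv \<times> real" assume "\<xi> ~= 0"
   hence "fst \<xi> ~= 0 \<or> snd \<xi> ~= 0" by (auto simp: prod_eq_iff)
   hence "0 < fst \<xi> \<bullet> fst \<xi> / (1 - c\<^sup>2 * (norm (fst p))^2 / 4)\<^sup>2 + snd \<xi> \<bullet> snd \<xi>"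
    using d by (cases "fst \<xi> = 0") (auto intro!: add_pos_nonneg divide_pos_pos zero_less_power)
   thus "0 < G_metric c p \<xi> \<xi>"
    by (simp add: G_metric_def product_metric_def hyp_metric_def round_metric_def)
  qed
 qed
 show "cts ((M_space c :: ('v rv \<times> 'w rv \<times> real) set) \<times> UNIV \<times> UNIV) (%z. G_metric c (fst z) (fst (snd z)) (snd (snd z)))"
  unfolding G_metric_def product_metric_def hyp_metric_def round_metric_def
 proof (intro continuous_intros ballI)
  fix z :: "('v rv \<times> 'w rv \<times> real) \<times> ('v rv \<times> 'w rv \<times> real) \<times> ('v rv \<times> 'w rv \<times> real)"
  assume "z \<in> M_space c \<times> UNIV \<times> UNIV"
  hence "1 - c\<^sup>2 * (norm (fst (fst z)))^2 / 4 > 0"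
   using hyp_space_denominator_pos[OF assms] by (auto simp: M_space_def)
  thus "(1 - c\<^sup>2 * (norm (fst (fst z)))^2 / 4)^2 ~= 0" by simp
 qed auto
qed

lemma range_pchart:
 assumes "c >= 0" "k > 0" "ep = 1 \<or> ep = -1"
 shows "range (pchart io c k ep) = hyp_space c \<times> (unit_sphere - {(0, ep)})"
proof (intro set_eqI iffI)
 fix z assume "z \<in> range (pchart io c k ep)"
 thus "z \<in> hyp_space c \<times> (unit_sphere - {(0, ep)})"
  using hchart_mem[OF assms(1)] stereo_mem[OF assms(3)] by (auto simp: pchart_def)
next
 fix z :: "(real ^ 'a) \<times> (real ^ 'b) \<times> real" assume z: "z \<in> hyp_space c \<times> (unit_sphere - {(0, ep)})"
 hence "fst z \<in> hyp_space c" "snd z \<in> unit_sphere - {(0, ep)}" by auto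
 hence "pchart io c k ep (pchart_inv io c k ep z) = z"
  by (simp add: pchart_def pchart_inv_def hchart_hchart_inv[OF assms(2,1)] stereo_stereo_inv[OF assms(3)])
 thus "z \<in> range (pchart io c k ep)" by (metis rangeI)
qed

lemma pchart_inv_pchart:
 assumes "c >= 0" "k > 0" "ep = 1 \<or> ep = -1"
 shows "pchart_inv io c k ep (pchart io c k ep q) = q"
 using assms by (simp add: pchart_inv_def pchart_def hchart_inv_hchart stereo_inv_stereo)

lemma continuous_on_pchart_inv:
 assumes "c >= 0"
 shows "cts (hyp_space c \<times> (unit_sphere - {(0, ep)})) (pchart_inv io c k ep)"
 unfolding pchart_inv_def
 by (intro continuous_on_vjoin continuous_on_compose2[OF continuous_on_hchart_inv[OF assms]]
   continuous_on_compose2[OF smooth_on_cts[OF smooth_on_stereo_inv[of ep]]]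
   continuous_on_fst continuous_on_snd continuous_on_id) auto

lemma smooth_on_pchart:
 assumes "ep = 1 \<or> ep = -1"
 shows "smooth_on UNIV (pchart io c k ep)"
 unfolding pchart_def[abs_def]
 by (intro smooth_on_Pair smooth_on_compose[OF smooth_on_hchart] smooth_on_compose[OF smooth_on_stereo[OF assms]]
   smooth_on_vfst smooth_on_vsnd smooth_on_id) auto

lemma local_param_pchart:
 assumes "c >= 0" "k > 0" "ep = 1 \<or> ep = -1"
 shows "local_param (M_space c) UNIV (pchart io c k ep :: real ^ ('v::finite + 'w::finite) => _)"
 unfolding local_param_def
proof (intro conjI ballI)
 let ?\<phi> = "pchart io c k ep :: real ^ ('v + 'w) => _"
 show "smooth_on UNIV ?\<phi>" by (rule smooth_on_pchart[OF assms(3)])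
 show "inj (FD ?\<phi> q)" for q
 proof -
  have eq: "FD ?\<phi> q = pchart' io c k ep q"
   using frechet_derivative_at[OF pchart_has_derivative[OF assms(3)]] by metis
  have lin: "linear (pchart' io c k ep q)"
   by (rule has_derivative_linear[OF pchart_has_derivative[OF assms(3)]])
  have "\<xi> = 0" if z: "pchart' io c k ep q \<xi> = 0" for \<xi>
  proof (rule ccontr)
   assume "\<xi> ~= 0"
   then obtain m where m: "\<xi> $ m ~= 0" by (auto simp: vec_eq_iff)
   have "(\<Sum>m\<in>UNIV. chart_coeff io (c * k) k q m * \<xi> $ m * \<xi> $ m) > 0"
   proof (rule sum_pos2[of _ m])
    show "0 < chart_coeff io (c * k) k q m * \<xi> $ m * \<xi> $ m"
     using chart_coeff_pos[OF assms(2), of io "c * k" q m] m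
     by (metis mult.assoc mult_pos_pos not_real_square_gt_zero)
    show "0 <= chart_coeff io (c * k) k q i * \<xi> $ i * \<xi> $ i" for i
     using chart_coeff_pos[OF assms(2), of io "c * k" q i] by (simp add: mult.assoc less_imp_le)
   qed auto
   moreover have "(\<Sum>m\<in>UNIV. chart_coeff io (c * k) k q m * \<xi> $ m * \<xi> $ m) = G_metric c (?\<phi> q) 0 0"
    using pchart'_metric[OF assms(1,3), of io k q \<xi> \<xi>] z by simp
   ultimately show False by (simp add: G_metric_def product_metric_def hyp_metric_def round_metric_def)
  qed
  thus ?thesis unfolding eq using linear_injective_0[OF lin] by blast
 qed
 show "openin (top_of_set (M_space c)) (range ?\<phi>)"
 proof -
  have "range ?\<phi> = M_space c \<inter> (UNIV \<times> (- {(0, ep)}))"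
   unfolding range_pchart[OF assms] by (auto simp: M_space_def)
  moreover have "open (UNIV \<times> (- {(0, ep)}) :: ((real ^ 'v) \<times> (real ^ 'w) \<times> real) set)"
   by (intro open_Times) auto
  ultimately show ?thesis by (metis openin_open_Int)
 qed
 show "\<exists>\<psi>. homeomorphism UNIV (range ?\<phi>) ?\<phi> \<psi>"
 proof (intro exI homeomorphismI)
  show "cts UNIV ?\<phi>" by (rule smooth_on_cts[OF smooth_on_pchart[OF assms(3)]])
  show "cts (range ?\<phi>) (pchart_inv io c k ep)"
   unfolding range_pchart[OF assms] by (rule continuous_on_pchart_inv[OF assms(1)])
 qed (auto simp: pchart_inv_pchart[OF assms])
qed auto

text \<open>Square root of the product of the entries \<open>chart_coeff\<close>; only v - 1 of the
  horospherical directions carry an exponential.\<close>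

definition pdens :: "'v => real => real => real ^ ('v::finite + 'w::finite) => real" where
 "pdens io b k q = k ^ CARD('v) * exp (b * (real CARD('v) - 1) * q $ Inl io) *
   (2 / (1 + vsnd q \<bullet> vsnd q)) ^ CARD('w)"

definition pnormsq :: "'v => real => real => (real ^ ('v::finite + 'w::finite) => real) => real ^ ('v + 'w) => real" where
 "pnormsq io b k f q = (\<Sum>m\<in>UNIV. (partial_deriv m f q)^2 / chart_coeff io b k q m)"

lemma pdens_pos: "k > 0 ==> pdens io b k q > 0"
 using one_plus_inner_pos[of "vsnd q"] by (simp add: pdens_def)

lemma pnormsq_nonneg: "k > 0 ==> pnormsq io b k f q >= 0"
 unfolding pnormsq_def using chart_coeff_pos[of k io b q] by (intro sum_nonneg divide_nonneg_pos) auto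

lemma metric_coeffs_pchart:
 assumes "c >= 0" "ep = 1 \<or> ep = -1"
 shows "metric_coeffs (G_metric c) (pchart io c k ep) q =
  (\<chi> i j. if i = j then chart_coeff io (c * k) k q i else 0)"
proof -
 have eq: "FD (pchart io c k ep) q = pchart' io c k ep q"
  using frechet_derivative_at[OF pchart_has_derivative[OF assms(2)]] by metis
 have "(\<Sum>m\<in>UNIV. chart_coeff io (c * k) k q m * axis i 1 $ m * axis j 1 $ m) =
   (if i = j then chart_coeff io (c * k) k q i else 0)" for i j
 proof -
  have "(\<Sum>m\<in>UNIV. chart_coeff io (c * k) k q m * axis i 1 $ m * axis j 1 $ m) =
    (\<Sum>m\<in>UNIV. if m = i then (if i = j then chart_coeff io (c * k) k q i else 0) else 0)"
   by (intro sum.cong) (auto simp: axis_def)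
  thus ?thesis by (simp add: sum.delta)
 qed
 thus ?thesis
  unfolding metric_coeffs_eq_form_matrix form_matrix_def eq pchart'_metric[OF assms] by simp
qed

lemma chart_density_pchart:
 fixes q :: "real ^ ('v::finite + 'w::finite)"
 assumes "c >= 0" "k > 0" "ep = 1 \<or> ep = -1"
 shows "chart_density (G_metric c) (pchart io c k ep) q = pdens io (c * k) k q"
proof -
 let ?b = "c * k"
 have v: "real (CARD('v) - 1) = real CARD('v) - 1" by (simp add: of_nat_diff Suc_leI)
 have "(\<Prod>i\<in>UNIV. chart_coeff io ?b k q (Inl i)) = k^2 * (\<Prod>i\<in>UNIV - {io}. k^2 * exp (2 * ?b * q $ Inl io))"
 proof (subst prod.remove[of _ io])
  show "chart_coeff io ?b k q (Inl io) * (\<Prod>i\<in>UNIV - {io}. chart_coeff io ?b k q (Inl i)) =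
   k^2 * (\<Prod>i\<in>UNIV - {io}. k^2 * exp (2 * ?b * q $ Inl io))"
   by (intro arg_cong2[of _ _ _ _ "(*)"] prod.cong) (auto simp: chart_coeff_def)
 qed auto
 also have "... = k^2 * (k^2 * exp (2 * ?b * q $ Inl io)) ^ (CARD('v) - 1)"
  by (simp add: card_Diff_singleton)
 also have "... = k\<^sup>2 ^ CARD('v) * exp (2 * ?b * q $ Inl io) ^ (CARD('v) - 1)"
  by (simp add: power_mult_distrib power_Suc[symmetric] Suc_leI mult.assoc[symmetric] del: power_Suc)
 also have "exp (2 * ?b * q $ Inl io) ^ (CARD('v) - 1) = (exp (?b * (real CARD('v) - 1) * q $ Inl io))^2"
  unfolding exp_of_nat_mult[symmetric] v by (simp add: power2_eq_square mult_ac flip: exp_add)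
 finally have "det (metric_coeffs (G_metric c) (pchart io c k ep) q) = (pdens io ?b k q)^2"
  unfolding metric_coeffs_pchart[OF assms(1,3)]
  by (subst det_diagonal) (auto simp: prod_UNIV_sum pdens_def chart_coeff_def power_mult_distrib power_mult[symmetric] mult.commute)
 thus ?thesis
  using pdens_pos[OF assms(2), of io ?b q] by (simp add: chart_density_def)
qed

lemma dual_normsq_pchart:
 assumes "c >= 0" "k > 0" "ep = 1 \<or> ep = -1"
 shows "dual_normsq (G_metric c (pchart io c k ep q)) (FD (pchart io c k ep) q) l =
  (\<Sum>m\<in>UNIV. (l (axis m 1))^2 / chart_coeff io (c * k) k q m)"
proof -
 let ?d = "chart_coeff io (c * k) k q"
 let ?C = "(\<chi> i j. if i = j then ?d i else 0) :: real ^ ('a + 'b) ^ ('a + 'b)"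
 have d: "?d m ~= 0" for m using chart_coeff_pos[OF assms(2)] by (metis less_irrefl)
 have C: "form_matrix (G_metric c (pchart io c k ep q)) (FD (pchart io c k ep) q) = ?C"
  using metric_coeffs_pchart[OF assms(1,3)] by (simp add: metric_coeffs_eq_form_matrix)
 have Cx: "?C *v x = (\<chi> m. ?d m * x $ m)" for x
  by (simp add: matrix_vector_mult_def if_distrib if_distribR sum.delta cong: if_cong)
 have inv: "invertible ?C"
  unfolding invertible_det_nz by (subst det_diagonal) (simp_all add: d)
 have "?C *v (\<chi> m. l (axis m 1) / ?d m) = (\<chi> m. l (axis m 1))"
  unfolding Cx using d by simp
 hence "matrix_inv ?C *v (\<chi> m. l (axis m 1)) = (\<chi> m. l (axis m 1) / ?d m)"
  using matrix_inv_works(2)[OF inv, of "\<chi> m. l (axis m 1) / ?d m"] by (simp only:)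
 thus ?thesis
  unfolding dual_normsq_eq C by (simp add: inner_vec_def power2_eq_square)
qed

lemma diff_normsq_pchart:
 fixes q :: "real ^ ('v::finite + 'w::finite)"
 assumes "c >= 0" "k > 0" "ep = 1 \<or> ep = -1"
  and "u \<in> smooth_compact_support TYPE('v + 'w) (M_space c)"
 shows "diff_normsq TYPE('v + 'w) (M_space c) (G_metric c) u (pchart io c k ep q) =
  pnormsq io (c * k) k (%q. u (pchart io c k ep q)) q"
proof -
 have lp: "local_param (M_space c) UNIV (pchart io c k ep :: real ^ ('v + 'w) => _)"
  by (rule local_param_pchart[OF assms(1-3)])
 have "inner_form (G_metric c (pchart io c k ep q))"
  using riemannian_on_M_space[OF assms(1)] local_paramD(6)[OF lp] by (auto simp: riemannian_on_def)
 from diff_normsq_eq[OF lp UNIV_I, where g = "G_metric c" and q = q, OF this assms(4)] show ?thesis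
  by (simp add: dual_normsq_pchart[OF assms(1-3)] pnormsq_def partial_deriv_def)
qed

lemma M_space_borel: "M_space c \<in> sets borel"
proof -
 have "open (hyp_space c)" unfolding hyp_space_def by (intro open_Collect_less continuous_intros)
 moreover have "closed unit_sphere" unfolding unit_sphere_def by simp
 ultimately show ?thesis unfolding M_space_def by (intro borel_Times borel_open borel_closed)
qed

lemma null_sets_vsnd_eq_0: "{q :: real ^ ('v::finite + 'w::finite). vsnd q = 0} \<in> null_sets lborel"
proof -
 let ?N = "{q :: real ^ ('v + 'w). vsnd q = 0}"
 obtain j :: 'w where True by blast
 have "closed ?N" by (intro closed_Collect_eq continuous_on_vsnd continuous_intros)
 moreover have "?N \<subseteq> {q. q \<bullet> axis (Inr j) 1 = 0}"
  by (auto simp: inner_axis vec_eq_iff)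
 moreover have "negligible {q :: real ^ ('v + 'w). q \<bullet> axis (Inr j) 1 = 0}"
  by (rule negligible_standard_hyperplane) (auto simp: Basis_vec_eq)
 ultimately have "?N \<in> sets borel" "negligible ?N" by (auto intro: negligible_subset)
 thus ?thesis by (simp add: negligible_iff_null_sets null_sets_completion_iff)
qed

lemma range_pchart_cover:
 assumes "c >= 0" "k > 0"
 shows "M_space c = range (pchart io c k 1) \<union> range (pchart io c k (-1))"
 using assms by (auto simp: range_pchart M_space_def)

text \<open>The charts from the two poles cover the manifold. The first misses the fibre over its
  own pole, which the second sees as the null set \<open>vsnd q = 0\<close>.\<close>

lemma riemannian_volume_M_space:
 fixes io :: "'v::finite"
 assumes "c >= 0" "k > 0"
 shows "riemannian_volume TYPE('v + 'w::finite) (M_space c :: ((real ^ 'v) \<times> (real ^ 'w) \<times> real) set) (G_metric c) =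
  distr (density lborel (%q. ennreal (pdens io (c * k) k q))) (restrict_space borel (M_space c)) (pchart io c k 1)"
proof -
 let ?sg = "%ep. pchart io c k ep :: real ^ ('v + 'w) => _"
 have "?sg (-1) -` (M_space c - range (?sg 1)) \<subseteq> {q. vsnd q = 0}"
 proof
  fix q assume "q \<in> ?sg (-1) -` (M_space c - range (?sg 1))"
  hence "?sg (-1) q \<in> M_space c - hyp_space c \<times> (unit_sphere - {(0, 1)})"
   using range_pchart[OF assms, of 1 io] by auto
  hence "stereo (-1) (vsnd q) = (0, 1)"
   by (auto simp: M_space_def pchart_def)
  hence "fst (stereo (-1) (vsnd q)) = 0" by simp
  hence "(2 / (1 + vsnd q \<bullet> vsnd q)) *\<^sub>R vsnd q = 0"
   by (subst (asm) stereo_eq) (simp_all only: fst_conv, simp)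
  moreover have "2 / (1 + vsnd q \<bullet> vsnd q) ~= 0"
   using one_plus_inner_pos[of "vsnd q"] by (intro divide_pos_pos[THEN less_imp_neq, symmetric]) auto
  ultimately have "vsnd q = 0" unfolding scaleR_eq_0_iff by blast
  thus "q \<in> {q. vsnd q = 0}" by simp
 qed
 moreover have "?sg (-1) -` (M_space c - range (?sg 1)) \<in> sets lborel"
 proof -
  have "range (?sg 1) \<in> sets borel"
  proof -
   have "range (?sg 1) = M_space c \<inter> (UNIV \<times> (- {(0, 1)}))"
    using assms by (auto simp: M_space_def range_pchart)
   moreover have "open (UNIV \<times> (- {(0, 1)}) :: ('v rv \<times> 'w rv \<times> real) set)"
    by (intro open_Times) auto
   ultimately show ?thesis using sets.Int[OF M_space_borel borel_open] by (simp only:)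
  qed
  hence "M_space c - range (?sg 1) \<in> sets borel" using M_space_borel by auto
  moreover have "?sg (-1) \<in> bmeas"
   by (rule borel_measurable_continuous_onI[OF smooth_on_cts[OF smooth_on_pchart]]) simp
  ultimately show ?thesis using measurable_sets_borel by simp
 qed
 ultimately have null: "?sg (-1) -` (M_space c - range (?sg 1)) \<in> null_sets lborel"
  using null_sets_subset[OF null_sets_vsnd_eq_0] by blast
 have "chart_density (G_metric c) (?sg 1) = pdens io (c * k) k"
  using chart_density_pchart[OF assms, of 1 io] by auto
 moreover have "M_space c \<subseteq> range (?sg 1) \<union> range (?sg (-1))"
  by (rule equalityD1[OF range_pchart_cover[OF assms]])
 ultimately show ?thesis
  using riemannian_volume_eq[OF local_param_pchart local_param_pchart riemannian_on_M_space[OF assms(1)] _ M_space_borel null]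
   assms by simp
qed

section \<open>Test functions in coordinates\<close>

abbreviation test_functions :: "real => ((real ^ 'v::finite) \<times> (real ^ 'w::finite) \<times> real => real) set" where
 "test_functions c \<equiv> smooth_compact_support TYPE('v + 'w) (M_space c)"

lemma test_function_smooth:
 fixes u :: "(real ^ 'v::finite) \<times> (real ^ 'w::finite) \<times> real => real"
 assumes "u \<in> test_functions c" "c >= 0" "k > 0" "ep = 1 \<or> ep = -1"
 shows "smooth_on UNIV (%q. u (pchart io c k ep q))"
 using assms(1) local_param_pchart[OF assms(2-4), of io]
 by (auto simp: smooth_compact_support_def o_def)

lemma continuous_on_M_spaceI:
 fixes F :: "(real ^ 'v::finite) \<times> (real ^ 'w::finite) \<times> real => real"
 assumes c: "c >= 0"
  and F: "!!ep. ep = 1 \<or> ep = -1 ==> cts UNIV (%q. F (pchart io c 1 ep q))"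
 shows "cts (M_space c) F"
proof -
 have F': "cts (range (pchart io c 1 ep)) F" if e: "ep = 1 \<or> ep = -1" for ep
 proof -
  have "cts (range (pchart io c 1 ep)) (%z. F (pchart io c 1 ep (pchart_inv io c 1 ep z)))"
   using continuous_on_pchart_inv[OF c, of ep io 1] c e
   by (intro continuous_on_compose2[OF F[OF e]]) (auto simp: range_pchart)
  thus ?thesis
   by (rule continuous_on_eq) (auto simp: pchart_inv_pchart[OF c _ e])
 qed
 have M: "M_space c = range (pchart io c 1 1) \<union> range (pchart io c 1 (-1))"
  by (rule range_pchart_cover[OF c]) simp
 have "openin (top_of_set (M_space c)) (range (pchart io c 1 ep :: real ^ ('v + 'w) => _))" if "ep = 1 \<or> ep = -1" for ep
  by (rule local_paramD(4)[OF local_param_pchart[OF c zero_less_one that]])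
 thus ?thesis
  unfolding M by (intro continuous_on_Un_local_open F') (auto simp flip: M)
qed

lemma continuous_on_pnormsq:
 assumes f: "smooth_on UNIV f" and k: "k > 0"
 shows "cts UNIV (pnormsq io b k f)"
 unfolding pnormsq_def[abs_def]
proof (intro continuous_on_sum continuous_on_divide continuous_on_power ballI)
 fix m :: "'a + 'b" and q
 show "cts UNIV (partial_deriv m f)"
  unfolding partial_deriv_def[abs_def]
  by (rule smooth_on_cts[OF smooth_on_frechet_derivative[OF f]])
 show "chart_coeff io b k q m ~= 0" using chart_coeff_pos[OF k] by (metis less_irrefl)
 show "cts UNIV (%q. chart_coeff io b k q m)"
 proof (cases m)
  case (Inl i)
  thus ?thesis by (cases "i = io") (auto simp: chart_coeff_def intro!: continuous_intros)
 next
  case (Inr j)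
  have "1 + vsnd q \<bullet> vsnd q ~= 0" for q :: "real ^ ('a + 'b)" using one_plus_inner_pos[of "vsnd q"] by simp
  thus ?thesis using Inr by (auto simp: chart_coeff_def intro!: continuous_intros)
 qed
qed

lemma continuous_on_pdens: "cts UNIV (pdens io b k)"
proof -
 have "1 + vsnd q \<bullet> vsnd q ~= 0" for q :: "real ^ ('a + 'b)" using one_plus_inner_pos[of "vsnd q"] by simp
 thus ?thesis unfolding pdens_def[abs_def] by (auto intro!: continuous_intros)
qed

lemma partial_deriv_zero:
 assumes "open T" "q \<in> T" "!!q. q \<in> T ==> f q = 0"
 shows "partial_deriv m f q = 0"
proof -
 have "(f has_derivative (%v. 0)) (at q)"
  by (rule has_derivative_transform_within_open[OF has_derivative_const assms(1,2)]) (use assms(3) in auto)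
 thus ?thesis unfolding partial_deriv_def by (metis frechet_derivative_at)
qed

text \<open>In coordinates compact support means a bound on the hyperbolic variable alone. The
  stereographic variable stays unbounded, and the density has to provide integrability
  there.\<close>

lemma test_function_support:
 fixes u :: "(real ^ 'v::finite) \<times> (real ^ 'w::finite) \<times> real => real"
 assumes u: "u \<in> test_functions c" and c: "c >= 0" and k: "k > 0"
 obtains R where "R > 0" "!!q ep. ep = 1 \<or> ep = -1 ==> u (pchart io c k ep q) ~= 0 ==> norm (vfst q) < R"
proof -
 obtain K where K: "K \<subseteq> M_space c" "compact K" "!!p. p \<in> M_space c - K ==> u p = 0"
  using u by (auto simp: smooth_compact_support_def)
 have fK: "compact (fst ` K)" by (rule compact_continuous_image[OF continuous_on_fst[OF continuous_on_id] K(2)])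
 have sub: "fst ` K \<subseteq> hyp_space c" using K(1) by (auto simp: M_space_def)
 have "compact (hchart_inv io c k ` fst ` K)"
  by (rule compact_continuous_image[OF continuous_on_subset[OF continuous_on_hchart_inv[OF c] sub] fK])
 then obtain R where R: "!!x. x \<in> hchart_inv io c k ` fst ` K ==> norm x <= R"
  using compact_imp_bounded bounded_iff by metis
 show ?thesis
 proof (rule that[of "\<bar>R\<bar> + 1"])
  fix q and ep :: real assume e: "ep = 1 \<or> ep = -1" and "u (pchart io c k ep q) ~= 0"
  moreover have "pchart io c k ep q \<in> M_space c"
   using local_paramD(6)[OF local_param_pchart[OF c k e]] by auto
  ultimately have "pchart io c k ep q \<in> K" using K(3) by blast
  hence "hchart_inv io c k (fst (pchart io c k ep q)) \<in> hchart_inv io c k ` fst ` K" by blast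
  hence "norm (vfst q) <= R"
   using R by (simp add: pchart_def hchart_inv_hchart[OF k c])
  thus "norm (vfst q) < \<bar>R\<bar> + 1" by simp
 qed simp
qed

lemma continuous_on_test_function:
 fixes u :: "(real ^ 'v::finite) \<times> (real ^ 'w::finite) \<times> real => real"
 assumes u: "u \<in> test_functions c" and c: "c >= 0"
 shows "cts (M_space c) u"
  and "cts (M_space c) (diff_normsq TYPE('v + 'w) (M_space c) (G_metric c) u)"
proof -
 obtain io :: 'v where True by blast
 show "cts (M_space c) u"
  by (rule continuous_on_M_spaceI[OF c, where io = io])
   (rule smooth_on_cts[OF test_function_smooth[OF u c]], auto)
 show "cts (M_space c) (diff_normsq TYPE('v + 'w) (M_space c) (G_metric c) u)"
 proof (rule continuous_on_M_spaceI[OF c, where io = io])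
  fix ep :: real assume e: "ep = 1 \<or> ep = -1"
  show "cts UNIV (%q. diff_normsq TYPE('v + 'w) (M_space c) (G_metric c) u (pchart io c 1 ep q))"
   by (simp add: diff_normsq_pchart[OF c zero_less_one e u])
    (rule continuous_on_pnormsq[OF test_function_smooth[OF u c zero_less_one e] zero_less_one])
 qed
qed

text \<open>Bounds cannot be read off one chart, whose stereographic variable is unbounded. They
  come from continuity of u and of \<open>diff_normsq u\<close> on the compact support inside the
  manifold.\<close>

lemma test_function_bounded:
 fixes u :: "(real ^ 'v::finite) \<times> (real ^ 'w::finite) \<times> real => real"
 assumes u: "u \<in> test_functions c" and c: "c >= 0" and k: "k > 0"
 obtains B where "B > 0" "!!q. \<bar>u (pchart io c k 1 q)\<bar> <= B"
  "!!q. pnormsq io (c * k) k (%q. u (pchart io c k 1 q)) q <= B"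
proof -
 obtain K where K: "K \<subseteq> M_space c" "compact K" "!!p. p \<in> M_space c - K ==> u p = 0"
  using u by (auto simp: smooth_compact_support_def)
 let ?n = "diff_normsq TYPE('v + 'w) (M_space c) (G_metric c) u"
 have "bounded (u ` K)" "bounded (?n ` K)"
  using continuous_on_test_function[OF u c] K(1,2)
  by (auto intro!: compact_imp_bounded compact_continuous_image intro: continuous_on_subset)
 then obtain B1 B2 where B: "!!p. p \<in> K ==> \<bar>u p\<bar> <= B1" "!!p. p \<in> K ==> \<bar>?n p\<bar> <= B2"
  by (auto simp: bounded_iff)
 let ?\<phi> = "pchart io c k 1 :: real ^ ('v + 'w) => _"
 have M: "?\<phi> q \<in> M_space c" for q
  using local_paramD(6)[OF local_param_pchart[OF c k, of 1]] by auto
 have cont: "cts UNIV ?\<phi>"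
  by (rule smooth_on_cts[OF smooth_on_pchart]) simp
 show ?thesis
 proof (rule that[of "\<bar>B1\<bar> + \<bar>B2\<bar> + 1"])
  fix q
  show "\<bar>u (?\<phi> q)\<bar> <= \<bar>B1\<bar> + \<bar>B2\<bar> + 1"
  proof (cases "?\<phi> q \<in> K")
   case True
   thus ?thesis using B(1)[OF True] by linarith
  qed (use K(3) M in auto)
  have eq: "pnormsq io (c * k) k (%q. u (?\<phi> q)) q = ?n (?\<phi> q)"
   using diff_normsq_pchart[OF c k _ u, of 1] by simp
  show "pnormsq io (c * k) k (%q. u (?\<phi> q)) q <= \<bar>B1\<bar> + \<bar>B2\<bar> + 1"
  proof (cases "?\<phi> q \<in> K")
   case True
   thus ?thesis using B(2)[OF True] eq by linarith
  next
   case False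
   have "open (?\<phi> -` (- K))"
    using cont K(2) by (intro open_vimage) (auto intro: compact_imp_closed)
   hence "partial_deriv m (%q. u (?\<phi> q)) q = 0" for m
    by (rule partial_deriv_zero) (use False K(3) M in auto)
   thus ?thesis by (simp add: pnormsq_def)
  qed
 qed simp
qed

lemma integral_M_space:
 fixes F :: "(real ^ 'v::finite) \<times> (real ^ 'w::finite) \<times> real => real" and io :: 'v
 assumes "c >= 0" "k > 0" "cts (M_space c) F"
 shows "(\<integral>x. F x \<partial>riemannian_volume TYPE('v + 'w) (M_space c) (G_metric c)) =
  (LBINT q. pdens io (c * k) k q * F (pchart io c k 1 q))"
proof -
 let ?\<phi> = "pchart io c k 1 :: real ^ ('v + 'w) => _"
 have Fm: "F \<in> borel_measurable (restrict_space borel (M_space c))"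
  by (rule borel_measurable_continuous_on_restrict[OF assms(3)])
 have "?\<phi> \<in> bmeas"
  by (rule borel_measurable_continuous_onI[OF smooth_on_cts[OF smooth_on_pchart]]) simp
 moreover have "range ?\<phi> \<subseteq> M_space c"
  using local_paramD(6)[OF local_param_pchart[OF assms(1,2), of 1]] by auto
 ultimately have \<phi>m: "?\<phi> \<in> lborel \<rightarrow>\<^sub>M restrict_space borel (M_space c)"
  by (intro measurable_restrict_space2) auto
 have dm: "pdens io (c * k) k \<in> bmeas"
  by (rule borel_measurable_continuous_onI[OF continuous_on_pdens])
 have "(\<integral>x. F x \<partial>riemannian_volume TYPE('v + 'w) (M_space c) (G_metric c)) =
   (\<integral>q. F (?\<phi> q) \<partial>density lborel (%q. ennreal (pdens io (c * k) k q)))"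
  unfolding riemannian_volume_M_space[OF assms(1,2), of io]
  by (rule integral_distr[OF _ Fm]) (use \<phi>m in simp)
 also have "... = (LBINT q. pdens io (c * k) k q *\<^sub>R F (?\<phi> q))"
  using measurable_compose[OF \<phi>m Fm] dm pdens_pos[OF assms(2)]
  by (intro integral_density) (auto intro!: AE_I2 less_imp_le)
 finally show ?thesis by simp
qed

lemma yamabe_quotient_M_space:
 fixes u :: "(real ^ 'v::finite) \<times> (real ^ 'w::finite) \<times> real => real" and io :: 'v
 assumes u: "u \<in> test_functions c" and c: "c >= 0" and k: "k > 0" and p: "yamabe_p CARD('v + 'w) > 0"
 shows "yamabe_quotient TYPE('v + 'w) (M_space c) (G_metric c) (%_. s) u =
  (LBINT q. pdens io (c * k) k q * (yamabe_a CARD('v + 'w) * pnormsq io (c * k) k (%q. u (pchart io c k 1 q)) q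
    + s * (u (pchart io c k 1 q))^2)) /
  ((LBINT q. pdens io (c * k) k q * \<bar>u (pchart io c k 1 q)\<bar> powr yamabe_p CARD('v + 'w))
   powr (1 / yamabe_p CARD('v + 'w)))^2"
proof -
 note cont = continuous_on_test_function[OF u c]
 have 1: "cts (M_space c) (%x. yamabe_a CARD('v + 'w) *
   diff_normsq TYPE('v + 'w) (M_space c) (G_metric c) u x + s * (u x)^2)"
  by (intro continuous_intros cont)
 have 2: "cts (M_space c) (%x. \<bar>u x\<bar> powr yamabe_p CARD('v + 'w))"
  by (intro continuous_on_powr' continuous_intros cont) (use p in auto)
 have eq: "diff_normsq TYPE('v + 'w) (M_space c) (G_metric c) u (pchart io c k 1 q) =
   pnormsq io (c * k) k (%q. u (pchart io c k 1 q)) q" for q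
  by (rule diff_normsq_pchart[OF c k _ u]) simp
 show ?thesis
  unfolding yamabe_quotient_def Lp_norm_def integral_M_space[OF c k 1, of io] integral_M_space[OF c k 2, of io] eq ..
qed

text \<open>Test functions must be smooth in every parametrization. Near each point one of the two
  poles is avoided, and there the composite factors smoothly through the corresponding stereographic
  chart.\<close>

lemma test_function_flat_chartsI:
 fixes W :: "(real ^ 'v::finite) \<times> (real ^ 'w::finite) \<times> real => real"
 assumes smooth: "!!ep. ep = 1 \<or> ep = -1 ==> smooth_on UNIV (%q. W (vfst q, stereo ep (vsnd q)))"
  and support: "!!z. norm (fst z) > R ==> W z = 0"
 shows "W \<in> test_functions 0"
 unfolding smooth_compact_support_def
proof (intro CollectI conjI allI impI)
 fix U and \<phi> :: "real ^ ('v + 'w) => (real ^ 'v) \<times> (real ^ 'w) \<times> real"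
 assume \<phi>: "local_param (M_space 0) U \<phi>"
 show "smooth_on U (W \<circ> \<phi>)"
 proof (rule smooth_on_local)
  fix q assume q: "q \<in> U"
  have mem: "snd (\<phi> q) \<in> unit_sphere" if "q \<in> U" for q
   using local_paramD(6)[OF \<phi>] that by (auto simp: M_space_def)
  obtain ep :: real where e: "ep = 1 \<or> ep = -1" "snd (\<phi> q) ~= (0, ep)"
   by (cases "snd (\<phi> q) = (0, 1)") force+
  define T where "T = U \<inter> (%q. snd (\<phi> q)) -` (- {(0, ep)})"
  have T: "open T" unfolding T_def
   using local_paramD(1,7)[OF \<phi>] by (intro continuous_open_preimage continuous_on_snd) auto
  have \<phi>T: "smooth_on T \<phi>" using smooth_on_subset[OF local_paramD(2)[OF \<phi>]] by (simp add: T_def)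
  have "smooth_on T (%q. stereo_inv ep (snd (\<phi> q)))"
   by (rule smooth_on_compose[OF smooth_on_stereo_inv _ T smooth_on_snd[OF T \<phi>T]]) (auto simp: T_def)
  hence "smooth_on T (%q. vjoin (fst (\<phi> q)) (stereo_inv ep (snd (\<phi> q))))"
   by (intro smooth_on_vjoin smooth_on_fst T \<phi>T)
  hence "smooth_on T (%q. W (vfst (vjoin (fst (\<phi> q)) (stereo_inv ep (snd (\<phi> q)))),
    stereo ep (vsnd (vjoin (fst (\<phi> q)) (stereo_inv ep (snd (\<phi> q)))))))"
   by (intro smooth_on_compose[OF smooth[OF e(1)] open_UNIV T]) auto
  hence "smooth_on T (W \<circ> \<phi>)"
   by (rule smooth_on_cong[OF T, rotated]) (auto simp: T_def stereo_stereo_inv[OF e(1)] mem)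
  thus "\<exists>T. open T & q \<in> T & smooth_on T (W \<circ> \<phi>)"
   using T q e(2) by (intro exI[of _ T]) (auto simp: T_def)
 qed
next
 have "compact (cball 0 R \<times> unit_sphere :: ('v rv \<times> 'w rv \<times> real) set)"
  unfolding unit_sphere_def by (intro compact_Times compact_cball compact_sphere)
 moreover have "W p = 0" if "p \<in> M_space 0 - cball 0 R \<times> unit_sphere" for p
  by (rule support) (use that in \<open>auto simp: M_space_def\<close>)
 ultimately show "\<exists>K\<subseteq>M_space 0. compact K & (\<forall>p\<in>M_space 0 - K. W p = 0)"
  by (intro exI[of _ "cball 0 R \<times> unit_sphere"]) (auto simp: M_space_def hyp_space_def)
qed

lemma local_param_linear_image:
 fixes L :: "'e::euclidean_space => 'f::euclidean_space"
 assumes \<phi>: "local_param M U \<phi>" and L: "bounded_linear L" "bounded_linear L'"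
  and inv: "!!x. L' (L x) = x" "!!y. L (L' y) = y"
 shows "local_param (L ` M) U (%q. L (\<phi> q))"
 unfolding local_param_def
proof (intro conjI ballI)
 show "open U" "smooth_on U (%q. L (\<phi> q))"
  using local_paramD(1,2)[OF \<phi>] L by (auto intro: smooth_on_linear_compose)
 show "inj (FD (%q. L (\<phi> q)) q)" if "q \<in> U" for q
 proof -
  have "((%q. L (\<phi> q)) has_derivative (%v. L (FD \<phi> q v))) (at q)"
   by (rule bounded_linear.has_derivative[OF L(1) local_paramD(8)[OF \<phi> that]])
  hence "FD (%q. L (\<phi> q)) q = (%v. L (FD \<phi> q v))"
   by (rule frechet_derivative_at[symmetric])
  moreover have "inj L" using inv(1) by (metis injI)
  ultimately show ?thesis using local_paramD(3)[OF \<phi> that] by (auto simp: inj_def)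
 qed
 have cont: "cts S L" "cts S' L'" for S S'
  using L by (auto intro: linear_continuous_on)
 have hom: "homeomorphism M (L ` M) L L'"
  using cont inv by (auto intro!: homeomorphismI)
 show "openin (top_of_set (L ` M)) ((%q. L (\<phi> q)) ` U)"
 proof -
  obtain T where T: "open T" "\<phi> ` U = M \<inter> T" using local_paramD(4)[OF \<phi>] by (auto simp: openin_open)
  have "open (L' -` T)" using T(1) cont(2) by (intro open_vimage)
  moreover have "(%q. L (\<phi> q)) ` U = L ` M \<inter> L' -` T"
  proof -
   have "(%q. L (\<phi> q)) ` U = L ` (M \<inter> T)" using T(2) by (metis image_image)
   also have "... = L ` M \<inter> L' -` T" using inv by (auto simp: image_iff)
   finally show ?thesis .
  qed
  ultimately show ?thesis by (metis openin_open_Int)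
 qed
 obtain \<psi> where "homeomorphism U (\<phi> ` U) \<phi> \<psi>" using \<phi> by (auto simp: local_param_def)
 moreover have "homeomorphism (\<phi> ` U) ((%q. L (\<phi> q)) ` U) L L'"
  using cont inv by (auto intro!: homeomorphismI simp: image_image)
 ultimately have "homeomorphism U ((%q. L (\<phi> q)) ` U) (L \<circ> \<phi>) (\<psi> \<circ> L')"
  by (rule homeomorphism_compose)
 thus "\<exists>\<psi>. homeomorphism U ((%q. L (\<phi> q)) ` U) (%q. L (\<phi> q)) \<psi>" by (auto simp: o_def)
qed

text \<open>The dilation z -> z / c of the hyperbolic factor is linear in the ball model and maps
  parametrizations of \<open>M_space 1\<close> to parametrizations of
  \<open>M_space c\<close>.\<close>

lemma test_function_rescale:
 fixes u :: "(real ^ 'v::finite) \<times> (real ^ 'w::finite) \<times> real => real"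
 assumes u: "u \<in> test_functions c" and c: "c > 0"
 shows "(%z. u ((1 / c) *\<^sub>R fst z, snd z)) \<in> test_functions 1"
proof -
 let ?L = "%z. ((1 / c) *\<^sub>R fst z, snd z) :: (real ^ 'v) \<times> (real ^ 'w) \<times> real"
 let ?L' = "%z. (c *\<^sub>R fst z, snd z) :: 'v rv \<times> 'w rv \<times> real"
 have L: "bounded_linear ?L" "bounded_linear ?L'"
  by (intro bounded_linear_Pair bounded_linear_snd
    bounded_linear_compose[OF bounded_linear_scaleR_right bounded_linear_fst])+
 have inv: "?L' (?L z) = z" "?L (?L' z) = z" for z using c by auto
 have "?L ` M_space 1 = M_space c"
 proof (intro set_eqI iffI)
  fix z assume "z \<in> ?L ` M_space 1"
  thus "z \<in> M_space c" using c by (auto simp: M_space_def hyp_space_def)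
 next
  fix z :: "'v rv \<times> 'w rv \<times> real" assume "z \<in> M_space c"
  hence "?L' z \<in> M_space 1" using c by (auto simp: M_space_def hyp_space_def)
  moreover have "z = ?L (?L' z)" using c by (simp add: prod_eq_iff)
  ultimately show "z \<in> ?L ` M_space 1" by (intro image_eqI[of z ?L "?L' z"])
 qed
 hence lp: "local_param (M_space c) U (%q. ?L (\<phi> q))" if "local_param (M_space 1) U \<phi>"
  for U and \<phi> :: "real ^ ('v + 'w) => _"
  using local_param_linear_image[OF that L inv] by metis
 obtain K where K: "K \<subseteq> M_space c" "compact K" "!!p. p \<in> M_space c - K ==> u p = 0"
  using u by (auto simp: smooth_compact_support_def)
 show ?thesis
  unfolding smooth_compact_support_def
 proof (intro CollectI conjI allI impI)
  fix U and \<phi> :: "real ^ ('v + 'w) => 'v rv \<times> 'w rv \<times> real"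
  assume "local_param (M_space 1) U \<phi>"
  from lp[OF this] show "smooth_on U ((%z. u (?L z)) \<circ> \<phi>)"
   using u by (auto simp: smooth_compact_support_def o_def)
 next
  have "compact (?L' ` K)" using K(2) L(2) by (intro compact_continuous_image linear_continuous_on)
  moreover have "?L' ` K \<subseteq> M_space 1" using K(1) c by (auto simp: M_space_def hyp_space_def)
  moreover have "u (?L p) = 0" if p: "p \<in> M_space 1 - ?L' ` K" for p
  proof (rule K(3))
   have "?L p \<in> M_space c" using p c by (auto simp: M_space_def hyp_space_def)
   moreover have "?L p \<notin> K"
   proof
    assume "?L p \<in> K"
    moreover have "p = ?L' (?L p)" using c by (simp add: prod_eq_iff)
    ultimately have "p \<in> ?L' ` K" by (intro image_eqI[of p ?L' "?L p"])
    thus False using p by blast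
   qed
   ultimately show "?L p \<in> M_space c - K" by blast
  qed
  ultimately show "\<exists>K\<subseteq>M_space 1. compact K & (\<forall>p\<in>M_space 1 - K. u (?L p) = 0)" by blast
 qed
qed

lemma hchart_rescale: "c > 0 ==> hchart io 1 c p = c *\<^sub>R hchart io c 1 p"
 by (simp add: hchart_def)

lemma pchart_rescale:
 "c > 0 ==> ((1 / c) *\<^sub>R fst (pchart io 1 c ep q), snd (pchart io 1 c ep q)) = pchart io c 1 ep q"
 by (simp add: pchart_def hchart_rescale)

text \<open>Keeps the infimum away from the empty set. The bump depends on the hyperbolic variable
  alone and is supported in the closed unit ball, which lies in the ball of radius 2/c as c <=
  1.\<close>

lemma exists_test_function:
 assumes "0 <= c" "c <= 1"
 shows "\<exists>u \<in> (test_functions c :: ((real ^ 'v::finite) \<times> (real ^ 'w::finite) \<times> real => real) set). \<exists>p\<in>M_space c. u p ~= 0"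
proof -
 define u where "u z = flat_exp 1 0 (1 - fst z \<bullet> fst z)" for z :: "(real ^ 'v) \<times> (real ^ 'w) \<times> real"
 have su: "smooth_on UNIV u"
  unfolding u_def[abs_def]
  by (rule smooth_on_compose[OF smooth_on_flat_exp]) (auto intro!: smooth_intros)
 have sub: "(cball 0 1 :: 'v rv set) \<subseteq> hyp_space c"
 proof
  fix x :: "'v rv" assume "x \<in> cball 0 1"
  hence "c * norm x <= 1 * 1" using assms by (intro mult_mono) auto
  thus "x \<in> hyp_space c" by (simp add: hyp_space_def)
 qed
 have "u \<in> test_functions c"
  unfolding smooth_compact_support_def
 proof (intro CollectI conjI allI impI)
  fix U and \<phi> :: "real ^ ('v + 'w) => 'v rv \<times> 'w rv \<times> real"
  assume "local_param (M_space c) U \<phi>"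
  thus "smooth_on U (u \<circ> \<phi>)"
   unfolding o_def using local_paramD by (intro smooth_on_compose[OF su]) auto
 next
  have "compact (cball 0 1 \<times> unit_sphere :: ('v rv \<times> 'w rv \<times> real) set)"
   unfolding unit_sphere_def by (intro compact_Times compact_cball compact_sphere)
  moreover have "u p = 0" if "p \<in> M_space c - cball 0 1 \<times> unit_sphere" for p
  proof -
   have "norm (fst p) > 1" using that by (auto simp: M_space_def)
   hence "fst p \<bullet> fst p > 1" by (simp add: dot_square_norm)
   thus ?thesis by (simp add: u_def flat_exp_def)
  qed
  ultimately show "\<exists>K\<subseteq>M_space c. compact K & (\<forall>p\<in>M_space c - K. u p = 0)"
   using sub by (intro exI[of _ "cball 0 1 \<times> unit_sphere"]) (auto simp: M_space_def)
 qed
 moreover have "(0, stereo 1 0) \<in> (M_space c :: ('v rv \<times> 'w rv \<times> real) set)"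
  using stereo_mem[of 1 0] by (auto simp: M_space_def hyp_space_def)
 moreover have "u (0, stereo 1 0) ~= 0" by (simp add: u_def flat_exp_def)
 ultimately show ?thesis by blast
qed

section \<open>Integration in coordinates\<close>

lemma integrable_continuous_bounded_support:
 fixes f :: "'a::euclidean_space => real"
 assumes "cts UNIV f" "!!x. norm x > R ==> f x = 0"
 shows "integrable lborel f"
proof -
 have "integrable lborel (%x. ind (cball 0 R) x *\<^sub>R f x)"
  by (rule borel_integrable_compact) (auto intro: continuous_on_subset[OF assms(1)])
 moreover have "(%x. ind (cball 0 R) x *\<^sub>R f x) = f"
  using assms(2) by (auto simp: fun_eq_iff indicator_def)
 ultimately show ?thesis by simp
qed

lemma integral_lborel_eq_on:
 fixes F :: "'a::euclidean_space => real"
 assumes "integrable lborel F" "!!x. x \<notin> K ==> F x = 0"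
 shows "(LBINT x. F x) = integral K F"
proof -
 have "integral K F = integral UNIV (%x. if x \<in> K then F x else 0)" by (rule integral_restrict_UNIV[symmetric])
 also have "(%x. if x \<in> K then F x else 0) = F" using assms(2) by auto
 finally show ?thesis using integral_lborel[OF assms(1)] by simp
qed

text \<open>By translation invariance the integral of g (x + t e) does not depend on t, and its
  derivative at t = 0 is the integral of g'. Only one directional derivative is asked for, which
  suits the transport coordinates below.\<close>

lemma integral_directional_derivative_zero:
 fixes g g' :: "'a::euclidean_space => real"
 assumes g: "cts UNIV g" and g': "cts UNIV g'"
  and der: "!!x. RD (%t. g (x + t *\<^sub>R e)) 0 :> g' x"
  and supp: "!!x. norm x > R ==> g x = 0"
 shows "(LBINT x. g' x) = 0"
proof -
 have der': "RD (%t. g (x + t *\<^sub>R e)) s :> g' (x + s *\<^sub>R e)" for x s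
  using der[of "x + s *\<^sub>R e"] DERIV_shift[of "%t. g (x + t *\<^sub>R e)" _ 0 s] by (simp add: algebra_simps)
 have supp': "g' x = 0" if "norm x > R" for x
 proof -
  have "RD (%t. g (x + t *\<^sub>R e)) 0 :> 0"
  proof (rule has_field_derivative_transform_within_open[of "%t. 0"])
   show "open {t. norm (x + t *\<^sub>R e) > R}" by (intro open_Collect_less continuous_intros)
  qed (use that supp in auto)
  thus ?thesis using der DERIV_unique by blast
 qed
 \<comment> \<open>The margin \<open>norm e\<close> keeps the supports of all translates with |t| <=
   1 in one fixed box, over which the integral is differentiated.\<close>
 obtain a where a: "cball (0 :: 'a) (\<bar>R\<bar> + norm e) \<subseteq> cbox (- a) a" using bounded_subset_cbox_symmetric[OF bounded_cball] by blast
 have off: "g (x + t *\<^sub>R e) = 0" if "\<bar>t\<bar> <= 1" "x \<notin> cbox (- a) a" for t and x :: 'a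
 proof (rule supp)
  have "norm x > \<bar>R\<bar> + norm e" using that(2) a by force
  moreover have "norm x <= norm (x + t *\<^sub>R e) + norm (t *\<^sub>R e)" using norm_triangle_ineq4[of "x + t *\<^sub>R e" "t *\<^sub>R e"] by simp
  moreover have "norm (t *\<^sub>R e) <= norm e" using that(1) by (simp add: mult_left_le_one_le)
  ultimately show "norm (x + t *\<^sub>R e) > R" by linarith
 qed
 have gm: "g \<in> bmeas" by (rule borel_measurable_continuous_onI[OF g])
 have const: "integral (cbox (- a) a) (%x. g (x + t *\<^sub>R e)) = (LBINT x. g x)" if t: "\<bar>t\<bar> <= 1" for t
 proof -
  have "integrable lborel (%x. g (x + t *\<^sub>R e))"
  proof -
   obtain r where r: "!!x. x \<in> cbox (- a) a ==> norm x <= r" using bounded_cbox bounded_iff by metis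
   show ?thesis
   proof (rule integrable_continuous_bounded_support)
    show "cts UNIV (%x. g (x + t *\<^sub>R e))" by (intro continuous_on_compose2[OF g] continuous_intros) auto
    show "norm x > r ==> g (x + t *\<^sub>R e) = 0" for x using off[OF t, of x] r[of x] by fastforce
   qed
  qed
  from integral_lborel_eq_on[OF this off[OF t]]
  have "integral (cbox (- a) a) (%x. g (x + t *\<^sub>R e)) = (LBINT x. g (t *\<^sub>R e + x))" by (simp add: add.commute)
  also have "... = (\<integral>x. g x \<partial>distr lborel borel ((+) (t *\<^sub>R e)))" by (rule integral_distr[symmetric]) (use gm in auto)
  finally show ?thesis by (simp only: lborel_distr_plus)
 qed
 have "((%t. integral (cbox (- a) a) (%x. g (x + t *\<^sub>R e))) has_real_derivative integral (cbox (- a) a) (%x. g' (x + 0 *\<^sub>R e))) (at 0 within {-1<..<1})"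
  by (rule leibniz_rule_field_derivative)
   (auto intro!: has_field_derivative_at_within[OF der'] integrable_continuous continuous_on_compose2[OF g] continuous_on_compose2[OF g']
    continuous_intros simp: case_prod_unfold)
 hence "RD (%t. integral (cbox (- a) a) (%x. g (x + t *\<^sub>R e))) 0 :> integral (cbox (- a) a) g'"
  by (simp add: at_within_open[of 0 "{-1<..<1}"])
 moreover have "RD (%t. integral (cbox (- a) a) (%x. g (x + t *\<^sub>R e))) 0 :> 0"
  by (rule has_field_derivative_transform_within_open[of "%t. (LBINT x. g x)" _ _ "{-1<..<1}"]) (auto simp: const)
 ultimately have "integral (cbox (- a) a) g' = 0" by (rule DERIV_unique)
 moreover have "g' x = 0" if "x \<notin> cbox (- a) a" for x
 proof (rule supp')
  have "norm x > \<bar>R\<bar> + norm e" using that a by force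
  thus "norm x > R" using norm_ge_zero[of e] by linarith
 qed
 ultimately show ?thesis using integral_lborel_eq_on[OF integrable_continuous_bounded_support[OF g' supp']] by metis
qed

lemma nn_integral_inverse_one_plus_square: "(LBNN t. ennreal (1 / (1 + t^2))) < \<infinity>"
proof -
 have half: "(LBNN t. ennreal (1 / (1 + t^2)) * ind {0..} t) = ennreal (pi / 2 - arctan 0)"
 proof (rule nn_integral_FTC_atLeast)
  show "DERIV arctan x :> 1 / (1 + x^2)" for x
   using DERIV_arctan[of x] by (simp add: inverse_eq_divide)
  show "(arctan \<longlongrightarrow> pi / 2) at_top" by (rule tendsto_arctan_at_top)
 qed auto
 have refl: "(LBNN t. ennreal (1 / (1 + t^2)) * ind {..0} t) =
   (LBNN t. ennreal (1 / (1 + t^2)) * ind {0..} t)"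
  by (subst nn_integral_real_affine[where c = "-1" and t = 0]) (auto intro!: nn_integral_cong simp: indicator_def)
 have "(LBNN t. ennreal (1 / (1 + t^2))) <=
   (LBNN t. ennreal (1 / (1 + t^2)) * ind {..0} t + ennreal (1 / (1 + t^2)) * ind {0..} t)"
  by (intro nn_integral_mono) (auto simp: indicator_def)
 also have "... = (LBNN t. ennreal (1 / (1 + t^2)) * ind {..0} t) +
   (LBNN t. ennreal (1 / (1 + t^2)) * ind {0..} t)"
  by (rule nn_integral_add) auto
 also have "... < \<infinity>" unfolding refl half by (simp add: ennreal_plus[symmetric] del: ennreal_plus)
 finally show ?thesis .
qed

section \<open>Integrability against the density of the product chart\<close>

definition sdens :: "real ^ 'w::finite => real" where
 "sdens y = (2 / (1 + y \<bullet> y)) ^ CARD('w)"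

definition hdens :: "'v => real => real ^ 'v::finite => real" where
 "hdens io b p = exp (b * (real CARD('v) - 1) * p $ io)"

lemma pdens_eq: "pdens io b k q = k ^ CARD('v) * hdens io b (vfst q) * sdens (vsnd q)"
 for q :: "real ^ ('v::finite + 'w::finite)"
 by (simp add: pdens_def hdens_def sdens_def)

lemma sdens_pos: "sdens y > 0"
 using one_plus_inner_pos[of y] by (simp add: sdens_def)

lemma hdens_pos: "hdens io b p > 0"
 by (simp add: hdens_def)

lemma continuous_on_sdens: "cts UNIV sdens"
proof -
 have "1 + y \<bullet> y ~= 0" for y :: "real ^ 'a" using one_plus_inner_pos[of y] by (metis less_irrefl)
 thus ?thesis unfolding sdens_def[abs_def] by (auto intro!: continuous_intros)
qed

lemma continuous_on_hdens: "cts UNIV (hdens io b)"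
 unfolding hdens_def[abs_def] by (auto intro!: continuous_intros)

text \<open>The density is a product of w equal factors 2 / (1 + |y|^2). Bounding the j-th one by 2
  / (1 + y_j^2) gives a product of one-dimensional integrable functions.\<close>

lemma nn_integral_sdens_finite: "(LBNN y. ennreal (sdens (y :: real ^ 'w::finite))) < \<infinity>"
proof -
 have "sdens y <= (\<Prod>b\<in>Basis. 2 * (1 / (1 + (y \<bullet> b)^2)))" for y :: "real ^ 'w"
 proof -
  have "(\<Prod>j\<in>(UNIV :: 'w set). 2 / (1 + y \<bullet> y)) <= (\<Prod>j\<in>UNIV. 2 * (1 / (1 + (y $ j)^2)))"
  proof (intro prod_mono conjI)
   fix j :: 'w
   show "0 <= 2 / (1 + y \<bullet> y)" using one_plus_inner_pos[of y] by simp
   have "(y $ j)^2 <= y \<bullet> y"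
    using member_le_sum[of j UNIV "%i. y $ i * y $ i"] by (simp add: inner_vec_def power2_eq_square)
   thus "2 / (1 + y \<bullet> y) <= 2 * (1 / (1 + (y $ j)^2))"
    by (simp add: frac_le add_pos_nonneg)
  qed
  also have "... = (\<Prod>b\<in>Basis. 2 * (1 / (1 + (y \<bullet> b)^2)))"
   by (rule prod_Basis_vec[where f = "%t. 2 * (1 / (1 + t^2))", symmetric])
  finally show ?thesis by (simp add: sdens_def)
 qed
 hence "(LBNN y. ennreal (sdens (y :: 'w rv))) <=
   (LBNN y. ennreal (\<Prod>b\<in>Basis. 2 * (1 / (1 + ((y :: 'w rv) \<bullet> b)^2))))"
  by (intro nn_integral_mono ennreal_leI)
 also have "... = (LBNN y. (\<Prod>b\<in>Basis. ennreal (2 * (1 / (1 + ((y :: 'w rv) \<bullet> b)^2)))))"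
  by (intro nn_integral_cong) (simp add: prod_ennreal add_nonneg_nonneg)
 also have "... = (\<Prod>b\<in>(Basis :: 'w rv set). (LBNN t. ennreal (2 * (1 / (1 + t^2)))))"
  by (rule nn_integral_lborel_prod) auto
 also have "(LBNN t. ennreal (2 * (1 / (1 + t^2)))) = 2 * (LBNN t. ennreal (1 / (1 + t^2)))"
 proof (subst nn_integral_cmult[symmetric])
  show "(LBNN t. ennreal (2 * (1 / (1 + t^2)))) = (LBNN t. 2 * ennreal (1 / (1 + t^2)))"
  proof (rule nn_integral_cong)
   fix t :: real
   show "ennreal (2 * (1 / (1 + t^2))) = 2 * ennreal (1 / (1 + t^2))"
    using ennreal_mult'[of 2 "1 / (1 + t^2)"] by simp
  qed
 qed auto
 also have "(\<Prod>b\<in>(Basis :: 'w rv set). 2 * (LBNN t. ennreal (1 / (1 + t^2)))) < \<infinity>"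
 proof -
  obtain r where r: "(LBNN t. ennreal (1 / (1 + t^2))) = ennreal r" "r >= 0"
   using nn_integral_inverse_one_plus_square
   by (cases "(LBNN t. ennreal (1 / (1 + t^2)))") auto
  have "2 * ennreal r = ennreal (2 * r)" using ennreal_mult'[of 2 r] by simp
  thus ?thesis unfolding r(1) by (simp only: prod_ennreal r(2) zero_le_mult_iff) (simp add: ennreal_power r(2))
 qed
 finally show ?thesis .
qed

lemma borel_measurable_sdens [measurable]: "sdens \<in> bmeas"
 by (rule borel_measurable_continuous_onI[OF continuous_on_sdens])

lemma borel_measurable_hdens [measurable]: "hdens io b \<in> bmeas"
 by (rule borel_measurable_continuous_onI[OF continuous_on_hdens])

lemma borel_measurable_pdens [measurable]: "pdens io b k \<in> bmeas"
 by (rule borel_measurable_continuous_onI[OF continuous_on_pdens])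

lemma borel_measurable_vfst [measurable]: "vfst \<in> bmeas"
 and borel_measurable_vsnd [measurable]: "vsnd \<in> bmeas"
 by (auto intro: measurable_bounded_linear bounded_linear_vfst bounded_linear_vsnd)

lemma integrable_pdens:
 fixes F :: "real ^ ('v::finite + 'w::finite) => real"
 assumes F: "F \<in> bmeas" and B: "!!q. \<bar>F q\<bar> <= B"
  and supp: "!!q. norm (vfst q) > R ==> F q = 0" and k: "k > 0"
 shows "integrable lborel (%q. pdens io b k q * F q)"
proof -
 have "bounded (hdens io b ` cball 0 R)"
  by (intro compact_imp_bounded compact_continuous_image continuous_on_subset[OF continuous_on_hdens]) auto
 then obtain C where C0: "!!y. y \<in> hdens io b ` cball 0 R ==> norm y <= C" unfolding bounded_iff by blast
 have C: "hdens io b p <= C" if "norm p <= R" for p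
  using C0[of "hdens io b p"] that by force
 define C' where "C' = k ^ CARD('v) * \<bar>C\<bar> * \<bar>B\<bar>"
 have bound: "\<bar>pdens io b k q * F q\<bar> <= C' * (ind (cball 0 R) (vfst q) * sdens (vsnd q))" for q
 proof (cases "norm (vfst q) <= R")
  case True
  have "\<bar>pdens io b k q * F q\<bar> = k ^ CARD('v) * hdens io b (vfst q) * sdens (vsnd q) * \<bar>F q\<bar>"
   using k hdens_pos[of io b "vfst q"] sdens_pos[of "vsnd q"] by (simp add: pdens_eq abs_mult)
  also have "... <= k ^ CARD('v) * \<bar>C\<bar> * sdens (vsnd q) * \<bar>B\<bar>"
   using k hdens_pos[of io b "vfst q"] sdens_pos[of "vsnd q"] C[OF True] B[of q]
   by (intro mult_mono mult_nonneg_nonneg) auto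
  also have "... = C' * (ind (cball 0 R) (vfst q) * sdens (vsnd q))"
   using True by (simp add: C'_def mult_ac)
  finally show ?thesis .
 next
  case False
  thus ?thesis using supp[of q] by simp
 qed
 have [measurable]: "(%q :: real ^ ('v + 'w). indicat_real (cball 0 R) (vfst q)) \<in> bmeas"
  by (rule measurable_compose[OF borel_measurable_vfst borel_measurable_indicator]) simp
 have fin: "(LBNN q. ennreal (ind (cball 0 R) (vfst (q :: real ^ ('v + 'w))) * sdens (vsnd q))) < \<infinity>"
 proof -
  have "(LBNN q. ennreal (ind (cball 0 R) (vfst (q :: real ^ ('v + 'w))) * sdens (vsnd q))) =
    (LBNN y. (LBNN p. ennreal (ind (cball 0 R) (p :: real ^ 'v) * sdens (y :: real ^ 'w))))"
   by (subst nn_integral_vjoin) auto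
  also have "... = (LBNN y. ennreal (sdens (y :: 'w rv)) * emeasure lborel (cball 0 R :: 'v rv set))"
  proof (intro nn_integral_cong)
   fix y :: "'w rv"
   have "(LBNN p. ennreal (ind (cball 0 R) (p :: 'v rv) * sdens y)) =
     (LBNN p. ennreal (sdens y) * ind (cball 0 R) (p :: 'v rv))"
    by (intro nn_integral_cong) (auto simp: indicator_def)
   thus "(LBNN p. ennreal (ind (cball 0 R) (p :: 'v rv) * sdens y)) =
     ennreal (sdens y) * emeasure lborel (cball 0 R :: 'v rv set)"
    by (simp add: nn_integral_cmult_indicator)
  qed
  also have "... = (LBNN y. ennreal (sdens (y :: 'w rv))) * emeasure lborel (cball 0 R :: 'v rv set)"
   by (rule nn_integral_multc) simp
  also have "... < \<infinity>"
   using nn_integral_sdens_finite emeasure_lborel_cball_finite[of 0 R] by (auto simp: ennreal_mult_less_top)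
  finally show ?thesis .
 qed
 have "integrable lborel (%q :: real ^ ('v + 'w). ind (cball 0 R) (vfst q) * sdens (vsnd q))"
  using fin sdens_pos by (intro integrableI_nonneg) (auto intro!: AE_I2 mult_nonneg_nonneg less_imp_le[OF sdens_pos])
 hence "integrable lborel (%q :: real ^ ('v + 'w). C' * (ind (cball 0 R) (vfst q) * sdens (vsnd q)))"
  by simp
 thus ?thesis
  by (rule Bochner_Integration.integrable_bound) (use F bound in \<open>auto intro!: AE_I2 order_trans[OF bound abs_ge_self]\<close>)
qed

lemma partial_deriv_directional:
 assumes "f differentiable (at q)"
 shows "RD (%t. f (q + t *\<^sub>R axis m 1)) 0 :> partial_deriv m f q"
proof -
 let ?D = "FD f q"
 have D: "(f has_derivative ?D) (at q)" using assms by (simp add: frechet_derivative_works)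
 hence lin: "linear ?D" by (rule has_derivative_linear)
 have "((%t. q + t *\<^sub>R axis m 1) has_derivative (%t. t *\<^sub>R axis m 1)) (at 0)"
  by (auto intro!: derivative_eq_intros)
 hence "((%t. f (q + t *\<^sub>R axis m 1)) has_derivative (%t. ?D (t *\<^sub>R axis m 1))) (at 0)"
  by (rule has_derivative_compose) (simp add: D)
 moreover have "(%t. ?D (t *\<^sub>R axis m 1)) = (*) (partial_deriv m f q)"
  by (auto simp: fun_eq_iff partial_deriv_def linear_scale[OF lin])
 ultimately show ?thesis by (simp add: has_field_derivative_def)
qed

lemma smooth_on_differentiable: "smooth_on UNIV f ==> f differentiable (at q)"
 using smooth_on_has_derivative[of UNIV f q] by (auto simp: differentiable_def)

lemma smooth_on_slice: "smooth_on UNIV f ==> smooth_on UNIV (%p. f (vjoin p y))"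
 by (rule smooth_on_compose[where T = UNIV]) (auto intro!: smooth_intros)

lemma smooth_on_partial_deriv: "smooth_on S f ==> smooth_on S (partial_deriv m f)"
 unfolding partial_deriv_def[abs_def] by (rule smooth_on_frechet_derivative)

lemma partial_deriv_slice:
 fixes f :: "real ^ ('v::finite + 'w::finite) => real"
 assumes f: "smooth_on UNIV f"
 shows "partial_deriv i (%p. f (vjoin p y)) p = partial_deriv (Inl i) f (vjoin p y)"
proof -
 have "RD (%t. f (vjoin (p + t *\<^sub>R axis i 1) y)) 0 :> partial_deriv i (%p. f (vjoin p y)) p"
  by (rule partial_deriv_directional[OF smooth_on_differentiable[OF smooth_on_slice[OF f]]])
 moreover have "vjoin (p + t *\<^sub>R axis i 1) y = vjoin p y + t *\<^sub>R axis (Inl i) 1" for t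
  by (simp add: vec_eq_iff vjoin_def axis_def split: sum.split)
 ultimately show ?thesis
  using partial_deriv_directional[OF smooth_on_differentiable[OF f], of "vjoin p y" "Inl i"] DERIV_unique by fastforce
qed

section \<open>The spectral bound for hyperbolic space\<close>

lemma hdens_has_derivative:
 "RD (%t. hdens io b (p + t *\<^sub>R axis io 1)) 0 :> b * (real CARD('v) - 1) * hdens io b p"
 for p :: "real ^ 'v::finite"
 unfolding hdens_def by (auto intro!: derivative_eq_intros simp: axis_def)

text \<open>Expand the integral of J (f' + \<kappa> f)^2 >= 0. The density has logarithmic
  derivative 2 \<kappa> along \<open>io\<close>, so integration by parts turns the mixed term into
  -2 \<kappa>^2 times the integral of J f^2. For b = 1 this is the lower bound ((v - 1)/2)^2 for the
  spectrum of hyperbolic space.\<close>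

lemma hyperbolic_spectral_bound:
 fixes f :: "real ^ 'v::finite => real" and b :: real
 assumes f: "smooth_on UNIV f" and supp: "!!p. norm p > R ==> f p = 0"
 defines "\<kappa> \<equiv> b * (real CARD('v) - 1) / 2"
 shows "(LBNN p. ennreal (hdens io b p * (\<kappa>^2 * (f p)^2))) <=
  (LBNN p. ennreal (hdens io b p * (partial_deriv io f p)^2))"
proof -
 let ?J = "hdens io b" and ?f' = "partial_deriv io f"
 have fc: "cts UNIV f" "cts UNIV ?f'"
  using f smooth_on_partial_deriv[OF f] smooth_on_cts by blast+
 have f'0: "?f' p = 0" if "norm p > R" for p
  by (rule partial_deriv_zero[where T = "{p. norm p > R}"])
   (use that supp in \<open>auto intro!: open_Collect_less continuous_intros\<close>)
 have "(LBINT p. 2 * \<kappa> * (?J p * (f p)^2) + 2 * (?J p * (f p * ?f' p))) = 0"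
 proof (rule integral_directional_derivative_zero[where g = "%p. ?J p * (f p)^2" and e = "axis io 1"])
  fix p
  have "RD (%t. f (p + t *\<^sub>R axis io 1)) 0 :> ?f' p"
   by (rule partial_deriv_directional[OF smooth_on_differentiable[OF f]])
  thus "((%t. ?J (p + t *\<^sub>R axis io 1) * (f (p + t *\<^sub>R axis io 1))^2) has_real_derivative
    2 * \<kappa> * (?J p * (f p)^2) + 2 * (?J p * (f p * ?f' p))) (at 0)"
  proof -
   assume fd: "RD (%t. f (p + t *\<^sub>R axis io 1)) 0 :> ?f' p"
   have k2: "b * (real CARD('v) - 1) = 2 * \<kappa>" by (simp add: \<kappa>_def)
   have "RD (%t. (f (p + t *\<^sub>R axis io 1))^2) 0 :> 2 * f p * ?f' p"
    using DERIV_power[OF fd, of 2] by (simp add: mult_ac)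
   from DERIV_mult[OF hdens_has_derivative[of io b p, unfolded k2] this] show ?thesis
    by (rule DERIV_cong) (simp add: algebra_simps)
  qed
 qed (use supp in \<open>auto intro!: continuous_intros fc continuous_on_hdens\<close>)
 moreover have int: "integrable lborel (%p. ?J p * (f p)^2)" "integrable lborel (%p. ?J p * (f p * ?f' p))"
   "integrable lborel (%p. ?J p * (?f' p)^2)"
  by (rule integrable_continuous_bounded_support[where R = R],
    use supp f'0 in \<open>auto intro!: continuous_intros fc continuous_on_hdens\<close>)+
 ultimately have z: "2 * \<kappa> * (LBINT p. ?J p * (f p)^2) + 2 * (LBINT p. ?J p * (f p * ?f' p)) = 0"
  by simp
 have "0 <= (LBINT p. ?J p * (?f' p + \<kappa> * f p)^2)"
  by (intro integral_nonneg_AE AE_I2) (simp add: hdens_pos less_imp_le)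
 also have "... = (LBINT p. ?J p * (?f' p)^2 + \<kappa>^2 * (?J p * (f p)^2) + 2 * \<kappa> * (?J p * (f p * ?f' p)))"
  by (intro Bochner_Integration.integral_cong) (auto simp: power2_eq_square algebra_simps)
 also have "... = (LBINT p. ?J p * (?f' p)^2) + \<kappa>^2 * (LBINT p. ?J p * (f p)^2)
   + \<kappa> * (2 * (LBINT p. ?J p * (f p * ?f' p)))"
  using int by simp
 also have "2 * (LBINT p. ?J p * (f p * ?f' p)) = - 2 * \<kappa> * (LBINT p. ?J p * (f p)^2)"
  using z by linarith
 finally have le: "\<kappa>^2 * (LBINT p. ?J p * (f p)^2) <= (LBINT p. ?J p * (?f' p)^2)"
  by (simp add: power2_eq_square algebra_simps)
 have int': "integrable lborel (%p. ?J p * (\<kappa>^2 * (f p)^2))"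
  using integrable_mult_right[OF int(1), of "\<kappa>^2"] by (simp only: mult.left_commute)
 have "(LBNN p. ennreal (?J p * (\<kappa>^2 * (f p)^2))) = ennreal (LBINT p. ?J p * (\<kappa>^2 * (f p)^2))"
  using int' by (intro nn_integral_eq_integral) (auto simp: hdens_pos less_imp_le)
 also have "... = ennreal (\<kappa>^2 * (LBINT p. ?J p * (f p)^2))"
  by (simp only: mult.left_commute[of _ "\<kappa>^2"] integral_mult_right_zero)
 also have "... <= ennreal (LBINT p. ?J p * (?f' p)^2)" using le by (rule ennreal_leI)
 also have "... = (LBNN p. ennreal (?J p * (?f' p)^2))"
  using int(3) by (intro nn_integral_eq_integral[symmetric]) (auto simp: hdens_pos less_imp_le)
 finally show ?thesis .
qed

lemma pdens_ge0: "k > 0 ==> pdens io b k q >= 0"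
 by (rule less_imp_le[OF pdens_pos])

section \<open>The Yamabe functional in coordinates\<close>

definition ynum :: "'v => real => real => real => (real ^ ('v::finite + 'w::finite) => real) => real" where
 "ynum io b k s f = (LBINT q. pdens io b k q *
   (yamabe_a CARD('v + 'w) * pnormsq io b k f q + s * (f q)^2))"

definition ypow :: "'v => real => real => (real ^ ('v::finite + 'w::finite) => real) => real" where
 "ypow io b k f = (LBINT q. pdens io b k q * \<bar>f q\<bar> powr yamabe_p CARD('v + 'w))"

lemma CARD_sum_ge:
 assumes "CARD('w::finite) >= 2"
 shows "real CARD('v::finite + 'w) >= 3"
proof -
 have "CARD('v) >= 1" by (simp add: Suc_leI)
 hence "CARD('v + 'w) >= 3" unfolding card_sum using assms by linarith
 thus ?thesis by linarith
qed

lemma yamabe_exponents: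
 assumes "CARD('w::finite) >= 2"
 shows "yamabe_a CARD('v::finite + 'w) > 0" "yamabe_p CARD('v + 'w) > 2"
 using CARD_sum_ge[OF assms, where 'v = 'v] by (auto simp: yamabe_a_def yamabe_p_def field_simps simp del: card_sum)

lemma yamabe_quotient_eq:
 fixes u :: "(real ^ 'v::finite) \<times> (real ^ 'w::finite) \<times> real => real" and io :: 'v
 assumes u: "u \<in> test_functions c" and c: "c >= 0" and k: "k > 0" and w: "CARD('w) >= 2"
 shows "yamabe_quotient TYPE('v + 'w) (M_space c) (G_metric c) (%_. s) u =
  ynum io (c * k) k s (%q. u (pchart io c k 1 q)) /
  (ypow io (c * k) k (%q. u (pchart io c k 1 q)) powr (1 / yamabe_p CARD('v + 'w)))^2"
 unfolding ynum_def ypow_def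
 by (rule yamabe_quotient_M_space[OF u c k]) (use yamabe_exponents(2)[OF w, where 'v = 'v] in linarith)

text \<open>What the integrals require of a test function in a single chart. The gradient bound is
  stated for k = 1; other scales are equivalent by \<open>pnormsq_scale_bound\<close>, so one
  function can be used with several k.\<close>

definition coord_test :: "'v => real => (real ^ ('v::finite + 'w::finite) => real) => bool" where
 "coord_test io b f \<longleftrightarrow> smooth_on UNIV f &
   (\<exists>R. \<forall>q. norm (vfst q) > R \<longrightarrow> f q = 0) & (\<exists>B. \<forall>q. \<bar>f q\<bar> <= B & pnormsq io b 1 f q <= B)"

lemma pnormsq_split:
 fixes q :: "real ^ ('v::finite + 'w::finite)"
 shows "pnormsq io b k f q =
  (1 / k\<^sup>2) * (\<Sum>i\<in>UNIV. (partial_deriv (Inl i) f q)^2 / (if i = io then 1 else exp (2 * b * q $ Inl io)))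
  + (\<Sum>j\<in>UNIV. (partial_deriv (Inr j) f q)^2) / (2 / (1 + vsnd q \<bullet> vsnd q))\<^sup>2"
 unfolding pnormsq_def sum_UNIV_sum sum_distrib_left
 by (simp add: chart_coeff_def sum_divide_distrib)

text \<open>The squared gradient has the form H / k^2 + S with a hyperbolic part H and a spherical
  part S. The third inequality is where the dilation comparison gives away spherical energy.\<close>

lemma pnormsq_scale_bound:
 assumes "k > 0"
 shows "pnormsq io b k f q <= (1 / k\<^sup>2 + 1) * pnormsq io b 1 f q"
  and "pnormsq io b 1 f q <= (k^2 + 1) * pnormsq io b k f q"
  and "k <= 1 ==> k^2 * pnormsq io b k f q <= pnormsq io b 1 f q"
proof -
 define H where "H = (\<Sum>i\<in>UNIV. (partial_deriv (Inl i) f q)^2 / (if i = io then 1 else exp (2 * b * q $ Inl io)))"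
 define S where "S = (\<Sum>j\<in>UNIV. (partial_deriv (Inr j) f q)^2) / (2 / (1 + vsnd q \<bullet> vsnd q))\<^sup>2"
 have nn: "H >= 0" "S >= 0" by (auto simp: H_def S_def intro!: sum_nonneg divide_nonneg_nonneg)
 have split: "pnormsq io b k f q = (1 / k\<^sup>2) * H + S" for k
  unfolding pnormsq_split H_def S_def ..
 define l where "l = 1 / k\<^sup>2"
 have l: "l > 0" "k^2 * l = 1" using assms by (auto simp: l_def)
 have "l * H + S <= (l + 1) * (1 * H + S)" using nn l by (simp add: algebra_simps)
 thus "pnormsq io b k f q <= (1 / k\<^sup>2 + 1) * pnormsq io b 1 f q"
  by (simp add: split l_def)
 have kl: "k^2 * (l * x) = x" for x using l(2) by (simp add: mult.assoc[symmetric])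
 have "(k^2 + 1) * (l * H + S) = H + l * H + (k^2 * S + S)"
  by (simp add: distrib_right distrib_left kl)
 thus "pnormsq io b 1 f q <= (k^2 + 1) * pnormsq io b k f q"
  using nn l(1) by (simp add: split flip: l_def)
 assume "k <= 1"
 hence "k^2 <= 1" using assms by (simp add: power_le_one)
 hence "k^2 * S <= 1 * S" using nn by (intro mult_right_mono)
 moreover have "k^2 * (l * H + S) = H + k^2 * S"
  by (simp add: distrib_left kl)
 ultimately show "k^2 * pnormsq io b k f q <= pnormsq io b 1 f q"
  by (simp add: split flip: l_def)
qed

lemma coord_test_pchart:
 assumes u: "u \<in> test_functions c" and c: "c >= 0" and k: "k > 0"
 shows "coord_test io (c * k) (%q. u (pchart io c k 1 q))"
 unfolding coord_test_def
proof (intro conjI)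
 show "smooth_on UNIV (%q. u (pchart io c k 1 q))" by (rule test_function_smooth[OF u c k]) simp
 obtain R where "!!q ep. ep = 1 \<or> ep = -1 ==> u (pchart io c k ep q) ~= 0 ==> norm (vfst q) < R"
  using test_function_support[OF u c k] by metis
 thus "\<exists>R. \<forall>q. norm (vfst q) > R \<longrightarrow> u (pchart io c k 1 q) = 0"
  by (metis less_asym)
 obtain B where B: "B > 0" "!!q. \<bar>u (pchart io c k 1 q)\<bar> <= B"
  "!!q. pnormsq io (c * k) k (%q. u (pchart io c k 1 q)) q <= B"
  using test_function_bounded[OF u c k] by metis
 have "\<bar>u (pchart io c k 1 q)\<bar> <= (k^2 + 1) * B & pnormsq io (c * k) 1 (%q. u (pchart io c k 1 q)) q <= (k^2 + 1) * B" for q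
 proof
  have "B <= (k^2 + 1) * B" using B(1) by (simp add: algebra_simps)
  thus "\<bar>u (pchart io c k 1 q)\<bar> <= (k^2 + 1) * B" using B(2)[of q] by linarith
  have "(k^2 + 1) * pnormsq io (c * k) k (%q. u (pchart io c k 1 q)) q <= (k^2 + 1) * B"
   using B(3)[of q] by (intro mult_left_mono) auto
  thus "pnormsq io (c * k) 1 (%q. u (pchart io c k 1 q)) q <= (k^2 + 1) * B"
   using pnormsq_scale_bound(2)[OF k, of io "c * k" "%q. u (pchart io c k 1 q)" q] by linarith
 qed
 thus "\<exists>B. \<forall>q. \<bar>u (pchart io c k 1 q)\<bar> <= B & pnormsq io (c * k) 1 (%q. u (pchart io c k 1 q)) q <= B"
  by blast
qed

lemma coord_test_integrable:
 fixes f :: "real ^ ('v::finite + 'w::finite) => real"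
 assumes f: "coord_test io b f" and k: "k > 0"
 shows "integrable lborel (%q. pdens io b k q * (f q)^2)"
  and "integrable lborel (%q. pdens io b k q * pnormsq io b k f q)"
  and "p > 0 ==> integrable lborel (%q. pdens io b k q * \<bar>f q\<bar> powr p)"
proof -
 obtain R B where sm: "smooth_on UNIV f" and R: "!!q. norm (vfst q) > R ==> f q = 0"
  and B: "!!q. \<bar>f q\<bar> <= B" "!!q. pnormsq io b 1 f q <= B"
  using f by (auto simp: coord_test_def)
 have fc: "cts UNIV f" by (rule smooth_on_cts[OF sm])
 have fm: "f \<in> bmeas" by (rule borel_measurable_continuous_onI[OF fc])
 have "(f q)^2 <= B^2" for q using B(1)[of q] by (metis abs_ge_zero power2_abs power_mono)
 thus "integrable lborel (%q. pdens io b k q * (f q)^2)"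
  using fm R by (intro integrable_pdens[OF _ _ _ k, of _ "B^2" R]) auto
 have "open {q :: real ^ ('v + 'w). norm (vfst q) > R}"
  by (intro open_Collect_less continuous_intros)
 hence "partial_deriv m f q = 0" if "norm (vfst q) > R" for m q
  by (rule partial_deriv_zero) (use that R in auto)
 hence pz: "pnormsq io b k f q = 0" if "norm (vfst q) > R" for q
  using that by (simp add: pnormsq_def)
 have "\<bar>pnormsq io b k f q\<bar> <= (1 / k\<^sup>2 + 1) * B" for q
 proof -
  have "(1 / k\<^sup>2 + 1) * pnormsq io b 1 f q <= (1 / k\<^sup>2 + 1) * B"
   using B(2)[of q] by (intro mult_left_mono) auto
  thus ?thesis
   using pnormsq_scale_bound(1)[OF k, of io b f q] pnormsq_nonneg[OF k, of io b f q] by linarith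
 qed
 thus "integrable lborel (%q. pdens io b k q * pnormsq io b k f q)"
  using pz borel_measurable_continuous_onI[OF continuous_on_pnormsq[OF sm k]]
  by (intro integrable_pdens[OF _ _ _ k, of _ "(1 / k\<^sup>2 + 1) * B" R]) auto
 assume p: "p > 0"
 have "\<bar>f q\<bar> powr p <= B powr p" for q using B(1)[of q] p by (intro powr_mono2) auto
 thus "integrable lborel (%q. pdens io b k q * \<bar>f q\<bar> powr p)"
  using fm R p by (intro integrable_pdens[OF _ _ _ k, of _ "B powr p" R]) auto
qed

lemma ynum_eq:
 fixes f :: "real ^ ('v::finite + 'w::finite) => real"
 assumes "coord_test io b f" "k > 0"
 shows "ynum io b k s f = yamabe_a CARD('v + 'w) * (LBINT q. pdens io b k q * pnormsq io b k f q)
  + s * (LBINT q. pdens io b k q * (f q)^2)"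
proof -
 note int = coord_test_integrable(1,2)[OF assms]
 have "ynum io b k s f = (LBINT q. yamabe_a CARD('v + 'w) * (pdens io b k q * pnormsq io b k f q)
   + s * (pdens io b k q * (f q)^2))"
  unfolding ynum_def by (simp only: distrib_left mult.left_commute)
 also have "... = yamabe_a CARD('v + 'w) * (LBINT q. pdens io b k q * pnormsq io b k f q)
  + s * (LBINT q. pdens io b k q * (f q)^2)"
  by (subst Bochner_Integration.integral_add) (use int in \<open>simp_all only: integrable_mult_right integral_mult_right_zero\<close>)
 finally show ?thesis .
qed

text \<open>The coefficient that remains on the curvature -1 product once the gradient is replaced
  by its spectral bound. It equals (w - 1)^2 (n - 1)/(n - 2) with n = v + w.\<close>

lemma scal_spectral_nonneg:
 fixes v w :: real
 assumes "v >= 1" "w >= 2"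
 shows "4 * (v + w - 1) / (v + w - 2) * ((v - 1) / 2)^2 + (w * (w - 1) - v * (v - 1)) >= 0"
proof -
 define V where "V = v - 1"
 have V: "V >= 0" "v = V + 1" using assms by (auto simp: V_def)
 have d: "V + w - 1 > 0" using V assms by simp
 have "4 * (v + w - 1) / (v + w - 2) * ((v - 1) / 2)^2 + (w * (w - 1) - v * (v - 1)) =
   (w - 1) * (w * (V + w - 1) - V) / (V + w - 1)"
  using d unfolding V(2) by (simp add: field_simps power2_eq_square)
 moreover have "w * (V + w - 1) - V = (w - 1) * V + w * (w - 1)" by (simp add: algebra_simps)
 hence "w * (V + w - 1) - V >= 0" using V assms by simp
 ultimately show ?thesis using d assms by simp
qed

text \<open>The scalar curvature may be negative here. The spectral bound on each horospherical
  slice, with only the derivative along \<open>io\<close> retained, pays for it.\<close>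

lemma ynum_hyperbolic_nonneg:
 fixes f :: "real ^ ('v::finite + 'w::finite) => real"
 assumes f: "coord_test io 1 f" and w: "CARD('w) >= 2"
 shows "ynum io 1 1 (M_scal CARD('v) CARD('w) 1) f >= 0"
proof -
 obtain R B where sm: "smooth_on UNIV f" and R: "!!q. norm (vfst q) > R ==> f q = 0"
  using f by (auto simp: coord_test_def)
 let ?\<kappa> = "1 * (real CARD('v) - 1) / 2" and ?f' = "partial_deriv (Inl io) f"
 have fc: "cts UNIV f" "cts UNIV ?f'"
  using sm smooth_on_partial_deriv[OF sm] smooth_on_cts by blast+
 note [measurable] = borel_measurable_continuous_onI[OF fc(1)] borel_measurable_continuous_onI[OF fc(2)]
 note int = coord_test_integrable[OF f zero_less_one]
 have le: "?f' q ^ 2 <= pnormsq io 1 1 f q" for q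
 proof -
  have "(partial_deriv (Inl io) f q)^2 / chart_coeff io 1 1 q (Inl io) <= pnormsq io 1 1 f q"
   unfolding pnormsq_def using chart_coeff_pos[OF zero_less_one, of io 1 q]
   by (intro member_le_sum) (auto simp: less_imp_le)
  thus ?thesis by (simp add: chart_coeff_def)
 qed
 have int': "integrable lborel (%q. pdens io 1 1 q * (?\<kappa>^2 * (f q)^2))"
  using integrable_mult_right[OF int(1), of "?\<kappa>^2"] by (simp only: mult.left_commute)
 have "ennreal (LBINT q. pdens io 1 1 q * (?\<kappa>^2 * (f q)^2)) = (LBNN q. ennreal (pdens io 1 1 q * (?\<kappa>^2 * (f q)^2)))"
  using int' pdens_ge0[OF zero_less_one, of io 1]
  by (intro nn_integral_eq_integral[symmetric]) (auto intro!: AE_I2 mult_nonneg_nonneg)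
 also have "... = (LBNN y. (LBNN p. ennreal (sdens y) * ennreal (hdens io 1 p * (?\<kappa>^2 * (f (vjoin p y))^2))))"
  by (subst nn_integral_vjoin) (auto intro!: nn_integral_cong
    simp: pdens_eq ennreal_mult'[symmetric] sdens_pos less_imp_le mult_ac)
 also have "... <= (LBNN y. (LBNN p. ennreal (sdens y) * ennreal (hdens io 1 p * (?f' (vjoin p y))^2)))"
 proof (rule nn_integral_mono)
  fix y :: "real ^ 'w"
  have sl: "smooth_on UNIV (%p. f (vjoin p y))" by (rule smooth_on_slice[OF sm])
  have c1: "(%p. f (vjoin p y)) \<in> bmeas" "(%p. ?f' (vjoin p y)) \<in> bmeas"
   by (auto intro!: borel_measurable_continuous_onI continuous_on_compose2[OF fc(1)] continuous_on_compose2[OF fc(2)] continuous_intros)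
  have "(LBNN p. ennreal (hdens io 1 p * (?\<kappa>^2 * (f (vjoin p y))^2))) <=
    (LBNN p. ennreal (hdens io 1 p * (partial_deriv io (%p. f (vjoin p y)) p)^2))"
   by (rule hyperbolic_spectral_bound[OF sl, of R]) (use R in auto)
  hence "ennreal (sdens y) * (LBNN p. ennreal (hdens io 1 p * (?\<kappa>^2 * (f (vjoin p y))^2))) <=
    ennreal (sdens y) * (LBNN p. ennreal (hdens io 1 p * (?f' (vjoin p y))^2))"
   unfolding partial_deriv_slice[OF sm] by (rule mult_left_mono) simp
  thus "(LBNN p. ennreal (sdens y) * ennreal (hdens io 1 p * (?\<kappa>^2 * (f (vjoin p y))^2))) <=
    (LBNN p. ennreal (sdens y) * ennreal (hdens io 1 p * (?f' (vjoin p y))^2))"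
   using c1 by (subst (1 2) nn_integral_cmult) auto
 qed
 also have "... = (LBNN q. ennreal (pdens io 1 1 q * (?f' q)^2))"
  by (subst nn_integral_vjoin) (auto intro!: nn_integral_cong
    simp: pdens_eq ennreal_mult'[symmetric] sdens_pos less_imp_le mult_ac)
 also have "... <= (LBNN q. ennreal (pdens io 1 1 q * pnormsq io 1 1 f q))"
  using le pdens_ge0[OF zero_less_one]
  by (intro nn_integral_mono ennreal_leI mult_left_mono) (auto simp: less_imp_le)
 also have "... = ennreal (LBINT q. pdens io 1 1 q * pnormsq io 1 1 f q)"
  using int(2) pdens_ge0[OF zero_less_one, of io 1] pnormsq_nonneg[OF zero_less_one, of io 1 f]
  by (intro nn_integral_eq_integral) (auto intro!: AE_I2 mult_nonneg_nonneg)
 finally have "(LBINT q. pdens io 1 1 q * (?\<kappa>^2 * (f q)^2)) <= (LBINT q. pdens io 1 1 q * pnormsq io 1 1 f q)"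
  using pdens_ge0[OF zero_less_one, of io 1] pnormsq_nonneg[OF zero_less_one, of io 1 f]
  by (subst (asm) ennreal_le_iff) (auto intro!: integral_nonneg_AE AE_I2 mult_nonneg_nonneg)
 hence key: "?\<kappa>^2 * (LBINT q. pdens io 1 1 q * (f q)^2) <= (LBINT q. pdens io 1 1 q * pnormsq io 1 1 f q)"
  by (simp only: mult.left_commute[of _ "?\<kappa>^2"] integral_mult_right_zero)
 let ?I = "(LBINT q. pdens io 1 1 q * (f q)^2)"
 have I: "?I >= 0"
  using pdens_ge0[OF zero_less_one, of io 1] by (intro integral_nonneg_AE AE_I2 mult_nonneg_nonneg) auto
 have v: "real CARD('v) >= 1" by (simp add: Suc_leI)
 have "yamabe_a CARD('v + 'w) * ?\<kappa>^2 + M_scal CARD('v) CARD('w) 1 >= 0"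
  using scal_spectral_nonneg[OF v, of "real CARD('w)"] w by (simp add: yamabe_a_def M_scal_def)
 hence "0 <= (yamabe_a CARD('v + 'w) * ?\<kappa>^2 + M_scal CARD('v) CARD('w) 1) * ?I"
  using I by (rule mult_nonneg_nonneg)
 also have "... = yamabe_a CARD('v + 'w) * (?\<kappa>^2 * ?I) + M_scal CARD('v) CARD('w) 1 * ?I"
  by (simp only: distrib_right mult.assoc)
 also have "... <= ynum io 1 1 (M_scal CARD('v) CARD('w) 1) f"
  unfolding ynum_eq[OF f zero_less_one]
  using yamabe_exponents(1)[OF w, where 'v = 'v] by (intro add_mono mult_left_mono[OF key] order_refl) auto
 finally show ?thesis .
qed

lemma ynum_nonneg:
 fixes f :: "real ^ ('v::finite + 'w::finite) => real"
 assumes f: "coord_test io b f" and k: "k > 0" and w: "CARD('w) >= 2" and s: "s >= 0"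
 shows "ynum io b k s f >= 0"
 unfolding ynum_def
 using yamabe_exponents(1)[OF w, where 'v = 'v] pdens_ge0[OF k, of io b] pnormsq_nonneg[OF k, of io b f] s
 by (intro integral_nonneg_AE AE_I2 mult_nonneg_nonneg add_nonneg_nonneg) (auto simp: less_imp_le)

lemma yamabe_quotient_nonneg:
 fixes u :: "(real ^ 'v::finite) \<times> (real ^ 'w::finite) \<times> real => real"
 assumes u: "u \<in> test_functions c" and c: "c = 0 \<or> c = 1" and w: "CARD('w) >= 2"
 shows "yamabe_quotient TYPE('v + 'w) (M_space c) (G_metric c) (%_. M_scal CARD('v) CARD('w) c) u >= 0"
proof -
 obtain io :: 'v where True by blast
 have c0: "c >= 0" using c by auto
 have ct: "coord_test io (c * 1) (%q. u (pchart io c 1 1 q))" by (rule coord_test_pchart[OF u c0]) simp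
 have "ynum io (c * 1) 1 (M_scal CARD('v) CARD('w) c) (%q. u (pchart io c 1 1 q)) >= 0"
 proof (cases "c = 0")
  case True
  thus ?thesis using ynum_nonneg[OF ct zero_less_one w] w by (simp add: M_scal_def)
 next
  case False
  hence "c = 1" using c by simp
  thus ?thesis using ynum_hyperbolic_nonneg[OF _ w] ct by simp
 qed
 thus ?thesis
  unfolding yamabe_quotient_eq[OF u c0 zero_less_one w, of _ io] by simp
qed

text \<open>For c = 0 and c = 1 the constant is used from above, as a lower bound for individual
  quotients, and this requires the set of quotients to be bounded below. At other c the constant is
  only bounded from below, by \<open>yamabe_mu_ge\<close>.\<close>

lemma bdd_below_yamabe_quotients:
 assumes "c = 0 \<or> c = 1" "CARD('w::finite) >= 2"
 shows "bdd_below {yamabe_quotient TYPE('v::finite + 'w) (M_space c :: ((real ^ 'v) \<times> (real ^ 'w) \<times> real) set) (G_metric c) (%_. M_scal CARD('v) CARD('w) c) u | u.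
   u \<in> test_functions c & (\<exists>p\<in>M_space c. u p ~= 0)}"
 using yamabe_quotient_nonneg[OF _ assms, where 'v = 'v] by (intro bdd_belowI[of _ 0]) auto

lemma yamabe_mu_nonneg:
 assumes "c = 0 \<or> c = 1" "CARD('w::finite) >= 2"
 shows "yamabe_mu TYPE('v::finite) TYPE('w) c >= 0"
proof -
 have "\<exists>u \<in> (test_functions c :: ((real ^ 'v) \<times> (real ^ 'w) \<times> real => real) set). \<exists>p\<in>M_space c. u p ~= 0"
  by (rule exists_test_function) (use assms in auto)
 thus ?thesis
  unfolding yamabe_mu_def yamabe_constant_def
  by (intro cInf_greatest) (use yamabe_quotient_nonneg[OF _ assms, where 'v = 'v] in auto)
qed

text \<open>Multiplied out, so that it holds for every test function, including zero, and no
  quotient has to be guarded in the comparisons.\<close>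

lemma yamabe_mu_lower:
 fixes u :: "(real ^ 'v::finite) \<times> (real ^ 'w::finite) \<times> real => real" and io :: 'v
 assumes u: "u \<in> test_functions c" and c: "c = 0 \<or> c = 1" and k: "k > 0" and w: "CARD('w) >= 2"
 shows "yamabe_mu TYPE('v) TYPE('w) c * (ypow io (c * k) k (%q. u (pchart io c k 1 q)) powr (1 / yamabe_p CARD('v + 'w)))^2
  <= ynum io (c * k) k (M_scal CARD('v) CARD('w) c) (%q. u (pchart io c k 1 q))"
proof -
 have c0: "c >= 0" using c by auto
 let ?f = "%q. u (pchart io c k 1 q)"
 let ?N = "ynum io (c * k) k (M_scal CARD('v) CARD('w) c) ?f"
 let ?P = "(ypow io (c * k) k ?f powr (1 / yamabe_p CARD('v + 'w)))^2"
 let ?Q = "yamabe_quotient TYPE('v + 'w) (M_space c) (G_metric c) (%_. M_scal CARD('v) CARD('w) c) u"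
 have Q: "?Q = ?N / ?P" by (rule yamabe_quotient_eq[OF u c0 k w])
 have N: "?N >= 0"
 proof (cases "c = 0")
  case True
  thus ?thesis using ynum_nonneg[OF coord_test_pchart[OF u c0 k] k w] w by (simp add: M_scal_def)
 next
  case False
  hence c1: "c = 1" using c by simp
  show ?thesis
  proof (cases "?P = 0")
   \<comment> \<open>A vanishing power integral forces f = 0 almost everywhere, which removes the
     scalar term of unknown sign and leaves the gradient.\<close>
   case P0: True
   have "ypow io (c * k) k ?f = 0" using P0 by simp
   have p2: "yamabe_p CARD('v + 'w) > 0" using yamabe_exponents(2)[OF w, where 'v = 'v] by linarith
   have ct: "coord_test io (c * k) ?f" by (rule coord_test_pchart[OF u c0 k])
   have "AE q in lborel. pdens io (c * k) k q * \<bar>?f q\<bar> powr yamabe_p CARD('v + 'w) = 0"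
    using coord_test_integrable(3)[OF ct k p2] \<open>ypow io (c * k) k ?f = 0\<close> pdens_ge0[OF k, of io "c * k"]
    unfolding ypow_def by (subst (asm) integral_nonneg_eq_0_iff_AE) (auto intro!: AE_I2 mult_nonneg_nonneg)
   hence "AE q in lborel. pdens io (c * k) k q * (?f q)^2 = 0"
    by eventually_elim auto
   hence "(LBINT q. pdens io (c * k) k q * (?f q)^2) = 0"
    by (rule integral_eq_zero_AE)
   moreover have "(LBINT q. pdens io (c * k) k q * pnormsq io (c * k) k ?f q) >= 0"
    using pdens_ge0[OF k, of io "c * k"] pnormsq_nonneg[OF k, of io "c * k" ?f]
    by (intro integral_nonneg_AE AE_I2 mult_nonneg_nonneg) auto
   ultimately show ?thesis
    unfolding ynum_eq[OF ct k] using yamabe_exponents(1)[OF w, where 'v = 'v] by simp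
  next
   case False
   thus ?thesis
    using Q yamabe_quotient_nonneg[OF u c w] by (metis zero_le_divide_iff zero_le_power2 order_antisym)
  qed
 qed
 show ?thesis
 proof (cases "\<exists>p\<in>M_space c. u p ~= 0")
  case True
  have "yamabe_mu TYPE('v) TYPE('w) c <= ?Q"
   unfolding yamabe_mu_def yamabe_constant_def
   by (rule cInf_lower[OF _ bdd_below_yamabe_quotients[OF c w]]) (use u True in auto)
  thus ?thesis unfolding Q using N
   by (cases "?P = 0") (auto simp: pos_le_divide_eq)
 next
  case False
  hence "?f q = 0" for q
   using local_paramD(6)[OF local_param_pchart[OF c0 k, of 1 io, where 'w = 'w]] by auto
  hence "ypow io (c * k) k ?f = 0" by (simp add: ypow_def)
  thus ?thesis using N by simp
 qed
qed

section \<open>Comparison with hyperbolic space of curvature -1\<close>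

lemma pdens_scale: "pdens io b k q = k ^ CARD('v) * pdens io b 1 q"
 for q :: "real ^ ('v::finite + 'w::finite)"
 by (simp add: pdens_def)

lemma ynum_mono_scal:
 fixes f :: "real ^ ('v::finite + 'w::finite) => real"
 assumes "coord_test io b f" "k > 0" "s <= s'"
 shows "ynum io b k s f <= ynum io b k s' f"
proof -
 have "(LBINT q. pdens io b k q * (f q)^2) >= 0"
  using pdens_ge0[OF assms(2), of io b] by (intro integral_nonneg_AE AE_I2 mult_nonneg_nonneg) auto
 thus ?thesis unfolding ynum_eq[OF assms(1,2)] using assms(3) by (simp add: mult_right_mono)
qed

text \<open>The dilated function lives on the curvature -1 product and has the same coordinate
  expression f, with k = c in place of k = 1. Volume contributes c^v, the hyperbolic part of the
  squared gradient c^(-2) and the spherical part nothing, so after multiplication by c^2 the energy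
  is at most that for k = 1.\<close>

lemma yamabe_hyperbolic_comparison:
 fixes u :: "(real ^ 'v::finite) \<times> (real ^ 'w::finite) \<times> real => real" and io :: 'v
 assumes u: "u \<in> test_functions c" and c: "0 < c" "c <= 1" and w: "CARD('w) >= 2"
 defines "f \<equiv> %q. u (pchart io c 1 1 q)" and "n \<equiv> real CARD('v + 'w)"
 shows "c powr (2 * real CARD('w) / n) * yamabe_mu TYPE('v) TYPE('w) 1 * (ypow io c 1 f powr (1 / yamabe_p CARD('v + 'w)))^2
  <= ynum io c 1 (c^2 * M_scal CARD('v) CARD('w) 1) f"
proof -
 let ?u = "%z. u ((1 / c) *\<^sub>R fst z, snd z)" and ?\<mu> = "yamabe_mu TYPE('v) TYPE('w) 1"
 let ?s = "M_scal CARD('v) CARD('w) 1" and ?p = "yamabe_p CARD('v + 'w)" and ?a = "yamabe_a CARD('v + 'w)"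
 let ?P = "(ypow io c 1 f powr (1 / ?p))^2"
 have f: "(%q. ?u (pchart io 1 c 1 q)) = f"
  unfolding f_def pchart_rescale[OF c(1)] ..
 have ct: "coord_test io c f"
  using coord_test_pchart[OF u, of 1 io] c by (simp add: f_def)
 have n: "n >= 3" unfolding n_def by (rule CARD_sum_ge[OF w])
 have p: "?p > 2" by (rule yamabe_exponents(2)[OF w])
 have p2n: "2 / ?p = (n - 2) / n" using n by (simp add: yamabe_p_def n_def field_simps)
 have "?\<mu> * (ypow io (1 * c) c (%q. ?u (pchart io 1 c 1 q)) powr (1 / ?p))^2
   <= ynum io (1 * c) c ?s (%q. ?u (pchart io 1 c 1 q))"
  by (rule yamabe_mu_lower[OF test_function_rescale[OF u c(1)] _ c(1) w]) simp
 hence 1: "?\<mu> * (ypow io c c f powr (1 / ?p))^2 <= ynum io c c ?s f"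
  unfolding f by simp
 have 2: "ypow io c c f = c ^ CARD('v) * ypow io c 1 f"
  unfolding ypow_def pdens_scale[of io c c] by (simp add: mult.assoc)
 have ypos: "ypow io c 1 f >= 0"
  unfolding ypow_def using pdens_ge0[OF zero_less_one, of io c] by (intro integral_nonneg_AE AE_I2 mult_nonneg_nonneg) auto
 have "(ypow io c c f powr (1 / ?p))^2 = ((c ^ CARD('v)) powr (1 / ?p))^2 * ?P"
  unfolding 2 using ypos c(1) by (simp add: powr_mult power_mult_distrib)
 also have "((c ^ CARD('v)) powr (1 / ?p))^2 = c powr (real CARD('v) * (2 / ?p))"
  using c(1) by (simp add: powr_powr powr_realpow[symmetric] power2_eq_square powr_add[symmetric] mult.commute)
 finally have 3: "(ypow io c c f powr (1 / ?p))^2 = c powr (real CARD('v) * (2 / ?p)) * ?P" .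
 let ?G = "(LBINT q. pdens io c 1 q * pnormsq io c 1 f q)" and ?G' = "(LBINT q. pdens io c c q * pnormsq io c c f q)"
 let ?F = "(LBINT q. pdens io c 1 q * (f q)^2)" and ?F' = "(LBINT q. pdens io c c q * (f q)^2)"
 have 4: "?F' = c ^ CARD('v) * ?F"
  unfolding pdens_scale[of io c c] by (simp add: mult.assoc)
 have 5: "c^2 * ?G' <= c ^ CARD('v) * ?G"
 proof -
  have "c^2 * ?G' = (LBINT q. c^2 * (pdens io c c q * pnormsq io c c f q))" by simp
  also have "... <= (LBINT q. c ^ CARD('v) * (pdens io c 1 q * pnormsq io c 1 f q))"
  proof (rule integral_mono)
   show "integrable lborel (%q. c^2 * (pdens io c c q * pnormsq io c c f q))"
    by (rule integrable_mult_right[OF coord_test_integrable(2)[OF ct c(1)]])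
   show "integrable lborel (%q. c ^ CARD('v) * (pdens io c 1 q * pnormsq io c 1 f q))"
    by (rule integrable_mult_right[OF coord_test_integrable(2)[OF ct zero_less_one]])
   fix q
   have "c^2 * (pdens io c c q * pnormsq io c c f q) = (c ^ CARD('v) * pdens io c 1 q) * (c^2 * pnormsq io c c f q)"
    unfolding pdens_scale[of io c c] by (simp only: mult_ac)
   also have "... <= (c ^ CARD('v) * pdens io c 1 q) * pnormsq io c 1 f q"
    using pnormsq_scale_bound(3)[OF c, of io c f q] pdens_ge0[OF zero_less_one, of io c q] c(1)
    by (intro mult_left_mono) auto
   finally show "c^2 * (pdens io c c q * pnormsq io c c f q) <= c ^ CARD('v) * (pdens io c 1 q * pnormsq io c 1 f q)"
    by (simp only: mult.assoc)
  qed
  finally show ?thesis by simp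
 qed
 have "c^2 * ynum io c c ?s f = ?a * (c^2 * ?G') + c^2 * ?s * ?F'"
  unfolding ynum_eq[OF ct c(1)] by (simp add: algebra_simps)
 also have "... <= ?a * (c ^ CARD('v) * ?G) + c^2 * ?s * (c ^ CARD('v) * ?F)"
  unfolding 4 using yamabe_exponents(1)[OF w, where 'v = 'v] by (intro add_mono mult_left_mono[OF 5] order_refl) auto
 also have "... = c ^ CARD('v) * ynum io c 1 (c^2 * ?s) f"
  unfolding ynum_eq[OF ct zero_less_one] by (simp add: algebra_simps)
 finally have 6: "c^2 * ynum io c c ?s f <= c ^ CARD('v) * ynum io c 1 (c^2 * ?s) f" .
 have "c^2 * (?\<mu> * (c powr (real CARD('v) * (2 / ?p)) * ?P)) <= c^2 * ynum io c c ?s f"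
  using 1 unfolding 3 by (intro mult_left_mono) auto
 also note 6
 finally have 7: "(c^2 * c powr (real CARD('v) * (2 / ?p))) * (?\<mu> * ?P) <= c ^ CARD('v) * ynum io c 1 (c^2 * ?s) f"
  by (simp only: mult_ac)
 have "c^2 * c powr (real CARD('v) * (2 / ?p)) = c powr (2 + real CARD('v) * (2 / ?p))"
  using c(1) by (simp add: powr_add)
 \<comment> \<open>Since 2/p = (n - 2)/n, the exponent is 2 + v - 2v/n, and n - v = w.\<close>
 also have "2 + real CARD('v) * (2 / ?p) = real CARD('v) + 2 * real CARD('w) / n"
 proof -
  have nvw: "n = real CARD('v) + real CARD('w)" by (simp add: n_def)
  show ?thesis unfolding p2n using n by (simp add: nvw field_simps)
 qed
 also have "c powr (real CARD('v) + 2 * real CARD('w) / n) = c ^ CARD('v) * c powr (2 * real CARD('w) / n)"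
  using c(1) by (simp add: powr_add powr_realpow)
 finally have "c ^ CARD('v) * (c powr (2 * real CARD('w) / n) * (?\<mu> * ?P)) <= c ^ CARD('v) * ynum io c 1 (c^2 * ?s) f"
  using 7 by (simp only: mult.assoc)
 thus ?thesis using c(1) by (simp add: mult.assoc)
qed

text \<open>If the integral vanished, u would be zero on the range of the first chart by continuity.
  The fibre over the missed pole is treated in the second chart, where the set u = 0 could fail only
  on an open subset of a null set.\<close>

lemma ypow_pos:
 fixes u :: "(real ^ 'v::finite) \<times> (real ^ 'w::finite) \<times> real => real" and io :: 'v
 assumes u: "u \<in> test_functions c" and c: "c >= 0" and w: "CARD('w) >= 2" and ne: "\<exists>p\<in>M_space c. u p ~= 0"
 shows "ypow io c 1 (%q. u (pchart io c 1 1 q)) > 0"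
proof (rule ccontr)
 let ?f = "%q. u (pchart io c 1 1 q)" and ?p = "yamabe_p CARD('v + 'w)"
 assume "\<not> ypow io c 1 ?f > 0"
 have p: "?p > 0" using yamabe_exponents(2)[OF w, where 'v = 'v] by linarith
 have nn: "pdens io c 1 q * \<bar>?f q\<bar> powr ?p >= 0" for q
  using pdens_ge0[OF zero_less_one] by (intro mult_nonneg_nonneg) auto
 have ct: "coord_test io (c * 1) ?f" by (rule coord_test_pchart[OF u c]) simp
 have "ypow io c 1 ?f >= 0" unfolding ypow_def using nn by (intro integral_nonneg_AE AE_I2)
 hence "ypow io c 1 ?f = 0" using \<open>\<not> ypow io c 1 ?f > 0\<close> by simp
 hence "AE q in lborel. pdens io c 1 q * \<bar>?f q\<bar> powr ?p = 0"
  using coord_test_integrable(3)[OF ct zero_less_one p] nn unfolding ypow_def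
  by (subst (asm) integral_nonneg_eq_0_iff_AE) auto
 hence ae: "AE q in lborel. ?f q = 0"
 proof eventually_elim
  case (elim q)
  thus ?case using pdens_pos[OF zero_less_one, of io c q] by auto
 qed
 have fc: "cts UNIV ?f"
  by (rule smooth_on_cts[OF test_function_smooth[OF u c]]) auto
 have f0: "?f q = 0" for q
 proof (rule ccontr)
  assume "?f q ~= 0"
  have "open (?f -` (- {0}))" by (rule open_vimage[OF _ fc]) auto
  hence "?f -` (- {0}) \<notin> null_sets lborel"
   using \<open>?f q ~= 0\<close> open_not_negligible[of "?f -` (- {0})"]
   by (auto simp: negligible_iff_null_sets null_sets_completion_iff)
  moreover have "?f -` (- {0}) \<in> null_sets lborel"
   using ae \<open>open (?f -` (- {0}))\<close> by (subst (asm) AE_iff_null) (auto simp: vimage_def Compl_eq)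
  ultimately show False by blast
 qed
 have g0: "u (pchart io c 1 (-1) q) = 0" for q
 proof -
  let ?g = "%q. u (pchart io c 1 (-1) q)"
  have gc: "cts UNIV ?g"
   by (rule smooth_on_cts[OF test_function_smooth[OF u c]]) auto
  have sub: "?g -` (- {0}) \<subseteq> {q. vsnd q = 0}"
  proof
   fix q assume q: "q \<in> ?g -` (- {0})"
   have "pchart io c 1 (-1) q \<notin> range (pchart io c 1 1 :: real ^ ('v + 'w) => _)"
    using q f0 by auto
   moreover have "pchart io c 1 (-1) q \<in> M_space c"
    using range_pchart_cover[OF c zero_less_one, of io] by auto
   ultimately have "pchart io c 1 (-1) q \<in> M_space c - hyp_space c \<times> (unit_sphere - {(0, 1)})"
    using range_pchart[OF c zero_less_one, of 1 io] by auto
   hence s1: "stereo (-1) (vsnd q) = (0, 1)"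
    unfolding M_space_def pchart_def by auto
   have s0: "stereo (-1) (0 :: real ^ 'w) = (0, 1)" by (simp add: stereo_eq)
   have "stereo_inv (-1) (stereo (-1) (vsnd q)) = stereo_inv (-1) (stereo (-1) (0 :: 'w rv))"
    by (simp only: s0 s1)
   hence "vsnd q = 0" by (simp add: stereo_inv_stereo)
   thus "q \<in> {q. vsnd q = 0}" by simp
  qed
  have "open (?g -` (- {0}))" by (rule open_vimage[OF _ gc]) auto
  moreover have "?g -` (- {0}) \<in> null_sets lborel"
   using null_sets_subset[OF null_sets_vsnd_eq_0 _ sub] \<open>open (?g -` (- {0}))\<close> by auto
  ultimately have "?g -` (- {0}) = {}"
   using open_not_negligible[of "?g -` (- {0})"] by (auto simp: negligible_iff_null_sets null_sets_completion_iff)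
  thus ?thesis by blast
 qed
 obtain z where z: "z \<in> M_space c" "u z ~= 0" using ne by blast
 hence "z \<in> range (pchart io c 1 1) \<union> range (pchart io c 1 (-1))"
  using range_pchart_cover[OF c zero_less_one, of io, where 'b = 'w] by auto
 thus False using z(2) f0 g0 by auto
qed

lemma yamabe_mu_ge:
 assumes w: "CARD('w::finite) >= 2" and c: "0 <= c" "c <= 1"
  and le: "!!u. u \<in> (test_functions c :: ((real ^ 'v::finite) \<times> (real ^ 'w) \<times> real => real) set) ==>
   B * (ypow io c 1 (%q. u (pchart io c 1 1 q)) powr (1 / yamabe_p CARD('v + 'w)))^2
    <= ynum io c 1 (M_scal CARD('v) CARD('w) c) (%q. u (pchart io c 1 1 q))"
 shows "yamabe_mu TYPE('v) TYPE('w) c >= B"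
 unfolding yamabe_mu_def yamabe_constant_def
proof (rule cInf_greatest)
 show "{yamabe_quotient TYPE('v + 'w) (M_space c :: ((real ^ 'v) \<times> 'w rv \<times> real) set) (G_metric c) (%_. M_scal CARD('v) CARD('w) c) u | u.
   u \<in> test_functions c & (\<exists>p\<in>M_space c. u p ~= 0)} ~= {}"
  using exists_test_function[OF c, where 'v = 'v and 'w = 'w] by auto
 fix x assume "x \<in> {yamabe_quotient TYPE('v + 'w) (M_space c :: ('v rv \<times> 'w rv \<times> real) set) (G_metric c) (%_. M_scal CARD('v) CARD('w) c) u | u.
   u \<in> test_functions c & (\<exists>p\<in>M_space c. u p ~= 0)}"
 then obtain u where u: "u \<in> test_functions c" "\<exists>p\<in>(M_space c :: ('v rv \<times> 'w rv \<times> real) set). u p ~= 0"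
  and x: "x = yamabe_quotient TYPE('v + 'w) (M_space c) (G_metric c) (%_. M_scal CARD('v) CARD('w) c) u" by auto
 let ?f = "%q. u (pchart io c 1 1 q)"
 have "ypow io c 1 ?f > 0" by (rule ypow_pos[OF u(1) c(1) w u(2)])
 hence "(ypow io c 1 ?f powr (1 / yamabe_p CARD('v + 'w)))^2 > 0" by simp
 moreover have "x = ynum io (c * 1) 1 (M_scal CARD('v) CARD('w) c) ?f /
   (ypow io (c * 1) 1 ?f powr (1 / yamabe_p CARD('v + 'w)))^2"
  unfolding x by (rule yamabe_quotient_eq[OF u(1) c(1) zero_less_one w])
 ultimately show "B <= x" using le[OF u(1)] by (simp add: pos_le_divide_eq)
qed

section \<open>Profiles of the Euclidean ball\<close>

text \<open>Up to a constant, the j-volume of the slice at height y of the unit ball of dimension j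
  + 1. The next three definitions are total mass, distribution function and inverse distribution
  function of one coordinate of a uniform point of that ball.\<close>

definition ball_profile :: "nat => real => real" where
 "ball_profile j y = sqrt (1 - y\<^sup>2) ^ j"

definition ball_mass :: "nat => real" where
 "ball_mass j = integral {-1..1} (ball_profile j)"

definition ball_cdf :: "nat => real => real" where
 "ball_cdf j y = integral {-1..y} (ball_profile j) / ball_mass j"

definition ball_quantile :: "nat => real => real" where
 "ball_quantile j = inv_into {-1..1} (ball_cdf j)"

lemma continuous_on_ball_profile: "cts S (ball_profile j)"
 unfolding ball_profile_def by (intro continuous_intros)

lemma ball_profile_integrable: "ball_profile j integrable_on {a..b}"
 by (rule integrable_continuous_interval[OF continuous_on_ball_profile])

lemma ball_profile_pos: "y \<in> {-1<..<1} ==> ball_profile j y > 0"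
 by (auto simp: ball_profile_def abs_square_less_1)

lemma ball_profile_nonneg: "y \<in> {-1..1} ==> ball_profile j y >= 0"
 by (auto simp: ball_profile_def abs_square_le_1)

lemma integral_ball_profile_pos:
 assumes "-1 <= a" "a < b" "b <= 1"
 shows "integral {a..b} (ball_profile j) > 0"
proof -
 have "integral {a..b} (%x. 0) < integral {a..b} (ball_profile j)"
  by (rule integral_less_real) (use assms ball_profile_pos in \<open>auto intro: continuous_on_ball_profile\<close>)
 thus ?thesis by simp
qed

lemma ball_mass_pos: "ball_mass j > 0"
 unfolding ball_mass_def by (rule integral_ball_profile_pos) auto

text \<open>Volume of the ball by slicing, as a Beta integral. In this form the masses telescope to
  the volume of the unit ball.\<close>

lemma ball_mass_eq: "ball_mass j = unit_ball_vol (real (Suc j)) / unit_ball_vol (real j)"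
proof -
 have "(ball_profile j has_integral ball_mass j) {-1..1}"
  unfolding ball_mass_def by (rule integrable_integral[OF ball_profile_integrable])
 hence "integral\<^sup>N lborel (%x. ind {-1..1} x * ball_profile j x) = ball_mass j"
  by (intro nn_integral_has_integral_lebesgue) (auto intro: ball_profile_nonneg)
 hence "ennreal (ball_mass j) = ennreal (Beta (1 / 2) (real j / 2 + 1))"
  using emeasure_cball_aux_integral[of j] by (simp add: ball_profile_def)
 moreover have "Beta (1 / 2) (real j / 2 + 1) > 0" unfolding Beta_def by (intro divide_pos_pos mult_pos_pos Gamma_real_pos) auto
 ultimately have "ball_mass j = Beta (1 / 2) (real j / 2 + 1)"
  using ball_mass_pos[of j] by (simp add: less_imp_le)
 also have "... = sqrt pi * Gamma (real j / 2 + 1) / Gamma (real (Suc j) / 2 + 1)"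
  by (simp add: Beta_def Gamma_one_half_real add_divide_distrib algebra_simps)
 also have "sqrt pi = pi powr (real (Suc j) / 2) / pi powr (real j / 2)"
  by (simp add: powr_diff[symmetric] powr_half_sqrt[symmetric] add_divide_distrib)
 finally show ?thesis by (simp add: unit_ball_vol_def)
qed

lemma prod_ball_mass: "(\<Prod>j<n. ball_mass j) = unit_ball_vol (real n)"
proof (induction n)
 case (Suc n)
 thus ?case by (simp add: ball_mass_eq less_imp_neq[symmetric])
qed simp

lemma ball_cdf_bounds: "ball_cdf j (-1) = 0" "ball_cdf j 1 = 1"
 using ball_mass_pos[of j] by (simp_all add: ball_cdf_def ball_mass_def)

lemma ball_cdf_strict_mono:
 assumes "-1 <= a" "a < b" "b <= 1"
 shows "ball_cdf j a < ball_cdf j b"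
proof -
 have "integral {-1..a} (ball_profile j) + integral {a..b} (ball_profile j) = integral {-1..b} (ball_profile j)"
  using assms by (intro Henstock_Kurzweil_Integration.integral_combine ball_profile_integrable) auto
 hence "integral {-1..a} (ball_profile j) < integral {-1..b} (ball_profile j)"
  using integral_ball_profile_pos[OF assms, of j] by linarith
 thus ?thesis unfolding ball_cdf_def using ball_mass_pos[of j] by (intro divide_strict_right_mono)
qed

lemma ball_cdf_inj: "inj_on (ball_cdf j) {-1..1}"
 by (rule inj_onI) (metis atLeastAtMost_iff ball_cdf_strict_mono less_irrefl linorder_neqE_linordered_idom)

lemma continuous_on_ball_cdf: "cts {-1..1} (ball_cdf j)"
 unfolding ball_cdf_def using ball_mass_pos[of j]
 by (intro continuous_on_divide indefinite_integral_continuous_1 ball_profile_integrable continuous_on_const) auto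

lemma ball_cdf_image: "ball_cdf j ` {-1..1} = {0..1}"
proof (intro set_eqI iffI)
 fix z assume "z \<in> ball_cdf j ` {-1..1}"
 then obtain y where y: "y \<in> {-1..1}" "z = ball_cdf j y" by blast
 have "ball_cdf j (-1) <= ball_cdf j y" "ball_cdf j y <= ball_cdf j 1"
  using y(1) ball_cdf_strict_mono[of "-1" y j] ball_cdf_strict_mono[of y 1 j] by (cases "y = -1"; cases "y = 1"; auto)+
 thus "z \<in> {0..1}" by (simp add: y(2) ball_cdf_bounds)
next
 fix z :: real assume "z \<in> {0..1}"
 hence "\<exists>y\<ge>-1. y <= 1 & ball_cdf j y = z"
  by (intro IVT') (auto simp: ball_cdf_bounds continuous_on_ball_cdf)
 thus "z \<in> ball_cdf j ` {-1..1}" by force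
qed

lemma ball_quantile:
 assumes "z \<in> {0..1}"
 shows "ball_quantile j z \<in> {-1..1}" "ball_cdf j (ball_quantile j z) = z"
 unfolding ball_quantile_def using assms ball_cdf_image[of j]
 by (auto intro: f_inv_into_f simp del: atLeastAtMost_iff intro!: inv_into_into)

lemma continuous_on_ball_quantile: "cts {0..1} (ball_quantile j)"
proof -
 have "cts (ball_cdf j ` {-1..1}) (ball_quantile j)"
  by (rule continuous_on_inv[OF continuous_on_ball_cdf])
   (auto simp: ball_quantile_def inv_into_f_f[OF ball_cdf_inj])
 thus ?thesis by (simp add: ball_cdf_image)
qed

lemma ball_quantile_ends: "ball_quantile j 0 = -1" "ball_quantile j 1 = 1"
 unfolding ball_quantile_def
 using inv_into_f_f[OF ball_cdf_inj, of "-1" j] inv_into_f_f[OF ball_cdf_inj, of 1 j] by (simp_all add: ball_cdf_bounds)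

lemma ball_quantile_interior:
 assumes "z \<in> {0<..<1}"
 shows "ball_quantile j z \<in> {-1<..<1}"
proof -
 have "ball_quantile j z \<in> {-1..1}" "ball_cdf j (ball_quantile j z) = z" using ball_quantile[of z j] assms by auto
 moreover from this have "ball_quantile j z ~= -1" "ball_quantile j z ~= 1"
  using assms ball_cdf_bounds[of j] by auto
 ultimately show ?thesis by auto
qed

lemma ball_quantile_has_derivative:
 assumes z: "z \<in> {0<..<1}"
 shows "(ball_quantile j has_real_derivative ball_mass j / ball_profile j (ball_quantile j z)) (at z)"
proof -
 let ?y = "ball_quantile j z"
 have y: "?y \<in> {-1<..<1}" by (rule ball_quantile_interior[OF z])
 have "((%u. integral {-1..u} (ball_profile j)) has_real_derivative ball_profile j ?y) (at ?y within {-1..1})"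
  by (rule integral_has_real_derivative[OF continuous_on_ball_profile]) (use y in auto)
 hence "RD (%u. integral {-1..u} (ball_profile j)) ?y :> ball_profile j ?y"
  using y at_within_Icc_at[of "-1" ?y 1] by (simp only: greaterThanLessThan_iff)
 hence d: "(ball_cdf j has_real_derivative ball_profile j ?y / ball_mass j) (at ?y)"
  unfolding ball_cdf_def[abs_def] by (rule DERIV_cdivide)
 have "(ball_quantile j has_real_derivative inverse (ball_profile j ?y / ball_mass j)) (at z)"
 proof (rule DERIV_inverse_function[where f = "ball_cdf j" and g = "ball_quantile j" and x = z and a = 0 and b = 1, OF d])
  show "ball_profile j ?y / ball_mass j ~= 0"
   using ball_profile_pos[OF y, of j] ball_mass_pos[of j] by simp
  show "isCont (ball_quantile j) z"
   using continuous_on_ball_quantile[of j] z by (auto intro: continuous_on_interior)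
  show "!!y. 0 < y ==> y < 1 ==> ball_cdf j (ball_quantile j y) = y" by (rule ball_quantile) auto
 qed (use z in auto)
 thus ?thesis by simp
qed

section \<open>The Knothe map onto the ball\<close>

definition vupd :: "real ^ 'v::finite => 'v => real => real ^ 'v" where
 "vupd x i s = (\<chi> j. if j = i then s else x $ j)"

lemma vupd_nth [simp]: "vupd x i s $ j = (if j = i then s else x $ j)"
 by (simp add: vupd_def)

lemma vupd_same [simp]: "vupd x i (x $ i) = x"
 by (simp add: vec_eq_iff)

lemma vupd_vupd [simp]: "vupd (vupd x i s) i t = vupd x i t"
 by (simp add: vec_eq_iff)

lemma vupd_commute: "i ~= j ==> vupd (vupd x i s) j t = vupd (vupd x j t) i s"
 by (auto simp: vec_eq_iff)

lemma vupd_add_axis: "x + t *\<^sub>R axis i 1 = vupd x i (x $ i + t)"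
 by (auto simp: vec_eq_iff axis_def)

lemma continuous_on_vupd [continuous_intros]:
 assumes "cts S f" "cts S g"
 shows "cts S (%z. vupd (f z) i (g z))"
proof -
 have "cts S (%z. if j = i then g z else f z $ j)" for j
  using assms by (cases "j = i") (auto intro!: continuous_intros)
 thus ?thesis unfolding vupd_def by (intro continuous_on_vec_lambda)
qed

text \<open>Trades a variable limit for a variable integrand; with fixed limits a primitive is
  jointly continuous in its parameters.\<close>

lemma integral_rescale_interval:
 fixes g :: "real => real"
 assumes g: "cts UNIV g" and ab: "a <= b"
 shows "(b - a) * integral {0..1} (%r. g (a + (b - a) * r)) = integral {a..b} g"
proof -
 define A where "A u = integral {a..u} g" for u
 have A: "(A has_real_derivative g u) (at u within {a..b})" if "u \<in> {a..b}" for u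
  unfolding A_def by (rule integral_has_real_derivative) (use that in \<open>auto intro: continuous_on_subset[OF g]\<close>)
 have "((%r. g (a + (b - a) * r) * (b - a)) has_integral A (a + (b - a) * 1) - A (a + (b - a) * 0)) {0..1}"
 proof (rule fundamental_theorem_of_calculus)
  fix r :: real assume r: "r \<in> {0..1}"
  have im: "(%r. a + (b - a) * r) ` {0..1} \<subseteq> {a..b}"
  proof
   fix x assume "x \<in> (%r. a + (b - a) * r) ` {0..1}"
   then obtain r where r: "0 <= r" "r <= 1" "x = a + (b - a) * r" by auto
   have "0 <= (b - a) * r" "(b - a) * r <= b - a" using r ab by (auto intro: mult_left_le)
   thus "x \<in> {a..b}" by (simp add: r(3))
  qed
  have "((%r. A (a + (b - a) * r)) has_real_derivative g (a + (b - a) * r) * (b - a)) (at r within {0..1})"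
  proof (rule DERIV_image_chain[where g = "%r. a + (b - a) * r" and f = A, unfolded o_def])
   show "(A has_real_derivative g (a + (b - a) * r)) (at (a + (b - a) * r) within (%r. a + (b - a) * r) ` {0..1})"
    using A im r by (meson DERIV_subset image_subset_iff)
   show "((%r. a + (b - a) * r) has_real_derivative b - a) (at r within {0..1})"
    by (auto intro!: derivative_eq_intros)
  qed
  thus "((%r. A (a + (b - a) * r)) has_vector_derivative g (a + (b - a) * r) * (b - a)) (at r within {0..1})"
   by (simp add: has_real_derivative_iff_has_vector_derivative)
 qed simp
 hence "integral {0..1} (%r. g (a + (b - a) * r) * (b - a)) = integral {a..b} g"
  by (intro integral_unique) (simp add: A_def)
 thus ?thesis by (simp add: mult.commute)
qed

text \<open>A positive density h on the cube [-L, L]^v, whose coordinates are processed in the order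
  \<open>idx\<close>. The Knothe map carries the normalised density to the uniform measure of the
  unit ball, one coordinate at a time. The argument works with its coordinates \<open>X k\<close>
  and their derivatives \<open>Y k\<close> along their own directions, whose sum is the
  divergence.\<close>

locale knothe =
 fixes h :: "real ^ 'v::finite => real" and L :: real and idx :: "nat => 'v"
 assumes h_cont: "cts UNIV h" and h_pos: "h x > 0" and L_pos: "L > 0"
  and idx: "bij_betw idx {..<CARD('v)} UNIV"
begin

text \<open>Counts the coordinates already integrated out, starting from the last one.
  \<open>H k\<close> is the same family numbered by the coordinates that remain: the marginal
  density of the first k, still written as a function of all of x.\<close>

primrec hm :: "nat => real ^ 'v => real" where
 "hm 0 = h"
| "hm (Suc n) = (%x. integral {-L..L} (%s. hm n (vupd x (idx (CARD('v) - Suc n)) s)))"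

definition H :: "nat => real ^ 'v => real" where
 "H k = hm (CARD('v) - k)"

lemma H_CARD: "H CARD('v) = h"
 by (simp add: H_def)

lemma H_step:
 assumes "k < CARD('v)"
 shows "H k x = integral {-L..L} (%s. H (Suc k) (vupd x (idx k) s))"
proof -
 have e: "CARD('v) - k = Suc (CARD('v) - Suc k)" using assms by simp
 hence "CARD('v) - Suc (CARD('v) - Suc k) = k" using assms by simp
 thus ?thesis by (simp add: H_def e)
qed

lemma idx_eq_iff: "i < CARD('v) ==> j < CARD('v) ==> idx i = idx j \<longleftrightarrow> i = j"
 using idx by (auto simp: bij_betw_def inj_on_eq_iff)

lemma continuous_on_hm: "cts UNIV (hm n)"
proof (induction n)
 case 0
 thus ?case by (simp add: h_cont)
next
 case (Suc n)
 have "cts (UNIV \<times> cbox (-L) L) (%(x, s). hm n (vupd x (idx (CARD('v) - Suc n)) s))"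
  unfolding case_prod_unfold
  by (rule continuous_on_compose2[OF Suc.IH]) (auto intro!: continuous_intros)
 from integral_continuous_on_param[OF this] show ?case by simp
qed

lemma continuous_on_H: "cts S (H k)"
 unfolding H_def by (rule continuous_on_subset[OF continuous_on_hm]) simp

lemma continuous_on_H_slice: "cts S (%s. H k (vupd x i s))"
 by (rule continuous_on_compose2[OF continuous_on_H[of UNIV]]) (auto intro!: continuous_intros)

lemma hm_pos: "hm n x > 0"
proof (induction n arbitrary: x)
 case (Suc n)
 have "cts {-L..L} (%s. hm n (vupd x (idx (CARD('v) - Suc n)) s))"
  by (rule continuous_on_compose2[OF continuous_on_hm]) (auto intro!: continuous_intros)
 hence "integral {-L..L} (%s. 0) < integral {-L..L} (%s. hm n (vupd x (idx (CARD('v) - Suc n)) s))"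
  using L_pos Suc.IH by (intro integral_less_real) auto
 thus ?case by simp
qed (simp add: h_pos)

lemma H_pos: "H k x > 0"
 by (simp add: H_def hm_pos)

lemma hm_vupd:
 "n <= CARD('v) ==> CARD('v) - n <= j ==> j < CARD('v) ==> hm n (vupd x (idx j) s) = hm n x"
proof (induction n arbitrary: x)
 case (Suc n)
 let ?k = "CARD('v) - Suc n"
 have "hm n (vupd (vupd x (idx j) s) (idx ?k) t) = hm n (vupd x (idx ?k) t)" for t
 proof (cases "j = ?k")
  case False
  hence ne: "idx j ~= idx ?k" using Suc.prems by (subst idx_eq_iff) auto
  show ?thesis
   unfolding vupd_commute[OF ne] using Suc.prems False by (intro Suc.IH) auto
 qed simp
 thus ?case by simp
qed simp

lemma H_vupd: "k <= j ==> j < CARD('v) ==> H k (vupd x (idx j) s) = H k x"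
 unfolding H_def by (rule hm_vupd) auto

text \<open>Distribution function of coordinate k conditional on the earlier ones. The integral is
  rescaled to [0, 1] so that continuity in all coordinates follows from a theorem with fixed
  limits.\<close>

definition F :: "nat => real ^ 'v => real" where
 "F k x = (x $ idx k + L) * integral {0..1} (%r. H (Suc k) (vupd x (idx k) (-L + (x $ idx k + L) * r))) / H k x"

lemma F_eq:
 assumes "-L <= x $ idx k"
 shows "F k x = integral {-L..x $ idx k} (%s. H (Suc k) (vupd x (idx k) s)) / H k x"
 using integral_rescale_interval[OF continuous_on_H_slice[of UNIV "Suc k" x "idx k"] assms]
 by (simp add: F_def)

lemma continuous_on_F: "cts UNIV (F k)"
proof -
 have "cts (UNIV \<times> cbox 0 1) (%(x, r). H (Suc k) (vupd x (idx k) (-L + (x $ idx k + L) * r)))"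
  unfolding case_prod_unfold
  by (rule continuous_on_compose2[OF continuous_on_H[of UNIV]]) (auto intro!: continuous_intros)
 from integral_continuous_on_param[OF this] show ?thesis
  unfolding F_def[abs_def] using H_pos[of k]
  by (intro continuous_on_divide continuous_on_mult continuous_on_H) (auto intro!: continuous_intros simp: less_imp_neq[symmetric])
qed

lemma F_bounds:
 assumes k: "k < CARD('v)" and x: "x $ idx k \<in> {-L..L}"
 shows "F k x \<in> {0..1}" "x $ idx k \<in> {-L<..<L} ==> F k x \<in> {0<..<1}"
  "x $ idx k = -L ==> F k x = 0" "x $ idx k = L ==> F k x = 1"
proof -
 let ?g = "%s. H (Suc k) (vupd x (idx k) s)" and ?t = "x $ idx k"
 have int: "?g integrable_on {a..b}" for a b
  by (rule integrable_continuous_interval[OF continuous_on_H_slice])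
 have pos: "0 < integral {a..b} ?g" if "a < b" for a b
 proof -
  have "integral {a..b} (%s. 0) < integral {a..b} ?g"
   by (rule integral_less_real) (use that H_pos in \<open>auto intro: continuous_on_H_slice\<close>)
  thus ?thesis by simp
 qed
 have nn: "0 <= integral {a..b} ?g" for a b
  using H_pos by (intro Henstock_Kurzweil_Integration.integral_nonneg int) (auto intro: less_imp_le)
 have comb: "integral {-L..?t} ?g + integral {?t..L} ?g = H k x"
  unfolding H_step[OF k] using x by (intro Henstock_Kurzweil_Integration.integral_combine int) auto
 have Fx: "F k x = integral {-L..?t} ?g / H k x" by (rule F_eq) (use x in auto)
 have Hk: "H k x > 0" by (rule H_pos)
 show "F k x \<in> {0..1}" unfolding Fx using nn[of "-L" ?t] nn[of ?t L] comb Hk by (auto simp: divide_le_eq)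
 show "?t \<in> {-L<..<L} ==> F k x \<in> {0<..<1}" unfolding Fx using pos[of "-L" ?t] pos[of ?t L] comb Hk by (auto simp: divide_less_eq)
 show "?t = -L ==> F k x = 0" unfolding Fx by simp
 show "?t = L ==> F k x = 1" unfolding Fx using comb Hk by simp
qed

lemma F_vupd:
 assumes "k < j" "j < CARD('v)"
 shows "F k (vupd x (idx j) s) = F k x"
proof -
 have ne: "idx j ~= idx k" using assms idx_eq_iff[of j k] by auto
 have "H (Suc k) (vupd (vupd x (idx j) s) (idx k) t) = H (Suc k) (vupd x (idx k) t)" for t
  unfolding vupd_commute[OF ne] using assms by (intro H_vupd) auto
 thus ?thesis unfolding F_def using ne assms by (auto simp: H_vupd)
qed

lemma F_has_derivative:
 assumes k: "k < CARD('v)" and x: "x $ idx k \<in> {-L<..<L}"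
 shows "RD (%s. F k (vupd x (idx k) s)) (x $ idx k) :> H (Suc k) x / H k x"
proof -
 let ?g = "%s. H (Suc k) (vupd x (idx k) s)" and ?t = "x $ idx k"
 have "((%u. integral {-L..u} ?g) has_real_derivative ?g ?t) (at ?t within {-L..L})"
  by (rule integral_has_real_derivative[OF continuous_on_H_slice]) (use x in auto)
 hence "RD (%u. integral {-L..u} ?g) ?t :> ?g ?t"
  using x at_within_Icc_at[of "-L" ?t L] by (simp only: greaterThanLessThan_iff)
 hence "RD (%u. integral {-L..u} ?g / H k x) ?t :> ?g ?t / H k x"
  by (rule DERIV_cdivide)
 hence "RD (%u. F k (vupd x (idx k) u)) ?t :> ?g ?t / H k x"
 proof (rule has_field_derivative_transform_within_open[of _ _ _ "{-L<..<L}"])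
  fix u assume "u \<in> {-L<..<L}"
  thus "integral {-L..u} ?g / H k x = F k (vupd x (idx k) u)"
   by (subst F_eq) (use k in \<open>auto simp: H_vupd\<close>)
 qed (use x in auto)
 thus ?thesis by simp
qed

text \<open>Once the first k coordinates of a uniform point of the ball are fixed, the rest ranges
  over a ball of dimension v - k and radius \<open>r k\<close>. Divided by that radius, the next
  coordinate has the profile of index v - k - 1, and \<xi> is its value.\<close>

definition \<xi> :: "nat => real ^ 'v => real" where
 "\<xi> k x = ball_quantile (CARD('v) - Suc k) (F k x)"

definition sg :: "nat => real ^ 'v => real" where
 "sg k x = sqrt (1 - (\<xi> k x)\<^sup>2)"

definition r :: "nat => real ^ 'v => real" where
 "r k x = (\<Prod>j<k. sg j x)"

definition X :: "nat => real ^ 'v => real" where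
 "X k x = r k x * \<xi> k x"

text \<open>The derivative of \<open>X k\<close> along \<open>idx k\<close>: radius, times the
  derivative of the quantile, times the conditional density.\<close>

definition Y :: "nat => real ^ 'v => real" where
 "Y k x = r k x * (ball_mass (CARD('v) - Suc k) / sg k x ^ (CARD('v) - Suc k) * (H (Suc k) x / H k x))"

definition obox :: "(real ^ 'v) set" where
 "obox = {x. \<forall>i. x $ i \<in> {-L<..<L}}"

definition kbox :: "(real ^ 'v) set" where
 "kbox = {x. \<forall>i. x $ i \<in> {-L..L}}"

lemma obox_subset: "obox \<subseteq> kbox"
 by (auto simp: obox_def kbox_def intro: less_imp_le)

lemma open_obox: "open obox"
proof -
 have "obox = box (\<chi> i. -L) (\<chi> i. L)" by (auto simp: obox_def mem_box_vec)
 thus ?thesis by (simp only: open_box)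
qed

lemma kbox_eq: "kbox = cbox (\<chi> i. -L) (\<chi> i. L)"
 by (auto simp: kbox_def mem_cbox_vec)

lemma \<xi>_bounds:
 assumes "k < CARD('v)"
 shows "x \<in> kbox ==> \<xi> k x \<in> {-1..1}" "x \<in> obox ==> \<xi> k x \<in> {-1<..<1}"
 using ball_quantile(1)[OF F_bounds(1)[OF assms], of x "CARD('v) - Suc k"]
  ball_quantile_interior[OF F_bounds(2)[OF assms], of x "CARD('v) - Suc k"]
 by (auto simp: \<xi>_def kbox_def obox_def less_imp_le)

lemma sg_pos: "k < CARD('v) ==> x \<in> obox ==> sg k x > 0"
 using \<xi>_bounds(2)[of k x] by (auto simp: sg_def abs_square_less_1)

lemma r_pos: "k <= CARD('v) ==> x \<in> obox ==> r k x > 0"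
 unfolding r_def by (intro prod_pos) (auto intro: sg_pos)

lemma continuous_on_\<xi>: "k < CARD('v) ==> cts kbox (\<xi> k)"
 unfolding \<xi>_def[abs_def]
 by (rule continuous_on_compose2[OF continuous_on_ball_quantile continuous_on_subset[OF continuous_on_F]])
  (use F_bounds(1) in \<open>auto simp: kbox_def simp del: atLeastAtMost_iff\<close>)

lemma continuous_on_sg: "k < CARD('v) ==> cts kbox (sg k)"
 unfolding sg_def[abs_def] by (intro continuous_intros continuous_on_\<xi>)

lemma continuous_on_r: "k <= CARD('v) ==> cts kbox (r k)"
 unfolding r_def[abs_def] by (intro continuous_on_prod continuous_on_sg) auto

lemma continuous_on_X: "k < CARD('v) ==> cts kbox (X k)"
 unfolding X_def[abs_def] by (intro continuous_on_mult continuous_on_r continuous_on_\<xi>) auto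

lemma continuous_on_Y:
 assumes k: "k < CARD('v)"
 shows "cts obox (Y k)"
 unfolding Y_def[abs_def]
proof (intro continuous_on_mult continuous_on_divide continuous_on_power continuous_on_H continuous_on_const ballI)
 show "cts obox (r k)" "cts obox (sg k)"
  using continuous_on_r[of k] continuous_on_sg[OF k] k continuous_on_subset[OF _ obox_subset] by auto
 fix x assume "x \<in> obox"
 thus "sg k x ^ (CARD('v) - Suc k) ~= 0" using sg_pos[OF k] by (simp add: less_imp_neq[symmetric])
 show "H k x ~= 0" using H_pos[of k x] by simp
qed

lemma Y_pos: "k < CARD('v) ==> x \<in> obox ==> Y k x > 0"
 unfolding Y_def using r_pos[of k x] sg_pos[of k x] ball_mass_pos H_pos
 by (intro mult_pos_pos divide_pos_pos zero_less_power) auto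

lemma \<xi>_vupd: "k < j ==> j < CARD('v) ==> \<xi> k (vupd x (idx j) s) = \<xi> k x"
 by (simp add: \<xi>_def F_vupd)

lemma r_vupd: "j < CARD('v) ==> r j (vupd x (idx j) s) = r j x"
 unfolding r_def sg_def by (intro prod.cong) (auto simp: \<xi>_vupd)

lemma X_has_derivative:
 assumes k: "k < CARD('v)" and x: "x \<in> obox"
 shows "RD (%t. X k (x + t *\<^sub>R axis (idx k) 1)) 0 :> Y k x"
proof -
 let ?j = "CARD('v) - Suc k" and ?t = "x $ idx k"
 have xk: "?t \<in> {-L<..<L}" "?t \<in> {-L..L}" using x by (auto simp: obox_def less_imp_le)
 have Fk: "F k x \<in> {0<..<1}" by (rule F_bounds(2)[OF k xk(2,1)])
 have "(ball_quantile ?j has_real_derivative ball_mass ?j / ball_profile ?j (ball_quantile ?j (F k x))) (at (F k (vupd x (idx k) ?t)))"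
  using ball_quantile_has_derivative[OF Fk] by simp
 hence "((%s. ball_quantile ?j (F k (vupd x (idx k) s))) has_real_derivative
   ball_mass ?j / ball_profile ?j (ball_quantile ?j (F k x)) * (H (Suc k) x / H k x)) (at ?t)"
  by (rule DERIV_chain2) (rule F_has_derivative[OF k xk(1)])
 hence "((%s. \<xi> k (vupd x (idx k) s)) has_real_derivative
   ball_mass ?j / sg k x ^ ?j * (H (Suc k) x / H k x)) (at ?t)"
  by (simp add: \<xi>_def sg_def ball_profile_def)
 hence "RD (%s. r k x * \<xi> k (vupd x (idx k) s)) ?t :> Y k x"
  unfolding Y_def by (rule DERIV_cmult)
 hence "RD (%s. X k (vupd x (idx k) s)) (?t + 0) :> Y k x"
  by (simp add: X_def r_vupd[OF k])
 moreover have "RD (%t. ?t + t) 0 :> 1" by (auto intro!: derivative_eq_intros)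
 ultimately have "RD (%t. X k (vupd x (idx k) (?t + t))) 0 :> Y k x * 1"
  by (rule DERIV_chain2)
 thus ?thesis by (simp add: vupd_add_axis)
qed

lemma sum_X_square: "m <= CARD('v) ==> x \<in> kbox ==> (\<Sum>k<m. (X k x)^2) = 1 - (r m x)\<^sup>2"
proof (induction m)
 case (Suc m)
 have "\<xi> m x \<in> {-1..1}" using \<xi>_bounds(1)[of m x] Suc.prems by simp
 hence "(\<xi> m x)^2 <= 1" by (auto simp: abs_square_le_1)
 hence "(sg m x)^2 = 1 - (\<xi> m x)\<^sup>2" by (simp add: sg_def)
 hence "(r (Suc m) x)^2 = (r m x)^2 * (1 - (\<xi> m x)\<^sup>2)"
  by (simp add: r_def power_mult_distrib)
 thus ?case using Suc by (simp add: X_def power_mult_distrib algebra_simps)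
qed (simp add: r_def)

text \<open>The factor \<open>sg j\<close> occurs in \<open>r k\<close> for each k > j. These powers
  are exactly the denominators of the \<open>Y k\<close>.\<close>

lemma prod_r: "(\<Prod>k<m. r k x) = (\<Prod>j<m. sg j x ^ (m - Suc j))"
proof (induction m)
 case (Suc m)
 have "(\<Prod>k<Suc m. r k x) = (\<Prod>j<m. sg j x ^ (m - Suc j)) * (\<Prod>j<m. sg j x)"
  using Suc by (simp add: r_def)
 also have "... = (\<Prod>j<m. sg j x ^ (Suc m - Suc j))"
  unfolding prod.distrib[symmetric]
  by (intro prod.cong) (auto simp: Suc_diff_Suc power_Suc2[symmetric] simp del: power_Suc)
 finally show ?case by simp
qed simp

lemma prod_H_quotient: "m <= CARD('v) ==> (\<Prod>k<m. H (Suc k) x / H k x) = H m x / H 0 x"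
proof (induction m)
 case 0
 thus ?case using H_pos[of 0 x] by simp
next
 case (Suc m)
 thus ?case using H_pos[of m x] by simp
qed

text \<open>The Jacobian equation of a triangular transport map: radii cancel, marginals telescope
  to h / H 0, and the masses multiply to the volume of the ball.\<close>

lemma prod_Y:
 assumes x: "x \<in> obox"
 shows "(\<Prod>k<CARD('v). Y k x) = unit_ball_vol (real CARD('v)) * (h x / H 0 x)"
proof -
 let ?n = "CARD('v)"
 have s: "(\<Prod>k<?n. sg k x ^ (?n - Suc k)) ~= 0"
  using sg_pos[OF _ x] by (auto simp: less_imp_neq[symmetric])
 have "(\<Prod>k<?n. Y k x) = (\<Prod>k<?n. r k x) * ((\<Prod>k<?n. ball_mass (?n - Suc k)) / (\<Prod>k<?n. sg k x ^ (?n - Suc k))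
   * (\<Prod>k<?n. H (Suc k) x / H k x))"
  unfolding Y_def prod.distrib prod_dividef ..
 also have "... = (\<Prod>k<?n. ball_mass (?n - Suc k)) * (h x / H 0 x)"
  unfolding prod_r prod_H_quotient[OF order_refl] H_CARD using nonzero_mult_div_cancel_left[OF s] by simp
 also have "(\<Prod>k<?n. ball_mass (?n - Suc k)) = (\<Prod>k<?n. ball_mass k)"
  by (rule prod.nat_diff_reindex)
 finally show ?thesis by (simp add: prod_ball_mass)
qed

end

text \<open>The map T exchanges coordinate i of x with the extra variable s. It is a
  content-preserving involution of the cube of one dimension more, where both sides are iterated
  integrals.\<close>

lemma integral_swap_coordinate:
 fixes f :: "real ^ 'v::finite => real"
 assumes f: "cts (cbox (\<chi> i. -L) (\<chi> i. L)) f" and L: "L >= 0"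
 shows "integral (cbox (\<chi> i. -L) (\<chi> i. L)) (%x. integral {-L..L} (%s. f (vupd x i s))) =
  2 * L * integral (cbox (\<chi> i. -L) (\<chi> i. L)) f"
proof -
 let ?K = "cbox (\<chi> i. -L) (\<chi> i. L) :: (real ^ 'v) set"
 let ?P = "cbox ((\<chi> i. -L) :: 'v rv, -L) ((\<chi> i. L), L)"
 define T :: "'v rv \<times> real => 'v rv \<times> real" where "T z = (vupd (fst z) i (snd z), fst z $ i)" for z
 have TT: "T (T z) = z" for z by (simp add: T_def)
 have im: "T ` cbox u v = cbox (T u) (T v)" for u v
 proof -
  have "T z \<in> cbox (T u) (T v) \<longleftrightarrow> z \<in> cbox u v" for z
  proof -
   obtain a s where z: "z = (a, s)" by (cases z)
   obtain u1 u2 where u: "u = (u1, u2)" by (cases u)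
   obtain v1 v2 where v: "v = (v1, v2)" by (cases v)
   show ?thesis unfolding z u v by (auto simp: T_def cbox_Pair_eq mem_cbox_vec split: if_splits)
  qed
  hence "cbox (T u) (T v) = T -` cbox u v" using TT by (metis vimageI2 vimageD subsetI subset_antisym)
  also have "... = T ` cbox u v"
  proof (intro set_eqI iffI)
   fix z assume "z \<in> T -` cbox u v"
   thus "z \<in> T ` cbox u v" using TT[of z, symmetric] by (intro image_eqI[of _ _ "T z"]) auto
  qed (use TT in auto)
  finally show ?thesis ..
 qed
 have cont: "measure lborel (cbox (T u) (T v)) = measure lborel (cbox u v)" for u v
 proof (cases "cbox u v = {}")
  case True
  thus ?thesis using im[of u v] by simp
 next
  case False
  obtain u1 u2 where u: "u = (u1, u2)" by (cases u)
  obtain v1 v2 where v: "v = (v1, v2)" by (cases v)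
  have ne: "cbox u1 v1 ~= {}" "cbox u2 v2 ~= {}" using False by (auto simp: u v cbox_Pair_eq)
  have "cbox (T u) (T v) ~= {}" using False im[of u v] by auto
  hence ne': "cbox (vupd u1 i u2) (vupd v1 i v2) ~= {}" "cbox (u1 $ i) (v1 $ i) ~= {}"
   by (auto simp: u v T_def cbox_Pair_eq)
  have "measure lborel (cbox (vupd u1 i u2) (vupd v1 i v2)) = (\<Prod>j\<in>UNIV. vupd v1 i v2 $ j - vupd u1 i u2 $ j)"
   by (rule content_cbox_cart[OF ne'(1)])
  also have "... = (v2 - u2) * (\<Prod>j\<in>UNIV - {i}. v1 $ j - u1 $ j)"
   by (subst prod.remove[of _ i]) auto
  finally have 1: "measure lborel (cbox (vupd u1 i u2) (vupd v1 i v2)) = (v2 - u2) * (\<Prod>j\<in>UNIV - {i}. v1 $ j - u1 $ j)" .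
  have "measure lborel (cbox u1 v1) = (\<Prod>j\<in>UNIV. v1 $ j - u1 $ j)"
   by (rule content_cbox_cart[OF ne(1)])
  also have "... = (v1 $ i - u1 $ i) * (\<Prod>j\<in>UNIV - {i}. v1 $ j - u1 $ j)"
   by (subst prod.remove[of _ i]) auto
  finally have 2: "measure lborel (cbox u1 v1) = (v1 $ i - u1 $ i) * (\<Prod>j\<in>UNIV - {i}. v1 $ j - u1 $ j)" .
  show ?thesis using ne(2) ne'(2) by (simp add: u v T_def content_Pair 1 2)
 qed
 have Tc: "cts S T" for S unfolding T_def[abs_def] by (intro continuous_intros)
 have "T (\<chi> i. s, s) = (\<chi> i. s, s)" for s by (simp add: T_def vec_eq_iff)
 hence TP: "T ` ?P = ?P" unfolding im by simp
 have fc: "cts ?P (%z. f (fst z))"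
  by (rule continuous_on_compose2[OF f]) (auto intro!: continuous_intros simp: cbox_Pair_eq)
 have "((%z. f (fst z)) has_integral integral ?P (%z. f (fst z))) ?P"
  by (intro integrable_integral integrable_continuous fc)
 hence "((%z. f (fst (T z))) has_integral (1 / 1) *\<^sub>R integral ?P (%z. f (fst z))) (T ` ?P)"
 proof (intro has_integral_twiddle TT)
  show "isCont T z" for z using Tc[of UNIV] by (simp only: continuous_on_eq_continuous_at[OF open_UNIV] UNIV_I)
  show "\<exists>w z. T ` cbox u v = cbox w z" "\<exists>w z. T ` cbox u v = cbox w z" for u v using im by blast+
  show "measure lborel (T ` cbox u v) = 1 * measure lborel (cbox u v)" for u v using im cont by simp
 qed simp
 hence eq: "integral ?P (%z. f (fst (T z))) = integral ?P (%z. f (fst z))"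
  unfolding TP by (simp add: integral_unique)
 have fTc: "cts ?P (%z. f (fst (T z)))"
  by (rule continuous_on_compose2[OF fc Tc]) (use TP in auto)
 have "integral ?P (%z. f (fst (T z))) = integral ?K (%x. integral {-L..L} (%s. f (vupd x i s)))"
  using integral_prod_continuous[OF fTc] by (simp add: T_def)
 moreover have "integral ?P (%z. f (fst z)) = integral ?K (%x. integral {-L..L} (%s. f x))"
  using integral_prod_continuous[OF fc] by simp
 ultimately show ?thesis using eq L by simp
qed

section \<open>Mean of the first transport coordinate and integration by parts\<close>

context knothe
begin

lemma integral_kbox_average:
 assumes "cts kbox f"
 shows "integral kbox (%x. integral {-L..L} (%s. f (vupd x i s))) = 2 * L * integral kbox f"
 using integral_swap_coordinate[of L f i] assms L_pos by (simp add: kbox_eq)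

lemma content_kbox: "integral kbox (%x. 1) = (2 * L) ^ CARD('v)"
proof -
 have "(\<chi> i. 0) \<in> (cbox (\<chi> i. -L) (\<chi> i. L) :: (real ^ 'v) set)" using L_pos by (simp add: mem_cbox_vec)
 hence "measure lborel (cbox (\<chi> i. -L) (\<chi> i. L) :: 'v rv set) = (\<Prod>i\<in>(UNIV :: 'v set). L - (- L))"
  by (subst content_cbox_cart) auto
 thus ?thesis by (simp add: kbox_eq)
qed

text \<open>A factor that ignores the coordinates from k on passes through their integration. Powers
  of 2L appear because all integrals stay over the full cube, also after a coordinate has been
  integrated out.\<close>

lemma integral_H_mult:
 assumes \<phi>: "cts kbox \<phi>" and inv: "!!x j s. k <= j ==> j < CARD('v) ==> \<phi> (vupd x (idx j) s) = \<phi> x"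
 shows "n <= CARD('v) - k ==> integral kbox (%x. h x * \<phi> x) * (2 * L) ^ n = integral kbox (%x. H (CARD('v) - n) x * \<phi> x)"
proof (induction n)
 case 0
 thus ?case by (simp add: H_CARD)
next
 case (Suc n)
 let ?m = "CARD('v) - Suc n"
 have m: "?m < CARD('v)" "Suc ?m = CARD('v) - n" "k <= ?m" using Suc.prems by auto
 have "integral kbox (%x. h x * \<phi> x) * (2 * L) ^ Suc n = 2 * L * (integral kbox (%x. h x * \<phi> x) * (2 * L) ^ n)" by simp
 also have "... = 2 * L * integral kbox (%x. H (Suc ?m) x * \<phi> x)" using Suc m by simp
 also have "... = integral kbox (%x. integral {-L..L} (%s. H (Suc ?m) (vupd x (idx ?m) s) * \<phi> (vupd x (idx ?m) s)))"
  by (rule integral_kbox_average[symmetric]) (intro continuous_on_mult continuous_on_H \<phi>)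
 also have "... = integral kbox (%x. H ?m x * \<phi> x)"
  using m by (simp add: inv H_step)
 finally show ?case .
qed

lemma H_0_const: "H 0 x = H 0 y"
proof -
 \<comment> \<open>Interpolates between x and y by replacing one coordinate at a time.\<close>
 define z where "z n = (\<chi> i. if i \<in> idx ` {..<n} then y $ i else x $ i)" for n
 have "n <= CARD('v) ==> H 0 (z n) = H 0 x" for n
 proof (induction n)
  case 0
  have "z 0 = x" by (simp add: z_def vec_eq_iff)
  thus ?case by simp
 next
  case (Suc n)
  have "z (Suc n) = vupd (z n) (idx n) (y $ idx n)"
   by (auto simp: z_def vec_eq_iff lessThan_Suc)
  thus ?case using Suc by (simp add: H_vupd)
 qed
 moreover have "z CARD('v) = y"
  using idx by (auto simp: z_def vec_eq_iff bij_betw_def)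
 ultimately show ?thesis by (metis order_refl)
qed

lemma H_0_eq: "H 0 x = integral kbox h"
proof -
 have "integral kbox (%x. h x * 1) * (2 * L) ^ CARD('v) = integral kbox (%x. H (CARD('v) - CARD('v)) x * 1)"
  by (rule integral_H_mult[where k = 0]) (auto intro: continuous_intros)
 also have "... = integral kbox (%y. H 0 x * 1)"
  using H_0_const[of _ x] by (intro integral_cong) simp
 also have "... = H 0 x * integral kbox (%y. 1)" by (rule integral_mult_right)
 also have "... = H 0 x * (2 * L) ^ CARD('v)" by (simp only: content_kbox)
 finally show ?thesis using L_pos by simp
qed

text \<open>In the variable y = \<xi> this is the mean of y against an even profile. A primitive of
  y sqrt(1 - y^2)^j is -sqrt(1 - y^2)^(j + 2) / (j + 2), which vanishes at both ends since \<xi>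
  runs from -1 to 1.\<close>

lemma integral_slice_\<xi>:
 "integral {-L..L} (%s. H 1 (vupd x (idx 0) s) * \<xi> 0 (vupd x (idx 0) s)) = 0"
proof -
 let ?j = "CARD('v) - 1" and ?z = "%s. vupd x (idx 0) s"
 let ?G = "%s. - H 0 x / (real (?j + 2) * ball_mass ?j) * sqrt (1 - (\<xi> 0 (?z s))\<^sup>2) ^ (?j + 2)"
 have v0: "0 < CARD('v)" by simp
 have \<xi>c: "cts {-L..L} (%s. \<xi> 0 (?z s))"
 proof -
  have "cts {-L..L} (%s. F 0 (?z s))"
   by (rule continuous_on_compose2[OF continuous_on_F continuous_on_vupd[OF continuous_on_const continuous_on_id]]) simp
  thus ?thesis
   unfolding \<xi>_def by (rule continuous_on_compose2[OF continuous_on_ball_quantile])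
    (use F_bounds(1)[OF v0] in \<open>auto simp del: atLeastAtMost_iff\<close>)
 qed
 have "((%s. H 1 (?z s) * \<xi> 0 (?z s)) has_integral ?G L - ?G (-L)) {-L..L}"
 proof (rule fundamental_theorem_of_calculus_interior)
  show "cts {-L..L} ?G" by (intro continuous_intros \<xi>c)
  fix s assume s: "s \<in> {-L<..<L}"
  have zs: "?z s $ idx 0 \<in> {-L<..<L}" "?z s $ idx 0 \<in> {-L..L}" using s by auto
  let ?y = "\<xi> 0 (?z s)"
  have F01: "F 0 (?z s) \<in> {0<..<1}" by (rule F_bounds(2)[OF v0 zs(2,1)])
  hence y: "?y \<in> {-1<..<1}" unfolding \<xi>_def by (rule ball_quantile_interior)
  hence y1: "1 - ?y\<^sup>2 > 0" using abs_square_less_1[of ?y] by auto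
  have "RD (%s. F 0 (?z s)) s :> H 1 (?z s) / H 0 x"
   using F_has_derivative[OF v0 zs(1)] by (simp add: H_vupd)
  hence d: "RD (%s. \<xi> 0 (?z s)) s :> ball_mass ?j / ball_profile ?j ?y * (H 1 (?z s) / H 0 x)"
   unfolding \<xi>_def using ball_quantile_has_derivative[OF F01, of ?j] by (intro DERIV_chain2) (auto simp: \<xi>_def)
  have d2: "RD (%y. sqrt (1 - y\<^sup>2) ^ (?j + 2)) ?y :> - real (?j + 2) * ?y * ball_profile ?j ?y"
  proof -
   have "RD (%y. sqrt (1 - y\<^sup>2)) ?y :> - ?y * inverse (sqrt (1 - ?y\<^sup>2))"
    using y1 by (auto intro!: derivative_eq_intros)
   hence "((%y. sqrt (1 - y\<^sup>2) ^ (?j + 2)) has_real_derivative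
     real (?j + 2) * ((- ?y * inverse (sqrt (1 - ?y\<^sup>2))) * sqrt (1 - ?y\<^sup>2) ^ (?j + 2 - Suc 0))) (at ?y)"
    by (rule DERIV_power)
   also have "sqrt (1 - ?y\<^sup>2) ^ (?j + 2 - Suc 0) = sqrt (1 - ?y\<^sup>2) * ball_profile ?j ?y"
   proof -
    have "?j + 2 - Suc 0 = Suc ?j" by simp
    thus ?thesis by (simp only: ball_profile_def power_Suc)
   qed
   also have "real (?j + 2) * ((- ?y * inverse (sqrt (1 - ?y\<^sup>2))) * (sqrt (1 - ?y\<^sup>2) * ball_profile ?j ?y))
     = - real (?j + 2) * ?y * ball_profile ?j ?y * (sqrt (1 - ?y\<^sup>2) * inverse (sqrt (1 - ?y\<^sup>2)))"
    by (simp only: mult_ac mult_minus_left mult_minus_right)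
   also have "sqrt (1 - ?y\<^sup>2) * inverse (sqrt (1 - ?y\<^sup>2)) = 1" using y1 by simp
   finally show ?thesis by (simp only: mult_1_right)
  qed
  have "(?G has_real_derivative - H 0 x / (real (?j + 2) * ball_mass ?j) *
    ((- real (?j + 2) * ?y * ball_profile ?j ?y) * (ball_mass ?j / ball_profile ?j ?y * (H 1 (?z s) / H 0 x)))) (at s)"
   by (intro DERIV_cmult DERIV_chain2[OF d2 d])
  moreover have "- H 0 x / (real (?j + 2) * ball_mass ?j) *
    ((- real (?j + 2) * ?y * ball_profile ?j ?y) * (ball_mass ?j / ball_profile ?j ?y * (H 1 (?z s) / H 0 x)))
    = H 1 (?z s) * ?y"
  proof -
   have "- h0 / (a * m) * ((- a * y * p) * (m / p * (h1 / h0))) = h1 * y"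
    if "a ~= 0" "m ~= 0" "p ~= 0" "h0 ~= 0" for a m p h0 h1 y :: real
    using that by (simp add: field_simps)
   moreover have "real (?j + 2) ~= 0" "ball_mass ?j ~= 0" "ball_profile ?j ?y ~= 0" "H 0 x ~= 0"
    using ball_mass_pos[of ?j] ball_profile_pos[OF y, of ?j] H_pos[of 0 x] by auto
   ultimately show ?thesis by blast
  qed
  ultimately show "(?G has_vector_derivative H 1 (?z s) * ?y) (at s)"
   by (simp add: has_real_derivative_iff_has_vector_derivative)
 qed (use L_pos in auto)
 moreover have "?z L $ idx 0 \<in> {-L..L}" "?z (-L) $ idx 0 \<in> {-L..L}" using L_pos by auto
 hence "\<xi> 0 (?z L) = 1" "\<xi> 0 (?z (-L)) = -1"
  unfolding \<xi>_def using F_bounds(3,4)[OF v0, of "?z (-L)"] F_bounds(4)[OF v0, of "?z L"] ball_quantile_ends by auto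
 ultimately show ?thesis by (simp add: integral_unique)
qed

text \<open>The first coordinate of the barycentre of the ball. It will cancel the drift that an
  exponential density causes in the direction \<open>idx 0\<close>.\<close>

lemma integral_h_X_0: "integral kbox (%x. h x * X 0 x) = 0"
proof -
 have v0: "0 < CARD('v)" by simp
 have c: "cts kbox (\<xi> 0)" by (rule continuous_on_\<xi>[OF v0])
 have "integral kbox (%x. h x * \<xi> 0 x) * (2 * L) ^ (CARD('v) - 1) = integral kbox (%x. H (CARD('v) - (CARD('v) - 1)) x * \<xi> 0 x)"
  by (rule integral_H_mult[where k = 1]) (auto intro!: c \<xi>_vupd)
 also have "CARD('v) - (CARD('v) - 1) = 1" using v0 by simp
 also have "2 * L * integral kbox (%x. H 1 x * \<xi> 0 x) =
   integral kbox (%x. integral {-L..L} (%s. H 1 (vupd x (idx 0) s) * \<xi> 0 (vupd x (idx 0) s)))"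
  by (rule integral_kbox_average[symmetric]) (intro continuous_on_mult continuous_on_H c)
 hence "integral kbox (%x. H 1 x * \<xi> 0 x) = 0" using L_pos unfolding integral_slice_\<xi> by simp
 finally show ?thesis using L_pos by (simp add: X_def r_def)
qed

text \<open>The transport coordinates and their derivatives are controlled inside the cube only.
  Multiplied by a function supported strictly inside, they extend by zero.\<close>

lemma continuous_on_cutoff:
 assumes g: "cts UNIV g" "!!x. norm x > R ==> g x = 0" "R < L" and Z: "cts obox Z"
 shows "cts UNIV (%x. g x * Z x :: real)"
proof -
 have "x \<in> obox" if "norm x <= R" for x
 proof -
  have "- L < x $ i & x $ i < L" for i using component_le_norm_cart[of x i] that g(3) by linarith
  thus ?thesis by (auto simp: obox_def)
 qed
 hence U: "UNIV = obox \<union> {x :: real ^ 'v. norm x > R}" by force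
 have op: "open {x :: 'v rv. norm x > R}" by (intro open_Collect_less continuous_intros)
 have "cts (obox \<union> {x. norm x > R}) (%x. g x * Z x)"
 proof (rule continuous_on_open_Un[OF open_obox op])
  show "cts obox (%x. g x * Z x)"
   by (intro continuous_on_mult Z continuous_on_subset[OF g(1)]) auto
  show "cts {x. norm x > R} (%x. g x * Z x)"
   by (rule continuous_on_cong[THEN iffD1, OF refl _ continuous_on_const[of _ 0]]) (auto simp: g(2))
 qed
 thus ?thesis using U by simp
qed

lemma support_obox:
 assumes "R < L" "x \<notin> obox"
 shows "norm x > R"
proof (rule ccontr)
 assume "\<not> norm x > R"
 hence "- L < x $ i & x $ i < L" for i using component_le_norm_cart[of x i] assms(1) by linarith
 thus False using assms(2) by (auto simp: obox_def)
qed

text \<open>One summand of the divergence theorem for the field with components wt g X_k.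
  Differentiating along \<open>idx k\<close> alone matches the single derivative known for
  \<open>X k\<close>.\<close>

lemma integral_by_parts_X:
 assumes g: "smooth_on UNIV g" "!!x. norm x > R ==> g x = 0" "R < L" and k: "k < CARD('v)"
  and wt: "cts UNIV wt" "cts UNIV wt'"
   "!!x. RD (%t. wt (x + t *\<^sub>R axis (idx k) 1)) 0 :> wt' x"
 defines "D \<equiv> %x. wt' x * (g x * X k x) + wt x * (partial_deriv (idx k) g x * X k x) + wt x * (g x * Y k x)"
 shows "integrable lborel D" "(LBINT x. D x) = 0"
proof -
 have op: "open {x :: real ^ 'v. norm x > R}" by (intro open_Collect_less continuous_intros)
 have g0: "partial_deriv (idx k) g x = 0" if "norm x > R" for x
  by (rule partial_deriv_zero[OF op]) (use that g(2) in auto)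
 have Xc: "cts obox (X k)" by (rule continuous_on_subset[OF continuous_on_X[OF k] obox_subset])
 have gc: "cts UNIV g" by (rule smooth_on_cts[OF g(1)])
 have pc: "cts UNIV (partial_deriv (idx k) g)"
  by (rule smooth_on_cts[OF smooth_on_partial_deriv[OF g(1)]])
 have cX: "cts UNIV (%x. g x * X k x)" by (rule continuous_on_cutoff[OF gc g(2,3) Xc])
 have c': "cts UNIV (%x. partial_deriv (idx k) g x * X k x)" by (rule continuous_on_cutoff[OF pc g0 g(3) Xc])
 have cY: "cts UNIV (%x. g x * Y k x)" by (rule continuous_on_cutoff[OF gc g(2,3) continuous_on_Y[OF k]])
 have D: "cts UNIV D" unfolding D_def by (intro continuous_on_add continuous_on_mult[OF wt(2) cX] continuous_on_mult[OF wt(1) c'] continuous_on_mult[OF wt(1) cY])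
 have D0: "D x = 0" if "norm x > R" for x using that by (simp add: D_def g(2) g0)
 show "integrable lborel D" by (rule integrable_continuous_bounded_support[OF D D0])
 show "(LBINT x. D x) = 0"
 proof (rule integral_directional_derivative_zero[where g = "%x. wt x * (g x * X k x)" and e = "axis (idx k) 1" and R = R])
  show "cts UNIV (%x. wt x * (g x * X k x))" by (intro continuous_on_mult wt(1) cX)
  show "wt x * (g x * X k x) = 0" if "norm x > R" for x using g(2)[OF that] by simp
  show "((%t. wt (x + t *\<^sub>R axis (idx k) 1) * (g (x + t *\<^sub>R axis (idx k) 1) * X k (x + t *\<^sub>R axis (idx k) 1)))
    has_real_derivative D x) (at 0)" for x
  proof (cases "x \<in> obox")
   case True
   have "((%t. wt (x + t *\<^sub>R axis (idx k) 1) * (g (x + t *\<^sub>R axis (idx k) 1) * X k (x + t *\<^sub>R axis (idx k) 1)))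
    has_real_derivative wt' x * (g (x + 0 *\<^sub>R axis (idx k) 1) * X k (x + 0 *\<^sub>R axis (idx k) 1))
     + (partial_deriv (idx k) g x * X k (x + 0 *\<^sub>R axis (idx k) 1) + Y k x * g (x + 0 *\<^sub>R axis (idx k) 1)) * wt (x + 0 *\<^sub>R axis (idx k) 1)) (at 0)"
    by (intro DERIV_mult wt(3) partial_deriv_directional smooth_on_differentiable[OF g(1)] X_has_derivative[OF k True])
   thus ?thesis by (simp add: D_def algebra_simps)
  next
   case False
   hence R: "norm x > R" by (rule support_obox[OF g(3)])
   have op': "open ((%t. x + t *\<^sub>R axis (idx k) 1 :: 'v rv) -` {x. norm x > R})"
    by (rule open_vimage[OF op]) (intro continuous_intros)
   have "RD (%t::real. 0::real) 0 :> 0" by simp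
   thus ?thesis unfolding D0[OF R]
    by (rule has_field_derivative_transform_within_open[OF _ op']) (use R g(2) in auto)
  qed
 qed (rule D)
qed

end

definition hgrad :: "'v => real => (real ^ 'v::finite => real) => real ^ 'v => real" where
 "hgrad io b g p = sqrt (\<Sum>i\<in>UNIV. (partial_deriv i g p)^2 / (if i = io then 1 else exp (2 * b * p $ io)))"

lemma hgrad_nonneg: "hgrad io b g p >= 0"
 unfolding hgrad_def by (intro real_sqrt_ge_zero sum_nonneg) auto

lemma continuous_on_hgrad:
 assumes "smooth_on UNIV g"
 shows "cts UNIV (hgrad io b g)"
proof -
 have "cts UNIV (%p. if i = io then 1 else exp (2 * b * p $ io))" for i
  by (cases "i = io") (auto intro!: continuous_intros)
 thus ?thesis unfolding hgrad_def[abs_def]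
  by (intro continuous_intros smooth_on_cts[OF smooth_on_partial_deriv[OF assms]]) auto
qed

text \<open>Gromov's argument in an exponentially weighted space: integrate the divergence of g
  times the transport field, with the ball-valued field expressed in the orthonormal frame of the
  metric. The transport part is bounded below by the arithmetic-geometric mean inequality, the
  gradient part by |X| <= 1, and the drift has almost zero mean. The constant \<open>ta\<close>
  makes the density positive on the cube.\<close>

lemma horospherical_isoperimetric_approx:
 fixes g :: "real ^ 'v::finite => real" and io :: 'v
 assumes g: "smooth_on UNIV g" "!!x. norm x > R ==> g x = 0" "!!x. g x >= 0" and R: "R < L" "L > 0"
  and b: "b >= 0" and ta: "ta > 0"
 defines "J \<equiv> hdens io b" and "n \<equiv> real CARD('v)"
 shows "n * unit_ball_vol n powr (1 / n) * (LBINT x. g x * g x powr (1 / n) * J x) <=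
  ((LBINT x. g x * J x) + ta * (2 * L) ^ CARD('v)) powr (1 / n) *
  ((LBINT x. J x * hgrad io b g x) + b * (n - 1) * ta * (2 * L) ^ CARD('v))"
proof -
 obtain idx0 :: "nat => 'v" where idx0: "bij_betw idx0 {..<CARD('v)} UNIV"
  using ex_bij_betw_nat_finite[of "UNIV :: 'v set"] by (auto simp: atLeast0LessThan)
 hence "io \<in> idx0 ` {..<CARD('v)}" by (simp add: bij_betw_def)
 then obtain k0 where k0: "k0 < CARD('v)" "idx0 k0 = io" by auto
 \<comment> \<open>The drift acts along \<open>io\<close>, and the transport coordinate known to
   have mean zero is the first one, so \<open>io\<close> is moved to the front.\<close>
 define idx where "idx = idx0 \<circ> Transposition.transpose 0 k0"
 have "bij_betw (Transposition.transpose 0 k0) {..<CARD('v)} {..<CARD('v)}"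
  using k0(1) by (intro bij_betw_byWitness[where f' = "Transposition.transpose 0 k0"])
   (auto simp: Transposition.transpose_def)
 hence idx: "bij_betw idx {..<CARD('v)} UNIV" unfolding idx_def by (rule bij_betw_trans[OF _ idx0])
 have idx_0: "idx 0 = io" by (simp add: idx_def k0(2))
 have Jpos: "J x > 0" for x unfolding J_def by (rule hdens_pos)
 have Jc: "cts UNIV J" unfolding J_def by (rule continuous_on_hdens)
 have gc: "cts UNIV g" by (rule smooth_on_cts[OF g(1)])
 define h where "h x = g x * J x + ta" for x
 interpret knothe h L idx
 proof
  show "cts UNIV h" unfolding h_def by (intro continuous_intros gc Jc)
  show "h x > 0" for x using g(3)[of x] Jpos[of x] ta by (simp add: h_def add_nonneg_pos less_imp_le)
 qed (use R idx in auto)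
 \<comment> \<open>The orthonormal frame consists of the axis \<open>io\<close> and of e times the
   other axes; \<open>wt k\<close> is the density times the k-th frame factor.\<close>
 define e where "e x = exp (- b * x $ io)" for x :: "real ^ 'v"
 define wt where "wt k x = J x * (if k = 0 then 1 else e x)" for k :: nat and x
 define wt' where "wt' k x = (if k = 0 then b * (n - 1) * J x else 0)" for k :: nat and x
 have ec: "cts UNIV e" unfolding e_def by (intro continuous_intros)
 have wt'c: "cts UNIV (wt' k)" for k unfolding wt'_def by (cases "k = 0") (auto intro!: continuous_intros Jc)
 have wtc: "cts UNIV (wt k)" for k unfolding wt_def by (cases "k = 0") (auto intro!: continuous_intros Jc ec)
 have wtd: "RD (%t. wt k (x + t *\<^sub>R axis (idx k) 1)) 0 :> wt' k x" if k: "k < CARD('v)" for k x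
 proof (cases "k = 0")
  case True
  thus ?thesis using hdens_has_derivative[of io b x] by (simp add: wt_def wt'_def idx_0 J_def n_def)
 next
  case False
  hence "idx k ~= io" using idx_eq_iff[of k 0] k idx_0 by auto
  hence "wt k (x + t *\<^sub>R axis (idx k) 1) = wt k x" for t
   by (simp add: wt_def J_def hdens_def e_def axis_def)
  thus ?thesis using False by (simp add: wt'_def)
 qed
 define D where "D k x = wt' k x * (g x * X k x) + wt k x * (partial_deriv (idx k) g x * X k x) + wt k x * (g x * Y k x)" for k x
 have D: "integrable lborel (D k)" "(LBINT x. D k x) = 0" if k: "k < CARD('v)" for k
  unfolding D_def using integral_by_parts_X[OF g(1,2) R(1) k wtc wt'c wtd[OF k]] by auto
 define G0 where "G0 = (LBINT x. g x * J x)"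
 define H0 where "H0 = integral kbox h"
 have n1: "n >= 1" unfolding n_def using zero_less_card_finite[where 'a = 'v] by linarith
 have op: "open {x :: 'v rv. norm x > R}" by (intro open_Collect_less continuous_intros)
 have g0': "partial_deriv i g x = 0" if "norm x > R" for i x
  by (rule partial_deriv_zero[OF op]) (use that g(2) in auto)
 have int_gJ: "integrable lborel (%x. g x * J x)"
  by (rule integrable_continuous_bounded_support[of _ R]) (auto intro!: continuous_on_mult gc Jc simp: g(2))
 have hg0: "hgrad io b g x = 0" if "norm x > R" for x using g0'[OF that] by (simp add: hgrad_def)
 have int_grad: "integrable lborel (%x. J x * hgrad io b g x)"
  by (rule integrable_continuous_bounded_support[of _ R])
   (use hg0 in \<open>auto intro!: continuous_on_mult Jc continuous_on_hgrad[OF g(1)]\<close>)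
 have int_Q: "integrable lborel (%x. g x * g x powr (1 / n) * J x)"
  by (rule integrable_continuous_bounded_support[of _ R])
   (use n1 g(3) in \<open>auto intro!: continuous_on_mult continuous_on_powr' gc Jc continuous_on_const simp: g(2)\<close>)
 have gX: "cts UNIV (%x. g x * X 0 x)"
  by (rule continuous_on_cutoff[OF gc g(2) R(1) continuous_on_subset[OF continuous_on_X obox_subset]]) auto
 have gJX: "cts UNIV (%x. J x * (g x * X 0 x))" by (intro continuous_on_mult Jc gX)
 have int_gX: "integrable lborel (%x. J x * (g x * X 0 x))"
  by (rule integrable_continuous_bounded_support[OF gJX, of R]) (simp add: g(2))
 have off: "norm x > R" if "x \<notin> kbox" for x
  using support_obox[OF R(1), of x] that obox_subset by auto
 have X0: "X 0 x <= 1" if "x \<in> kbox" for x using \<xi>_bounds(1)[of 0 x] that by (simp add: X_def r_def)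
 have H0: "H0 = G0 + ta * (2 * L) ^ CARD('v)"
 proof -
  have "G0 = integral kbox (%x. g x * J x)"
   unfolding G0_def by (rule integral_lborel_eq_on[OF int_gJ]) (use off g(2) in auto)
  moreover have "(%x. g x * J x) integrable_on kbox" "(%x. ta) integrable_on kbox"
   unfolding kbox_eq by (auto intro!: integrable_continuous continuous_on_mult continuous_on_subset[OF gc] continuous_on_subset[OF Jc])
  moreover have "integral kbox (%x. ta * 1) = ta * (2 * L) ^ CARD('v)"
   unfolding content_kbox[symmetric] by (rule integral_mult_right)
  ultimately show ?thesis unfolding H0_def h_def by (simp add: Henstock_Kurzweil_Integration.integral_add)
 qed
 have H0pos: "H0 > 0" using H_pos[of 0] unfolding H0_def H_0_eq by simp
 \<comment> \<open>The integral of h X_0 is zero, so the part with g equals minus the part with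
   \<open>ta\<close>, and X_0 <= 1 bounds that by \<open>ta\<close> times the volume of the
   cube.\<close>
 have drift: "- (ta * (2 * L) ^ CARD('v)) <= (LBINT x. J x * (g x * X 0 x))"
 proof -
  have Xi: "cts kbox (X 0)" by (rule continuous_on_X) simp
  have "0 = integral kbox (%x. J x * (g x * X 0 x) + ta * X 0 x)"
   using integral_h_X_0 by (simp add: h_def algebra_simps)
  also have "... = integral kbox (%x. J x * (g x * X 0 x)) + integral kbox (%x. ta * X 0 x)"
   using continuous_on_subset[OF gJX, of kbox] Xi unfolding kbox_eq
   by (intro Henstock_Kurzweil_Integration.integral_add integrable_continuous)
    (auto intro!: continuous_on_mult)
  also have "integral kbox (%x. J x * (g x * X 0 x)) = (LBINT x. J x * (g x * X 0 x))"
   by (rule integral_lborel_eq_on[OF int_gX, symmetric]) (use off g(2) in auto)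
  finally have "(LBINT x. J x * (g x * X 0 x)) = - integral kbox (%x. ta * X 0 x)" by simp
  moreover have "integral kbox (%x. ta * X 0 x) <= integral kbox (%x. ta * 1)"
  proof (rule integral_le)
   show "(%x. ta * X 0 x) integrable_on kbox"
    using Xi unfolding kbox_eq by (intro integrable_continuous continuous_intros)
   show "(%x. ta * 1) integrable_on kbox" unfolding kbox_eq by (intro integrable_continuous continuous_intros)
   show "ta * X 0 x <= ta * 1" if "x \<in> kbox" for x using X0[OF that] ta by simp
  qed
  moreover have "integral kbox (%x. ta * 1) = ta * (2 * L) ^ CARD('v)"
   unfolding content_kbox[symmetric] by (rule integral_mult_right)
  ultimately show ?thesis by simp
 qed
 let ?c = "n * unit_ball_vol n powr (1 / n) * H0 powr (- (1 / n))"
 \<comment> \<open>The three summands of D are drift, gradient and transport. The drift is kept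
   exactly, and the other two are estimated pointwise by c and d.\<close>
 have pt: "?c * (g x * g x powr (1 / n) * J x) + b * (n - 1) * (J x * (g x * X 0 x)) - J x * hgrad io b g x <= (\<Sum>k<CARD('v). D k x)" for x
 proof (cases "x \<in> obox")
  case False
  hence "norm x > R" by (rule support_obox[OF R(1)])
  thus ?thesis using g(2) g0' hg0 by (simp add: D_def)
 next
  case True
  let ?q = "%k. if k = 0 then 1 else e x"
  have epos: "e x > 0" by (simp add: e_def)
  have a: "(\<Sum>k<CARD('v). wt' k x * (g x * X k x)) = b * (n - 1) * (J x * (g x * X 0 x))"
  proof -
   have "(\<Sum>k<CARD('v). wt' k x * (g x * X k x)) = (\<Sum>k<CARD('v). if k = 0 then b * (n - 1) * (J x * (g x * X 0 x)) else 0)"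
    by (rule sum.cong) (auto simp: wt'_def)
   thus ?thesis by (simp add: sum.delta)
  qed
  have c: "- (J x * hgrad io b g x) <= (\<Sum>k<CARD('v). wt k x * (partial_deriv (idx k) g x * X k x))"
  proof -
   have h2: "(\<Sum>k<CARD('v). (?q k * partial_deriv (idx k) g x)^2) = (hgrad io b g x)^2"
   proof -
    have "(hgrad io b g x)^2 = (\<Sum>i\<in>UNIV. (partial_deriv i g x)^2 / (if i = io then 1 else exp (2 * b * x $ io)))"
     unfolding hgrad_def by (intro real_sqrt_pow2 sum_nonneg) auto
    also have "... = (\<Sum>k<CARD('v). (partial_deriv (idx k) g x)^2 / (if idx k = io then 1 else exp (2 * b * x $ io)))"
     by (rule sum.reindex_bij_betw[OF idx, symmetric])
    also have "... = (\<Sum>k<CARD('v). (?q k * partial_deriv (idx k) g x)^2)"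
    proof (rule sum.cong)
     fix k assume "k \<in> {..<CARD('v)}"
     hence "idx k = io \<longleftrightarrow> k = 0" using idx_eq_iff[of k 0] idx_0 by auto
     moreover have "(e x)^2 = inverse (exp (2 * b * x $ io))"
      by (simp add: e_def exp_minus[symmetric] power2_eq_square exp_add[symmetric])
     ultimately show "(partial_deriv (idx k) g x)^2 / (if idx k = io then 1 else exp (2 * b * x $ io)) = (?q k * partial_deriv (idx k) g x)^2"
      by (simp add: power_mult_distrib divide_inverse mult.commute)
    qed simp
    finally show ?thesis ..
   qed
   have "(\<Sum>k<CARD('v). (X k x)^2) = 1 - (r CARD('v) x)\<^sup>2"
    by (rule sum_X_square) (use True obox_subset in auto)
   hence X1: "(\<Sum>k<CARD('v). (X k x)^2) <= 1" by simp
   have "(\<Sum>k<CARD('v). (?q k * partial_deriv (idx k) g x) * X k x)^2 <= (hgrad io b g x)^2 * (\<Sum>k<CARD('v). (X k x)^2)"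
    unfolding h2[symmetric] by (rule Cauchy_Schwarz_ineq_sum)
   also have "... <= (hgrad io b g x)^2 * 1" by (intro mult_left_mono X1) auto
   finally have "\<bar>\<Sum>k<CARD('v). (?q k * partial_deriv (idx k) g x) * X k x\<bar> <= hgrad io b g x"
    unfolding mult_1_right abs_le_square_iff[symmetric] abs_of_nonneg[OF hgrad_nonneg] .
   hence "- hgrad io b g x <= (\<Sum>k<CARD('v). (?q k * partial_deriv (idx k) g x) * X k x)" by linarith
   hence "J x * (- hgrad io b g x) <= J x * (\<Sum>k<CARD('v). (?q k * partial_deriv (idx k) g x) * X k x)"
    by (rule mult_left_mono[OF _ less_imp_le[OF Jpos]])
   also have "... = (\<Sum>k<CARD('v). wt k x * (partial_deriv (idx k) g x * X k x))"
    unfolding sum_distrib_left by (intro sum.cong) (auto simp: wt_def)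
   finally show ?thesis by simp
  qed
  have d: "?c * (g x * g x powr (1 / n) * J x) <= (\<Sum>k<CARD('v). wt k x * (g x * Y k x))"
  proof -
   let ?a = "%k. ?q k * Y k x"
   have an: "?a k >= 0" if "k < CARD('v)" for k
    using Y_pos[OF that True] epos by (simp add: less_imp_le)
   have "(\<Prod>k<CARD('v). ?a k) = (\<Prod>k<CARD('v). ?q k) * (unit_ball_vol n * (h x / H0))"
    unfolding prod.distrib prod_Y[OF True] by (simp add: H0_def H_0_eq n_def)
   also have "(\<Prod>k<CARD('v). ?q k) = e x ^ (CARD('v) - 1)"
   proof -
    have "(\<Prod>k<CARD('v). ?q k) = (\<Prod>k<CARD('v) - 1. e x)"
     using prod.lessThan_Suc_shift[of ?q "CARD('v) - 1"] by simp
    thus ?thesis by simp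
   qed
   \<comment> \<open>The v - 1 nontrivial frame factors multiply to the reciprocal of the density,
     so J cancels against the J in h and the constant is the Euclidean one.\<close>
   also have "e x ^ (CARD('v) - 1) = inverse (J x)"
   proof -
    have "real (CARD('v) - 1) = n - 1" by (simp add: n_def of_nat_diff)
    thus ?thesis unfolding e_def J_def hdens_def exp_of_nat_mult[symmetric]
     by (simp add: exp_minus[symmetric] n_def mult_ac)
   qed
   finally have prod: "(\<Prod>k<CARD('v). ?a k) = inverse (J x) * (unit_ball_vol n * (h x / H0))" .
   have "unit_ball_vol n * (g x / H0) <= (\<Prod>k<CARD('v). ?a k)"
   proof -
    have "J x * (g x / H0) <= h x / H0" using ta H0pos by (simp add: h_def divide_right_mono mult.commute)
    hence "unit_ball_vol n * (J x * (g x / H0)) <= unit_ball_vol n * (h x / H0)"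
     using n1 by (intro mult_left_mono) (auto simp: unit_ball_vol_nonneg)
    hence "inverse (J x) * (unit_ball_vol n * (J x * (g x / H0))) <= inverse (J x) * (unit_ball_vol n * (h x / H0))"
     by (rule mult_left_mono[OF _ less_imp_le[OF positive_imp_inverse_positive[OF Jpos]]])
    also have "inverse (J x) * (unit_ball_vol n * (J x * (g x / H0))) = (inverse (J x) * J x) * (unit_ball_vol n * (g x / H0))"
     by (simp only: mult_ac)
    also have "inverse (J x) * J x = 1" using Jpos[of x] by simp
    finally show ?thesis unfolding prod by simp
   qed
   hence "(unit_ball_vol n * (g x / H0)) powr (1 / n) <= (\<Prod>k<CARD('v). ?a k) powr (1 / real (card {..<CARD('v)}))"
    using n1 g(3)[of x] H0pos by (auto simp: n_def intro!: powr_mono2)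
   also have "... <= (\<Sum>k<CARD('v). ?a k / real (card {..<CARD('v)}))"
   proof (rule arith_geom_mean)
    have "0 \<in> {..<CARD('v)}" by simp
    thus "{..<CARD('v)} ~= {}" by blast
   qed (use an in auto)
   also have "... = (\<Sum>k<CARD('v). ?a k) / n" by (simp add: sum_divide_distrib n_def)
   finally have "n * (unit_ball_vol n * (g x / H0)) powr (1 / n) <= (\<Sum>k<CARD('v). ?a k)"
    using n1 by (simp add: pos_le_divide_eq mult.commute)
   moreover have "n * (unit_ball_vol n * (g x / H0)) powr (1 / n) = ?c * g x powr (1 / n)"
    using g(3)[of x] H0pos n1 by (simp add: powr_mult powr_divide powr_minus_divide)
   ultimately have "(g x * J x) * (?c * g x powr (1 / n)) <= (g x * J x) * (\<Sum>k<CARD('v). ?a k)"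
    using g(3)[of x] Jpos[of x] by (intro mult_left_mono) (auto intro: less_imp_le)
   also have "... = (\<Sum>k<CARD('v). wt k x * (g x * Y k x))"
    unfolding sum_distrib_left by (intro sum.cong) (auto simp: wt_def)
   finally show ?thesis by (simp only: mult_ac)
  qed
  show ?thesis unfolding D_def sum.distrib a using c d by linarith
 qed
 have "?c * (LBINT x. g x * g x powr (1 / n) * J x) + b * (n - 1) * (LBINT x. J x * (g x * X 0 x))
   - (LBINT x. J x * hgrad io b g x)
   = (LBINT x. ?c * (g x * g x powr (1 / n) * J x) + b * (n - 1) * (J x * (g x * X 0 x)) - J x * hgrad io b g x)"
  using int_Q int_gX int_grad by (simp only: Bochner_Integration.integral_diff Bochner_Integration.integral_add
   integral_mult_right_zero integrable_mult_right Bochner_Integration.integrable_add)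
 also have "... <= (LBINT x. (\<Sum>k<CARD('v). D k x))"
  by (intro integral_mono pt Bochner_Integration.integrable_diff Bochner_Integration.integrable_add integrable_mult_right
   Bochner_Integration.integrable_sum int_Q int_gX int_grad D(1)) auto
 also have "... = 0" using D by (simp add: Bochner_Integration.integral_sum)
 finally have "?c * (LBINT x. g x * g x powr (1 / n) * J x) <=
   (LBINT x. J x * hgrad io b g x) - b * (n - 1) * (LBINT x. J x * (g x * X 0 x))" by linarith
 also have "... <= (LBINT x. J x * hgrad io b g x) + b * (n - 1) * ta * (2 * L) ^ CARD('v)"
  using mult_left_mono[OF drift, of "b * (n - 1)"] b n1 by (simp add: mult.assoc)
 finally have "H0 powr (1 / n) * (?c * (LBINT x. g x * g x powr (1 / n) * J x)) <=
   H0 powr (1 / n) * ((LBINT x. J x * hgrad io b g x) + b * (n - 1) * ta * (2 * L) ^ CARD('v))"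
  by (intro mult_left_mono) auto
 also have "H0 powr (1 / n) * (?c * (LBINT x. g x * g x powr (1 / n) * J x)) =
   (H0 powr (1 / n) * H0 powr (- (1 / n))) * (n * unit_ball_vol n powr (1 / n) * (LBINT x. g x * g x powr (1 / n) * J x))"
  by (simp only: mult_ac)
 also have "H0 powr (1 / n) * H0 powr (- (1 / n)) = 1" using H0pos by (simp add: powr_add[symmetric])
 finally show ?thesis unfolding G0_def[symmetric] H0[symmetric] by simp
qed

text \<open>The limit of vanishing \<open>ta\<close>. For g close to the indicator of a set E it is
  the Euclidean isoperimetric inequality n \<omega>^(1/n) |E|^(1 - 1/n) <= Per E, in a functional
  form that speaks of smooth functions only.\<close>

lemma horospherical_isoperimetric:
 fixes g :: "real ^ 'v::finite => real" and io :: 'v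
 assumes g: "smooth_on UNIV g" "!!x. norm x > R ==> g x = 0" "!!x. g x >= 0" and b: "b >= 0"
 defines "J \<equiv> hdens io b" and "n \<equiv> real CARD('v)"
 shows "n * unit_ball_vol n powr (1 / n) * (LBINT x. g x * g x powr (1 / n) * J x) <=
  (LBINT x. g x * J x) powr (1 / n) * (LBINT x. J x * hgrad io b g x)"
proof -
 define L where "L = \<bar>R\<bar> + 1"
 have L: "R < L" "L > 0" by (auto simp: L_def)
 let ?c = "%ta. ((LBINT x. g x * J x) + ta * (2 * L) ^ CARD('v)) powr (1 / n) *
  ((LBINT x. J x * hgrad io b g x) + b * (n - 1) * ta * (2 * L) ^ CARD('v))"
 have n: "n > 0" unfolding n_def by simp
 have nn: "(LBINT x. g x * J x) >= 0"
  using g(3) by (intro integral_nonneg_AE AE_I2 mult_nonneg_nonneg) (auto simp: J_def less_imp_le[OF hdens_pos])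
 have "(?c \<longlongrightarrow> ?c 0) (at_right 0)"
 proof (intro tendsto_mult tendsto_add tendsto_const tendsto_powr' tendsto_ident_at)
  show "(LBINT x. g x * J x) + 0 * (2 * L) ^ CARD('v) ~= 0 \<or>
   0 < 1 / n & (\<forall>\<^sub>F x in at_right 0. 0 <= (LBINT x. g x * J x) + x * (2 * L) ^ CARD('v))"
   using n nn L by (auto simp: eventually_at_filter intro!: always_eventually)
 qed
 moreover have "\<forall>\<^sub>F ta in at_right 0. n * unit_ball_vol n powr (1 / n) * (LBINT x. g x * g x powr (1 / n) * J x) <= ?c ta"
  using horospherical_isoperimetric_approx[OF g L b] eventually_at_right_less[of "0::real"]
  by (auto elim!: eventually_mono simp: J_def n_def)
 ultimately have "n * unit_ball_vol n powr (1 / n) * (LBINT x. g x * g x powr (1 / n) * J x) <= ?c 0"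
  by (intro tendsto_lowerbound) auto
 thus ?thesis by simp
qed

section \<open>A smooth layer-cake kernel\<close>

text \<open>For large even \<open>N\<close> the function \<open>chi N s u\<close> approximates the indicator of \<open>\<bar>u\<bar> > s\<close>. It is
 smooth in \<open>(s, u)\<close> for \<open>s > 0\<close>, which is what makes the rearrangement below smooth.\<close>

definition chi :: "nat => real => real => real" where
 "chi N s u = u ^ N / (u ^ N + s ^ N)"

definition chi_u :: "nat => real => real => real" where
 "chi_u N s u = real N * u ^ (N - 1) * s ^ N / (u ^ N + s ^ N)\<^sup>2"

text \<open>Minus the derivative in s, which makes it nonnegative. For large N it concentrates near
  s = |u|.\<close>

definition chi_s :: "nat => real => real => real" where
 "chi_s N s u = real N * s ^ (N - 1) * u ^ N / (u ^ N + s ^ N)\<^sup>2"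

text \<open>The weight complementary to \<open>chi_s\<close> in Cauchy-Schwarz, with chi_u^2 = chi_s
  chi_b. It is (s / u)^2 chi_s in a form that makes sense at u = 0.\<close>

definition chi_b :: "nat => real => real => real" where
 "chi_b N s u = real N * s ^ (N + 1) * u ^ (N - 2) / (u ^ N + s ^ N)\<^sup>2"

lemma chi_denom_pos: "even N ==> s > 0 ==> u ^ N + s ^ N > (0::real)"
 by (intro add_nonneg_pos) (auto simp: zero_le_even_power)

lemma chi_bounds:
 assumes "even N" "s > 0"
 shows "0 <= chi N s u" "chi N s u <= 1"
 using chi_denom_pos[OF assms, of u] assms by (auto simp: chi_def zero_le_even_power)

lemma chi_nonneg_derivs:
 assumes "even N" "s > 0"
 shows "0 <= chi_s N s u" "0 <= chi_b N s u"
 using chi_denom_pos[OF assms, of u] assms by (auto simp: chi_s_def chi_b_def zero_le_even_power)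

lemma chi_zero:
 assumes "N > 2"
 shows "chi N s 0 = 0" "chi_u N s 0 = 0" "chi_s N s 0 = 0" "chi_b N s 0 = 0"
 using assms by (auto simp: chi_def chi_u_def chi_s_def chi_b_def)

lemma chi_s_pos: "even N ==> N > 0 ==> s > 0 ==> u ~= 0 ==> chi_s N s u > 0"
 using chi_denom_pos[of N s u] by (auto simp: chi_s_def zero_less_power_eq intro!: divide_pos_pos mult_pos_pos)

text \<open>The defect chi - chi^2 tells how far the kernel is from an indicator. It carries a
  factor 1/N and is the source of the isoperimetric error term.\<close>

lemma chi_s_eq:
 assumes "even N" "N > 0" "s > 0"
 shows "s / real N * chi_s N s u = chi N s u - (chi N s u)\<^sup>2"
proof -
 have d: "u ^ N + s ^ N ~= 0" using chi_denom_pos[OF assms(1,3), of u] by simp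
 have "s * s ^ (N - 1) = s ^ N" using assms(2) by (cases N) auto
 hence "s / real N * chi_s N s u = s ^ N * u ^ N / (u ^ N + s ^ N)\<^sup>2"
  using assms(2) by (simp add: chi_s_def mult.assoc[symmetric])
 also have "... = chi N s u - (chi N s u)\<^sup>2"
 proof -
  have "c * a / (a + c)\<^sup>2 = a / (a + c) - (a / (a + c))\<^sup>2" if "a + c ~= 0" for a c :: real
  proof -
   have "a / (a + c) - (a / (a + c))\<^sup>2 = a * (a + c) / (a + c)\<^sup>2 - a\<^sup>2 / (a + c)\<^sup>2"
    using that by (simp add: power_divide power2_eq_square)
   also have "... = (a * (a + c) - a\<^sup>2) / (a + c)\<^sup>2" by (rule diff_divide_distrib[symmetric])
   also have "a * (a + c) - a\<^sup>2 = c * a" by (simp add: power2_eq_square algebra_simps)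
   finally show ?thesis ..
  qed
  thus ?thesis unfolding chi_def using d by blast
 qed
 finally show ?thesis .
qed

lemma chi_u_square:
 assumes "N > 2"
 shows "(chi_u N s u)^2 = chi_s N s u * chi_b N s u" "u^2 * chi_b N s u = s^2 * chi_s N s u"
proof -
 obtain m where N: "N = m + 2" using assms by (metis add.commute le_add_diff_inverse less_imp_le)
 show "(chi_u N s u)^2 = chi_s N s u * chi_b N s u"
  by (simp add: N chi_u_def chi_s_def chi_b_def power2_eq_square mult_ac)
 show "u^2 * chi_b N s u = s^2 * chi_s N s u"
  by (simp add: N chi_s_def chi_b_def power2_eq_square mult_ac)
qed

lemma chi_has_derivative_s:
 assumes N: "even N" "N > 0" and s: "s > 0"
 shows "RD (%s. chi N s u) s :> - chi_s N s u"
 using chi_denom_pos[OF N(1) s, of u] unfolding chi_def chi_s_def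
 by (auto intro!: derivative_eq_intros simp: power2_eq_square mult_ac)

lemma chi_has_derivative_u:
 assumes N: "even N" "N > 0" and s: "s > 0"
 shows "(chi N s has_real_derivative chi_u N s u) (at u)"
proof -
 have u: "u * u ^ (N - 1) = u ^ N" using N by (cases N) auto
 show ?thesis using chi_denom_pos[OF N(1) s, of u] unfolding chi_def[abs_def] chi_u_def
  by (auto intro!: derivative_eq_intros simp: power2_eq_square algebra_simps)
qed

lemma chi_mono_le:
 assumes N: "even N" and s: "s > 0" and u: "\<bar>u\<bar> <= a"
 shows "chi N s u <= (a / s) ^ N"
proof -
 have "chi N s u <= u ^ N / s ^ N"
  unfolding chi_def using N s chi_denom_pos[OF N s, of u] by (intro divide_left_mono) (auto simp: zero_le_even_power)
 also have "u ^ N = \<bar>u\<bar> ^ N" using N by (simp add: power_even_abs)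
 also have "\<bar>u\<bar> ^ N / s ^ N <= a ^ N / s ^ N" using u s by (intro divide_right_mono power_mono) auto
 finally show ?thesis by (simp add: power_divide)
qed

text \<open>The factor (s / u)^2 relating \<open>chi_b\<close> to \<open>chi_s\<close> is at most
  chi^(-2/N), and chi^(-2/N) chi_s has the primitive -chi^\<theta> / \<theta> with \<theta> = 1 -
  2/N. The resulting bound 1/\<theta> tends to 1, so energies are compared without loss in the
  limit.\<close>

lemma nn_integral_chi_b:
 assumes N: "even N" "N > 2" and s: "0 < s0" "s0 <= s1"
 shows "(LBNN s. ennreal (chi_b N s u) * ind {s0..s1} s) <= ennreal (real N / (real N - 2))"
proof (cases "u = 0")
 case True
 thus ?thesis using N by (simp add: chi_zero)
next
 case False
 let ?\<theta> = "1 - 2 / real N"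
 let ?B = "%s. - (1 / ?\<theta>) * chi N s u powr ?\<theta>"
 let ?b = "%s. chi N s u powr (- (2 / real N)) * chi_s N s u"
 have \<theta>: "?\<theta> > 0" using N by (simp add: field_simps)
 have N0: "N > 0" using N by simp
 have chi_pos: "chi N s u > 0" if "s > 0" for s
  using False N chi_denom_pos[OF N(1) that, of u] unfolding chi_def by (intro divide_pos_pos) (auto simp: zero_less_power_eq)
 have le: "chi_b N s u <= ?b s" if s: "s > 0" for s
 proof -
  have "chi_b N s u = (s / u)^2 * chi_s N s u"
   using chi_u_square(2)[OF N(2), of u s] False by (simp add: power_divide field_simps)
  moreover have "(s / u)^2 <= chi N s u powr (- (2 / real N))"
  proof -
   have "(s / u)^2 = (s / \<bar>u\<bar>)^2" by (simp add: power_divide)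
   also have "... = (s / \<bar>u\<bar>) powr 2" using s False by (simp add: powr_numeral)
   also have "... = ((s / \<bar>u\<bar>) ^ N) powr (2 / real N)"
    using s False N0 by (subst powr_realpow[symmetric]) (auto simp: powr_powr)
   also have "... <= (1 / chi N s u) powr (2 / real N)"
   proof (rule powr_mono2)
    have "(s / \<bar>u\<bar>) ^ N = s ^ N / u ^ N" using N(1) by (simp add: power_divide power_even_abs)
    also have "... <= (u ^ N + s ^ N) / u ^ N" using N(1) by (intro divide_right_mono) (auto simp: zero_le_even_power)
    finally show "(s / \<bar>u\<bar>) ^ N <= 1 / chi N s u" by (simp add: chi_def)
   qed (use s in auto)
   also have "... = chi N s u powr (- (2 / real N))"
    using chi_pos[OF s] by (simp add: powr_minus_divide powr_divide)
   finally show ?thesis .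
  qed
  ultimately show ?thesis using chi_nonneg_derivs(1)[OF N(1) s, of u] by (simp add: mult_right_mono)
 qed
 have "(LBNN s. ennreal (chi_b N s u) * ind {s0..s1} s) <= (LBNN s. ennreal (?b s) * ind {s0..s1} s)"
  using le s by (intro nn_integral_mono) (auto intro!: mult_right_mono ennreal_leI split: split_indicator)
 also have "... = ennreal (?B s1 - ?B s0)"
 proof (rule nn_integral_FTC_Icc)
  show "?b \<in> bmeas" unfolding chi_def chi_s_def by measurable
  fix x assume "x \<in> {s0..s1}"
  hence x0: "x > 0" using s by simp
  have "RD ?B x :> - (1 / ?\<theta>) * (?\<theta> * chi N x u powr (?\<theta> - 1) * (- chi_s N x u))"
   using chi_pos[OF x0] by (intro DERIV_cmult has_real_derivative_powr[THEN DERIV_chain2] chi_has_derivative_s N N0 x0)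
  moreover have "- (1 / t) * (t * p * (- c)) = p * c" if "t > 0" for t p c :: real using that by simp
  from this[OF \<theta>] have "- (1 / ?\<theta>) * (?\<theta> * chi N x u powr (?\<theta> - 1) * (- chi_s N x u)) = ?b x" by simp
  ultimately show "RD ?B x :> ?b x" by simp
  show "0 <= ?b x" using chi_nonneg_derivs(1)[OF N(1) x0, of u] by simp
 qed (use s in auto)
 also have "... <= ennreal (real N / (real N - 2))"
 proof (rule ennreal_leI)
  have "?B s1 - ?B s0 <= 1 / ?\<theta> * chi N s0 u powr ?\<theta>" using \<theta> by simp
  also have "... <= 1 / ?\<theta> * 1"
   using \<theta> chi_bounds[OF N(1) s(1), of u] by (intro mult_left_mono) (auto intro!: powr_le1)
  also have "... = real N / (real N - 2)" using N by (simp add: field_simps)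
  finally show "?B s1 - ?B s0 <= real N / (real N - 2)" .
 qed
 finally show ?thesis .
qed

section \<open>Radial slices\<close>

text \<open>Polar coordinates for radial functions: the distribution of the norm is determined by
  the volumes of balls.\<close>

lemma nn_integral_norm:
 fixes g :: "real => ennreal"
 assumes g: "g \<in> bmeas"
 defines "n \<equiv> DIM('a::euclidean_space)"
 shows "(LBNN x. g (norm (x :: 'a))) =
  (LBNN r. g r * (ennreal (real n * unit_ball_vol (real n) * r ^ (n - 1)) * ind {0..} r))"
proof -
 let ?d = "%r. ennreal (real n * unit_ball_vol (real n) * r ^ (n - 1)) * ind {0..} r"
 have n: "n > 0" by (simp add: n_def)
 have dm: "?d \<in> bmeas" by measurable
 have "distr lborel borel (norm :: 'a => real) = density lborel ?d"
 proof (rule measure_eqI_generator_eq[where \<Omega> = UNIV and E = "range (%a::real. {..a})" and A = "%i. {..real i}"])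
  have eq: "emeasure (distr lborel borel (norm :: 'a => real)) {..a} = (if a < 0 then 0 else ennreal (unit_ball_vol n * a ^ n))" for a
  proof -
   have "emeasure (distr lborel borel (norm :: 'a => real)) {..a} = emeasure lborel {x :: 'a. norm x <= a}"
    by (subst emeasure_distr) (auto simp: vimage_def)
   also have "{x :: 'a. norm x <= a} = (if a < 0 then {} else cball 0 a)"
    by (auto simp: not_less dest: order_trans[OF norm_ge_zero])
   finally show ?thesis by (simp add: emeasure_cball n_def)
  qed
  have eq': "emeasure (density lborel ?d) {..a} = (if a < 0 then 0 else ennreal (unit_ball_vol n * a ^ n))" for a
  proof (cases "a < 0")
   case True
   have "emeasure (density lborel ?d) {..a} = (LBNN r. ?d r * ind {..a} r)"
    using dm by (subst emeasure_density) auto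
   also have "... = (\<integral>\<^sup>+(r::real). 0 \<partial>lborel)"
    using True by (intro nn_integral_cong) (auto split: split_indicator)
   finally show ?thesis using True by simp
  next
   case False
   have "emeasure (density lborel ?d) {..a} = (LBNN r. ?d r * ind {..a} r)"
    using dm by (subst emeasure_density) auto
   also have "... = (LBNN r. ennreal (real n * unit_ball_vol (real n) * r ^ (n - 1)) * ind {0..a} r)"
    by (intro nn_integral_cong) (auto split: split_indicator)
   also have "... = ennreal (unit_ball_vol (real n) * a ^ n - unit_ball_vol (real n) * 0 ^ n)"
   proof (rule nn_integral_FTC_Icc)
    fix x :: real assume "x \<in> {0..a}"
    thus "0 <= real n * unit_ball_vol (real n) * x ^ (n - 1)" by simp
    show "RD (%a. unit_ball_vol (real n) * a ^ n) x :> real n * unit_ball_vol (real n) * x ^ (n - 1)"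
     by (auto intro!: derivative_eq_intros)
   qed (use False in auto)
   finally show ?thesis using False n by simp
  qed
  show "emeasure (distr lborel borel (norm :: 'a => real)) X = emeasure (density lborel ?d) X"
   if "X \<in> range (%a::real. {..a})" for X using that eq eq' by auto
  show "emeasure (distr lborel borel (norm :: 'a => real)) {..real i} ~= \<infinity>" for i unfolding eq by simp
  show "(\<Union>i. {..real i}) = UNIV" using real_arch_simple by auto
  have "sets (borel :: real measure) = sigma_sets UNIV (range (%a::real. {..a}))"
   by (subst borel_eq_atMost) simp
  thus "sets (distr lborel borel (norm :: 'a => real)) = sigma_sets UNIV (range (%a::real. {..a}))"
   "sets (density lborel ?d) = sigma_sets UNIV (range (%a::real. {..a}))" by simp_all
  show "Int_stable (range (%a::real. {..a}))" by (auto simp: Int_stable_def)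
 qed auto
 hence "(\<integral>\<^sup>+r. g r \<partial>distr lborel borel (norm :: 'a => real)) = (\<integral>\<^sup>+r. g r \<partial>density lborel ?d)" by simp
 thus ?thesis
  using g dm by (subst (asm) nn_integral_distr, simp, simp) (subst (asm) nn_integral_density, auto simp: mult.commute)
qed

text \<open>The summand dl keeps the volume coordinate smooth at the origin and bounded away from
  zero.\<close>

definition vball :: "real => real ^ 'v::finite => real" where
 "vball dl p = unit_ball_vol (real CARD('v)) * (p \<bullet> p + dl) powr (real CARD('v) / 2)"

text \<open>The volume \<open>\<omega> (\<bar>p\<bar>^2 + dl)\<^bsup>v/2\<^esup>\<close> pushes Lebesgue measure forward to a measure of density at most one;
 this is where \<open>v >= 2\<close> enters.\<close>

lemma nn_integral_vball_le:
 fixes \<Phi> :: "real => real"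
 assumes v: "CARD('v::finite) >= 2" and dl: "dl > 0"
  and \<Phi>: "\<Phi> \<in> bmeas" "!!x. \<Phi> x >= 0" "!!x. x > c ==> \<Phi> x = 0"
  and d: "d <= unit_ball_vol (real CARD('v)) * dl powr (real CARD('v) / 2)"
 shows "(LBNN p. ennreal (\<Phi> (vball dl (p :: real ^ 'v)))) <= (LBNN x. ennreal (\<Phi> x) * ind {d..c} x)"
proof -
 define n where "n = CARD('v)"
 define \<omega> where "\<omega> = unit_ball_vol (real n)"
 have \<omega>: "\<omega> > 0" by (simp add: \<omega>_def)
 define m where "m r = \<omega> * (r^2 + dl) powr (real n / 2)" for r
 define m' where "m' r = \<omega> * (real n * r * (r^2 + dl) powr (real n / 2 - 1))" for r
 have pos: "r^2 + dl > 0" for r :: real using dl by (simp add: add_nonneg_pos)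
 have dm: "RD m r :> m' r" for r
  unfolding m_def[abs_def] m'_def using pos[of r] by (auto intro!: derivative_eq_intros)
 have vb: "vball dl p = m (norm p)" for p :: "'v rv"
  by (simp add: vball_def m_def \<omega>_def n_def power2_norm_eq_inner)
 \<comment> \<open>Beyond radius K the volume coordinate exceeds c, where \<Phi> vanishes, so the
   substitution can be made on a compact interval.\<close>
 define K where "K = max 1 (c / \<omega>)"
 have K: "K >= 1" "m r > c" if "r > K" for r
 proof -
  show "K >= 1" by (simp add: K_def)
  have r: "r > 1" "\<omega> * r > c" using that \<omega> by (auto simp: K_def pos_divide_less_eq mult.commute)
  have "r <= r^2" using r(1) by (simp add: power2_eq_square)
  also have "... < r^2 + dl" using dl by simp
  also have "... = (r^2 + dl) powr 1" using pos[of r] by simp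
  also have "... <= (r^2 + dl) powr (real n / 2)"
  proof (rule powr_mono)
   have "1 <= r^2" using r(1) by simp
   thus "1 <= r^2 + dl" using dl by linarith
  qed (use v in \<open>simp add: n_def\<close>)
  finally have "\<omega> * r <= m r" unfolding m_def using \<omega> by (intro mult_left_mono) auto
  thus "m r > c" using r(2) by linarith
 qed
 have K1: "K >= 1" by (simp add: K_def)
 have mm: "m \<in> bmeas" unfolding m_def[abs_def] by measurable
 have "(LBNN p. ennreal (\<Phi> (vball dl (p :: 'v rv)))) =
   (LBNN r. ennreal (\<Phi> (m r)) * (ennreal (real n * \<omega> * r ^ (n - 1)) * ind {0..} r))"
  unfolding vb using nn_integral_norm[of "%r. ennreal (\<Phi> (m r))", where 'a = "'v rv"] \<Phi>(1) mm
  by (simp add: n_def \<omega>_def)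
 also have "... <= (LBNN r. ennreal (\<Phi> (m r) * m' r * ind {0..K} r))"
 proof (rule nn_integral_mono)
  fix r :: real
  show "ennreal (\<Phi> (m r)) * (ennreal (real n * \<omega> * r ^ (n - 1)) * ind {0..} r) <= ennreal (\<Phi> (m r) * m' r * ind {0..K} r)"
  proof (cases "0 <= r & r <= K")
   case True
   have "real n * \<omega> * r ^ (n - 1) <= m' r"
   proof -
    have "r ^ (n - 1) = r * r ^ (n - 2)"
     using v power_Suc[of r "n - 2"] by (simp add: n_def Suc_diff_le[symmetric] numeral_2_eq_2)
    also have "... <= r * (r^2 + dl) powr (real n / 2 - 1)"
    proof (cases "r = 0")
     case False
     hence r: "r > 0" using True by simp
     have "(r^2) powr (real n / 2 - 1) = (r powr 2) powr (real n / 2 - 1)" using r by simp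
     also have "... = r powr (2 * (real n / 2 - 1))" by (rule powr_powr)
     also have "2 * (real n / 2 - 1) = real (n - 2)" using v by (simp add: n_def of_nat_diff)
     also have "r powr real (n - 2) = r ^ (n - 2)" by (rule powr_realpow[OF r])
     finally have "r ^ (n - 2) = (r^2) powr (real n / 2 - 1)" ..
     also have "... <= (r^2 + dl) powr (real n / 2 - 1)"
      using dl v by (intro powr_mono2) (auto simp: n_def)
     finally show ?thesis using r by simp
    qed simp
    finally have "(real n * \<omega>) * r ^ (n - 1) <= (real n * \<omega>) * (r * (r^2 + dl) powr (real n / 2 - 1))"
     using \<omega> by (intro mult_left_mono) auto
    thus ?thesis by (simp add: m'_def mult_ac)
   qed
   thus ?thesis using True \<Phi>(2)[of "m r"] \<omega>
    by (auto simp: ennreal_mult''[symmetric] intro!: ennreal_leI mult_left_mono)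
  next
   case False
   hence "r < 0 \<or> \<Phi> (m r) = 0" using K(2)[of r] \<Phi>(3) by auto
   thus ?thesis by auto
  qed
 qed
 also have "... = (LBNN x. ennreal (\<Phi> x * ind {m 0..m K} x))"
 proof (rule nn_integral_substitution[symmetric])
  show "set_borel_measurable borel {m 0..m K} \<Phi>" using \<Phi>(1) unfolding set_borel_measurable_def by measurable
  show "RD m x :> m' x" for x by (rule dm)
  show "cts {0..K} m'" unfolding m'_def[abs_def] using pos
   by (intro continuous_intros) (auto simp: less_imp_neq[symmetric])
  show "0 <= m' x" if "x \<in> {0..K}" for x using that \<omega> by (simp add: m'_def)
 qed (use K1 in simp)
 also have "... <= (LBNN x. ennreal (\<Phi> x) * ind {d..c} x)"
 proof (rule nn_integral_mono)
  fix x
  have "d <= m 0" using d by (simp add: m_def n_def \<omega>_def)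
  thus "ennreal (\<Phi> x * ind {m 0..m K} x) <= ennreal (\<Phi> x) * ind {d..c} x"
   using \<Phi>(3)[of x] by (auto split: split_indicator)
 qed
 finally show ?thesis .
qed

text \<open>Substitutes x = M s in the volume integral; as M decreases, this is done in the variable
  -s. The last assumption says that M has dropped to the minimum of \<open>vball\<close> by the
  level s1, so the levels up to s1 account for all volumes that occur.\<close>

lemma nn_integral_vball_le_levels:
 fixes \<Phi> :: "real => real" and M A :: "real => real"
 assumes v: "CARD('v::finite) >= 2" and dl: "dl > 0"
  and \<Phi>: "\<Phi> \<in> bmeas" "!!x. \<Phi> x >= 0" "!!x. x > M s0 ==> \<Phi> x = 0"
  and s: "s0 <= s1" and M: "!!s. s \<in> {s0..s1} ==> RD M s :> - A s"
  and A: "cts {s0..s1} A" "!!s. s \<in> {s0..s1} ==> A s >= 0"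
  and M1: "M s1 <= unit_ball_vol (real CARD('v)) * dl powr (real CARD('v) / 2)"
 shows "(LBNN p. ennreal (\<Phi> (vball dl (p :: real ^ 'v)))) <=
  (LBNN s. ennreal (\<Phi> (M s) * A s) * ind {s0..s1} s)"
proof -
 have "(LBNN p. ennreal (\<Phi> (vball dl (p :: 'v rv)))) <= (LBNN x. ennreal (\<Phi> x) * ind {M s1..M s0} x)"
  by (rule nn_integral_vball_le[OF v dl \<Phi> M1])
 also have "... = (LBNN x. ennreal (\<Phi> x * ind {M (- (- s1))..M (- (- s0))} x))"
  by (intro nn_integral_cong) (auto split: split_indicator)
 also have "... = (LBNN t. ennreal (\<Phi> (M (- t)) * A (- t) * ind {- s1..- s0} t))"
 proof (rule nn_integral_substitution)
  show "set_borel_measurable borel {M (- (- s1))..M (- (- s0))} \<Phi>"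
   using \<Phi>(1) unfolding set_borel_measurable_def by measurable
  fix t assume t: "t \<in> {- s1..- s0}"
  thus "A (- t) >= 0" using A(2) by auto
  have "RD (%t. M (- t)) t :> (- A (- t)) * (- 1)"
   by (rule DERIV_chain2[OF M]) (use t in \<open>auto intro!: derivative_eq_intros\<close>)
  thus "RD (%t. M (- t)) t :> A (- t)" by simp
 next
  show "cts {- s1..- s0} (%t. A (- t))"
   by (rule continuous_on_compose2[OF A(1)]) (auto intro!: continuous_intros)
 qed (use s in simp)
 also have "... = (LBNN s. ennreal (\<Phi> (M (- (- s))) * A (- (- s)) * ind {- s1..- s0} (- s)))"
 proof -
  have Mm: "(%t. \<Phi> (M (- t)) * A (- t) * ind {- s1..- s0} t) \<in> bmeas"
  proof -
   have "cts {- s1..- s0} (%t. M (- t))"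
    by (rule continuous_on_compose2[where g = M and t = "{s0..s1}"])
     (auto intro!: continuous_at_imp_continuous_on continuous_intros DERIV_isCont[OF M])
   hence 1: "(%t. if t \<in> {- s1..- s0} then M (- t) else 0) \<in> bmeas"
    by (rule borel_measurable_if_continuous_on) simp
   have "cts {- s1..- s0} (%t. A (- t))"
    by (rule continuous_on_compose2[OF A(1)]) (auto intro!: continuous_intros)
   hence 2: "(%t. if t \<in> {- s1..- s0} then A (- t) else 0) \<in> bmeas"
    by (rule borel_measurable_if_continuous_on) simp
   have "(%t. \<Phi> (if t \<in> {- s1..- s0} then M (- t) else 0) * (if t \<in> {- s1..- s0} then A (- t) else 0)) \<in> bmeas"
    by (intro borel_measurable_times measurable_compose[OF 1 \<Phi>(1)] 2)
   also have "(%t. \<Phi> (if t \<in> {- s1..- s0} then M (- t) else 0) * (if t \<in> {- s1..- s0} then A (- t) else 0)) =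
     (%t. \<Phi> (M (- t)) * A (- t) * ind {- s1..- s0} t)" by (auto simp: fun_eq_iff)
   finally show ?thesis .
  qed
  thus ?thesis
   using nn_integral_real_affine[of "%t. ennreal (\<Phi> (M (- t)) * A (- t) * ind {- s1..- s0} t)" "-1" 0] by simp
 qed
 also have "... = (LBNN s. ennreal (\<Phi> (M s) * A s) * ind {s0..s1} s)"
  by (intro nn_integral_cong) (auto split: split_indicator)
 finally show ?thesis .
qed

section \<open>Level functions of the slices\<close>

lemma directional_derivative:
 fixes f :: "'a::real_normed_vector => real"
 assumes "f differentiable (at x)"
 shows "RD (%t. f (x + t *\<^sub>R e)) 0 :> FD f x e"
proof -
 have f: "(f has_derivative FD f x) (at (x + 0 *\<^sub>R e))"
  using frechet_derivative_works[THEN iffD1, OF assms] by simp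
 have "((%t. x + t *\<^sub>R e) has_derivative (%t. t *\<^sub>R e)) (at 0)"
  by (auto intro!: derivative_eq_intros)
 from has_derivative_compose[OF this f]
 have "((%t. f (x + t *\<^sub>R e)) has_derivative (%t. FD f x (t *\<^sub>R e))) (at 0)" .
 moreover have "FD f x (t *\<^sub>R e) = FD f x e * t" for t
  using linear_cmul[OF linear_frechet_derivative[OF assms], of t e] by simp
 ultimately show ?thesis by (simp add: has_field_derivative_def)
qed

lemma smooth_on_chi [smooth_intros]:
 assumes "open S" "smooth_on S s" "smooth_on S u" "even N" "!!x. x \<in> S ==> s x > 0"
 shows "smooth_on S (%x. chi N (s x) (u x))"
 unfolding chi_def using chi_denom_pos[OF assms(4) assms(5)] by (intro smooth_intros assms(1-3)) (simp add: less_imp_neq[symmetric])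

lemma smooth_on_hdens: "smooth_on UNIV (hdens io b)"
 unfolding hdens_def[abs_def]
 by (intro smooth_intros open_UNIV smooth_on_bounded_linear bounded_linear_vec_nth)

text \<open>Integrates the pointwise inequality 2 l z - l^2 \<alpha> <= \<beta>, a consequence of (z
  - l \<alpha>)^2 >= 0, with the optimal l, the quotient of the two integrals.\<close>

lemma integral_Cauchy_Schwarz:
 fixes \<alpha> \<beta> z :: "'a::euclidean_space => real"
 assumes int: "\<alpha> integrable_on S" "\<beta> integrable_on S" "z integrable_on S"
  and z: "!!x. x \<in> S ==> (z x)^2 = \<alpha> x * \<beta> x" "!!x. x \<in> S ==> \<alpha> x >= 0" "!!x. x \<in> S ==> \<beta> x >= 0"
  and pos: "integral S \<alpha> > 0"
 shows "(integral S z)^2 / integral S \<alpha> <= integral S \<beta>"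
proof -
 let ?l = "integral S z / integral S \<alpha>"
 have "integral S (%x. 2 * ?l * z x - ?l\<^sup>2 * \<alpha> x) <= integral S \<beta>"
 proof (rule integral_le)
  show "(%x. 2 * ?l * z x - ?l\<^sup>2 * \<alpha> x) integrable_on S"
   using int by (intro Henstock_Kurzweil_Integration.integrable_diff integrable_on_mult_right)
  fix x assume x: "x \<in> S"
  show "2 * ?l * z x - ?l\<^sup>2 * \<alpha> x <= \<beta> x"
  proof (cases "\<alpha> x = 0")
   case True
   hence "z x = 0" using z(1)[OF x] by simp
   thus ?thesis using True z(3)[OF x] by simp
  next
   case False
   hence a: "\<alpha> x > 0" using z(2)[OF x] by simp
   have "0 <= (z x - ?l * \<alpha> x)^2" by simp
   also have "... = \<alpha> x * (\<beta> x - (2 * ?l * z x - ?l\<^sup>2 * \<alpha> x))"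
    using z(1)[OF x] by (simp add: power2_eq_square algebra_simps)
   finally have "0 <= \<beta> x - (2 * ?l * z x - ?l\<^sup>2 * \<alpha> x)" using a by (simp add: zero_le_mult_iff)
   thus ?thesis by simp
  qed
 qed (use int in auto)
 also have "integral S (%x. 2 * ?l * z x - ?l\<^sup>2 * \<alpha> x) = 2 * ?l * integral S z - ?l\<^sup>2 * integral S \<alpha>"
 proof -
  have "integral S (%x. 2 * ?l * z x - ?l\<^sup>2 * \<alpha> x) = integral S (%x. 2 * ?l * z x) - integral S (%x. ?l^2 * \<alpha> x)"
   by (intro Henstock_Kurzweil_Integration.integral_diff integrable_on_mult_right int)
  thus ?thesis by (simp only: integral_mult_right)
 qed
 also have "... = (integral S z)^2 / integral S \<alpha>"
  using pos by (simp add: field_simps power2_eq_square)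
 finally show ?thesis .
qed

abbreviation cube :: "real => (real ^ 'v::finite) set" where
 "cube R \<equiv> cbox (\<chi> i. -R) (\<chi> i. R)"

lemma cube_off: "x \<notin> cube R ==> norm x > R" for x :: "real ^ 'v::finite"
proof (rule ccontr)
 assume x: "x \<notin> cube R" "\<not> norm x > R"
 have "- R <= x $ i & x $ i <= R" for i using component_le_norm_cart[of x i] x(2) by linarith
 thus False using x(1) by (simp add: mem_cbox_vec)
qed

text \<open>Smoothed volume of the set |\<phi>| > s. It takes a function on one slice as its
  argument, so that it does not depend on a chart of the sphere.\<close>

definition lev :: "'v => real => nat => real => real => (real ^ 'v::finite => real) => real" where
 "lev io b N R s \<phi> = integral (cube R) (%p. chi N s (\<phi> p) * hdens io b p)"

text \<open>f is a test function in the product chart, and a slice is its restriction to fixed y. R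
  bounds the supports of the slices and \<Lambda> the values.\<close>

locale levels =
 fixes f :: "real ^ ('v::finite + 'w::finite) => real" and io :: 'v and b R \<Lambda> :: real and N :: nat
 assumes f: "smooth_on UNIV f" and supp: "!!q. norm (vfst q) > R ==> f q = 0" and bound: "!!q. \<bar>f q\<bar> <= \<Lambda>"
  and R: "R > 0" and \<Lambda>: "\<Lambda> > 0" and N: "even N" "N > 2" and b: "b >= 0"
begin

abbreviation "J \<equiv> hdens io b"

definition V :: real where
 "V = integral (cube R) J"

definition M :: "real => real ^ 'w => real" where
 "M s y = lev io b N R s (%p. f (vjoin p y))"

text \<open>\<open>A\<close> and \<open>Z j\<close> turn out to be minus the derivative of M in s
  and its derivative in the j-th coordinate of y. They are written out as integrals because
  Cauchy-Schwarz is applied to them.\<close>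

definition A :: "real => real ^ 'w => real" where
 "A s y = integral (cube R) (%p. chi_s N s (f (vjoin p y)) * J p)"

definition Z :: "'w => real => real ^ 'w => real" where
 "Z j s y = integral (cube R) (%p. chi_u N s (f (vjoin p y)) * partial_deriv (Inr j) f (vjoin p y) * J p)"

lemma N0: "N > 0"
 using N by simp

lemma f_continuous: "cts S (%p. f (vjoin p y))" and partial_f_continuous: "cts S (%p. partial_deriv m f (vjoin p y))"
 using continuous_on_subset[OF smooth_on_cts[OF smooth_on_slice[OF f]]]
  continuous_on_subset[OF smooth_on_cts[OF smooth_on_slice[OF smooth_on_partial_deriv[OF f]]]] by auto

lemma J_continuous: "cts S J"
 by (rule continuous_on_subset[OF continuous_on_hdens]) simp

lemma chi_continuous:
 assumes "s > 0"
 shows "cts S (%p. chi N s (f (vjoin p y)))" "cts S (%p. chi_u N s (f (vjoin p y)))"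
  "cts S (%p. chi_s N s (f (vjoin p y)))" "cts S (%p. chi_b N s (f (vjoin p y)))"
 unfolding chi_def chi_u_def chi_s_def chi_b_def using chi_denom_pos[OF N(1) assms]
 by (auto intro!: continuous_intros f_continuous simp: less_imp_neq[symmetric])

lemma J_pos: "J p > 0" and J_nonneg: "J p >= 0"
 using hdens_pos[of io b p] by simp_all

lemma integral_cube_pos:
 fixes g :: "real ^ 'v => real"
 assumes "cts UNIV g" "!!p. g p >= 0" "norm p <= R" "g p > 0"
 shows "integral (cube R) g > 0"
proof -
 have g: "cts (cube R) g" by (rule continuous_on_subset[OF assms(1)]) simp
 have nn: "integral (cube R) g >= 0" by (rule Henstock_Kurzweil_Integration.integral_nonneg[OF integrable_continuous[OF g] assms(2)])
 have p: "p \<in> cube R" using cube_off[of p R] assms(3) by auto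
 have ne: "box (\<chi> i. -R) (\<chi> i. R) ~= ({} :: 'v rv set)"
 proof -
  have "(\<chi> i. 0) \<in> (box (\<chi> i. -R) (\<chi> i. R) :: 'v rv set)" using R by (simp add: mem_box_vec)
  thus ?thesis by blast
 qed
 have "integral (cube R) g ~= 0"
  using integral_cbox_eq_0_iff[OF g ne] assms(2,4) p by (auto dest!: bspec[OF _ p])
 thus ?thesis using nn by simp
qed

lemma V_pos: "V > 0"
 unfolding V_def by (rule integral_cube_pos[of _ 0]) (use J_continuous J_nonneg J_pos R in auto)

lemma M_bounds:
 assumes s: "s > 0"
 shows "0 <= M s y" "M s y <= V" "M s y <= (\<Lambda> / s) ^ N * V"
proof -
 have i: "(%p. chi N s (f (vjoin p y)) * J p) integrable_on cube R"
  by (intro integrable_continuous continuous_on_mult chi_continuous J_continuous s)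
 show "0 <= M s y" unfolding M_def lev_def
  by (intro Henstock_Kurzweil_Integration.integral_nonneg i mult_nonneg_nonneg chi_bounds N s J_nonneg)
 have iJ: "J integrable_on cube R" by (intro integrable_continuous J_continuous)
 show "M s y <= V" unfolding M_def lev_def V_def
  using chi_bounds(2)[OF N(1) s] J_nonneg by (intro integral_le i iJ) (auto intro!: mult_left_le_one_le chi_bounds N s)
 have "M s y <= integral (cube R) (%p. (\<Lambda> / s) ^ N * J p)" unfolding M_def lev_def
  by (intro integral_le i integrable_on_mult_right iJ mult_right_mono chi_mono_le N s bound J_nonneg)
 also have "... = (\<Lambda> / s) ^ N * V" unfolding V_def by (rule integral_mult_right)
 finally show "M s y <= (\<Lambda> / s) ^ N * V" .
qed

lemma A_nonneg:
 assumes s: "s > 0"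
 shows "A s y >= 0"
 unfolding A_def by (intro Henstock_Kurzweil_Integration.integral_nonneg integrable_continuous continuous_on_mult chi_continuous J_continuous
  mult_nonneg_nonneg chi_nonneg_derivs N s J_nonneg)

text \<open>Requires a slice that is not identically zero. Positivity of M at some level expresses
  this, since all kernels vanish at u = 0.\<close>

lemma A_pos:
 assumes s: "s > 0" and s': "s' > 0" and M: "M s' y > 0"
 shows "A s y > 0"
proof -
 have "\<exists>p. f (vjoin p y) ~= 0"
 proof (rule ccontr)
  assume "\<not> (\<exists>p. f (vjoin p y) ~= 0)"
  hence "M s' y = 0" using chi_zero[OF N(2)] by (simp add: M_def lev_def)
  thus False using M by simp
 qed
 then obtain p where p: "f (vjoin p y) ~= 0" by blast
 show ?thesis unfolding A_def
 proof (rule integral_cube_pos)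
  show "norm p <= R" using supp[of "vjoin p y"] p by force
  show "chi_s N s (f (vjoin p y)) * J p > 0" using chi_s_pos[OF N(1) N0 s p] J_pos[of p] by simp
  show "cts UNIV (%p. chi_s N s (f (vjoin p y)) * J p)"
   by (intro continuous_on_mult chi_continuous J_continuous s)
  show "chi_s N s (f (vjoin p y)) * J p >= 0" for p
   by (intro mult_nonneg_nonneg chi_nonneg_derivs N s J_nonneg)
 qed
qed

lemma smooth_on_kernel:
 "smooth_on (UNIV \<times> ({0<..} \<times> UNIV)) (%z. chi N (fst (snd z)) (f (vjoin (fst z) (snd (snd z)))) * J (fst z))"
proof -
 have op: "open ((UNIV :: (real ^ 'v) set) \<times> ({0::real<..} \<times> (UNIV :: (real ^ 'w) set)))"
  by (intro open_Times) auto
 have l: "bounded_linear (%z :: 'v rv \<times> real \<times> 'w rv. vjoin (fst z) (snd (snd z)))"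
  using bounded_linear_compose[OF bounded_linear_vjoin, of "%z :: 'v rv \<times> real \<times> 'w rv. (fst z, snd (snd z))"]
  by (simp add: bounded_linear_Pair bounded_linear_fst bounded_linear_snd bounded_linear_compose[OF bounded_linear_snd])
 show ?thesis
 proof (rule smooth_on_mult[OF op smooth_on_chi[OF op _ _ N(1)]])
  show "smooth_on (UNIV \<times> ({0<..} \<times> UNIV)) (%z :: 'v rv \<times> real \<times> 'w rv. fst (snd z))"
   by (intro smooth_on_bounded_linear op bounded_linear_compose[OF bounded_linear_fst] bounded_linear_snd)
  show "smooth_on (UNIV \<times> ({0<..} \<times> UNIV)) (%z :: 'v rv \<times> real \<times> 'w rv. f (vjoin (fst z) (snd (snd z))))"
   by (rule smooth_on_compose[OF f open_UNIV op smooth_on_bounded_linear[OF op l]]) simp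
  show "smooth_on (UNIV \<times> ({0<..} \<times> UNIV)) (%z :: 'v rv \<times> real \<times> 'w rv. J (fst z))"
   by (rule smooth_on_compose[OF smooth_on_hdens open_UNIV op smooth_on_bounded_linear[OF op bounded_linear_fst]]) simp
 qed auto
qed

abbreviation "ldom \<equiv> {0::real<..} \<times> (UNIV :: 'w rv set)"

lemma open_ldom: "open ldom"
 by (intro open_Times) auto

lemma smooth_on_M: "smooth_on ldom (%z. M (fst z) (snd z))"
 unfolding M_def lev_def using smooth_on_integral_param[OF open_ldom, of "%p z. chi N (fst z) (f (vjoin p (snd z))) * J p"] smooth_on_kernel
 by simp

definition DM :: "real => real ^ 'w => real \<times> 'w rv => real" where
 "DM s y = FD (%z. M (fst z) (snd z)) (s, y)"

lemma M_has_derivative: "s > 0 ==> ((%z. M (fst z) (snd z)) has_derivative DM s y) (at (s, y))"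
 unfolding DM_def by (rule smooth_on_has_derivative[OF smooth_on_M]) auto

lemma DM_eq:
 assumes s: "s > 0"
 shows "DM s y (1, 0) = - A s y" "DM s y (0, axis j 1) = Z j s y"
proof -
 let ?F = "%p z. chi N (fst z) (f (vjoin p (snd z))) * J p"
 let ?F' = "%z. ?F (fst z) (snd z)"
 define D where "D z = FD ?F' z" for z
 have Ck: "Ck_on (Suc 0) (UNIV \<times> ldom) ?F'" using smooth_on_kernel unfolding smooth_on_def by blast
 have "((%z. M (fst z) (snd z)) has_derivative (%v. integral (cube R) (%p. D (p, s, y) (0, v)))) (at (s, y))"
  unfolding M_def lev_def D_def by (rule has_derivative_integral_param[OF open_ldom Ck]) (use s in auto)
 hence DM: "DM s y = (%v. integral (cube R) (%p. D (p, s, y) (0, v)))"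
  using has_derivative_unique M_has_derivative[OF s] by blast
 have dir: "RD (%t. ?F' ((p, s, y) + t *\<^sub>R (0, v))) 0 :> D (p, s, y) (0, v)" for p v
  unfolding D_def by (rule directional_derivative)
   (use Ck s in \<open>auto simp: Ck_on.simps(2)\<close>)
 have "D (p, s, y) (0, (1, 0)) = - (chi_s N s (f (vjoin p y)) * J p)" for p
 proof (rule DERIV_unique[OF dir])
  have "RD (%t. chi N t (f (vjoin p y))) (s + 0) :> - chi_s N s (f (vjoin p y))"
   using chi_has_derivative_s[OF N(1) N0 s] by simp
  hence "RD (%t. chi N (s + t) (f (vjoin p y))) 0 :> - chi_s N s (f (vjoin p y)) * 1"
   by (rule DERIV_chain2) (auto intro!: derivative_eq_intros)
  thus "RD (%t. ?F' ((p, s, y) + t *\<^sub>R (0, (1, 0)))) 0 :> - (chi_s N s (f (vjoin p y)) * J p)"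
   using DERIV_cmult_right[of _ _ _ _ "J p"] by fastforce
 qed
 thus "DM s y (1, 0) = - A s y" by (simp add: DM A_def)
 have "D (p, s, y) (0, (0, axis j 1)) = chi_u N s (f (vjoin p y)) * partial_deriv (Inr j) f (vjoin p y) * J p" for p
 proof (rule DERIV_unique[OF dir])
  have v: "vjoin p (y + t *\<^sub>R axis j 1) = vjoin p y + t *\<^sub>R axis (Inr j) 1" for t
   by (auto simp: vec_eq_iff vjoin_def axis_def split: sum.split)
  have "RD (%t. f (vjoin p y + t *\<^sub>R axis (Inr j) 1)) 0 :> partial_deriv (Inr j) f (vjoin p y)"
   by (rule partial_deriv_directional[OF smooth_on_differentiable[OF f]])
  hence "((%t. chi N s (f (vjoin p y + t *\<^sub>R axis (Inr j) 1))) has_real_derivative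
    chi_u N s (f (vjoin p y + 0 *\<^sub>R axis (Inr j) 1)) * partial_deriv (Inr j) f (vjoin p y)) (at 0)"
   by (rule DERIV_chain2[OF chi_has_derivative_u[OF N(1) N0 s]])
  from DERIV_cmult_right[OF this, of "J p"]
  show "((%t. ?F' ((p, s, y) + t *\<^sub>R (0, (0, axis j 1)))) has_real_derivative
    chi_u N s (f (vjoin p y)) * partial_deriv (Inr j) f (vjoin p y) * J p) (at 0)"
   by (simp add: v)
 qed
 thus "DM s y (0, axis j 1) = Z j s y" by (simp add: DM Z_def)
qed

lemma M_has_derivative_s:
 assumes s: "s > 0"
 shows "RD (%s. M s y) s :> - A s y"
proof -
 have "RD (%t. (%z. M (fst z) (snd z)) ((s, y) + t *\<^sub>R (1, 0))) 0 :> DM s y (1, 0)"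
  unfolding DM_def by (rule directional_derivative) (use M_has_derivative[OF s] differentiable_def in blast)
 hence "RD (%t. M (s + t) y) (s - s) :> - A s y" by (simp add: DM_eq[OF s])
 hence "RD (%t. M (s + (t - s)) y) s :> - A s y * 1"
  by (rule DERIV_chain2) (auto intro!: derivative_eq_intros)
 thus ?thesis by simp
qed

lemma A_continuous: "cts {0<..} (%s. A s y)"
proof -
 have "cts ldom (%z. DM (fst z) (snd z) (1, 0))"
  using smooth_on_cts[OF smooth_on_frechet_derivative[OF smooth_on_M]] by (simp add: DM_def)
 hence "cts {0<..} (%s. DM (fst (s, y)) (snd (s, y)) (1, 0))"
  by (rule continuous_on_compose2) (auto intro!: continuous_intros)
 hence "cts {0<..} (%s. - DM s y (1, 0))" by (intro continuous_on_minus) simp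
 thus ?thesis by (rule continuous_on_cong[THEN iffD1, OF refl, rotated]) (auto simp: DM_eq)
qed

lemma M_strict_antimono:
 assumes "0 < s" "s < s'" "t > 0" "M t y > 0"
 shows "M s' y < M s y"
proof (rule DERIV_neg_imp_decreasing[OF assms(2)])
 fix x assume "s <= x" "x <= s'"
 hence "x > 0" using assms(1) by simp
 thus "\<exists>y'. RD (%s. M s y) x :> y' & y' < 0"
  using M_has_derivative_s A_pos[OF _ assms(3,4)] by (metis neg_less_0_iff_less)
qed

lemma M_antimono:
 assumes "0 < s" "s <= s'"
 shows "M s' y <= M s y"
proof (rule DERIV_nonpos_imp_nonincreasing[OF assms(2)])
 fix x assume "s <= x" "x <= s'"
 hence "x > 0" using assms(1) by simp
 thus "\<exists>y'. RD (%s. M s y) x :> y' & y' <= 0"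
  using M_has_derivative_s A_nonneg by (metis neg_le_0_iff_le)
qed

section \<open>The level as a function of volume and slice\<close>

definition S :: "real => real ^ 'w => real" where
 "S x y = (THE s. s > 0 & M s y = x)"

lemma S_unique:
 assumes "s > 0" "M s y = x" "x > 0"
 shows "S x y = s"
 unfolding S_def
proof (rule the_equality)
 fix s' assume s': "s' > 0 & M s' y = x"
 show "s' = s"
  using M_strict_antimono[of s s' s y] M_strict_antimono[of s' s s y] s' assms by (cases s s' rule: linorder_cases) auto
qed (use assms in auto)

lemma S_props:
 assumes t: "t > 0" and x: "0 < x" "x <= M t y"
 shows "S x y >= t" "M (S x y) y = x"
proof -
 \<comment> \<open>For s >= \<Lambda> the decay (\<Lambda> / s)^N V is at most (\<Lambda> / s) V,
   and the last entry of the maximum brings this below x.\<close>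
 define s2 where "s2 = max t (max \<Lambda> (V * \<Lambda> / x))"
 have s2: "s2 >= t" "s2 >= \<Lambda>" "V * \<Lambda> / x <= s2" "s2 > 0" using t by (auto simp: s2_def)
 have "M s2 y <= (\<Lambda> / s2) ^ N * V" by (rule M_bounds(3)[OF s2(4)])
 also have "... <= (\<Lambda> / s2) ^ 1 * V"
  using s2 \<Lambda> N0 V_pos by (intro mult_right_mono power_decreasing) auto
 also have "... <= x" using s2 x by (simp add: field_simps)
 finally have M2: "M s2 y <= x" .
 have "cts {t..s2} (%s. M s y)"
  by (intro continuous_at_imp_continuous_on ballI DERIV_isCont[OF M_has_derivative_s]) (use t in auto)
 then obtain s where s: "t <= s" "s <= s2" "M s y = x"
  using IVT2'[of "%s. M s y" s2 x t] M2 x s2 by auto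
 hence "S x y = s" using S_unique[of s y x] t x by auto
 thus "S x y >= t" "M (S x y) y = x" using s by auto
qed

lemma S_less:
 assumes t: "t > 0" "x <= M t y" and x: "0 < x" and s: "s > 0" "M s y < x"
 shows "S x y < s"
proof (rule ccontr)
 assume "\<not> S x y < s"
 hence "M (S x y) y <= M s y" using s by (intro M_antimono) auto
 thus False using S_props(2)[OF t(1) x t(2)] s(2) by simp
qed

lemma less_S:
 assumes t: "t > 0" "x <= M t y" and x: "0 < x" and s: "x < M s y"
 shows "s < S x y"
proof (rule ccontr)
 assume "\<not> s < S x y"
 moreover have "S x y > 0" using S_props(1)[OF t(1) x t(2)] t(1) by simp
 ultimately have "M s y <= M (S x y) y" by (intro M_antimono) auto
 thus False using S_props(2)[OF t(1) x t(2)] s by simp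
qed

definition sdom :: "real => (real \<times> (real ^ 'w)) set" where
 "sdom t = {r. 0 < fst r & fst r < M t (snd r)}"

lemma M_continuous_y: "t > 0 ==> cts UNIV (M t)"
 using continuous_on_compose2[OF smooth_on_cts[OF smooth_on_M] continuous_on_Pair[OF continuous_on_const continuous_on_id]]
 by auto

lemma open_sdom: "t > 0 ==> open (sdom t)"
 unfolding sdom_def
 by (intro open_Collect_conj open_Collect_less continuous_intros continuous_on_compose2[OF M_continuous_y]) auto

text \<open>By monotonicity a < S x y is implied by M a y > x, and S x y < a by M a y < x; both
  conditions are open in (x, y). This is the continuity that the implicit function lemma starts
  from.\<close>

lemma S_continuous:
 assumes t: "t > 0"
 shows "cts (sdom t) (%r. S (fst r) (snd r))"
proof (intro continuous_at_imp_continuous_on ballI)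
 fix r assume r: "r \<in> sdom t"
 obtain x y where xy: "r = (x, y)" by (cases r)
 have x: "0 < x" "x <= M t y" using r by (auto simp: xy sdom_def)
 let ?s = "S x y"
 have s: "?s >= t" "M ?s y = x" by (rule S_props[OF t x])+
 have ev: "\<forall>\<^sub>F r' in nhds r. r' \<in> sdom t" using open_sdom[OF t] r by (rule eventually_nhds_in_open)
 have Mt: "((%r'. M a (snd r') - fst r') \<longlongrightarrow> M a y - x) (at r)" if a: "a > 0" for a
 proof -
  have "cts UNIV (%r'. M a (snd r') - fst r')"
   by (intro continuous_on_diff continuous_on_compose2[OF M_continuous_y[OF a]] continuous_on_snd continuous_on_fst continuous_on_id) simp
  hence "isCont (%r'. M a (snd r') - fst r') r"
   by (simp only: continuous_on_eq_continuous_at[OF open_UNIV] UNIV_I)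
  thus ?thesis by (simp add: isCont_def xy)
 qed
 show "isCont (%r. S (fst r) (snd r)) r"
  unfolding isCont_def xy fst_conv snd_conv
 proof (rule order_tendstoI)
  fix a assume a: "a < ?s"
  define a' where "a' = max a (t / 2)"
  have a': "a' > 0" "a' < ?s" "a <= a'" using a s(1) t by (auto simp: a'_def)
  have "M a' y > x" using M_strict_antimono[OF a'(1,2), of ?s y] s t x(1) by auto
  hence "\<forall>\<^sub>F r' in at (x, y). M a' (snd r') - fst r' > 0"
   using order_tendstoD(1)[OF Mt[OF a'(1)], of 0] by (simp add: xy)
  moreover have "\<forall>\<^sub>F r' in at (x, y). r' \<in> sdom t" using ev xy by (simp add: eventually_at_filter eventually_mono)
  ultimately show "\<forall>\<^sub>F r' in at (x, y). a < S (fst r') (snd r')"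
  proof eventually_elim
   case (elim r')
   hence "a' < S (fst r') (snd r')" by (intro less_S[OF t]) (auto simp: sdom_def)
   thus ?case using a' by simp
  qed
 next
  fix a assume a: "?s < a"
  hence a0: "a > 0" using s t by simp
  have "M a y < x" using M_strict_antimono[of ?s a ?s y] a s t x(1) by auto
  hence "\<forall>\<^sub>F r' in at (x, y). M a (snd r') - fst r' < 0"
   using order_tendstoD(2)[OF Mt[OF a0], of 0] by (simp add: xy)
  moreover have "\<forall>\<^sub>F r' in at (x, y). r' \<in> sdom t" using ev xy by (simp add: eventually_at_filter eventually_mono)
  ultimately show "\<forall>\<^sub>F r' in at (x, y). S (fst r') (snd r') < a"
  proof eventually_elim
   case (elim r')
   thus ?case using a0 by (intro S_less[OF t]) (auto simp: sdom_def)
  qed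
 qed
qed

text \<open>Implicit function lemma for M s y - x = 0, whose derivative in s is -A and hence nonzero
  on the domain.\<close>

lemma S_smooth:
 assumes t: "t > 0"
 shows "smooth_on (sdom t) (%r. S (fst r) (snd r))"
  and "r \<in> sdom t ==> ((%r. S (fst r) (snd r)) has_derivative
   (%h. (DM (S (fst r) (snd r)) (snd r) (0, snd h) - fst h) / A (S (fst r) (snd r)) (snd r))) (at r)"
proof -
 let ?U = "{0::real<..} \<times> (UNIV :: (real \<times> (real ^ 'w)) set)"
 let ?F = "%z. M (fst z) (snd (snd z)) - fst (snd z)"
 let ?sg = "%r. S (fst r) (snd r)"
 have U: "open ?U" by (intro open_Times) auto
 have l: "bounded_linear (%z :: real \<times> real \<times> 'w rv. (fst z, snd (snd z)))"
  by (intro bounded_linear_Pair bounded_linear_fst bounded_linear_compose[OF bounded_linear_snd] bounded_linear_snd)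
 have l2: "bounded_linear (%z :: real \<times> real \<times> 'w rv. fst (snd z))"
  by (intro bounded_linear_compose[OF bounded_linear_fst] bounded_linear_snd)
 have Fs: "smooth_on ?U ?F"
 proof (rule smooth_on_diff[OF U _ smooth_on_bounded_linear[OF U l2]])
  have im: "(%z. (fst z, snd (snd z))) ` ?U \<subseteq> ldom" by auto
  show "smooth_on ?U (%z. M (fst z) (snd (snd z)))"
   using smooth_on_compose[OF smooth_on_M open_ldom U smooth_on_bounded_linear[OF U l] im] by simp
 qed
 have Fd: "FD ?F (s, r) = (%h. DM s (snd r) (fst h, snd (snd h)) - fst (snd h))" if s: "s > 0" for s r
 proof -
  have "((%z. (fst z, snd (snd z))) has_derivative (%h. (fst h, snd (snd h)))) (at (s, r))"
   by (rule bounded_linear_imp_has_derivative[OF l])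
  hence "((%z. M (fst (fst z, snd (snd z))) (snd (fst z, snd (snd z)))) has_derivative (%h. DM s (snd r) (fst h, snd (snd h)))) (at (s, r))"
   by (rule has_derivative_compose) (use M_has_derivative[OF s] in simp)
  hence "(?F has_derivative (%h. DM s (snd r) (fst h, snd (snd h)) - fst (snd h))) (at (s, r))"
   by (intro has_derivative_diff bounded_linear_imp_has_derivative[OF l2]) simp
  thus ?thesis by (rule frechet_derivative_at[symmetric])
 qed
 have r: "?sg r > 0" "M (?sg r) (snd r) = fst r" "A (?sg r) (snd r) > 0" if "r \<in> sdom t" for r
 proof -
  have x: "0 < fst r" "fst r <= M t (snd r)" using that by (auto simp: sdom_def)
  show s: "?sg r > 0" using S_props(1)[OF t x] t by simp
  show "M (?sg r) (snd r) = fst r" by (rule S_props(2)[OF t x])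
  show "A (?sg r) (snd r) > 0" using A_pos[OF s t] x by simp
 qed
 have F10: "FD ?F (?sg r, r) (1, 0) = - A (?sg r) (snd r)" if "r \<in> sdom t" for r
  using Fd[OF r(1)[OF that], of r] DM_eq(1)[OF r(1)[OF that]] by (simp add: zero_prod_def)
 note imp = smooth_on_implicit[OF U Fs open_sdom[OF t] S_continuous[OF t]]
 show "smooth_on (sdom t) ?sg"
  by (rule imp(1)) (use r F10 in \<open>auto simp: less_imp_neq[symmetric]\<close>)
 show "(?sg has_derivative (%h. (DM (?sg r) (snd r) (0, snd h) - fst h) / A (?sg r) (snd r))) (at r)" if rs: "r \<in> sdom t"
 proof -
  have "(?sg has_derivative (%v. - FD ?F (?sg r, r) (0, v) / FD ?F (?sg r, r) (1, 0))) (at r)"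
   by (rule imp(2)) (use r F10 rs in \<open>auto simp: less_imp_neq[symmetric]\<close>)
  thus ?thesis unfolding F10[OF rs] by (simp add: Fd[OF r(1)[OF rs]] minus_divide_left)
 qed
qed

end

section \<open>The rearrangement and its energy\<close>

text \<open>The definite description is the level belonging to the volume \<open>vball dl x\<close>.
  Levels below t are cut off smoothly, because M is smooth only at positive levels. The slice
  function is an argument so that the result is defined at each point of the sphere, independently
  of charts.\<close>

definition rearr :: "'v => real => nat => real => real => real => (real ^ 'v::finite => real) => real ^ 'v => real" where
 "rearr io b N R dl t \<phi> x = (if vball dl x < lev io b N R t \<phi>
   then soft_pos t ((THE s. s > 0 & lev io b N R s \<phi> = vball dl x) - t) else 0)"

lemma vball_pos: "dl > 0 ==> vball dl p > 0"
 using add_nonneg_pos[OF inner_ge_zero[of p], of dl] by (simp add: vball_def)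

lemma smooth_on_vball: "dl > 0 ==> smooth_on UNIV (vball dl)"
 unfolding vball_def[abs_def]
 by (intro smooth_intros open_UNIV) (auto intro: add_nonneg_pos)

definition vball' :: "real => real ^ 'v::finite => real ^ 'v => real" where
 "vball' dl p h = unit_ball_vol (real CARD('v)) * (real CARD('v) * (p \<bullet> p + dl) powr (real CARD('v) / 2 - 1) * (p \<bullet> h))"

lemma vball_has_derivative:
 fixes p :: "real ^ 'v::finite"
 assumes "dl > 0"
 shows "(vball dl has_derivative vball' dl p) (at p)"
proof -
 have pos: "p \<bullet> p + dl > 0" using assms by (intro add_nonneg_pos) auto
 have 1: "((%p. p \<bullet> p + dl) has_derivative (%h. 2 * (p \<bullet> h))) (at p)"
  by (auto intro!: derivative_eq_intros simp: inner_commute)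
 have 2: "RD (%x. x powr (real CARD('v) / 2)) (p \<bullet> p + dl) :> real CARD('v) / 2 * (p \<bullet> p + dl) powr (real CARD('v) / 2 - 1)"
  by (rule has_real_derivative_powr[OF pos])
 have "((%p. (p \<bullet> p + dl) powr (real CARD('v) / 2)) has_derivative
   (%h. 2 * (p \<bullet> h) * (real CARD('v) / 2 * (p \<bullet> p + dl) powr (real CARD('v) / 2 - 1)))) (at p)"
  by (rule DERIV_compose_FDERIV[OF 2 1])
 from has_derivative_mult_right[OF this, of "unit_ball_vol (real CARD('v))"] show ?thesis
  unfolding vball_def[abs_def] vball'_def[abs_def] by (simp add: mult_ac)
qed

text \<open>Perimeter of the Euclidean ball of volume x in dimension n.\<close>

definition ball_perimeter :: "real => real => real" where
 "ball_perimeter n x = n * unit_ball_vol n powr (1 / n) * x powr (1 - 1 / n)"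

text \<open>The gradient of the volume of a ball is its perimeter; the shift by dl costs only the
  estimate of p . p by p . p + dl.\<close>

lemma sum_vball'_le:
 fixes p :: "real ^ 'v::finite"
 assumes "dl > 0"
 shows "(\<Sum>i\<in>UNIV. (vball' dl p (axis i 1))^2) <= (ball_perimeter (real CARD('v)) (vball dl p))^2"
proof -
 let ?n = "real CARD('v)" and ?ta = "p \<bullet> p + dl" and ?\<omega> = "unit_ball_vol (real CARD('v))"
 have ta: "?ta > 0" using assms by (intro add_nonneg_pos) auto
 have n: "?n > 0" and \<omega>: "?\<omega> > 0" by simp_all
 have "(\<Sum>i\<in>UNIV. (vball' dl p (axis i 1))^2) = (?\<omega> * ?n * ?ta powr (?n / 2 - 1))^2 * (p \<bullet> p)"
  unfolding vball'_def inner_vec_def[of p p] sum_distrib_left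
  by (intro sum.cong) (auto simp: inner_axis power_mult_distrib power2_eq_square)
 also have "... <= (?\<omega> * ?n * ?ta powr (?n / 2 - 1))^2 * ?ta"
  using assms by (intro mult_left_mono) auto
 also have "... = (?\<omega> * ?n)^2 * ?ta powr (?n - 1)"
 proof -
  have "(?ta powr (?n / 2 - 1))^2 * ?ta = ?ta powr (?n / 2 - 1) * ?ta powr (?n / 2 - 1) * ?ta powr 1"
   using ta by (simp add: power2_eq_square)
  also have "... = ?ta powr (?n - 1)" by (simp only: powr_add[symmetric]) simp
  finally show ?thesis by (simp add: power_mult_distrib)
 qed
 also have "... = (ball_perimeter ?n (vball dl p))^2"
 proof -
  have "?\<omega> powr (1 / ?n) * (?\<omega> * ?ta powr (?n / 2)) powr (1 - 1 / ?n) = (?\<omega> powr (1 / ?n) * ?\<omega> powr (1 - 1 / ?n)) * ?ta powr (?n / 2 * (1 - 1 / ?n))"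
   using \<omega> by (simp add: powr_mult powr_powr)
  also have "?\<omega> powr (1 / ?n) * ?\<omega> powr (1 - 1 / ?n) = ?\<omega>" using \<omega> by (simp add: powr_add[symmetric])
  also have "?n / 2 * (1 - 1 / ?n) = (?n - 1) / 2" using n by (simp add: field_simps)
  finally have "ball_perimeter ?n (vball dl p) = ?\<omega> * ?n * ?ta powr ((?n - 1) / 2)"
   unfolding ball_perimeter_def vball_def mult.assoc by (simp add: mult_ac)
  moreover have "(?ta powr ((?n - 1) / 2))^2 = ?ta powr (?n - 1)"
   by (simp add: power2_eq_square powr_add[symmetric])
  ultimately show ?thesis by (simp add: power_mult_distrib)
 qed
 finally show ?thesis .
qed

lemma vfst_axis: "vfst (axis (Inl i) 1) = axis i 1" "vfst (axis (Inr j) 1) = 0"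
 and vsnd_axis: "vsnd (axis (Inl i) 1) = 0" "vsnd (axis (Inr j) 1) = axis j 1"
 by (auto simp: vec_eq_iff vfst_def vsnd_def axis_def)

context levels
begin

context
 fixes dl t :: real
 assumes dl: "dl > 0" and t: "t > 0"
begin

definition W :: "real ^ ('v + 'w) => real" where
 "W q = rearr io b N R dl t (%p. f (vjoin p (vsnd q))) (vfst q)"

lemma W_eq: "W q = (if vball dl (vfst q) < M t (vsnd q) then soft_pos t (S (vball dl (vfst q)) (vsnd q) - t) else 0)"
 by (simp add: W_def rearr_def M_def S_def)

text \<open>The threshold t/2 makes this open set overlap with \<open>zdom\<close>, so that the
  cutoff at level t happens inside the region where S is smooth.\<close>

definition wdom :: "(real ^ ('v + 'w)) set" where
 "wdom = {q. vball dl (vfst q) < M (t / 2) (vsnd q)}"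

definition zdom :: "(real ^ ('v + 'w)) set" where
 "zdom = {q. M t (vsnd q) < vball dl (vfst q)}"

lemma vball_vfst_continuous: "cts UNIV (%q :: real ^ ('v + 'w). vball dl (vfst q))"
 by (rule continuous_on_compose2[OF smooth_on_cts[OF smooth_on_vball[OF dl]]]) (auto intro!: continuous_intros)

lemma M_vsnd_continuous: "s > 0 ==> cts UNIV (%q :: real ^ ('v + 'w). M s (vsnd q))"
 by (rule continuous_on_compose2[OF M_continuous_y]) (auto intro!: continuous_intros)

lemma open_wdom: "open wdom" and open_zdom: "open zdom"
 unfolding wdom_def zdom_def using t by (auto intro!: open_Collect_less vball_vfst_continuous M_vsnd_continuous)

lemma wdom_zdom: "q \<in> wdom \<or> q \<in> zdom"
proof (rule disjCI)
 assume "q \<notin> zdom"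
 hence 1: "vball dl (vfst q) <= M t (vsnd q)" by (simp add: zdom_def)
 moreover have "M t (vsnd q) > 0" using 1 vball_pos[OF dl, of "vfst q"] by linarith
 ultimately show "q \<in> wdom" using M_strict_antimono[of "t / 2" t t "vsnd q"] t by (simp add: wdom_def)
qed

lemma wdom_sdom: "q \<in> wdom ==> (vball dl (vfst q), vsnd q) \<in> sdom (t / 2)"
 using vball_pos[OF dl, of "vfst q"] by (simp add: wdom_def sdom_def)

text \<open>Between the levels t/2 and t the softened positive part is already zero, so one formula
  holds on the whole domain.\<close>

lemma W_wdom:
 assumes "q \<in> wdom"
 shows "W q = soft_pos t (S (vball dl (vfst q)) (vsnd q) - t)"
proof (cases "vball dl (vfst q) < M t (vsnd q)")
 case False
 let ?s = "S (vball dl (vfst q)) (vsnd q)"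
 have x: "0 < vball dl (vfst q)" "vball dl (vfst q) <= M (t / 2) (vsnd q)"
  using wdom_sdom[OF assms] by (auto simp: sdom_def)
 have t2: "t / 2 > 0" using t by simp
 have s: "?s > 0" "M ?s (vsnd q) = vball dl (vfst q)" using S_props[OF t2 x] t2 by auto
 have "\<not> ?s > t" using M_strict_antimono[OF t, of ?s ?s "vsnd q"] s x(1) False by auto
 thus ?thesis using False soft_pos_bounds(4)[OF t] by (simp add: W_eq)
qed (simp add: W_eq)

lemma W_zdom: "q \<in> zdom ==> W q = 0"
 by (simp add: W_eq zdom_def)

lemma W_smooth: "smooth_on UNIV W"
proof (rule smooth_on_local)
 fix q :: "real ^ ('v + 'w)"
 have 1: "smooth_on wdom W"
 proof -
  have r: "smooth_on wdom (%q. (vball dl (vfst q), vsnd q))"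
   using open_wdom by (intro smooth_intros smooth_on_compose[OF smooth_on_vball[OF dl]]) auto
  have s: "smooth_on wdom (%q. S (fst (vball dl (vfst q), vsnd q)) (snd (vball dl (vfst q), vsnd q)))"
   by (rule smooth_on_compose[OF S_smooth(1)[of "t / 2"] open_sdom[of "t / 2"] open_wdom r]) (use t wdom_sdom in auto)
  hence "smooth_on wdom (%q. soft_pos t (S (vball dl (vfst q)) (vsnd q) - t))"
   using open_wdom by (intro smooth_on_compose[OF smooth_on_soft_pos[OF t]] smooth_intros) auto
  thus ?thesis by (rule smooth_on_cong[OF open_wdom, rotated]) (simp add: W_wdom)
 qed
 have 2: "smooth_on zdom W"
  by (rule smooth_on_cong[OF open_zdom _ smooth_on_const[OF open_zdom, of 0]]) (simp add: W_zdom)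
 show "\<exists>T. open T & q \<in> T & smooth_on T W"
  using wdom_zdom[of q] open_wdom open_zdom 1 2 by blast
qed

lemma W_nonneg: "W q >= 0"
 using soft_pos_bounds(1)[OF t] by (simp add: W_eq)

text \<open>A quantity depending on a volume and its level, extended by zero to volumes whose level
  is not above t.\<close>

definition lvl :: "(real => real => real) => real ^ 'w => real => real" where
 "lvl \<psi> y x = (if 0 < x & x < M t y then \<psi> x (S x y) else 0)"

text \<open>By the chain rule the derivative of W is that of S, with components Z_j / A and -grad
  vball / A, times a factor of \<open>soft_pos'\<close> between 0 and 1. The value is at most the
  level itself.\<close>

lemma W_partial_deriv:
 shows "(\<Sum>i\<in>UNIV. (partial_deriv (Inl i) W q)^2) <= lvl (%x s. (ball_perimeter (real CARD('v)) x / A s (vsnd q))^2) (vsnd q) (vball dl (vfst q))"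
  and "(partial_deriv (Inr j) W q)^2 <= lvl (%x s. (Z j s (vsnd q) / A s (vsnd q))^2) (vsnd q) (vball dl (vfst q))"
  and "(W q)^2 <= lvl (%x s. s^2) (vsnd q) (vball dl (vfst q))"
proof -
 let ?x = "vball dl (vfst q)" and ?y = "vsnd q"
 let ?s = "S ?x ?y"
 have x0: "?x > 0" by (rule vball_pos[OF dl])
 show "(W q)^2 <= lvl (%x s. s^2) ?y ?x"
 proof (cases "?x < M t ?y")
  case True
  have "?s >= t" using S_props(1)[OF t x0] True by simp
  hence "W q <= ?s" using soft_pos_bounds(3)[OF t, of "?s - t"] True t by (simp add: W_eq)
  thus ?thesis using True x0 W_nonneg[of q] by (simp add: lvl_def)
 qed (simp add: lvl_def W_eq)
 \<comment> \<open>Absorbs the cutoff into one factor, so that the same derivative formula covers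
   both domains; it is 0 where the volume is not below M t y.\<close>
 define g where "g = (if ?x < M t ?y then soft_pos' t (?s - t) else 0)"
 have g: "0 <= g" "g <= 1" using soft_pos'_bounds[OF t] by (auto simp: g_def)
 have der: "\<exists>a. (W has_derivative (%h. g * a h)) (at q) & (?x < M t ?y \<longrightarrow> a = (%h. (DM ?s ?y (0, vsnd h) - vball' dl (vfst q) (vfst h)) / A ?s ?y))"
 proof (cases "q \<in> wdom")
  case True
  let ?a = "%h. (DM ?s ?y (0, vsnd h) - vball' dl (vfst q) (vfst h)) / A ?s ?y"
  have t2: "t / 2 > 0" using t by simp
  have r: "((%q. (vball dl (vfst q), vsnd q)) has_derivative (%h. (vball' dl (vfst q) (vfst h), vsnd h))) (at q)"
   by (intro has_derivative_Pair has_derivative_compose[OF bounded_linear_imp_has_derivative[OF bounded_linear_vfst] vball_has_derivative[OF dl]]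
     bounded_linear_imp_has_derivative[OF bounded_linear_vsnd])
  have "((%q. S (fst (vball dl (vfst q), vsnd q)) (snd (vball dl (vfst q), vsnd q))) has_derivative ?a) (at q)"
   using has_derivative_compose[OF r S_smooth(2)[OF t2 wdom_sdom[OF True]]] by simp
  hence "((%q. S (vball dl (vfst q)) (vsnd q) - t) has_derivative ?a) (at q)"
   by (auto intro!: derivative_eq_intros)
  hence "((%q. soft_pos t (S (vball dl (vfst q)) (vsnd q) - t)) has_derivative (%h. ?a h * soft_pos' t (?s - t))) (at q)"
   by (rule DERIV_compose_FDERIV[OF soft_pos_has_derivative[OF t]])
  hence "(W has_derivative (%h. ?a h * soft_pos' t (?s - t))) (at q)"
   by (rule has_derivative_transform_within_open[OF _ open_wdom True]) (simp add: W_wdom)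
  moreover have "soft_pos' t (?s - t) = g"
  proof (cases "?x < M t ?y")
   case False
   have "?s <= t"
   proof (rule ccontr)
    assume "\<not> ?s <= t"
    have xx: "?x <= M (t / 2) ?y" using True by (simp add: wdom_def)
    have "M ?s ?y = ?x" using S_props(2)[OF t2 x0 xx] .
    moreover have "?s > 0" using S_props(1)[OF t2 x0 xx] t2 by linarith
    ultimately show False using M_strict_antimono[OF t, of ?s ?s ?y] x0 False \<open>\<not> ?s <= t\<close> by auto
   qed
   thus ?thesis using False by (simp add: g_def soft_pos'_def)
  qed (simp add: g_def)
  ultimately have "(W has_derivative (%h. g * ?a h)) (at q)" by (simp add: mult.commute)
  thus ?thesis by (intro exI[of _ ?a]) simp
 next
  case False
  hence z: "q \<in> zdom" using wdom_zdom[of q] by simp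
  have "((%q. 0) has_derivative (%h. 0)) (at q)" by simp
  hence "(W has_derivative (%h. 0)) (at q)"
   by (rule has_derivative_transform_within_open[OF _ open_zdom z]) (simp add: W_zdom)
  moreover have "\<not> ?x < M t ?y" using z by (simp add: zdom_def)
  ultimately show ?thesis by (intro exI[of _ "%h. 0"]) simp
 qed
 then obtain a where a0: "(W has_derivative (%h. g * a h)) (at q) &
  (?x < M t ?y \<longrightarrow> a = (%h. (DM ?s ?y (0, vsnd h) - vball' dl (vfst q) (vfst h)) / A ?s ?y))" ..
 note a = conjunct1[OF a0] conjunct2[OF a0, rule_format]
 have pd: "partial_deriv m W q = g * a (axis m 1)" for m
  unfolding partial_deriv_def frechet_derivative_at[OF a(1), symmetric] ..
 have le: "(g * z)^2 <= z^2" for z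
  using g mult_left_le_one_le[of "z^2" "g^2"] by (simp add: power_mult_distrib power_le_one)
 have main: "(\<Sum>i\<in>UNIV. (partial_deriv (Inl i) W q)^2) <= (ball_perimeter (real CARD('v)) ?x / A ?s ?y)^2 &
   (partial_deriv (Inr j) W q)^2 <= (Z j ?s ?y / A ?s ?y)^2" if lt: "?x < M t ?y"
 proof
  have s: "?s > 0" using S_props(1)[OF t x0, of ?y] lt t by simp
  have DM0: "DM ?s ?y (0, 0) = 0"
   using linear_0[OF has_derivative_linear[OF M_has_derivative[OF s, of ?y]]] by (simp add: zero_prod_def)
  have v0: "vball' dl (vfst q) 0 = 0" by (simp add: vball'_def)
  have aI: "a (axis (Inl i) 1) = - vball' dl (vfst q) (axis i 1) / A ?s ?y" for i
   unfolding a(2)[OF lt] by (simp add: vfst_axis vsnd_axis DM0)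
  have "(\<Sum>i\<in>UNIV. (partial_deriv (Inl i) W q)^2) <= (\<Sum>i\<in>UNIV. (a (axis (Inl i) 1))^2)"
   unfolding pd by (intro sum_mono le)
  also have "... = (\<Sum>i\<in>UNIV. (vball' dl (vfst q) (axis i 1))^2) / (A ?s ?y)\<^sup>2"
   unfolding aI sum_divide_distrib by (simp add: power_divide)
  also have "... <= (ball_perimeter (real CARD('v)) ?x)^2 / (A ?s ?y)\<^sup>2"
   by (intro divide_right_mono sum_vball'_le[OF dl]) simp
  finally show "(\<Sum>i\<in>UNIV. (partial_deriv (Inl i) W q)^2) <= (ball_perimeter (real CARD('v)) ?x / A ?s ?y)^2"
   by (simp add: power_divide)
  have "a (axis (Inr j) 1) = Z j ?s ?y / A ?s ?y"
   unfolding a(2)[OF lt] by (simp add: vfst_axis vsnd_axis DM_eq(2)[OF s] v0)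
  thus "(partial_deriv (Inr j) W q)^2 <= (Z j ?s ?y / A ?s ?y)^2" unfolding pd using le by metis
 qed
 have off: "partial_deriv m W q = 0" if "\<not> ?x < M t ?y" for m using that by (simp add: pd g_def)
 show "(\<Sum>i\<in>UNIV. (partial_deriv (Inl i) W q)^2) <= lvl (%x s. (ball_perimeter (real CARD('v)) x / A s ?y)^2) ?y ?x"
  "(partial_deriv (Inr j) W q)^2 <= lvl (%x s. (Z j s ?y / A s ?y)^2) ?y ?x"
  using main off x0 by (auto simp: lvl_def)
qed

end

end

lemma nn_integral_cbox_eq:
 fixes h :: "'a::euclidean_space => real"
 assumes "cts (cbox a b) h" "!!x. x \<in> cbox a b ==> h x >= 0"
 shows "ennreal (integral (cbox a b) h) = (LBNN x. ennreal (h x) * ind (cbox a b) x)"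
proof -
 have "integral\<^sup>N lborel (%x. ennreal (ind (cbox a b) x * h x)) = ennreal (integral (cbox a b) h)"
  using assms by (intro nn_integral_has_integral_lebesgue integrable_integral integrable_continuous) auto
 thus ?thesis by (simp add: ennreal_mult'' mult.commute ennreal_indicator[symmetric])
qed

section \<open>Energy bounds level by level\<close>

context levels
begin

text \<open>Tonelli: for each p the weight \<open>chi_b\<close> integrates over the levels to at
  most N / (N - 2). This assembles bounds at single levels into an energy.\<close>

lemma nn_integral_levels_swap:
 fixes G :: "real ^ 'v => real"
 assumes G: "cts UNIV G" "!!p. G p >= 0" and t: "0 < t" "t <= s1"
 shows "(%s. ennreal (integral (cube R) (%p. chi_b N s (f (vjoin p y)) * G p)) * ind {t..s1} s) \<in> borel_measurable lborel"
  and "(LBNN s. ennreal (integral (cube R) (%p. chi_b N s (f (vjoin p y)) * G p)) * ind {t..s1} s)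
   <= ennreal (real N / (real N - 2)) * (LBNN p. ennreal (G p))"
proof -
 let ?h = "%s p. ennreal (chi_b N s (f (vjoin p y)) * G p) * ind (cube R) p * ind {t..s1} s"
 have Gm: "G \<in> bmeas" by (rule borel_measurable_continuous_onI[OF G(1)])
 have fm: "(%p. f (vjoin p y)) \<in> bmeas" by (rule borel_measurable_continuous_onI[OF f_continuous])
 have hm: "(%(s, p). ?h s p) \<in> borel_measurable (lborel \<Otimes>\<^sub>M lborel)"
  unfolding chi_b_def using measurable_compose[OF measurable_snd fm] measurable_compose[OF measurable_snd Gm] by measurable
 have eq: "(%s. ennreal (integral (cube R) (%p. chi_b N s (f (vjoin p y)) * G p)) * ind {t..s1} s) = (%s. (LBNN p. ?h s p))"
 proof
  fix s
  show "ennreal (integral (cube R) (%p. chi_b N s (f (vjoin p y)) * G p)) * ind {t..s1} s = (LBNN p. ?h s p)"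
  proof (cases "s \<in> {t..s1}")
   case True
   hence s: "s > 0" using t by simp
   have "ennreal (integral (cube R) (%p. chi_b N s (f (vjoin p y)) * G p)) =
     (LBNN p. ennreal (chi_b N s (f (vjoin p y)) * G p) * ind (cube R) p)"
    by (intro nn_integral_cbox_eq continuous_on_mult chi_continuous s continuous_on_subset[OF G(1)] mult_nonneg_nonneg chi_nonneg_derivs N G(2)) simp
   thus ?thesis using True by simp
  qed simp
 qed
 show "(%s. ennreal (integral (cube R) (%p. chi_b N s (f (vjoin p y)) * G p)) * ind {t..s1} s) \<in> borel_measurable lborel"
  unfolding eq using hm by (rule lborel.borel_measurable_nn_integral)
 have "(LBNN s. ennreal (integral (cube R) (%p. chi_b N s (f (vjoin p y)) * G p)) * ind {t..s1} s)
   = (LBNN s. (LBNN p. ?h s p))"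
  unfolding eq ..
 also have "... = (LBNN p. (LBNN s. ?h s p))"
  using lborel_pair.Fubini'[OF hm] by simp
 also have "... <= (LBNN p. ennreal (real N / (real N - 2)) * ennreal (G p))"
 proof (rule nn_integral_mono)
  fix p
  have "(LBNN s. ?h s p) <= (LBNN s. ennreal (G p) * (ennreal (chi_b N s (f (vjoin p y))) * ind {t..s1} s))"
   using G(2)[of p] t by (intro nn_integral_mono) (auto simp: ennreal_mult'[symmetric] mult.commute split: split_indicator)
  also have "... = ennreal (G p) * (LBNN s. ennreal (chi_b N s (f (vjoin p y))) * ind {t..s1} s)"
   unfolding chi_b_def by (intro nn_integral_cmult) measurable
  also have "... <= ennreal (G p) * ennreal (real N / (real N - 2))"
   by (intro mult_left_mono nn_integral_chi_b N t) simp
  finally show "(LBNN s. ?h s p) <= ennreal (real N / (real N - 2)) * ennreal (G p)" by (simp add: mult.commute)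
 qed
 also have "... = ennreal (real N / (real N - 2)) * (LBNN p. ennreal (G p))"
  using Gm by (intro nn_integral_cmult) measurable
 finally show "(LBNN s. ennreal (integral (cube R) (%p. chi_b N s (f (vjoin p y)) * G p)) * ind {t..s1} s)
   <= ennreal (real N / (real N - 2)) * (LBNN p. ennreal (G p))" .
qed

text \<open>Reduces a slice integral of the rearranged function to a bound at each level; the factor
  A is the Jacobian of the passage from volumes to levels.\<close>

lemma nn_integral_lvl_le:
 assumes v: "CARD('v) >= 2" and dl: "dl > 0" and t: "0 < t" "t <= s1"
  and M1: "M s1 y <= unit_ball_vol (real CARD('v)) * dl powr (real CARD('v) / 2)"
  and \<psi>: "cts {0<..<M t y} (%x. \<psi> x (S x y))" "!!x s. \<psi> x s >= 0"
  and E: "!!s. t < s ==> s <= s1 ==> M s y > 0 ==> \<psi> (M s y) s * A s y <= E s"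
 shows "(LBNN p. ennreal (lvl t \<psi> y (vball dl (p :: real ^ 'v)))) <= (LBNN s. ennreal (E s) * ind {t..s1} s)"
proof -
 have "(LBNN p. ennreal (lvl t \<psi> y (vball dl (p :: 'v rv)))) <=
   (LBNN s. ennreal (lvl t \<psi> y (M s y) * A s y) * ind {t..s1} s)"
 proof (rule nn_integral_vball_le_levels[where M = "%s. M s y" and A = "%s. A s y", OF v dl _ _ _ t(2) _ _ _ M1])
  have "(%x. if x \<in> {0<..<M t y} then \<psi> x (S x y) else 0) \<in> bmeas"
   by (rule borel_measurable_if_continuous_on[OF \<psi>(1)]) simp
  moreover have "lvl t \<psi> y = (%x. if x \<in> {0<..<M t y} then \<psi> x (S x y) else 0)"
   by (simp add: fun_eq_iff lvl_def[OF dl t(1)])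
  ultimately show "lvl t \<psi> y \<in> bmeas" by simp
  show "0 <= lvl t \<psi> y x" for x using \<psi>(2) by (simp add: lvl_def[OF dl t(1)])
  show "lvl t \<psi> y x = 0" if "M t y < x" for x using that by (simp add: lvl_def[OF dl t(1)])
  show "RD (%s. M s y) s :> - A s y" "0 <= A s y" if "s \<in> {t..s1}" for s
   using that t by (auto intro: M_has_derivative_s A_nonneg)
  show "cts {t..s1} (%s. A s y)" by (rule continuous_on_subset[OF A_continuous]) (use t in auto)
 qed
 also have "... <= (LBNN s. ennreal (E s) * ind {t..s1} s)"
 proof (rule nn_integral_mono)
  fix s
  show "ennreal (lvl t \<psi> y (M s y) * A s y) * ind {t..s1} s <= ennreal (E s) * ind {t..s1} s"
  proof (cases "s \<in> {t..s1} & 0 < M s y & M s y < M t y")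
   case True
   hence s: "s > 0" "t < s" using t by (auto simp: less_le)
   have "lvl t \<psi> y (M s y) = \<psi> (M s y) s" using True S_unique[OF s(1) refl] by (simp add: lvl_def[OF dl t(1)])
   thus ?thesis using True E[OF s(2)] by (auto intro: ennreal_leI)
  next
   case False
   hence "s \<notin> {t..s1} \<or> lvl t \<psi> y (M s y) = 0" by (auto simp: lvl_def[OF dl t(1)])
   thus ?thesis by auto
  qed
 qed
 finally show ?thesis .
qed

lemma S_slice_continuous:
 assumes "t > 0"
 shows "cts {0<..<M t y} (%x. S x y)"
proof -
 have "cts {0<..<M t y} (%x. S (fst (x, y)) (snd (x, y)))"
  by (rule continuous_on_compose2[OF S_continuous[OF assms] continuous_on_Pair[OF continuous_on_id continuous_on_const]])
   (auto simp: sdom_def)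
 thus ?thesis by simp
qed

lemma A_slice_continuous:
 assumes t: "t > 0"
 shows "cts {0<..<M t y} (%x. A (S x y) y)" "x \<in> {0<..<M t y} ==> A (S x y) y > 0"
proof -
 have S: "S x y > 0" if "x \<in> {0<..<M t y}" for x using S_props(1)[OF t, of x y] that t by auto
 show "cts {0<..<M t y} (%x. A (S x y) y)"
  by (rule continuous_on_compose2[OF A_continuous S_slice_continuous[OF t]]) (use S in auto)
 show "x \<in> {0<..<M t y} ==> A (S x y) y > 0" using A_pos[OF S t] by auto
qed

lemma Z_continuous: "cts {0<..} (%s. Z j s y)"
proof -
 have "cts ldom (%z. DM (fst z) (snd z) (0, axis j 1))"
  using smooth_on_cts[OF smooth_on_frechet_derivative[OF smooth_on_M]] by (simp add: DM_def)
 hence "cts {0<..} (%s. DM (fst (s, y)) (snd (s, y)) (0, axis j 1))"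
  by (rule continuous_on_compose2) (auto intro!: continuous_intros)
 thus ?thesis by (rule continuous_on_cong[THEN iffD1, OF refl, rotated]) (auto simp: DM_eq)
qed

lemma chi_b_integral_nonneg:
 assumes "s > 0" "!!p. G p >= 0" "cts UNIV G"
 shows "integral (cube R) (%p. chi_b N s (f (vjoin p y)) * G p) >= 0"
 by (intro Henstock_Kurzweil_Integration.integral_nonneg integrable_continuous continuous_on_mult chi_continuous
  mult_nonneg_nonneg chi_nonneg_derivs N assms continuous_on_subset[OF assms(3)]) simp

text \<open>Cauchy-Schwarz with chi_u^2 = chi_s chi_b. Spherical derivatives are handled by this
  alone, while horospherical ones also use the isoperimetric inequality.\<close>

lemma Z_level_bound:
 assumes s: "s > 0" and A: "A s y > 0"
 shows "(Z j s y)^2 / A s y <= integral (cube R) (%p. chi_b N s (f (vjoin p y)) * ((partial_deriv (Inr j) f (vjoin p y))^2 * J p))"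
 unfolding Z_def A_def
proof (rule integral_Cauchy_Schwarz)
 show "0 < integral (cube R) (%p. chi_s N s (f (vjoin p y)) * J p)" using A by (simp add: A_def)
 fix p
 show "(chi_u N s (f (vjoin p y)) * partial_deriv (Inr j) f (vjoin p y) * J p)^2 =
   chi_s N s (f (vjoin p y)) * J p * (chi_b N s (f (vjoin p y)) * ((partial_deriv (Inr j) f (vjoin p y))^2 * J p))"
  unfolding power_mult_distrib chi_u_square(1)[OF N(2)] by (simp add: power2_eq_square mult_ac)
qed (auto intro!: integrable_continuous continuous_intros chi_continuous s partial_f_continuous J_continuous
 mult_nonneg_nonneg chi_nonneg_derivs N J_nonneg)

text \<open>From u^2 chi_b = s^2 chi_s, which puts the quadratic term under the same weight as the
  gradients.\<close>

lemma A_level_eq: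
 assumes s: "s > 0"
 shows "s^2 * A s y = integral (cube R) (%p. chi_b N s (f (vjoin p y)) * ((f (vjoin p y))^2 * J p))"
proof -
 have "s^2 * A s y = integral (cube R) (%p. s^2 * (chi_s N s (f (vjoin p y)) * J p))"
  unfolding A_def by (rule integral_mult_right[symmetric])
 also have "... = integral (cube R) (%p. chi_b N s (f (vjoin p y)) * ((f (vjoin p y))^2 * J p))"
 proof (rule integral_cong)
  fix p
  show "s^2 * (chi_s N s (f (vjoin p y)) * J p) = chi_b N s (f (vjoin p y)) * ((f (vjoin p y))^2 * J p)"
   using chi_u_square(2)[OF N(2), of "f (vjoin p y)" s] by (simp add: mult_ac)
 qed
 finally show ?thesis .
qed

lemma hgrad_chi:
 assumes s: "s > 0"
 shows "hgrad io b (%p. chi N s (f (vjoin p y))) p = \<bar>chi_u N s (f (vjoin p y))\<bar> * hgrad io b (%p. f (vjoin p y)) p"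
proof -
 let ?\<phi> = "%p. f (vjoin p y)"
 have sm: "smooth_on UNIV ?\<phi>" by (rule smooth_on_slice[OF f])
 have smc: "smooth_on UNIV (%p. chi N s (?\<phi> p))" using s by (intro smooth_intros open_UNIV sm N)
 have pd: "partial_deriv i (%p. chi N s (?\<phi> p)) p = chi_u N s (?\<phi> p) * partial_deriv i ?\<phi> p" for i
 proof (rule DERIV_unique)
  show "RD (%t. chi N s (?\<phi> (p + t *\<^sub>R axis i 1))) 0 :> partial_deriv i (%p. chi N s (?\<phi> p)) p"
   by (rule partial_deriv_directional[OF smooth_on_differentiable[OF smc]])
  have "RD (%t. chi N s (?\<phi> (p + t *\<^sub>R axis i 1))) 0 :> chi_u N s (?\<phi> (p + 0 *\<^sub>R axis i 1)) * partial_deriv i ?\<phi> p"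
   by (rule DERIV_chain2[OF chi_has_derivative_u[OF N(1) N0 s] partial_deriv_directional[OF smooth_on_differentiable[OF sm]]])
  thus "RD (%t. chi N s (?\<phi> (p + t *\<^sub>R axis i 1))) 0 :> chi_u N s (?\<phi> p) * partial_deriv i ?\<phi> p" by simp
 qed
 have "(\<Sum>i\<in>UNIV. (partial_deriv i (%p. chi N s (?\<phi> p)) p)^2 / (if i = io then 1 else exp (2 * b * p $ io))) =
   (chi_u N s (?\<phi> p))^2 * (\<Sum>i\<in>UNIV. (partial_deriv i ?\<phi> p)^2 / (if i = io then 1 else exp (2 * b * p $ io)))"
  unfolding sum_distrib_left by (intro sum.cong) (auto simp: pd power_mult_distrib)
 thus ?thesis by (simp add: hgrad_def real_sqrt_mult)
qed

definition isoc :: real where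
 "isoc = 2 * (real CARD('v) * unit_ball_vol (real CARD('v)) powr (1 / real CARD('v)))^2 / real N"

text \<open>Apply the isoperimetric inequality to g = chi N s. As g^(1 + 1/n) >= g^2 and g - g^2 =
  (s / N) chi_s, the ball perimeter I at volume M is at most P + E, with P the integral of |grad g|
  and E proportional to A / N. Cauchy-Schwarz bounds P^2 / A, and A cancels in the error.\<close>

lemma perimeter_level_bound:
 assumes s: "s > 0" and Mp: "M s y > 0"
 shows "(ball_perimeter (real CARD('v)) (M s y))^2 / A s y <=
  integral (cube R) (%p. chi_b N s (f (vjoin p y)) * ((hgrad io b (%p. f (vjoin p y)) p)^2 * J p))
   + isoc * s * M s y powr (1 - 2 / real CARD('v))"
proof -
 let ?\<phi> = "%p. f (vjoin p y)" and ?n = "real CARD('v)"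
 let ?g = "%p. chi N s (?\<phi> p)" and ?m = "M s y" and ?A = "A s y"
 let ?c = "?n * unit_ball_vol ?n powr (1 / ?n)"
 have n: "?n > 0" by simp
 have n1: "?n >= 1" using zero_less_card_finite[where 'a = 'v] by linarith
 have A: "?A > 0" by (rule A_pos[OF s s Mp])
 have sm: "smooth_on UNIV ?\<phi>" by (rule smooth_on_slice[OF f])
 have smg: "smooth_on UNIV ?g" using s by (intro smooth_intros open_UNIV sm N)
 have g0: "?g p = 0" if "norm p > R" for p using supp[of "vjoin p y"] that chi_zero[OF N(2)] by simp
 have gn: "?g p >= 0" "?g p <= 1" for p using chi_bounds[OF N(1) s] by auto
 have gc: "cts T ?g" for T by (rule chi_continuous(1)[OF s])
 have eq: "(LBINT p. F p) = integral (cube R) F" if "cts UNIV F" "!!p. norm p > R ==> F p = 0" for F :: "real ^ 'v => real"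
  using integral_lborel_eq_on[OF integrable_continuous_bounded_support[OF that], where K = "cube R"] cube_off that(2) by blast
 have Mm: "(LBINT p. ?g p * J p) = ?m"
  unfolding M_def lev_def by (rule eq) (auto intro!: continuous_on_mult gc J_continuous simp: g0)
 have hgc: "cts T (hgrad io b ?\<phi>)" for T by (rule continuous_on_subset[OF continuous_on_hgrad[OF sm]]) simp
 define P where "P = integral (cube R) (%p. \<bar>chi_u N s (?\<phi> p)\<bar> * hgrad io b ?\<phi> p * J p)"
 have Pe: "(LBINT p. J p * hgrad io b ?g p) = P"
 proof -
  have "(LBINT p. J p * hgrad io b ?g p) = (LBINT p. \<bar>chi_u N s (?\<phi> p)\<bar> * hgrad io b ?\<phi> p * J p)"
   by (simp add: hgrad_chi[OF s] mult_ac)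
  also have "... = P" unfolding P_def
   by (rule eq) (use supp chi_zero[OF N(2)] in \<open>auto intro!: continuous_intros hgc chi_continuous s J_continuous\<close>)
  finally show ?thesis .
 qed
 have Q: "?m - s / real N * ?A <= (LBINT p. ?g p * ?g p powr (1 / ?n) * J p)"
 proof -
  have "?m - s / real N * ?A = integral (cube R) (%p. ?g p * J p) - integral (cube R) (%p. s / real N * (chi_s N s (?\<phi> p) * J p))"
   unfolding A_def M_def lev_def by (simp only: integral_mult_right)
  also have "... = integral (cube R) (%p. ?g p * J p - s / real N * (chi_s N s (?\<phi> p) * J p))"
   by (intro Henstock_Kurzweil_Integration.integral_diff[symmetric] integrable_continuous continuous_intros chi_continuous s J_continuous)
  also have "... = integral (cube R) (%p. (?g p)^2 * J p)"
  proof (rule integral_cong)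
   fix p
   have "?g p * J p - s / real N * (chi_s N s (?\<phi> p) * J p) = (?g p - s / real N * chi_s N s (?\<phi> p)) * J p"
    by (simp add: left_diff_distrib mult.assoc)
   thus "?g p * J p - s / real N * (chi_s N s (?\<phi> p) * J p) = (?g p)^2 * J p"
    unfolding chi_s_eq[OF N(1) N0 s] by simp
  qed
  also have "... <= integral (cube R) (%p. ?g p * ?g p powr (1 / ?n) * J p)"
  proof (rule integral_le)
   show "(%p. (?g p)^2 * J p) integrable_on cube R"
    by (intro integrable_continuous continuous_intros gc J_continuous)
   show "(%p. ?g p * ?g p powr (1 / ?n) * J p) integrable_on cube R"
    using gn n by (intro integrable_continuous continuous_on_mult continuous_on_powr' gc J_continuous continuous_on_const) auto
   fix p
   have "?g p <= ?g p powr (1 / ?n)"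
   proof (cases "?g p = 0")
    case False
    hence "?g p > 0" using gn(1)[of p] by simp
    hence "?g p powr 1 <= ?g p powr (1 / ?n)" using gn(2)[of p] n1 by (intro powr_mono') auto
    thus ?thesis using gn(1)[of p] by simp
   qed simp
   hence "?g p * ?g p * J p <= ?g p * ?g p powr (1 / ?n) * J p"
    using gn(1)[of p] J_nonneg[of p] by (intro mult_right_mono mult_left_mono)
   thus "(?g p)^2 * J p <= ?g p * ?g p powr (1 / ?n) * J p" by (simp add: power2_eq_square)
  qed
  also have "... = (LBINT p. ?g p * ?g p powr (1 / ?n) * J p)"
   by (rule eq[symmetric]) (use gn n g0 in \<open>auto intro!: continuous_on_mult continuous_on_powr' gc J_continuous continuous_on_const\<close>)
  finally show ?thesis .
 qed
 have "?c * (?m - s / real N * ?A) <= ?c * (LBINT p. ?g p * ?g p powr (1 / ?n) * J p)"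
  by (intro mult_left_mono Q) auto
 also have "... <= ?m powr (1 / ?n) * P"
  using horospherical_isoperimetric[OF smg g0 gn(1) b, where io = io] unfolding Mm Pe by simp
 finally have 1: "?c * (?m - s / real N * ?A) <= ?m powr (1 / ?n) * P" .
 let ?I = "ball_perimeter ?n ?m"
 define E where "E = ?c * (s / real N * ?A) * ?m powr (- (1 / ?n))"
 have I: "?I = ?c * ?m * ?m powr (- (1 / ?n))"
  using Mp by (simp add: ball_perimeter_def powr_diff powr_minus_divide)
 have mm: "?m powr (1 / ?n) * ?m powr (- (1 / ?n)) = 1" using Mp by (simp add: powr_add[symmetric])
 have "?c * (?m - s / real N * ?A) * ?m powr (- (1 / ?n)) <= ?m powr (1 / ?n) * P * ?m powr (- (1 / ?n))"
  by (intro mult_right_mono 1) simp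
 also have "... = P" using mm by (simp add: mult_ac)
 finally have IP: "?I <= P + E" unfolding I E_def by (simp add: algebra_simps)
 have I0: "?I >= 0" unfolding ball_perimeter_def by simp
 \<comment> \<open>Combined with 2 I P <= I^2 + P^2 this gives I^2 <= P^2 + 2 I E. The error stays
   linear in E and therefore in A, so division by A is harmless.\<close>
 have "?I^2 <= ?I * (P + E)" unfolding power2_eq_square by (rule mult_left_mono[OF IP I0])
 moreover have "2 * (?I * P) <= ?I^2 + P^2" using sum_squares_bound[of ?I P] by simp
 ultimately have "?I^2 <= P^2 + 2 * (?I * E)" by (simp add: algebra_simps)
 hence "?I^2 / ?A <= (P^2 + 2 * (?I * E)) / ?A" using A by (intro divide_right_mono) auto
 also have "... = P^2 / ?A + 2 * (?I * E) / ?A" by (rule add_divide_distrib)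
 also have "2 * (?I * E) / ?A = isoc * s * ?m powr (1 - 2 / ?n)"
 proof -
  have "?I * E = ?c^2 * (s / real N) * ?A * (?m powr 1 * ?m powr (- (1 / ?n)) * ?m powr (- (1 / ?n)))"
   unfolding I E_def using Mp by (simp add: power2_eq_square)
  also have "?m powr 1 * ?m powr (- (1 / ?n)) * ?m powr (- (1 / ?n)) = ?m powr (1 - 2 / ?n)"
   by (simp only: powr_add[symmetric]) simp
  finally show ?thesis using A by (simp add: isoc_def)
 qed
 also have "P^2 / ?A <= integral (cube R) (%p. chi_b N s (?\<phi> p) * ((hgrad io b ?\<phi> p)^2 * J p))"
  unfolding P_def A_def
 proof (rule integral_Cauchy_Schwarz)
  show "0 < integral (cube R) (%p. chi_s N s (f (vjoin p y)) * J p)" using A by (simp add: A_def)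
  fix p
  show "(\<bar>chi_u N s (?\<phi> p)\<bar> * hgrad io b ?\<phi> p * J p)^2 = chi_s N s (?\<phi> p) * J p * (chi_b N s (?\<phi> p) * ((hgrad io b ?\<phi> p)^2 * J p))"
   unfolding power_mult_distrib power2_abs chi_u_square(1)[OF N(2)] by (simp add: power2_eq_square mult_ac)
 qed (auto intro!: integrable_continuous continuous_intros chi_continuous s hgc J_continuous
  mult_nonneg_nonneg chi_nonneg_derivs N J_nonneg)
 finally show ?thesis by simp
qed

end

lemma nn_integral_energy:
 fixes x w :: "'a::euclidean_space => real" and z :: "'j::finite => 'a => real"
 assumes c: "c >= 0" "a >= 0" "D > 0" "sg >= 0"
  and x: "cts UNIV x" "!!p. x p >= 0" and w: "cts UNIV w" "!!p. w p >= 0"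
  and z: "!!j. cts UNIV (z j)" "!!j p. z j p >= 0"
 shows "(LBNN p. ennreal (c * (a * (x p + (\<Sum>j\<in>UNIV. z j p) / D) + sg * w p))) =
  ennreal c * (ennreal a * (LBNN p. ennreal (x p))
   + (\<Sum>j\<in>UNIV. ennreal (a / D) * (LBNN p. ennreal (z j p))) + ennreal sg * (LBNN p. ennreal (w p)))"
proof -
 have m: "x \<in> bmeas" "w \<in> bmeas" "!!j. z j \<in> bmeas"
  by (auto intro: borel_measurable_continuous_onI x(1) w(1) z(1))
 have "ennreal (c * (a * (x p + (\<Sum>j\<in>UNIV. z j p) / D) + sg * w p)) =
   ennreal c * (ennreal a * ennreal (x p) + (\<Sum>j\<in>UNIV. ennreal (a / D) * ennreal (z j p)) + ennreal sg * ennreal (w p))" for p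
 proof -
  have "a * (x p + (\<Sum>j\<in>UNIV. z j p) / D) = a * x p + (\<Sum>j\<in>UNIV. a / D * z j p)"
   by (simp add: distrib_left sum_distrib_left sum_divide_distrib)
  moreover have "(\<Sum>j\<in>UNIV. a / D * z j p) >= 0" using c z(2) by (intro sum_nonneg) auto
  moreover have "(\<Sum>j\<in>UNIV. ennreal (a / D) * ennreal (z j p)) = ennreal (\<Sum>j\<in>UNIV. a / D * z j p)"
  proof -
   have "(\<Sum>j\<in>UNIV. ennreal (a / D) * ennreal (z j p)) = (\<Sum>j\<in>UNIV. ennreal (a / D * z j p))"
    using c by (intro sum.cong refl ennreal_mult'[symmetric]) auto
   also have "... = ennreal (\<Sum>j\<in>UNIV. a / D * z j p)" using c z(2) by (intro sum_ennreal) auto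
   finally show ?thesis .
  qed
  ultimately show ?thesis using c x(2)[of p] w(2)[of p]
   by (simp add: ennreal_mult' ennreal_plus)
 qed
 thus ?thesis using m
  by (simp add: nn_integral_cmult nn_integral_add nn_integral_sum)
qed

context levels
begin

abbreviation "\<kappa> \<equiv> real N / (real N - 2)"

lemma partial_W_continuous:
 assumes "dl > 0" "t > 0"
 shows "cts UNIV (%p. partial_deriv m (W dl t) (vjoin p y))" "cts UNIV (%p. W dl t (vjoin p y))"
 using smooth_on_cts[OF smooth_on_slice[OF smooth_on_partial_deriv[OF W_smooth[OF assms]]]]
  smooth_on_cts[OF smooth_on_slice[OF W_smooth[OF assms]]] by auto

text \<open>The three level bounds, integrated over [t, s1]. The isoperimetric error is replaced by
  its value at s1 and the total volume V, which yields the factor s1^2 after integration.\<close>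

lemma W_slice_energy:
 assumes v: "CARD('v) >= 2" and dl: "dl > 0" and t: "0 < t" "t <= s1"
  and M1: "M s1 y <= unit_ball_vol (real CARD('v)) * dl powr (real CARD('v) / 2)"
 shows "(LBNN p. ennreal (\<Sum>i\<in>UNIV. (partial_deriv (Inl i) (W dl t) (vjoin p y))^2)) <=
   ennreal \<kappa> * (LBNN p. ennreal ((hgrad io b (%p. f (vjoin p y)) p)^2 * J p))
    + ennreal (isoc * s1^2 * V powr (1 - 2 / real CARD('v)))" (is ?p)
  and "(LBNN p. ennreal ((partial_deriv (Inr j) (W dl t) (vjoin p y))^2)) <=
   ennreal \<kappa> * (LBNN p. ennreal ((partial_deriv (Inr j) f (vjoin p y))^2 * J p))" (is ?j)
  and "(LBNN p. ennreal ((W dl t (vjoin p y))^2)) <= ennreal \<kappa> * (LBNN p. ennreal ((f (vjoin p y))^2 * J p))" (is ?l)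
proof -
 let ?n = "real CARD('v)" and ?\<phi> = "%p. f (vjoin p y)"
 note lvl_le = nn_integral_lvl_le[OF v dl t M1]
 note Sc = S_slice_continuous[OF t(1), of y] and Ac = A_slice_continuous(1)[OF t(1), of y] A_slice_continuous(2)[OF t(1), of _ y]
 have sq_le: "(x / A s y)^2 * A s y = x^2 / A s y" if "A s y > 0" for x s
  using that by (simp add: power2_eq_square)
 have pos: "s > 0 & A s y > 0" if "t < s" "M s y > 0" for s
  using A_pos[OF _ _ that(2)] that t(1) by auto
 have hgc: "cts UNIV (%p. (hgrad io b ?\<phi> p)^2 * J p)"
  by (intro continuous_intros continuous_on_hgrad smooth_on_slice[OF f] J_continuous)
 have jc: "cts UNIV (%p. (partial_deriv (Inr j) f (vjoin p y))^2 * J p)"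
  by (intro continuous_intros partial_f_continuous J_continuous)
 have fc: "cts UNIV (%p. (f (vjoin p y))^2 * J p)"
  by (intro continuous_intros f_continuous J_continuous)
 have S0: "S x y > 0" if "x \<in> {0<..<M t y}" for x using S_props(1)[OF t(1), of x y] that t by auto
 show ?j
 proof -
  have "(LBNN p. ennreal ((partial_deriv (Inr j) (W dl t) (vjoin p y))^2)) <=
    (LBNN p. ennreal (lvl t (%x s. (Z j s y / A s y)^2) y (vball dl (p :: real ^ 'v))))"
   using W_partial_deriv(2)[OF dl t(1), of j "vjoin _ y"] by (intro nn_integral_mono ennreal_leI) simp
  also have "... <= (LBNN s. ennreal (integral (cube R) (%p. chi_b N s (?\<phi> p) * ((partial_deriv (Inr j) f (vjoin p y))^2 * J p))) * ind {t..s1} s)"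
  proof (rule lvl_le)
   show "cts {0<..<M t y} (%x. (Z j (S x y) y / A (S x y) y)^2)"
    using Ac S0 by (intro continuous_intros continuous_on_compose2[OF Z_continuous Sc]) (auto simp: less_imp_neq[symmetric])
   fix s assume "t < s" "M s y > 0"
   thus "(Z j s y / A s y)^2 * A s y <= integral (cube R) (%p. chi_b N s (?\<phi> p) * ((partial_deriv (Inr j) f (vjoin p y))^2 * J p))"
    using pos[of s] Z_level_bound[of s y j] by (simp add: sq_le)
  qed simp
  also have "... <= ennreal \<kappa> * (LBNN p. ennreal ((partial_deriv (Inr j) f (vjoin p y))^2 * J p))"
   by (rule nn_integral_levels_swap(2)[OF jc _ t]) (simp add: J_nonneg)
  finally show ?thesis .
 qed
 show ?l
 proof -
  have "(LBNN p. ennreal ((W dl t (vjoin p y))^2)) <=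
    (LBNN p. ennreal (lvl t (%x s. s^2) y (vball dl (p :: 'v rv))))"
   using W_partial_deriv(3)[OF dl t(1), of "vjoin _ y"] by (intro nn_integral_mono ennreal_leI) simp
  also have "... <= (LBNN s. ennreal (integral (cube R) (%p. chi_b N s (?\<phi> p) * ((f (vjoin p y))^2 * J p))) * ind {t..s1} s)"
  proof (rule lvl_le)
   show "cts {0<..<M t y} (%x. (S x y)^2)" by (intro continuous_intros Sc)
   fix s assume "t < s"
   thus "s^2 * A s y <= integral (cube R) (%p. chi_b N s (?\<phi> p) * ((f (vjoin p y))^2 * J p))"
    using A_level_eq[of s y] t(1) by simp
  qed simp
  also have "... <= ennreal \<kappa> * (LBNN p. ennreal ((f (vjoin p y))^2 * J p))"
   by (rule nn_integral_levels_swap(2)[OF fc _ t]) (simp add: J_nonneg)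
  finally show ?thesis .
 qed
 show ?p
 proof -
  let ?G = "%s. integral (cube R) (%p. chi_b N s (?\<phi> p) * ((hgrad io b ?\<phi> p)^2 * J p))"
  let ?e = "isoc * s1 * V powr (1 - 2 / ?n)"
  have isoc: "isoc >= 0" unfolding isoc_def by simp
  have G0: "?G s >= 0" if "s > 0" for s
   by (rule chi_b_integral_nonneg[OF that _ hgc]) (simp add: J_nonneg)
  have "(LBNN p. ennreal (\<Sum>i\<in>UNIV. (partial_deriv (Inl i) (W dl t) (vjoin p y))^2)) <=
    (LBNN p. ennreal (lvl t (%x s. (ball_perimeter ?n x / A s y)^2) y (vball dl (p :: 'v rv))))"
   using W_partial_deriv(1)[OF dl t(1), of "vjoin _ y"] by (intro nn_integral_mono ennreal_leI) simp
  also have "... <= (LBNN s. ennreal (?G s + ?e) * ind {t..s1} s)"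
  proof (rule lvl_le)
   show "cts {0<..<M t y} (%x. (ball_perimeter ?n x / A (S x y) y)^2)"
    unfolding ball_perimeter_def using Ac by (intro continuous_intros) (auto simp: less_imp_neq[symmetric])
   fix s assume s: "t < s" "s <= s1" "M s y > 0"
   have "(ball_perimeter ?n (M s y) / A s y)^2 * A s y <= ?G s + isoc * s * M s y powr (1 - 2 / ?n)"
    using pos[OF s(1,3)] perimeter_level_bound[of s y] s(3) by (simp add: sq_le)
   also have "... <= ?G s + ?e"
   proof -
    have "M s y powr (1 - 2 / ?n) <= V powr (1 - 2 / ?n)"
     using M_bounds(1,2)[of s y] s t v by (intro powr_mono2) auto
    thus ?thesis using isoc s t by (intro add_left_mono mult_mono) auto
   qed
   finally show "(ball_perimeter ?n (M s y) / A s y)^2 * A s y <= ?G s + ?e" .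
  qed simp
  also have "... = (LBNN s. ennreal (?G s) * ind {t..s1} s + ennreal ?e * ind {t..s1} s)"
  proof (rule nn_integral_cong)
   fix s
   show "ennreal (?G s + ?e) * ind {t..s1} s = ennreal (?G s) * ind {t..s1} s + ennreal ?e * ind {t..s1} s"
    using G0[of s] isoc t by (auto split: split_indicator simp: ennreal_plus)
  qed
  also have "... = (LBNN s. ennreal (?G s) * ind {t..s1} s) + (LBNN s. ennreal ?e * ind {t..s1} s)"
   by (rule nn_integral_add[OF nn_integral_levels_swap(1)[OF hgc _ t]]) (auto simp: J_nonneg)
  also have "... <= ennreal \<kappa> * (LBNN p. ennreal ((hgrad io b ?\<phi> p)^2 * J p)) + ennreal (isoc * s1^2 * V powr (1 - 2 / ?n))"
  proof (rule add_mono)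
   show "(LBNN s. ennreal (?G s) * ind {t..s1} s) <= ennreal \<kappa> * (LBNN p. ennreal ((hgrad io b ?\<phi> p)^2 * J p))"
    by (rule nn_integral_levels_swap(2)[OF hgc _ t]) (simp add: J_nonneg)
   have "(LBNN s. ennreal ?e * ind {t..s1} s) = ennreal (?e * (s1 - t))"
    using t isoc by (simp add: nn_integral_cmult_indicator ennreal_mult')
   also have "... <= ennreal (?e * s1)" using t isoc by (intro ennreal_leI mult_left_mono) auto
   also have "?e * s1 = isoc * s1^2 * V powr (1 - 2 / ?n)" by (simp add: power2_eq_square)
   finally show "(LBNN s. ennreal ?e * ind {t..s1} s) <= ennreal (isoc * s1^2 * V powr (1 - 2 / ?n))" .
  qed
  finally show ?thesis .
 qed
qed

text \<open>Both functionals carry the same weights in the sphere variable, so the slice estimates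
  can be integrated against them. The error is multiplied by the finite mass of
  \<open>sdens\<close>.\<close>

lemma W_energy:
 assumes v: "CARD('v) >= 2" and dl: "dl > 0" and t: "0 < t" "t <= s1"
  and M1: "!!y. M s1 y <= unit_ball_vol (real CARD('v)) * dl powr (real CARD('v) / 2)"
  and a: "a >= 0" and sg: "sg >= 0"
 shows "(LBNN q. ennreal (pdens io 0 1 q * (a * pnormsq io 0 1 (W dl t) q + sg * (W dl t q)^2))) <=
  ennreal \<kappa> * (LBNN q. ennreal (pdens io b 1 q * (a * pnormsq io b 1 f q + sg * (f q)^2)))
  + ennreal (a * (isoc * s1^2 * V powr (1 - 2 / real CARD('v)))) * (LBNN y. ennreal (sdens (y :: real ^ 'w)))"
proof -
 let ?W = "W dl t" and ?e = "isoc * s1^2 * V powr (1 - 2 / real CARD('v))"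
 let ?D = "%y :: 'w rv. (2 / (1 + y \<bullet> y))^2"
 have D: "?D y > 0" for y using one_plus_inner_pos[of y] by simp
 have Wsm: "smooth_on UNIV ?W" by (rule W_smooth[OF dl t(1)])
 let ?LW = "%q. ennreal (pdens io 0 1 q * (a * pnormsq io 0 1 ?W q + sg * (?W q)^2))"
 let ?Lf = "%q. ennreal (pdens io b 1 q * (a * pnormsq io b 1 f q + sg * (f q)^2))"
 have meas: "(%q. pdens io b' 1 q * (a * pnormsq io b' 1 g q + sg * (g q)^2)) \<in> bmeas"
  if "smooth_on UNIV g" for g :: "real ^ ('v + 'w) => real" and b'
  by (intro borel_measurable_continuous_onI continuous_intros continuous_on_pdens continuous_on_pnormsq that smooth_on_cts[OF that]) simp
 have eqW: "(LBNN p. ?LW (vjoin p y)) =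
   ennreal (sdens y) * (ennreal a * (LBNN p. ennreal (\<Sum>i\<in>UNIV. (partial_deriv (Inl i) ?W (vjoin p y))^2))
   + (\<Sum>j\<in>UNIV. ennreal (a / ?D y) * (LBNN p. ennreal ((partial_deriv (Inr j) ?W (vjoin p y))^2)))
   + ennreal sg * (LBNN p. ennreal ((?W (vjoin p y))^2)))" for y
 proof -
  have "pdens io 0 1 (vjoin p y) * (a * pnormsq io 0 1 ?W (vjoin p y) + sg * (?W (vjoin p y))^2) =
    sdens y * (a * ((\<Sum>i\<in>UNIV. (partial_deriv (Inl i) ?W (vjoin p y))^2) + (\<Sum>j\<in>UNIV. (partial_deriv (Inr j) ?W (vjoin p y))^2) / ?D y)
     + sg * (?W (vjoin p y))^2)" for p :: "real ^ 'v"
  proof -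
   have "(if i = io then 1 else exp (2 * 0 * vjoin p y $ Inl io)) = (1::real)" for i by simp
   thus ?thesis unfolding pdens_eq hdens_def pnormsq_split by simp
  qed
  thus ?thesis
   using sdens_pos[of y] a sg D[of y] partial_W_continuous[OF dl t(1)]
   by (simp only:) (intro nn_integral_energy continuous_intros, auto intro: sum_nonneg)
 qed
 have eqf: "(LBNN p. ?Lf (vjoin p y)) =
   ennreal (sdens y) * (ennreal a * (LBNN p. ennreal ((hgrad io b (%p. f (vjoin p y)) p)^2 * J p))
   + (\<Sum>j\<in>UNIV. ennreal (a / ?D y) * (LBNN p. ennreal ((partial_deriv (Inr j) f (vjoin p y))^2 * J p)))
   + ennreal sg * (LBNN p. ennreal ((f (vjoin p y))^2 * J p)))" for y
 proof -
  have hg: "(hgrad io b (%p. f (vjoin p y)) p)^2 =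
    (\<Sum>i\<in>UNIV. (partial_deriv (Inl i) f (vjoin p y))^2 / (if i = io then 1 else exp (2 * b * p $ io)))" for p
   unfolding hgrad_def partial_deriv_slice[OF f] by (intro real_sqrt_pow2 sum_nonneg) auto
  have ns: "pnormsq io b 1 f (vjoin p y) = (hgrad io b (%p. f (vjoin p y)) p)^2 + (\<Sum>j\<in>UNIV. (partial_deriv (Inr j) f (vjoin p y))^2) / ?D y" for p :: "'v rv"
  proof -
   have "vjoin p y $ Inl io = p $ io" by (simp add: vjoin_def)
   thus ?thesis unfolding pnormsq_split hg by (simp cong: if_cong)
  qed
  have "pdens io b 1 (vjoin p y) * (a * pnormsq io b 1 f (vjoin p y) + sg * (f (vjoin p y))^2) =
    sdens y * (a * ((hgrad io b (%p. f (vjoin p y)) p)^2 * J p + (\<Sum>j\<in>UNIV. (partial_deriv (Inr j) f (vjoin p y))^2 * J p) / ?D y)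
     + sg * ((f (vjoin p y))^2 * J p))" for p :: "'v rv"
   unfolding ns sum_distrib_right[symmetric] by (simp add: pdens_eq algebra_simps)
  moreover have "cts UNIV (hgrad io b (%p. f (vjoin p y)))" by (rule continuous_on_hgrad[OF smooth_on_slice[OF f]])
  ultimately show ?thesis
   using sdens_pos[of y] a sg D[of y] J_nonneg
   by (simp only:) (intro nn_integral_energy continuous_intros f_continuous partial_f_continuous J_continuous, auto)
 qed
 have sm: "(%y. ennreal (sdens y)) \<in> borel_measurable (lborel :: 'w rv measure)" by measurable
 have Lfm: "(%y. (LBNN p. ?Lf (vjoin p y))) \<in> borel_measurable (lborel :: 'w rv measure)"
 proof -
  have "cts UNIV (%z :: 'w rv \<times> 'v rv. vjoin (snd z) (fst z) :: real ^ ('v + 'w))" by (intro continuous_intros)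
  hence "(%z :: 'w rv \<times> 'v rv. vjoin (snd z) (fst z) :: real ^ ('v + 'w)) \<in> bmeas"
   by (rule borel_measurable_continuous_onI)
  from measurable_compose[OF this meas[OF f, of b]]
  have "(%(y, p). ?Lf (vjoin p y)) \<in> borel_measurable (lborel \<Otimes>\<^sub>M lborel)"
   by (simp add: lborel_prod case_prod_unfold)
  thus ?thesis by (rule lborel.borel_measurable_nn_integral)
 qed
 have "(LBNN q. ?LW q) = (LBNN y. (LBNN p. ?LW (vjoin p y)))"
  by (rule nn_integral_vjoin[OF measurable_compose[OF meas[OF Wsm] measurable_ennreal]])
 also have "... <= (LBNN y. ennreal \<kappa> * (LBNN p. ?Lf (vjoin p y)) + ennreal (a * ?e) * ennreal (sdens y))"
 proof (rule nn_integral_mono)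
  fix y :: "'w rv"
  note E = W_slice_energy[OF v dl t M1[of y]]
  have isoc: "isoc >= 0" unfolding isoc_def by simp
  have "(LBNN p. ?LW (vjoin p y)) <= ennreal (sdens y) *
   (ennreal a * (ennreal \<kappa> * (LBNN p. ennreal ((hgrad io b (%p. f (vjoin p y)) p)^2 * J p)) + ennreal ?e)
   + (\<Sum>j\<in>UNIV. ennreal (a / ?D y) * (ennreal \<kappa> * (LBNN p. ennreal ((partial_deriv (Inr j) f (vjoin p y))^2 * J p))))
   + ennreal sg * (ennreal \<kappa> * (LBNN p. ennreal ((f (vjoin p y))^2 * J p))))"
   unfolding eqW by (intro mult_left_mono add_mono sum_mono E) auto
  also have "... = ennreal \<kappa> * (LBNN p. ?Lf (vjoin p y)) + ennreal a * ennreal ?e * ennreal (sdens y)"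
   unfolding eqf by (simp add: distrib_left sum_distrib_left mult_ac add_ac)
  also have "ennreal a * ennreal ?e = ennreal (a * ?e)" using a by (simp add: ennreal_mult')
  finally show "(LBNN p. ?LW (vjoin p y)) <= ennreal \<kappa> * (LBNN p. ?Lf (vjoin p y)) + ennreal (a * ?e) * ennreal (sdens y)" .
 qed
 also have "... = ennreal \<kappa> * (LBNN y. (LBNN p. ?Lf (vjoin p y))) + ennreal (a * ?e) * (LBNN y. ennreal (sdens (y :: 'w rv)))"
  using Lfm sm by (simp add: nn_integral_add nn_integral_cmult)
 also have "(LBNN y. (LBNN p. ?Lf (vjoin p y))) = (LBNN q. ?Lf q)"
  by (rule nn_integral_vjoin[OF measurable_compose[OF meas[OF f] measurable_ennreal], symmetric])
 finally show ?thesis .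
qed

end

section \<open>The rearrangement asymptotically preserves the power integral\<close>

lemma layer_cake:
 fixes w r :: real
 assumes w: "w >= 0" and r: "r > 1"
 shows "(\<integral>\<^sup>+ta. ennreal (r * ta powr (r - 1)) * ind {0..w} ta \<partial>lborel) = ennreal (w powr r)"
proof -
 have "((%ta. r * ta powr (r - 1)) has_integral w powr r - 0 powr r) {0..w}"
 proof (rule fundamental_theorem_of_calculus_interior[OF w])
  show "cts {0..w} (%ta. ta powr r)"
   using r by (intro continuous_on_powr' continuous_on_id continuous_on_const) auto
  fix ta assume "ta \<in> {0<..<w}"
  thus "((%ta. ta powr r) has_vector_derivative r * ta powr (r - 1)) (at ta)"
   unfolding has_real_derivative_iff_has_vector_derivative[symmetric] by (intro has_real_derivative_powr) auto
 qed
 hence "integral\<^sup>N lborel (%ta. ennreal (ind {0..w} ta * (r * ta powr (r - 1)))) = ennreal (w powr r - 0 powr r)"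
  using r by (intro nn_integral_has_integral_lebesgue) auto
 thus ?thesis using r by (simp add: ennreal_mult'' mult.commute ennreal_indicator[symmetric])
qed

text \<open>Without dl the set would be a ball of volume m. The mean value theorem bounds the
  deficit by a multiple of dl that is uniform in m <= V.\<close>

lemma emeasure_vball_less:
 assumes v: "CARD('v::finite) >= 2" and dl: "dl > 0" and m: "0 <= m" "m <= V"
 defines "\<omega> \<equiv> unit_ball_vol (real CARD('v))" and "\<beta> \<equiv> real CARD('v) / 2"
 shows "ennreal (m - \<omega> * \<beta> * ((V / \<omega>) powr (1 / \<beta>)) powr (\<beta> - 1) * dl) <= emeasure lborel {p :: real ^ 'v. vball dl p < m}"
proof -
 define a where "a = (m / \<omega>) powr (1 / \<beta>)"
 define a' where "a' = (V / \<omega>) powr (1 / \<beta>)"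
 have \<omega>: "\<omega> > 0" by (simp add: \<omega>_def)
 have \<beta>: "\<beta> >= 1" using v by (simp add: \<beta>_def)
 have aa': "0 <= a" "a <= a'" using m \<omega> \<beta> unfolding a_def a'_def by (auto intro!: powr_mono2 divide_right_mono)
 have ma: "m = \<omega> * a powr \<beta>" using m \<omega> \<beta> by (simp add: a_def powr_powr)
 have pw: "a powr (\<beta> - 1) <= a' powr (\<beta> - 1)" using aa' \<beta> by (intro powr_mono2) auto
 show ?thesis
 proof (cases "a <= dl")
  \<comment> \<open>The set may be empty here, but m is so small that the left side is zero.\<close>
  case True
  have "a powr \<beta> = a powr (\<beta> - 1) * a"
  proof (cases "a = 0")
   case False
   hence "a powr (\<beta> - 1) * a powr 1 = a powr \<beta>" unfolding powr_add[symmetric] by simp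
   thus ?thesis using aa' by simp
  qed simp
  also have "... <= a' powr (\<beta> - 1) * dl" using pw True aa' by (intro mult_mono) auto
  also have "... <= \<beta> * (a' powr (\<beta> - 1) * dl)" using \<beta> dl mult_right_mono[OF \<beta>, of "a' powr (\<beta> - 1) * dl"] by simp
  finally have "m <= \<omega> * \<beta> * a' powr (\<beta> - 1) * dl" unfolding ma using \<omega> by (simp add: mult.assoc)
  thus ?thesis by (simp add: a'_def ennreal_neg)
 next
  case False
  hence ad: "a - dl > 0" by simp
  have "\<exists>z. a - dl < z & z < a & a powr \<beta> - (a - dl) powr \<beta> = (a - (a - dl)) * (\<beta> * z powr (\<beta> - 1))"
   by (rule MVT2) (use dl ad in \<open>auto intro!: has_real_derivative_powr\<close>)
  then obtain z where z: "a - dl < z" "z < a" "a powr \<beta> - (a - dl) powr \<beta> = dl * (\<beta> * z powr (\<beta> - 1))" by auto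
  have "z powr (\<beta> - 1) <= a' powr (\<beta> - 1)" using z ad aa' \<beta> by (intro powr_mono2) auto
  hence "dl * (\<beta> * z powr (\<beta> - 1)) <= dl * (\<beta> * a' powr (\<beta> - 1))" using dl \<beta> by (intro mult_left_mono) auto
  hence "\<omega> * (a powr \<beta> - (a - dl) powr \<beta>) <= \<omega> * (dl * (\<beta> * a' powr (\<beta> - 1)))" unfolding z(3) by (rule mult_left_mono) (use \<omega> in simp)
  hence 1: "m - \<omega> * \<beta> * a' powr (\<beta> - 1) * dl <= \<omega> * (a - dl) powr \<beta>" unfolding ma by (simp add: algebra_simps)
  let ?r = "sqrt (a - dl)"
  have "ball 0 ?r \<subseteq> {p :: 'v rv. vball dl p < m}"
  proof
   fix p :: "'v rv" assume "p \<in> ball 0 ?r"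
   hence "norm p < ?r" by simp
   hence "(norm p)^2 < ?r^2" by (intro power_strict_mono) auto
   hence "p \<bullet> p + dl < a" using ad by (simp add: power2_norm_eq_inner)
   hence "(p \<bullet> p + dl) powr \<beta> < a powr \<beta>" using \<beta> dl by (intro powr_less_mono2) (auto intro: add_nonneg_nonneg)
   thus "p \<in> {p. vball dl p < m}" using \<omega> unfolding ma vball_def \<omega>_def \<beta>_def by simp
  qed
  hence "emeasure lborel (ball 0 ?r :: 'v rv set) <= emeasure lborel {p :: 'v rv. vball dl p < m}"
   using smooth_on_cts[OF smooth_on_vball[OF dl]]
   by (intro emeasure_mono) (auto intro!: borel_open open_Collect_less continuous_intros)
  moreover have "emeasure lborel (ball 0 ?r :: 'v rv set) = ennreal (\<omega> * (a - dl) powr \<beta>)"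
  proof -
   have "?r ^ CARD('v) = (a - dl) powr \<beta>"
    using ad by (simp add: powr_half_sqrt[symmetric] powr_power \<beta>_def)
   thus ?thesis using ad by (simp add: emeasure_ball \<omega>_def)
  qed
  ultimately show ?thesis using ennreal_leI[OF 1] by (simp add: a'_def)
 qed
qed

text \<open>The layer-cake integral for |u|^r with the indicator of |u| > ta replaced by the kernel
  at level ta + 2t. The shift pays for two losses of t in the rearrangement, one from the cutoff
  level and one from \<open>soft_pos\<close>.\<close>

definition chi_pow :: "nat => real => real => real => real => ennreal" where
 "chi_pow N t \<Lambda> r u = (\<integral>\<^sup>+ta. ennreal (r * ta powr (r - 1)) * ind {0..\<Lambda>} ta * ennreal (chi N (ta + 2 * t) u) \<partial>lborel)"

lemma chi_pow_measurable [measurable]: "chi_pow N t \<Lambda> r \<in> bmeas"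
proof -
 have "(%(u, ta). ennreal (r * ta powr (r - 1)) * ind {0..\<Lambda>} ta * ennreal (chi N (ta + 2 * t) u)) \<in> borel_measurable (borel \<Otimes>\<^sub>M lborel)"
  unfolding chi_def by measurable
 thus ?thesis unfolding chi_pow_def[abs_def] by (rule lborel.borel_measurable_nn_integral)
qed

context levels
begin

definition vloss :: "real => real" where
 "vloss dl = unit_ball_vol (real CARD('v)) * (real CARD('v) / 2) *
   ((V / unit_ball_vol (real CARD('v))) powr (1 / (real CARD('v) / 2))) powr (real CARD('v) / 2 - 1) * dl"

text \<open>The set W >= ta contains all points whose volume coordinate is below M (ta + 2t), so up
  to \<open>vloss\<close> it has at least that volume. Integration over ta gives a lower bound for
  the power integral of W, the direction needed in the denominator of the quotient.\<close>

lemma W_slice_pow: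
 assumes v: "CARD('v) >= 2" and dl: "dl > 0" and t: "0 < t" and r: "r > 1"
 shows "(LBNN p. ennreal (J p) * chi_pow N t \<Lambda> r (f (vjoin p y))) <=
  (LBNN p. ennreal (W dl t (vjoin p y) powr r)) + ennreal (vloss dl * \<Lambda> powr r)"
proof -
 let ?k = "%ta. ennreal (r * ta powr (r - 1)) * ind {0..\<Lambda>} ta"
 have fm: "(%p. f (vjoin p y)) \<in> bmeas" by (rule borel_measurable_continuous_onI[OF f_continuous])
 have Wc: "cts UNIV (%p. W dl t (vjoin p y))" by (rule partial_W_continuous(2)[OF dl t])
 have Wm: "(%p. W dl t (vjoin p y)) \<in> bmeas" by (rule borel_measurable_continuous_onI[OF Wc])
 have W0: "W dl t q >= 0" for q by (rule W_nonneg[OF dl t])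
 have vl: "vloss dl >= 0" using dl unfolding vloss_def by simp
 have Mnn: "(LBNN p. ennreal (chi N s (f (vjoin p y))) * ennreal (J p)) = ennreal (M s y)" if s: "s > 0" for s
 proof -
  have "ennreal (M s y) = (LBNN p. ennreal (chi N s (f (vjoin p y)) * J p) * ind (cube R) p)"
   unfolding M_def lev_def
   by (intro nn_integral_cbox_eq continuous_on_mult chi_continuous s J_continuous mult_nonneg_nonneg chi_bounds N J_nonneg)
  also have "... = (LBNN p. ennreal (chi N s (f (vjoin p y))) * ennreal (J p))"
  proof (rule nn_integral_cong)
   fix p
   show "ennreal (chi N s (f (vjoin p y)) * J p) * ind (cube R) p = ennreal (chi N s (f (vjoin p y))) * ennreal (J p)"
   proof (cases "p \<in> cube R")
    case True
    thus ?thesis using chi_bounds(1)[OF N(1) s] by (simp add: ennreal_mult')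
   next
    case False
    thus ?thesis using cube_off[OF False] supp[of "vjoin p y"] chi_zero[OF N(2)] by simp
   qed
  qed
  finally show ?thesis ..
 qed
 have vol: "ennreal (M (ta + 2 * t) y) <= emeasure lborel {p. ta <= W dl t (vjoin p y)} + ennreal (vloss dl)" if ta: "ta >= 0" for ta
 proof -
  let ?m = "M (ta + 2 * t) y"
  have s: "ta + 2 * t > 0" using ta t by simp
  have "{p :: real ^ 'v. vball dl p < ?m} \<subseteq> {p. ta <= W dl t (vjoin p y)}"
  proof
   fix p :: "'v rv" assume "p \<in> {p. vball dl p < ?m}"
   hence p: "vball dl p < ?m" by simp
   also have "?m <= M t y" using ta t by (intro M_antimono) auto
   finally have pt: "vball dl p < M t y" .
   have "ta + 2 * t < S (vball dl p) y" by (rule less_S[OF t _ vball_pos[OF dl] p]) (use pt in simp)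
   hence "ta <= soft_pos t (S (vball dl p) y - t)" using soft_pos_bounds(2)[OF t, of "S (vball dl p) y - t"] by simp
   thus "p \<in> {p. ta <= W dl t (vjoin p y)}" using pt by (simp add: W_eq[OF dl t])
  qed
  hence "emeasure lborel {p :: 'v rv. vball dl p < ?m} <= emeasure lborel {p. ta <= W dl t (vjoin p y)}"
   using Wc by (intro emeasure_mono) (auto intro!: borel_closed closed_Collect_le continuous_intros)
  moreover have "ennreal (?m - vloss dl) <= emeasure lborel {p :: 'v rv. vball dl p < ?m}"
   using emeasure_vball_less[OF v dl M_bounds(1,2)[OF s]] by (simp add: vloss_def)
  moreover have "ennreal ?m <= ennreal (?m - vloss dl) + ennreal (vloss dl)"
   using vl M_bounds(1)[OF s, of y] by (cases "?m <= vloss dl") (auto simp: ennreal_plus[symmetric] ennreal_neg simp del: ennreal_plus intro: ennreal_leI)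
  ultimately show ?thesis by (meson add_right_mono order_trans)
 qed
 have "(LBNN p. ennreal (J p) * chi_pow N t \<Lambda> r (f (vjoin p y))) =
   (LBNN p. \<integral>\<^sup>+ta. ?k ta * (ennreal (chi N (ta + 2 * t) (f (vjoin p y))) * ennreal (J p)) \<partial>lborel)"
 proof (rule nn_integral_cong)
  fix p
  have "(%ta. ?k ta * ennreal (chi N (ta + 2 * t) (f (vjoin p y)))) \<in> borel_measurable lborel" unfolding chi_def by measurable
  from nn_integral_cmult[OF this, of "ennreal (J p)"]
  show "ennreal (J p) * chi_pow N t \<Lambda> r (f (vjoin p y)) =
    (\<integral>\<^sup>+ta. ?k ta * (ennreal (chi N (ta + 2 * t) (f (vjoin p y))) * ennreal (J p)) \<partial>lborel)"
   unfolding chi_pow_def by (simp add: mult_ac)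
 qed
 also have "... = (\<integral>\<^sup>+ta. (LBNN p. ?k ta * (ennreal (chi N (ta + 2 * t) (f (vjoin p y))) * ennreal (J p))) \<partial>lborel)"
 proof -
  have "(%(p, ta). ?k ta * (ennreal (chi N (ta + 2 * t) (f (vjoin p y))) * ennreal (J p))) \<in> borel_measurable (lborel \<Otimes>\<^sub>M lborel)"
   unfolding chi_def using measurable_compose[OF measurable_fst fm] by measurable
  from lborel_pair.Fubini'[OF this] show ?thesis by simp
 qed
 also have "... = (\<integral>\<^sup>+ta. ?k ta * ennreal (M (ta + 2 * t) y) \<partial>lborel)"
 proof (rule nn_integral_cong)
  fix ta :: real
  have m: "(%p. ennreal (chi N (ta + 2 * t) (f (vjoin p y))) * ennreal (J p)) \<in> borel_measurable lborel"
   unfolding chi_def using fm by measurable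
  show "(LBNN p. ?k ta * (ennreal (chi N (ta + 2 * t) (f (vjoin p y))) * ennreal (J p))) = ?k ta * ennreal (M (ta + 2 * t) y)"
   unfolding nn_integral_cmult[OF m] using Mnn[of "ta + 2 * t"] t by (auto split: split_indicator)
 qed
 also have "... <= (\<integral>\<^sup>+ta. (LBNN p. ennreal (r * ta powr (r - 1)) * ind {0..W dl t (vjoin p y)} ta) + ?k ta * ennreal (vloss dl) \<partial>lborel)"
 proof (rule nn_integral_mono)
  fix ta :: real
  show "?k ta * ennreal (M (ta + 2 * t) y) <= (LBNN p. ennreal (r * ta powr (r - 1)) * ind {0..W dl t (vjoin p y)} ta) + ?k ta * ennreal (vloss dl)"
  proof (cases "ta \<in> {0..\<Lambda>}")
   case True
   have "(LBNN p. ennreal (r * ta powr (r - 1)) * ind {0..W dl t (vjoin p y)} ta)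
     = (LBNN p. ennreal (r * ta powr (r - 1)) * ind {p. ta <= W dl t (vjoin p y)} p)"
    using True by (intro nn_integral_cong) (auto split: split_indicator)
   also have "... = ennreal (r * ta powr (r - 1)) * emeasure lborel {p. ta <= W dl t (vjoin p y)}"
    using Wc by (intro nn_integral_cmult_indicator) (auto intro!: borel_closed closed_Collect_le continuous_intros)
   finally show ?thesis using True mult_left_mono[OF vol[of ta], of "ennreal (r * ta powr (r - 1))"] by (simp add: distrib_left)
  qed simp
 qed
 also have "... = (LBNN p. \<integral>\<^sup>+ta. ennreal (r * ta powr (r - 1)) * ind {0..W dl t (vjoin p y)} ta \<partial>lborel) + (\<integral>\<^sup>+ta. ?k ta * ennreal (vloss dl) \<partial>lborel)"
 proof -
  have "{x :: real \<times> 'v rv. 0 <= fst x & fst x <= W dl t (vjoin (snd x) y)} \<in> sets (lborel \<Otimes>\<^sub>M lborel)"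
  proof -
   have "closed {x :: real \<times> 'v rv. 0 <= fst x & fst x <= W dl t (vjoin (snd x) y)}"
    by (intro closed_Collect_conj closed_Collect_le continuous_intros continuous_on_compose2[OF Wc]) auto
   thus ?thesis unfolding lborel_prod sets_lborel by (rule borel_closed)
  qed
  hence "(%x. ennreal (r * fst x powr (r - 1)) * ind {x :: real \<times> 'v rv. 0 <= fst x & fst x <= W dl t (vjoin (snd x) y)} x) \<in> borel_measurable (lborel \<Otimes>\<^sub>M lborel)"
   by measurable
  also have "(%x. ennreal (r * fst x powr (r - 1)) * ind {x :: real \<times> 'v rv. 0 <= fst x & fst x <= W dl t (vjoin (snd x) y)} x) =
    (%(ta, p). ennreal (r * ta powr (r - 1)) * ind {0..W dl t (vjoin p y)} ta)"
   by (auto simp: fun_eq_iff split: split_indicator)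
  finally have m: "(%(ta, p). ennreal (r * ta powr (r - 1)) * ind {0..W dl t (vjoin p y)} ta) \<in> borel_measurable (lborel \<Otimes>\<^sub>M (lborel :: 'v rv measure))" .
  have "(\<integral>\<^sup>+ta. (LBNN p. ennreal (r * ta powr (r - 1)) * ind {0..W dl t (vjoin p y)} ta) + ?k ta * ennreal (vloss dl) \<partial>lborel) = (\<integral>\<^sup>+ta. (LBNN p. ennreal (r * ta powr (r - 1)) * ind {0..W dl t (vjoin p y)} ta) \<partial>lborel) + (\<integral>\<^sup>+ta. ?k ta * ennreal (vloss dl) \<partial>lborel)"
   by (rule nn_integral_add[OF lborel.borel_measurable_nn_integral[OF m]]) measurable
  also have "(\<integral>\<^sup>+ta. (LBNN p. ennreal (r * ta powr (r - 1)) * ind {0..W dl t (vjoin p y)} ta) \<partial>lborel) = (LBNN p. \<integral>\<^sup>+ta. ennreal (r * ta powr (r - 1)) * ind {0..W dl t (vjoin p y)} ta \<partial>lborel)"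
   using lborel_pair.Fubini'[OF m] by simp
  finally show ?thesis .
 qed
 also have "(LBNN p. \<integral>\<^sup>+ta. ennreal (r * ta powr (r - 1)) * ind {0..W dl t (vjoin p y)} ta \<partial>lborel) = (LBNN p. ennreal (W dl t (vjoin p y) powr r))"
  by (intro nn_integral_cong layer_cake W0 r)
 also have "(\<integral>\<^sup>+ta. ?k ta * ennreal (vloss dl) \<partial>lborel) = (\<integral>\<^sup>+ta. ?k ta \<partial>lborel) * ennreal (vloss dl)"
  by (rule nn_integral_multc) measurable
 also have "... = ennreal (vloss dl) * ennreal (\<Lambda> powr r)"
  unfolding layer_cake[OF less_imp_le[OF \<Lambda>] r] by (rule mult.commute)
 also have "... = ennreal (vloss dl * \<Lambda> powr r)" using vl by (simp add: ennreal_mult')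
 finally show ?thesis .
qed

lemma W_pow:
 assumes v: "CARD('v) >= 2" and dl: "dl > 0" and t: "0 < t" and r: "r > 1"
 shows "(LBNN q. ennreal (pdens io b 1 q) * chi_pow N t \<Lambda> r (f q)) <=
  (LBNN q. ennreal (pdens io 0 1 q * W dl t q powr r)) + ennreal (vloss dl * \<Lambda> powr r) * (LBNN y. ennreal (sdens (y :: real ^ 'w)))"
proof -
 have fm: "f \<in> bmeas" by (rule borel_measurable_continuous_onI[OF smooth_on_cts[OF f]])
 have Wm: "W dl t \<in> bmeas" by (rule borel_measurable_continuous_onI[OF smooth_on_cts[OF W_smooth[OF dl t]]])
 have sliced: "(%p. g (vjoin p y)) \<in> bmeas" if "g \<in> bmeas" for g :: "real ^ ('v + 'w) => ennreal" and y
  by (rule measurable_compose[OF borel_measurable_continuous_onI that]) (intro continuous_intros)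
 have cm: "(%q. chi_pow N t \<Lambda> r (f q)) \<in> bmeas" by (rule measurable_compose[OF fm chi_pow_measurable])
 have Wrm: "(%q. ennreal (W dl t q powr r)) \<in> bmeas" using Wm by measurable
 have m1: "(%q. ennreal (pdens io b 1 q) * chi_pow N t \<Lambda> r (f q)) \<in> bmeas" using cm by measurable
 have m2: "(%q. ennreal (pdens io 0 1 q * W dl t q powr r)) \<in> bmeas" using Wm by measurable
 have "(LBNN q. ennreal (pdens io b 1 q) * chi_pow N t \<Lambda> r (f q)) =
   (LBNN y. (LBNN p. ennreal (pdens io b 1 (vjoin p y)) * chi_pow N t \<Lambda> r (f (vjoin p y))))"
  by (rule nn_integral_vjoin[OF m1])
 also have "... = (LBNN y. ennreal (sdens y) * (LBNN p. ennreal (J p) * chi_pow N t \<Lambda> r (f (vjoin p y))))"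
 proof (rule nn_integral_cong)
  fix y :: "'w rv"
  have "(%p. ennreal (J p) * chi_pow N t \<Lambda> r (f (vjoin p y))) \<in> borel_measurable lborel" using sliced[OF cm, of y] by measurable
  from nn_integral_cmult[OF this, of "ennreal (sdens y)"]
  show "(LBNN p. ennreal (pdens io b 1 (vjoin p y)) * chi_pow N t \<Lambda> r (f (vjoin p y))) =
    ennreal (sdens y) * (LBNN p. ennreal (J p) * chi_pow N t \<Lambda> r (f (vjoin p y)))"
   using sdens_pos[of y] J_nonneg by (simp add: pdens_eq ennreal_mult' mult_ac)
 qed
 also have "... <= (LBNN y. (LBNN p. ennreal (pdens io 0 1 (vjoin p y) * W dl t (vjoin p y) powr r)) + ennreal (vloss dl * \<Lambda> powr r) * ennreal (sdens y))"
 proof (rule nn_integral_mono)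
  fix y :: "'w rv"
  have "(%p. ennreal (W dl t (vjoin p y) powr r)) \<in> borel_measurable lborel" using sliced[OF Wrm, of y] by simp
  from nn_integral_cmult[OF this, of "ennreal (sdens y)"]
  have "(LBNN p. ennreal (pdens io 0 1 (vjoin p y) * W dl t (vjoin p y) powr r)) = ennreal (sdens y) * (LBNN p. ennreal (W dl t (vjoin p y) powr r))"
   using sdens_pos[of y] by (simp add: pdens_eq hdens_def ennreal_mult')
  thus "ennreal (sdens y) * (LBNN p. ennreal (J p) * chi_pow N t \<Lambda> r (f (vjoin p y))) <=
    (LBNN p. ennreal (pdens io 0 1 (vjoin p y) * W dl t (vjoin p y) powr r)) + ennreal (vloss dl * \<Lambda> powr r) * ennreal (sdens y)"
   using mult_left_mono[OF W_slice_pow[OF v dl t r, of y], of "ennreal (sdens y)"] by (simp add: distrib_left mult.commute)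
 qed
 also have "... = (LBNN y. (LBNN p. ennreal (pdens io 0 1 (vjoin p y) * W dl t (vjoin p y) powr r))) + ennreal (vloss dl * \<Lambda> powr r) * (LBNN y. ennreal (sdens (y :: 'w rv)))"
 proof -
  have c: "cts UNIV (%z :: 'w rv \<times> (real ^ 'v). vjoin (snd z) (fst z) :: real ^ ('v + 'w))" by (intro continuous_intros)
  from measurable_compose[OF borel_measurable_continuous_onI[OF c] m2]
  have "(%(y, p). ennreal (pdens io 0 1 (vjoin p y) * W dl t (vjoin p y) powr r)) \<in> borel_measurable (lborel \<Otimes>\<^sub>M lborel)"
   by (simp add: lborel_prod case_prod_unfold)
  from lborel.borel_measurable_nn_integral[OF this] show ?thesis
   by (simp add: nn_integral_add nn_integral_cmult)
 qed
 also have "(LBNN y. (LBNN p. ennreal (pdens io 0 1 (vjoin p y) * W dl t (vjoin p y) powr r))) = (LBNN q. ennreal (pdens io 0 1 q * W dl t q powr r))"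
  by (rule nn_integral_vjoin[OF m2, symmetric])
 finally show ?thesis .
qed

end

section \<open>Comparison with the flat product\<close>

text \<open>Fatou's lemma. For ta < |u| the shifted level is eventually at most \<theta> |u| with a
  fixed \<theta> < 1, and the kernel is then at least 1 / (1 + \<theta>^N), which tends to
  1.\<close>

lemma liminf_chi_pow:
 assumes u: "\<bar>u\<bar> <= \<Lambda>" and r: "r > 1"
 shows "ennreal (\<bar>u\<bar> powr r) <= liminf (%n. chi_pow (2 * (n + 2)) (1 / (real n + 1)) \<Lambda> r u)"
proof -
 let ?k = "%ta. ennreal (r * ta powr (r - 1))"
 let ?g = "%n ta. ?k ta * ind {0..\<Lambda>} ta * ennreal (chi (2 * (n + 2)) (ta + 2 * (1 / (real n + 1))) u)"
 have "ennreal (\<bar>u\<bar> powr r) = (\<integral>\<^sup>+ta. ?k ta * ind {0..\<bar>u\<bar>} ta \<partial>lborel)"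
  by (rule layer_cake[OF abs_ge_zero r, symmetric])
 also have "... <= (\<integral>\<^sup>+ta. liminf (%n. ?g n ta) \<partial>lborel)"
 proof (rule nn_integral_mono_AE)
  have "AE ta in lborel. ta ~= \<bar>u\<bar>" by (rule AE_lborel_singleton)
  thus "AE ta in lborel. ?k ta * ind {0..\<bar>u\<bar>} ta <= liminf (%n. ?g n ta)"
  proof eventually_elim
   case (elim ta)
   show ?case
   proof (cases "0 <= ta & ta < \<bar>u\<bar>")
    case True
    hence u0: "\<bar>u\<bar> > 0" by linarith
    \<comment> \<open>The midpoint of ta and |u|, divided by |u|.\<close>
    define \<theta> where "\<theta> = (ta + \<bar>u\<bar>) / (2 * \<bar>u\<bar>)"
    have \<theta>: "0 <= \<theta>" "\<theta> < 1" using True u0 by (auto simp: \<theta>_def)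
    let ?s = "%n. ta + 2 * (1 / (real n + 1))"
    have s0: "?s n > 0" for n using True by (intro add_nonneg_pos) auto
    have "(%n. ?s n) \<longlonglongrightarrow> ta + 2 * 0"
     using LIMSEQ_inverse_real_of_nat by (intro tendsto_intros) (simp add: inverse_eq_divide add.commute)
    moreover have "ta + 2 * 0 < (ta + \<bar>u\<bar>) / 2" using True by simp
    ultimately have ev: "\<forall>\<^sub>F n in sequentially. ?s n < (ta + \<bar>u\<bar>) / 2" by (rule order_tendstoD(2))
    have "(%n. chi (2 * (n + 2)) (?s n) u) \<longlonglongrightarrow> 1"
    proof (rule tendsto_sandwich[where h = "%n. 1"])
     have t0: "(%n. \<theta> ^ (2 * (n + 2))) \<longlonglongrightarrow> 0"
     proof -
      have "(%n. (\<theta>^2) ^ n * \<theta> ^ 4) \<longlonglongrightarrow> 0 * \<theta> ^ 4"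
       using \<theta> by (intro tendsto_intros LIMSEQ_power_zero) (simp add: abs_square_less_1)
      moreover have "\<theta> ^ (2 * (n + 2)) = (\<theta>^2) ^ n * \<theta> ^ 4" for n
      proof -
       have "2 * (n + 2) = 2 * n + 4" by simp
       thus ?thesis by (simp only: power_add power_mult)
      qed
      ultimately show ?thesis by simp
     qed
     have "(%n. 1 / (1 + \<theta> ^ (2 * (n + 2)))) \<longlonglongrightarrow> 1 / (1 + 0)" by (intro tendsto_intros t0) simp
     thus "(%n. 1 / (1 + \<theta> ^ (2 * (n + 2)))) \<longlonglongrightarrow> 1" by simp
     show "\<forall>\<^sub>F n in sequentially. 1 / (1 + \<theta> ^ (2 * (n + 2))) <= chi (2 * (n + 2)) (?s n) u"
      using ev
     proof eventually_elim
      case (elim n)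
      let ?N = "2 * (n + 2)"
      have "?s n <= \<theta> * \<bar>u\<bar>" using elim u0 by (simp add: \<theta>_def)
      hence "(?s n) ^ ?N <= (\<theta> * \<bar>u\<bar>) ^ ?N" using s0[of n] by (intro power_mono) auto
      moreover have "even ?N" by simp
      ultimately have "(?s n) ^ ?N <= \<theta> ^ ?N * u ^ ?N" by (simp only: power_mult_distrib power_even_abs)
      moreover have un: "u ^ ?N > 0" unfolding zero_less_power_eq using u0 by auto
      ultimately have le: "u ^ ?N + (?s n) ^ ?N <= (1 + \<theta> ^ ?N) * u ^ ?N" by (simp add: algebra_simps)
      have "1 / (1 + \<theta> ^ ?N) = u ^ ?N / ((1 + \<theta> ^ ?N) * u ^ ?N)"
       using nonzero_mult_divide_mult_cancel_right[OF less_imp_neq[OF un, symmetric], of 1 "1 + \<theta> ^ ?N"] by (simp only: mult_1_left)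
      also have "... <= u ^ ?N / (u ^ ?N + (?s n) ^ ?N)"
       using le un chi_denom_pos[of ?N "?s n" u] s0[of n] by (intro divide_left_mono) auto
      finally show ?case unfolding chi_def .
     qed
     show "\<forall>\<^sub>F n in sequentially. chi (2 * (n + 2)) (?s n) u <= 1"
      by (intro always_eventually allI chi_bounds(2) s0) simp
    qed simp
    hence "(%n. ennreal (chi (2 * (n + 2)) (?s n) u)) \<longlonglongrightarrow> ennreal 1" by (rule tendsto_ennrealI)
    hence "(%n. ?k ta * ennreal (chi (2 * (n + 2)) (?s n) u)) \<longlonglongrightarrow> ?k ta * ennreal 1"
     by (intro ennreal_tendsto_cmult) auto
    moreover have "ta \<in> {0..\<Lambda>}" "ta \<in> {0..\<bar>u\<bar>}" using True u by auto
    ultimately have "(%n. ?g n ta) \<longlonglongrightarrow> ?k ta * ind {0..\<bar>u\<bar>} ta" by simp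
    thus ?thesis by (simp add: lim_imp_Liminf)
   qed (use elim in \<open>auto simp: indicator_def\<close>)
  qed
 qed
 also have "... <= liminf (%n. \<integral>\<^sup>+ta. ?g n ta \<partial>lborel)"
  unfolding chi_def by (rule nn_integral_liminf) measurable
 finally show ?thesis unfolding chi_pow_def .
qed

lemma test_function_charts_bounded:
 fixes u :: "(real ^ 'v::finite) \<times> (real ^ 'w::finite) \<times> real => real"
 assumes u: "u \<in> test_functions c" and c: "c >= 0"
 obtains B where "B > 0" "!!(q :: real ^ ('v + 'w)) ep. ep = 1 \<or> ep = -1 ==> \<bar>u (pchart io c 1 ep q)\<bar> <= B"
proof -
 obtain K where K: "K \<subseteq> M_space c" "compact K" "!!p. p \<in> M_space c - K ==> u p = 0"
  using u by (auto simp: smooth_compact_support_def)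
 have "bounded (u ` K)"
  using continuous_on_test_function(1)[OF u c] K(1,2)
  by (auto intro!: compact_imp_bounded compact_continuous_image intro: continuous_on_subset)
 then obtain B where B: "!!p. p \<in> K ==> \<bar>u p\<bar> <= B" by (auto simp: bounded_iff)
 show ?thesis
 proof (rule that[of "\<bar>B\<bar> + 1"])
  fix q :: "real ^ ('v + 'w)" and ep :: real assume "ep = 1 \<or> ep = -1"
  hence "pchart io c 1 ep q \<in> M_space c"
   using local_paramD(6)[OF local_param_pchart[OF c zero_less_one, of ep]] by auto
  thus "\<bar>u (pchart io c 1 ep q)\<bar> <= \<bar>B\<bar> + 1"
   using B[of "pchart io c 1 ep q"] K(3)[of "pchart io c 1 ep q"] by force
 qed simp
qed

lemma pchart_flat: "pchart io 0 1 ep q = (vfst q, stereo ep (vsnd q))"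
 by (simp add: pchart_def hchart_def)

text \<open>Read in either stereographic chart, the rearrangement is the function W of that chart,
  hence smooth. Far out the volume coordinate exceeds the total volume V, so the support is
  bounded.\<close>

lemma rearr_test_function:
 fixes u :: "(real ^ 'v::finite) \<times> (real ^ 'w::finite) \<times> real => real" and io :: 'v
 assumes v: "CARD('v) >= 2" and dl: "dl > 0" and t: "t > 0"
  and lev: "!!ep. ep = 1 \<or> ep = -1 ==> levels (%q. u (pchart io c 1 ep q)) b R \<Lambda> N"
 shows "(%z. rearr io b N R dl t (%p. u (hchart io c 1 p, snd z)) (fst z)) \<in> test_functions 0"
proof -
 let ?W = "%z :: (real ^ 'v) \<times> (real ^ 'w) \<times> real. rearr io b N R dl t (%p. u (hchart io c 1 p, snd z)) (fst z)"
 interpret P: levels "%q. u (pchart io c 1 1 q)" io b R \<Lambda> N by (rule lev) simp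
 let ?\<omega> = "unit_ball_vol (real CARD('v))"
 \<comment> \<open>The point z need not lie on the sphere, so \<phi> is arbitrary and its kernel
   need not be integrable; the integral is then 0 by convention.\<close>
 have le: "lev io b N R t \<phi> <= P.V" for \<phi>
 proof (cases "(%p. chi N t (\<phi> p) * hdens io b p) integrable_on cube R")
  case True
  thus ?thesis unfolding lev_def P.V_def using chi_bounds[OF P.N(1) t] P.J_nonneg
   by (intro integral_le[OF True integrable_continuous[OF P.J_continuous]]) (auto intro!: mult_left_le_one_le)
 next
  case False
  thus ?thesis using P.V_pos by (simp add: lev_def not_integrable_integral)
 qed
 show ?thesis
 proof (rule test_function_flat_chartsI)
  fix ep :: real assume e: "ep = 1 \<or> ep = -1"
  interpret E: levels "%q. u (pchart io c 1 ep q)" io b R \<Lambda> N by (rule lev[OF e])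
  have "(%q. ?W (vfst q, stereo ep (vsnd q))) = E.W dl t"
   unfolding fun_eq_iff E.W_def[OF dl t] by (simp add: pchart_def)
  thus "smooth_on UNIV (%q. ?W (vfst q, stereo ep (vsnd q)))" using E.W_smooth[OF dl t] by simp
 next
  fix z :: "'v rv \<times> 'w rv \<times> real"
  assume z: "norm (fst z) > max 1 (P.V / ?\<omega>)"
  hence z1: "norm (fst z) > 1" "norm (fst z) * ?\<omega> > P.V" by (auto simp: pos_divide_less_eq)
  have z2: "norm (fst z) <= fst z \<bullet> fst z + dl"
   using z1(1) dl mult_left_mono[of 1 "norm (fst z)" "norm (fst z)"] by (simp add: power2_norm_eq_inner[symmetric] power2_eq_square)
  also have "fst z \<bullet> fst z + dl = (fst z \<bullet> fst z + dl) powr 1" using dl by (simp add: add_nonneg_nonneg)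
  also have "... <= (fst z \<bullet> fst z + dl) powr (real CARD('v) / 2)"
   using order_trans[OF less_imp_le[OF z1(1)] z2] v by (intro powr_mono) auto
  finally have "?\<omega> * norm (fst z) <= vball dl (fst z)" unfolding vball_def by (intro mult_left_mono) auto
  hence "\<not> vball dl (fst z) < lev io b N R t (%p. u (hchart io c 1 p, snd z))"
   using z1(2) le[of "%p. u (hchart io c 1 p, snd z)"] by (simp add: mult.commute)
  thus "?W z = 0" by (simp add: rearr_def)
 qed
qed

text \<open>For v = 1 neither the density nor the metric coefficients involve the curvature
  parameter, so the same coordinate expression is a test function on the flat product with the same
  energy.\<close>

lemma yamabe_flat_comparison_line:
 fixes u :: "(real ^ 'v::finite) \<times> (real ^ 'w::finite) \<times> real => real" and io :: 'v
 assumes u: "u \<in> test_functions c" and c: "c >= 0" and v: "CARD('v) = 1" and w: "CARD('w) >= 2"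
 defines "f \<equiv> %q. u (pchart io c 1 1 q)"
 shows "yamabe_mu TYPE('v) TYPE('w) 0 * (ypow io c 1 f powr (1 / yamabe_p CARD('v + 'w)))^2
  <= ynum io c 1 (real CARD('w) * (real CARD('w) - 1)) f"
proof -
 obtain R where R: "!!q ep. ep = 1 \<or> ep = -1 ==> u (pchart io c 1 ep q) ~= 0 ==> norm (vfst q) < R"
  using test_function_support[OF u c zero_less_one] by blast
 \<comment> \<open>The values of u off the manifold are arbitrary. The cutoff makes the support
   condition true for every z and leaves the coordinate expressions unchanged.\<close>
 let ?U = "%z. if norm (fst z) <= R then u (hchart io c 1 (fst z), snd z) else 0"
 have U: "?U (vfst q, stereo ep (vsnd q)) = u (pchart io c 1 ep q)" if "ep = 1 \<or> ep = -1" for ep q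
  using R[OF that, of q] by (force simp: pchart_def)
 have "?U \<in> test_functions 0"
 proof (rule test_function_flat_chartsI)
  fix ep :: real assume e: "ep = 1 \<or> ep = -1"
  show "smooth_on UNIV (%q. ?U (vfst q, stereo ep (vsnd q)))"
   unfolding U[OF e] by (rule test_function_smooth[OF u c zero_less_one e])
 next
  fix z :: "(real ^ 'v) \<times> (real ^ 'w) \<times> real"
  assume "norm (fst z) > R"
  thus "?U z = 0" by simp
 qed
 note lower = yamabe_mu_lower[OF this _ zero_less_one w, of io]
 have "(%q. ?U (pchart io 0 1 1 q)) = f"
  unfolding f_def pchart_flat by (rule ext, rule U) simp
 hence "yamabe_mu TYPE('v) TYPE('w) 0 * (ypow io 0 1 f powr (1 / yamabe_p CARD('v + 'w)))^2 <= ynum io 0 1 (M_scal CARD('v) CARD('w) 0) f"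
  using lower by simp
 moreover have "i = io" for i :: 'v using v by (metis UNIV_I card_1_singletonE singletonD)
 hence "chart_coeff io c 1 q m = chart_coeff io 0 1 q m" for q :: "real ^ ('v + 'w)" and m
  by (auto simp: chart_coeff_def split: sum.split)
 ultimately show ?thesis using v by (simp add: ynum_def ypow_def pdens_def pnormsq_def M_scal_def)
qed

text \<open>For each set of parameters the rearranged function is a test function on the flat
  product, with energy at most N / (N - 2) times that of f plus a small error, and with power
  integral at least a regularised one of f minus a small error. The inequality for the flat constant
  is then passed to the limit.\<close>

lemma yamabe_flat_comparison_rearr:
 fixes u :: "(real ^ 'v::finite) \<times> (real ^ 'w::finite) \<times> real => real" and io :: 'v
 assumes u: "u \<in> test_functions c" and c: "c >= 0" and v: "CARD('v) >= 2" and w: "CARD('w) >= 2"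
 defines "f \<equiv> %q. u (pchart io c 1 1 q)"
 shows "yamabe_mu TYPE('v) TYPE('w) 0 * (ypow io c 1 f powr (1 / yamabe_p CARD('v + 'w)))^2
  <= ynum io c 1 (real CARD('w) * (real CARD('w) - 1)) f"
proof -
 let ?\<mu> = "yamabe_mu TYPE('v) TYPE('w) 0" and ?r = "yamabe_p CARD('v + 'w)" and ?a = "yamabe_a CARD('v + 'w)"
 let ?sg = "real CARD('w) * (real CARD('w) - 1)" and ?\<omega> = "unit_ball_vol (real CARD('v))"
 let ?P = "%x. ?\<mu> * (x powr (1 / ?r))^2"
 obtain R where R: "R > 0" "!!q ep. ep = 1 \<or> ep = -1 ==> u (pchart io c 1 ep q) ~= 0 ==> norm (vfst q) < R"
  using test_function_support[OF u c zero_less_one] by blast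
 obtain B where B: "B > 0" "!!q ep. ep = 1 \<or> ep = -1 ==> \<bar>u (pchart io c 1 ep q)\<bar> <= B"
  using test_function_charts_bounded[OF u c] by blast
 define \<Lambda> where "\<Lambda> = B + 1"
 have r: "?r > 1" and a: "?a >= 0" using yamabe_exponents[OF w, where 'v = 'v] by auto
 have sg: "?sg >= 0" using w by simp
 have \<mu>: "?\<mu> >= 0" by (rule yamabe_mu_nonneg[OF _ w]) simp
 define V where "V = integral (cube R) (hdens io c)"
 define s where "s = enn2real (LBNN y. ennreal (sdens (y :: real ^ 'w)))"
 have s: "(LBNN y. ennreal (sdens (y :: 'w rv))) = ennreal s" "s >= 0"
  using nn_integral_sdens_finite[where 'w = 'w] by (auto simp: s_def less_top)
 define Nn where "Nn n = 2 * (n + 2)" for n :: nat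
 define tn where "tn n = 1 / (real n + 1)" for n :: nat
 \<comment> \<open>Makes \<omega> dn^(v/2) equal to V / 2^N, the bound for M at the level s1 = 2
   \<Lambda>, which is what the condition on the top level asks for.\<close>
 define dn where "dn n = (V / (2 ^ Nn n * ?\<omega>)) powr (2 / real CARD('v))" for n
 have lev: "levels (%q. u (pchart io c 1 ep q)) c R \<Lambda> (Nn n)" if e: "ep = 1 \<or> ep = -1" for ep n
 proof
  show "smooth_on UNIV (%q. u (pchart io c 1 ep q))" by (rule test_function_smooth[OF u c zero_less_one e])
  show "u (pchart io c 1 ep q) = 0" if "R < norm (vfst q)" for q using R(2)[OF e, of q] that by fastforce
  show "\<bar>u (pchart io c 1 ep q)\<bar> <= \<Lambda>" for q using B(2)[OF e, of q] by (simp add: \<Lambda>_def)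
 qed (use R B c in \<open>auto simp: \<Lambda>_def Nn_def\<close>)
 have ct: "coord_test io c f" using coord_test_pchart[OF u c zero_less_one, of io] by (simp add: f_def)
 have nn: "pdens io b' 1 q * (?a * pnormsq io b' 1 g q + ?sg * (g q)^2) >= 0" for b' q and g :: "real ^ ('v + 'w) => real"
  using a sg pdens_ge0[OF zero_less_one, of io b' q] pnormsq_nonneg[OF zero_less_one, of io b' g q] by simp
 define Y where "Y = ynum io c 1 ?sg f"
 have nY: "(LBNN q. ennreal (pdens io b' 1 q * (?a * pnormsq io b' 1 g q + ?sg * (g q)^2))) = ennreal (ynum io b' 1 ?sg g)"
  if "coord_test io b' g" for b' and g :: "real ^ ('v + 'w) => real"
 proof -
  have "integrable lborel (%q. ?a * (pdens io b' 1 q * pnormsq io b' 1 g q) + ?sg * (pdens io b' 1 q * (g q)^2))"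
   using coord_test_integrable(1,2)[OF that zero_less_one] by (intro Bochner_Integration.integrable_add integrable_mult_right)
  thus ?thesis unfolding ynum_def
   by (intro nn_integral_eq_integral AE_I2 nn) (simp add: algebra_simps)
 qed
 \<comment> \<open>\<open>en\<close> and \<open>cn\<close> are the error terms of
   \<open>W_energy\<close> at s1 = 2 \<Lambda> and of \<open>W_pow\<close>; s is the mass of
   \<open>sdens\<close>.\<close>
 define en where "en n = ?a * (2 * (real CARD('v) * ?\<omega> powr (1 / real CARD('v)))^2 / real (Nn n) * (2 * \<Lambda>)^2 * V powr (1 - 2 / real CARD('v))) * s" for n
 define cn where "cn n = ?\<omega> * (real CARD('v) / 2) * ((V / ?\<omega>) powr (1 / (real CARD('v) / 2))) powr (real CARD('v) / 2 - 1) * dn n * \<Lambda> powr ?r * s" for n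
 define Fn where "Fn n = (LBNN q. ennreal (pdens io c 1 q) * chi_pow (Nn n) (tn n) \<Lambda> ?r (f q))" for n
 \<comment> \<open>Only a number x, the power integral of the rearranged function, is handed over to
   the limit, so no convergence of the functions themselves is involved.\<close>
 have step: "\<exists>x\<ge>0. Fn n <= ennreal (x + cn n) & ?P x <= real (Nn n) / (real (Nn n) - 2) * Y + en n" and cn: "cn n >= 0" for n
 proof -
  interpret L: levels f io c R \<Lambda> "Nn n" unfolding f_def by (rule lev) simp
  have V: "V > 0" "L.V = V" using L.V_pos by (auto simp: V_def L.V_def)
  have \<omega>: "?\<omega> > 0" by simp
  have dl: "dn n > 0" using V less_imp_neq[OF \<omega>] by (simp add: dn_def)
  have t: "tn n > 0" "tn n <= 2 * \<Lambda>"
  proof -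
   have "tn n <= 1" by (simp add: tn_def)
   thus "tn n <= 2 * \<Lambda>" using B(1) by (simp add: \<Lambda>_def)
  qed (simp add: tn_def)
  show "cn n >= 0" using s(2) dl \<omega> by (simp add: cn_def)
  have vl: "ennreal (L.vloss (dn n) * \<Lambda> powr ?r) * ennreal s = ennreal (cn n)"
   using s(2) dl by (simp add: L.vloss_def V(2) cn_def ennreal_mult'[symmetric] ennreal_mult''[symmetric])
  have M1: "L.M (2 * \<Lambda>) y <= ?\<omega> * dn n powr (real CARD('v) / 2)" for y
  proof -
   have "L.M (2 * \<Lambda>) y <= (\<Lambda> / (2 * \<Lambda>)) ^ Nn n * V" using L.M_bounds(3)[of "2 * \<Lambda>" y] L.\<Lambda> V(2) by simp
   also have "... = ?\<omega> * (V / (2 ^ Nn n * ?\<omega>))" using L.\<Lambda> less_imp_neq[OF \<omega>] by (simp add: power_divide del: unit_ball_vol_pos)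
   also have "... = ?\<omega> * dn n powr (real CARD('v) / 2)" using V \<omega> by (simp add: dn_def powr_powr)
   finally show ?thesis .
  qed
  let ?W = "L.W (dn n) (tn n)"
  have W: "(%q. rearr io c (Nn n) R (dn n) (tn n) (%p. u (hchart io c 1 p, snd (pchart io 0 1 1 q))) (fst (pchart io 0 1 1 q))) = ?W"
   unfolding fun_eq_iff L.W_def[OF dl t(1)] pchart_flat by (simp add: f_def pchart_def)
  note T = rearr_test_function[OF v dl t(1) lev, of n]
  have ctW: "coord_test io 0 ?W" using coord_test_pchart[OF T order_refl zero_less_one, of io] unfolding W by simp
  have "?P (ypow io 0 1 ?W) <= ynum io 0 1 ?sg ?W"
   using yamabe_mu_lower[OF T _ zero_less_one w, of io] unfolding W by (simp add: M_scal_def)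
  also have "... <= real (Nn n) / (real (Nn n) - 2) * Y + en n"
  proof -
   have Y0: "Y >= 0" unfolding Y_def by (rule ynum_nonneg[OF ct zero_less_one w sg])
   have e0: "en n >= 0" unfolding en_def using s(2) a by (intro mult_nonneg_nonneg) auto
   have k0: "real (Nn n) / (real (Nn n) - 2) >= 0" by (simp add: Nn_def)
   have "ennreal (ynum io 0 1 ?sg ?W) <= ennreal (real (Nn n) / (real (Nn n) - 2)) * ennreal Y + ennreal (?a * (L.isoc * (2 * \<Lambda>)^2 * V powr (1 - 2 / real CARD('v)))) * ennreal s"
    using L.W_energy[OF v dl t M1 a sg] unfolding nY[OF ctW] nY[OF ct] s(1) V(2) Y_def .
   also have "ennreal (?a * (L.isoc * (2 * \<Lambda>)^2 * V powr (1 - 2 / real CARD('v)))) * ennreal s = ennreal (en n)"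
    unfolding en_def L.isoc_def by (rule ennreal_mult''[OF s(2), symmetric])
   also have "ennreal (real (Nn n) / (real (Nn n) - 2)) * ennreal Y + ennreal (en n) = ennreal (real (Nn n) / (real (Nn n) - 2) * Y + en n)"
    unfolding ennreal_mult'[OF k0, symmetric] by (intro ennreal_plus[symmetric] mult_nonneg_nonneg k0 Y0 e0)
   finally show ?thesis
    by (subst (asm) ennreal_le_iff) (intro add_nonneg_nonneg mult_nonneg_nonneg k0 Y0 e0)
  qed
  finally have 1: "?P (ypow io 0 1 ?W) <= real (Nn n) / (real (Nn n) - 2) * Y + en n" .
  have y0: "ypow io 0 1 ?W >= 0"
   unfolding ypow_def using pdens_ge0[OF zero_less_one, of io 0] by (intro integral_nonneg_AE AE_I2 mult_nonneg_nonneg) auto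
  have "Fn n <= (LBNN q. ennreal (pdens io 0 1 q * ?W q powr ?r)) + ennreal (cn n)"
   using L.W_pow[OF v dl t(1) r] unfolding Fn_def s(1) vl .
  also have "(LBNN q. ennreal (pdens io 0 1 q * ?W q powr ?r)) = ennreal (ypow io 0 1 ?W)"
  proof -
   have "(LBNN q. ennreal (pdens io 0 1 q * \<bar>?W q\<bar> powr ?r)) = ennreal (ypow io 0 1 ?W)"
    unfolding ypow_def using r coord_test_integrable(3)[OF ctW zero_less_one, of ?r] pdens_ge0[OF zero_less_one, of io 0]
    by (intro nn_integral_eq_integral AE_I2 mult_nonneg_nonneg) auto
   thus ?thesis using L.W_nonneg[OF dl t(1)] by simp
  qed
  also have "ennreal (ypow io 0 1 ?W) + ennreal (cn n) = ennreal (ypow io 0 1 ?W + cn n)"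
   using y0 \<open>cn n >= 0\<close> by simp
  finally show "\<exists>x\<ge>0. Fn n <= ennreal (x + cn n) & ?P x <= real (Nn n) / (real (Nn n) - 2) * Y + en n"
   using 1 y0 by blast
 qed

 \<comment> \<open>Limits of the parameters and of the error terms\<close>
 have v0: "real CARD('v) > 0" by simp
 have Nmono: "strict_mono Nn" by (simp add: strict_mono_def Nn_def)
 have Nlim: "filterlim (%n. real (Nn n)) at_top sequentially"
  by (rule filterlim_compose[OF filterlim_real_sequentially filterlim_subseq[OF Nmono]])
 have klim: "(%n. real (Nn n) / (real (Nn n) - 2)) \<longlonglongrightarrow> 1"
 proof -
  have "(%n. 1 + inverse (real (Suc n))) \<longlonglongrightarrow> 1 + 0" by (intro tendsto_intros LIMSEQ_inverse_real_of_nat)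
  moreover have "real (Nn n) / (real (Nn n) - 2) = 1 + inverse (real (Suc n))" for n by (simp add: Nn_def field_simps)
  ultimately show ?thesis by simp
 qed
 have elim: "en \<longlonglongrightarrow> 0"
 proof -
  have "(%n. inverse (real (Nn n))) \<longlonglongrightarrow> 0" by (rule tendsto_inverse_0_at_top[OF Nlim])
  hence "(%n. ?a * (2 * (real CARD('v) * ?\<omega> powr (1 / real CARD('v)))^2 * inverse (real (Nn n)) * (2 * \<Lambda>)^2 * V powr (1 - 2 / real CARD('v))) * s)
    \<longlonglongrightarrow> ?a * (2 * (real CARD('v) * ?\<omega> powr (1 / real CARD('v)))^2 * 0 * (2 * \<Lambda>)^2 * V powr (1 - 2 / real CARD('v))) * s"
   by (intro tendsto_intros)
  thus ?thesis by (simp add: en_def[abs_def] divide_inverse)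
 qed
 have dlim: "dn \<longlonglongrightarrow> 0"
 proof -
  have "(%n. V / ?\<omega> * (1 / 2) ^ Nn n) \<longlonglongrightarrow> V / ?\<omega> * 0"
   using LIMSEQ_subseq_LIMSEQ[OF LIMSEQ_power_zero Nmono, of "1 / 2 :: real"] by (intro tendsto_intros) (simp add: o_def)
  hence "(%n. V / (2 ^ Nn n * ?\<omega>)) \<longlonglongrightarrow> 0" by (simp add: power_divide mult.commute)
  moreover have "V >= 0"
  proof -
   interpret L: levels f io c R \<Lambda> "Nn 0" unfolding f_def by (rule lev) simp
   show ?thesis using L.V_pos by (simp add: V_def L.V_def)
  qed
  ultimately have "(%n. (V / (2 ^ Nn n * ?\<omega>)) powr (2 / real CARD('v))) \<longlonglongrightarrow> 0 powr (2 / real CARD('v))"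
   by (intro tendsto_powr' tendsto_const) (auto intro!: always_eventually)
  thus ?thesis by (simp add: dn_def[abs_def])
 qed
 have clim: "cn \<longlonglongrightarrow> 0"
 proof -
  have "(%n. ?\<omega> * (real CARD('v) / 2) * ((V / ?\<omega>) powr (1 / (real CARD('v) / 2))) powr (real CARD('v) / 2 - 1) * dn n * \<Lambda> powr ?r * s)
    \<longlonglongrightarrow> ?\<omega> * (real CARD('v) / 2) * ((V / ?\<omega>) powr (1 / (real CARD('v) / 2))) powr (real CARD('v) / 2 - 1) * 0 * \<Lambda> powr ?r * s"
   by (intro tendsto_intros dlim)
  thus ?thesis by (simp add: cn_def[abs_def])
 qed
 define P0 where "P0 = ypow io c 1 f"
 have P0: "P0 >= 0" unfolding P0_def ypow_def using pdens_ge0[OF zero_less_one, of io c]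
  by (intro integral_nonneg_AE AE_I2 mult_nonneg_nonneg) auto
 have fb: "\<bar>f q\<bar> <= \<Lambda>" for q using B(2)[of 1 q] by (simp add: f_def \<Lambda>_def)
 have liminf: "ennreal P0 <= liminf Fn"
 proof -
  have "ennreal P0 = (LBNN q. ennreal (pdens io c 1 q * \<bar>f q\<bar> powr ?r))"
   unfolding P0_def ypow_def using r coord_test_integrable(3)[OF ct zero_less_one, of ?r] pdens_ge0[OF zero_less_one, of io c]
   by (intro nn_integral_eq_integral[symmetric] AE_I2 mult_nonneg_nonneg) auto
  also have "... <= (LBNN q. liminf (%n. ennreal (pdens io c 1 q) * chi_pow (Nn n) (tn n) \<Lambda> ?r (f q)))"
  proof (rule nn_integral_mono)
   fix q
   have "ennreal (pdens io c 1 q * \<bar>f q\<bar> powr ?r) = ennreal (pdens io c 1 q) * ennreal (\<bar>f q\<bar> powr ?r)"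
    using pdens_ge0[OF zero_less_one, of io c q] by (simp add: ennreal_mult')
   also have "... <= ennreal (pdens io c 1 q) * liminf (%n. chi_pow (Nn n) (tn n) \<Lambda> ?r (f q))"
    unfolding Nn_def tn_def by (intro mult_left_mono liminf_chi_pow fb r) simp
   also have "... = liminf (%n. ennreal (pdens io c 1 q) * chi_pow (Nn n) (tn n) \<Lambda> ?r (f q))"
    by (intro Liminf_compose_continuous_mono[symmetric]) (auto intro!: ennreal_continuous_on_cmult monoI mult_left_mono)
   finally show "ennreal (pdens io c 1 q * \<bar>f q\<bar> powr ?r) <= liminf (%n. ennreal (pdens io c 1 q) * chi_pow (Nn n) (tn n) \<Lambda> ?r (f q))" .
  qed
  also have "... <= liminf Fn" unfolding Fn_def[abs_def]
  proof (rule nn_integral_liminf)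
   have "f \<in> bmeas"
    by (intro borel_measurable_continuous_onI smooth_on_cts) (use ct in \<open>auto simp: coord_test_def\<close>)
   from measurable_compose[OF this chi_pow_measurable]
   show "(%q. ennreal (pdens io c 1 q) * chi_pow (Nn n) (tn n) \<Lambda> ?r (f q)) \<in> borel_measurable lborel" for n by measurable
  qed
  finally show ?thesis .
 qed
 \<comment> \<open>Any P1 < P0 is eventually exceeded by Fn, so that x >= P1 - cn. Strict inequality
   is needed because only the lower limit of Fn is known; P0 itself follows by continuity from the
   left.\<close>
 have below: "?P P1 <= Y" if P1: "0 <= P1" "P1 < P0" for P1
 proof (rule tendsto_le)
  show "(%n. real (Nn n) / (real (Nn n) - 2) * Y + en n) \<longlonglongrightarrow> Y" using tendsto_add[OF tendsto_mult_right[OF klim, of Y] elim] by simp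
  \<comment> \<open>The maximum with 0 keeps the argument of the power nonnegative, where the power
    is monotone and continuous.\<close>
  have "(%n. max 0 (P1 - cn n)) \<longlonglongrightarrow> max 0 (P1 - 0)" by (intro tendsto_intros clim)
  hence "(%n. max 0 (P1 - cn n)) \<longlonglongrightarrow> P1" using P1 by simp
  thus "(%n. ?P (max 0 (P1 - cn n))) \<longlonglongrightarrow> ?P P1"
   using r by (intro tendsto_intros tendsto_powr') auto
  have "ennreal P1 < liminf Fn" using liminf P1 by (intro less_le_trans[OF ennreal_lessI liminf]) auto
  hence "\<forall>\<^sub>F n in sequentially. ennreal P1 < Fn n" by (rule less_LiminfD)
  thus "\<forall>\<^sub>F n in sequentially. ?P (max 0 (P1 - cn n)) <= real (Nn n) / (real (Nn n) - 2) * Y + en n"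
  proof eventually_elim
   case (elim n)
   obtain x where x: "x >= 0" "Fn n <= ennreal (x + cn n)" "?P x <= real (Nn n) / (real (Nn n) - 2) * Y + en n"
    using step[of n] by blast
   have "ennreal P1 < ennreal (x + cn n)" using elim x(2) by order
   hence "max 0 (P1 - cn n) <= x" using x(1) P1 by (simp add: ennreal_less_iff)
   hence "?P (max 0 (P1 - cn n)) <= ?P x" using \<mu> r by (intro mult_left_mono power_mono powr_mono2) auto
   thus ?case using x(3) by simp
  qed
 qed simp
 have "?P P0 <= Y"
 proof (cases "P0 = 0")
  case True
  thus ?thesis using ynum_nonneg[OF ct zero_less_one w sg] by (simp add: Y_def)
 next
  case False
  hence P: "P0 > 0" using P0 by simp
  have "(?P \<longlongrightarrow> ?P P0) (at_left P0)" using False by (intro tendsto_intros) auto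
  moreover have "\<forall>\<^sub>F x in at_left P0. ?P x <= Y"
   using eventually_at_left_real[OF P] by eventually_elim (rule below, auto)
  ultimately show ?thesis by (rule tendsto_upperbound) simp
 qed
 thus ?thesis by (simp add: P0_def Y_def)
qed

theorem theorem4p1:
 fixes v w n :: nat and c :: real and \<mu> :: "real \<Rightarrow> real"
 assumes "v = CARD('v::finite)" and "w = CARD('w::finite)"
  and "v \<ge> 1" and "w \<ge> 2" and "n = v + w"
  and "\<mu> = yamabe_mu TYPE('v) TYPE('w)"
  and "0 < c" and "c < 1"
 shows "\<mu> c \<ge> (\<mu> 0 / \<mu> 1
       - c\<^sup>2 * real v * (real v - 1) /
         ((1 - c\<^sup>2) * real w * (real w - 1) + c\<^sup>2 * real v * (real v - 1))
        * (\<mu> 0 / \<mu> 1 - c powr (2 * real w / real n))) * \<mu> 1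
    \<and> \<mu> c \<ge> c powr (2 * real w / real n) * \<mu> 1"
proof -
 obtain io :: 'v where True by blast
 have w2: "CARD('w) >= 2" using assms by simp
 have c: "0 <= c" "c <= 1" "0 < c" using assms by auto
 have n: "real CARD('v + 'w) = real n" using assms by simp
 let ?A = "real w * (real w - 1)" and ?B = "real v * (real v - 1)" and ?e = "c powr (2 * real w / real n)"
 have A: "?A > 0" and B: "?B >= 0" using assms by auto
 have c2: "c^2 < 1" using assms by (simp add: power_less_one_iff)
 define D where "D = (1 - c\<^sup>2) * ?A + c^2 * ?B"
 have D: "D > 0" unfolding D_def using A B c2 by (intro add_pos_nonneg) auto
 define l where "l = c^2 * ?B / D"
 have l: "0 <= l" "l <= 1" "l * D = c^2 * ?B" using D B A c2 by (auto simp: l_def D_def)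
 let ?Q = "%u :: (real ^ 'v) \<times> (real ^ 'w) \<times> real => real. (ypow io c 1 (%q. u (pchart io c 1 1 q)) powr (1 / yamabe_p CARD('v + 'w)))^2"
 let ?Y = "%s (u :: (real ^ 'v) \<times> (real ^ 'w) \<times> real => real). ynum io c 1 s (%q. u (pchart io c 1 1 q))"
 have s1: "c^2 * M_scal CARD('v) CARD('w) 1 = c^2 * (?A - ?B)" and sc: "M_scal CARD('v) CARD('w) c = ?A - c\<^sup>2 * ?B"
  using assms by (simp_all add: M_scal_def mult.assoc)
 have hyp: "?e * \<mu> 1 * ?Q u <= ?Y (c^2 * (?A - ?B)) u" if "u \<in> test_functions c" for u
  using yamabe_hyperbolic_comparison[OF that c(3,2) w2, of io] assms unfolding s1 n by simp
 have flat: "\<mu> 0 * ?Q u <= ?Y ?A u" if "u \<in> test_functions c" for u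
 proof (cases "CARD('v) = 1")
  case True
  thus ?thesis using yamabe_flat_comparison_line[OF that c(1) True w2, of io] assms by simp
 next
  case False
  hence "CARD('v) >= 2" using zero_less_card_finite[where 'a = 'v] by linarith
  thus ?thesis using yamabe_flat_comparison_rearr[OF that c(1) _ w2, of io] assms by simp
 qed
 have ct: "coord_test io c (%q. u (pchart io c 1 1 q))" if "u \<in> test_functions c" for u :: "(real ^ 'v) \<times> (real ^ 'w) \<times> real => real"
  using coord_test_pchart[OF that c(1) zero_less_one, of io] by simp
 have second: "\<mu> c >= ?e * \<mu> 1"
  unfolding assms(6)
 proof (rule yamabe_mu_ge[OF w2 c(1,2), where io = io])
  fix u :: "(real ^ 'v) \<times> (real ^ 'w) \<times> real => real" assume u: "u \<in> test_functions c"
  \<comment> \<open>The curvature of the product exceeds the dilated one of curvature -1 by (1 -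
    c^2) w (w - 1), the share of the undilated sphere.\<close>
  have "c^2 * ?A <= 1 * ?A" using c2 A by (intro mult_right_mono) auto
  hence "c^2 * (?A - ?B) <= ?A - c\<^sup>2 * ?B" by (simp add: algebra_simps)
  thus "?e * yamabe_mu TYPE('v) TYPE('w) 1 * ?Q u <= ?Y (M_scal CARD('v) CARD('w) c) u"
   using hyp[OF u] ynum_mono_scal[OF ct[OF u] zero_less_one] unfolding sc assms(6) by (meson order_trans)
 qed
 have first: "\<mu> c >= (1 - l) * \<mu> 0 + l * (?e * \<mu> 1)"
  unfolding assms(6)
 proof (rule yamabe_mu_ge[OF w2 c(1,2), where io = io])
  fix u :: "(real ^ 'v) \<times> (real ^ 'w) \<times> real => real" assume u: "u \<in> test_functions c"
  have eq: "?A - c\<^sup>2 * ?B = (1 - l) * ?A + l * (c^2 * (?A - ?B))"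
   using l(3) by (simp add: D_def algebra_simps)
  have "?Y (?A - c\<^sup>2 * ?B) u = (1 - l) * ?Y ?A u + l * ?Y (c^2 * (?A - ?B)) u"
   unfolding eq ynum_eq[OF ct[OF u] zero_less_one] by (simp add: algebra_simps)
  also have "... >= (1 - l) * (\<mu> 0 * ?Q u) + l * (?e * \<mu> 1 * ?Q u)"
   using l flat[OF u] hyp[OF u] by (intro add_mono mult_left_mono) auto
  finally show "((1 - l) * yamabe_mu TYPE('v) TYPE('w) 0 + l * (?e * yamabe_mu TYPE('v) TYPE('w) 1)) * ?Q u <= ?Y (M_scal CARD('v) CARD('w) c) u"
   unfolding sc assms(6) by (simp add: algebra_simps)
 qed
 have "c^2 * real v * (real v - 1) / ((1 - c\<^sup>2) * real w * (real w - 1) + c^2 * real v * (real v - 1)) = l"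
  by (simp add: l_def D_def mult.assoc)
 moreover have "(\<mu> 0 / \<mu> 1 - l * (\<mu> 0 / \<mu> 1 - ?e)) * \<mu> 1 <= \<mu> c"
 proof (cases "\<mu> 1 = 0")
  \<comment> \<open>With \<mu> 1 = 0 the left side is 0 whatever the quotients mean, and the second
    bound reads 0 <= \<mu> c.\<close>
  case True
  thus ?thesis using second by simp
 next
  case False
  hence "(\<mu> 0 / \<mu> 1 - l * (\<mu> 0 / \<mu> 1 - ?e)) * \<mu> 1 = (1 - l) * \<mu> 0 + l * (?e * \<mu> 1)"
   by (simp add: field_simps)
  thus ?thesis using first by simp
 qed
 ultimately show ?thesis using second by simp
qed

end
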